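(* Assume $\eta\ge r_a$ and $r_a=r_b$, and let $\{\varepsilon_n\}$ be a sequence of positive numbers converging to $0$. Then there exist $T>0$, a subsequence $\{\varepsilon_{n'}\}$ of $\{\varepsilon_n\}$, and $$f\in\mathcal C([0,T],w\text{-}L^1(\mathbb R_+,x^{r_a\delta}dx))\cap L^\infty(0,T;L^1(\mathbb R_+,(1+x)dx))$$ such that the measure $f(t,x)dx$ is an $N$-solution of the LS equation on $[0,T]$ with mass $m$ (with initial data $u^{\rm in},\mu^{\rm in}$) and $$f^{\varepsilon_{n'}}\to f\quad\text{as }n'\to+\infty\ \text{ in }\ \mathcal C([0,T];w\text{-}L^1(\mathbb R_+,x^{r_a\delta}dx)),$$ where the nucleation rate is $N(u)=\alpha u^2$ for $u\ge0$ if $\eta>r_a$, and $$N(u)=\alpha u^2\,\frac{\overline a u-\overline b}{\overline a u-\overline b+\beta/2^{\eta}}\quad(u>\rho)\qquad\text{if }\eta=r_a.$$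
   Context: **Rescaled Becker–Döring (BD) system.** Fix $\eta\ge 0$. For each $\varepsilon>0$ let $\alpha^\varepsilon,\beta^\varepsilon,(a_i^\varepsilon)_{i\ge2},(b_i^\varepsilon)_{i\ge3}$ be positive numbers for which there is a constant $K(\varepsilon)>0$ with $a_{i+1}^\varepsilon-a_i^\varepsilon\le K(\varepsilon)$ ($i\ge2$) and $b_i^\varepsilon-b_{i+1}^\varepsilon\le K(\varepsilon)$ ($i\ge3$). Let $u^\varepsilon$ and $(c_i^\varepsilon)_{i\ge2}$ be non-negative functions in $\mathcal C([0,+\infty))$ forming a global solution of $$\frac{d}{dt}u^\varepsilon=-\varepsilon J_1^\varepsilon-\varepsilon\sum_{i\ge1}J_i^\varepsilon,\qquad \frac{d}{dt}c_i^\varepsilon=\frac1\varepsilon\big[J_{i-1}^\varepsilon-J_i^\varepsilon\big]\quad(i\ge2),$$ $$J_1^\varepsilon=\alpha^\varepsilon(u^\varepsilon)^2-\varepsilon^\eta\beta^\varepsilon c_2^\varepsilon,\qquad J_i^\varepsilon=a_i^\varepsilon u^\varepsilon c_i^\varepsilon-b_{i+1}^\varepsilon c_{i+1}^\varepsilon\quad(i\ge2),$$ with non-negative initial data $u^{{\rm in},\varepsilon},(c_i^{{\rm in},\varepsilon})_{i\ge2}$, and satisfying the mass balance $u^\varepsilon(t)+\sum_{i\ge2}\varepsilon^2 i\,c_i^\varepsilon(t)=m^\varepsilon$ for all $t\ge0$, with $m^\varepsilon<\infty$ constant. Put $\Lambda_i^\varepsilon=[(i-\frac12)\varepsilon,(i+\frac12)\varepsilon)$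 and $$f^\varepsilon(t,x)=\sum_{i\ge2}c_i^\varepsilon(t)\mathbf 1_{\Lambda_i^\varepsilon}(x),\quad f^{{\rm in},\varepsilon}=f^\varepsilon(0,\cdot),\quad a^\varepsilon(x)=\sum_{i\ge2}a_i^\varepsilon\mathbf 1_{\Lambda_i^\varepsilon}(x),\quad b^\varepsilon(x)=\sum_{i\ge3}b_i^\varepsilon\mathbf 1_{\Lambda_i^\varepsilon}(x).$$ **Assumptions on the rates.** $\alpha,\beta>0$; $a,b$ are non-negative continuous functions on $[0,+\infty)$, positive on $(0,+\infty)$. As $\varepsilon\to0$: $\alpha^\varepsilon\to\alpha$, $\beta^\varepsilon\to\beta$, and $a^\varepsilon\to a$, $b^\varepsilon\to b$ uniformly on compact subsets of $[0,+\infty)$. There are $K_a,K_b>0$ with $a^\varepsilon(x)\le K_a(1+x)$ and $b^\varepsilon(x)\le K_b(1+x)$ for all $x\ge0$, $\varepsilon>0$. There are $r_a\in[0,1)$, $r_b\ge r_a$, $\overline a>0$, $\overline b>0$ with $a(x)\sim_{0^+}\overline a x^{r_a}$, $b(x)\sim_{0^+}\overline b x^{r_b}$, and $a^\varepsilon(\varepsilon i)=a(\varepsilon i)+o((\varepsilon i)^{r_a})$, $b^\varepsilon(\varepsilon i)=b(\varepsilon i)+o((\varepsilon i)^{r_b})$, where the Landau symbol refers to $\varepsilon i\to0$ ($i\ge2$ for $a$, $i\ge3$ for $b$). Set $\rho:=\lim_{x\to0^+}b(x)/a(x)=\lim_{x\to 0^+}\frac{\overline b}{\overline a}x^{r_b-r_a}\in[0,+\infty)$.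 **Assumptions on the initial data.** $\mathcal M_f(U)$ is the set of non-negative finite regular Borel measures on $U$, with the weak-$*$ topology: $\nu^n\to\nu$ iff $\int\varphi\,d\nu^n\to\int\varphi\,d\nu$ for all $\varphi\in\mathcal C_c(U)$; a density $f$ is identified with $f(x)dx$. There are $u^{\rm in}>\rho$ and $\mu^{\rm in}\in\mathcal M_f([0,+\infty))$ such that, as $\varepsilon\to0$, $u^{{\rm in},\varepsilon}\to u^{\rm in}$ and $f^{{\rm in},\varepsilon}\to\mu^{\rm in}$ weak-$*$ in $\mathcal M_f([0,+\infty))$. Let $\mathcal U$ be the set of non-negative convex functions $\Phi\in\mathcal C^1([0,+\infty))$, piecewise $\mathcal C^2$, with $\Phi(0)=0$, $\Phi'$ concave, $\Phi'(0)\ge0$, $\Phi(x)/x\to+\infty$ as $x\to+\infty$. There is $\Phi\in\mathcal U$ with $\sup_{\varepsilon>0}\int_0^\infty\Phi(x)f^{{\rm in},\varepsilon}(x)dx<\infty$. For all $z\in(0,1)$, $\sup_{\varepsilon>0}\sum_{i\ge2}\varepsilon^{r_a}c_i^{{\rm in},\varepsilon}e^{-iz}<\infty$. Set $m:=u^{\rm in}+\int_0^\infty x\,\mu^{\rm in}(dx)$. **Extra assumption.** There is $\delta\in(0,1/r_a-1)$ (with $1/0=+\infty$) such that, with $\Psi(y)=y^{1+\delta}$, $\sup_{\varepsilon>0}\int_0^\infty\Psi(f^{{\rm in},\varepsilon}(x))dx<\infty$; and the rates are exact power laws: $a_i^\varepsilon=\overline a(\varepsilon i)^{r_a}$ for $i\ge2$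 and $b_i^\varepsilon=\overline b(\varepsilon i)^{r_b}$ for $i\ge3$. **$N$-solution.** Given $T>0$ and a function $N\in L^\infty_{loc}(\mathbb R_+)$ (nucleation rate; only its values at $u>\rho$ matter below, so it may be extended by any locally bounded function to $[0,\rho]$), $\mu\in L^\infty([0,T];\mathcal M_f([0,+\infty)))$ is an $N$-solution of the LS equation (in measure) on $[0,T]$ with mass $m$ if: (i) there is a non-negative $u\in\mathcal C([0,T])$ with $u(0)=u^{\rm in}$, $\inf_{[0,T]}u>\rho$, and $u(t)+\int_0^\infty x\,\mu_t(dx)=m$ for all $t\in[0,T]$ (for a suitable representative of $\mu$); (ii) for all $\varphi\in\mathcal C^1_c([0,T)\times[0,+\infty))$, $$\int_0^T\!\!\int_0^\infty\big[\partial_t\varphi(t,x)+(a(x)u(t)-b(x))\partial_x\varphi(t,x)\big]\mu_t(dx)\,dt+\int_0^\infty\varphi(0,x)\mu^{\rm in}(dx)+\int_0^T\varphi(s,0)N(u(s))\,ds=0.$$ $w\text{-}L^1(\mathbb R_+,x^{r_a\delta}dx)$ denotes $L^1(\mathbb R_+,x^{r_a\delta}dx)$ with its weak topology; $\mathcal C([0,T],w\text{-}L^1)$ is the space of functions continuous in time for this weak topology (with uniform-in-time convergence). *)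

theory Defs
  imports "HOL-Analysis.Analysis" "HOL-Library.Landau_Symbols"
begin

definition BD_flux ::
  "real \<Rightarrow> real \<Rightarrow> real \<Rightarrow> real \<Rightarrow> (nat \<Rightarrow> real) \<Rightarrow> (nat \<Rightarrow> real) \<Rightarrow>
   (real \<Rightarrow> real) \<Rightarrow> (nat \<Rightarrow> real \<Rightarrow> real) \<Rightarrow> nat \<Rightarrow> real \<Rightarrow> real" where
  "BD_flux \<eta> \<epsilon> \<alpha> \<beta> a b u c i t =
     (if i = 1 then \<alpha> * (u t)\<^sup>2 - \<epsilon> powr \<eta> * \<beta> * c 2 t
      else a i * u t * c i t - b (i + 1) * c (i + 1) t)"

text \<open>Derivatives at time zero are one-sided. The sum over \<open>i \<ge> 1\<close> is indexed by \<open>Suc i\<close>.\<close>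

definition BD_solution ::
  "real \<Rightarrow> real \<Rightarrow> real \<Rightarrow> real \<Rightarrow> (nat \<Rightarrow> real) \<Rightarrow> (nat \<Rightarrow> real) \<Rightarrow>
   (real \<Rightarrow> real) \<Rightarrow> (nat \<Rightarrow> real \<Rightarrow> real) \<Rightarrow> bool" where
  "BD_solution \<eta> \<epsilon> \<alpha> \<beta> a b u c \<longleftrightarrow>
     continuous_on {0..} u \<and> (\<forall>t\<ge>0. 0 \<le> u t) \<and>
     (\<forall>i\<ge>2. continuous_on {0..} (c i) \<and> (\<forall>t\<ge>0. 0 \<le> c i t)) \<and>
     (\<forall>t\<ge>0. let J = (\<lambda>i. BD_flux \<eta> \<epsilon> \<alpha> \<beta> a b u c i t) in
        summable (\<lambda>i. J (Suc i)) \<and>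
        (u has_real_derivative - \<epsilon> * J 1 - \<epsilon> * (\<Sum>i. J (Suc i))) (at t within {0..}) \<and>
        (\<forall>i\<ge>2. (c i has_real_derivative (1 / \<epsilon>) * (J (i - 1) - J i)) (at t within {0..})))"

text \<open>\<open>step_fun \<epsilon> k v\<close> is the sum over \<open>i \<ge> k\<close> of \<open>v i\<close> times the indicator of
  the cell around \<open>i * \<epsilon>\<close>. The cells are disjoint, so each pointwise sum has at most one
  nonzero term.\<close>

definition step_fun :: "real \<Rightarrow> nat \<Rightarrow> (nat \<Rightarrow> real) \<Rightarrow> real \<Rightarrow> real" where
  "step_fun \<epsilon> k v x =
     (\<Sum>\<^sub>\<infinity>i\<in>{k..}. v i * indicator {(real i - 1/2) * \<epsilon> ..< (real i + 1/2) * \<epsilon>} x)"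

text \<open>The filter of pairs \<open>(\<epsilon>, i)\<close> with \<open>\<epsilon> > 0\<close> and \<open>i \<ge> k\<close> along which \<open>\<epsilon> * i\<close> tends
  to zero; it carries the Landau symbols in the hypotheses on the rates.\<close>

definition small_sizes :: "nat \<Rightarrow> (real \<times> nat) filter" where
  "small_sizes k =
     inf (filtercomap (\<lambda>(\<epsilon>, i). \<epsilon> * real i) (nhds 0)) (principal ({0<..} \<times> {k..}))"

abbreviation half_line :: "real measure" where
  "half_line \<equiv> restrict_space lborel {0..}"

text \<open>Regularity is automatic for finite Borel measures on the half-line.\<close>

definition finite_half_line_measure :: "real measure \<Rightarrow> bool" where
  "finite_half_line_measure \<mu> \<longleftrightarrow>
     finite_measure \<mu> \<and> sets \<mu> = sets (restrict_space borel {0..})"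

definition Cc_half_line :: "(real \<Rightarrow> real) set" where
  "Cc_half_line = {\<phi>. continuous_on {0..} \<phi> \<and>
     (\<exists>K. compact K \<and> K \<subseteq> {0..} \<and> (\<forall>x\<in>{0..} - K. \<phi> x = 0))}"

definition weak_star_tendsto ::
  "('i \<Rightarrow> real measure) \<Rightarrow> real measure \<Rightarrow> 'i filter \<Rightarrow> bool" where
  "weak_star_tendsto \<nu> \<mu> F \<longleftrightarrow>
     (\<forall>\<phi>\<in>Cc_half_line. ((\<lambda>i. \<integral>x. \<phi> x \<partial>\<nu> i) \<longlongrightarrow> (\<integral>x. \<phi> x \<partial>\<mu>)) F)"

text \<open>\<open>\<Phi>'\<close> is the derivative of \<open>\<Phi>\<close> on the half-line
  (one-sided at zero); piecewise \<open>C\<^sup>2\<close> is understood with finitely many breakpoints on each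
  bounded interval.\<close>

definition superlinear_weights :: "(real \<Rightarrow> real) set" where
  "superlinear_weights = {\<Phi>. (\<forall>x\<ge>0. 0 \<le> \<Phi> x) \<and> convex_on {0..} \<Phi> \<and> \<Phi> 0 = 0 \<and>
     (\<exists>\<Phi>'. (\<forall>x\<ge>0. (\<Phi> has_real_derivative \<Phi>' x) (at x within {0..})) \<and>
        continuous_on {0..} \<Phi>' \<and>
        (\<forall>R>0. \<Phi>' piecewise_C1_differentiable_on {0..R}) \<and>
        concave_on {0..} \<Phi>' \<and> 0 \<le> \<Phi>' 0) \<and>
     filterlim (\<lambda>x. \<Phi> x / x) at_top at_top}"

definition Linf :: "'a measure \<Rightarrow> ('a \<Rightarrow> real) set" where
  "Linf M = {g \<in> borel_measurable M. \<exists>C. AE x in M. \<bar>g x\<bar> \<le> C}"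

text \<open>Continuity in time for the weak topology of \<open>L\<^sup>1(\<nu>)\<close>, tested against its dual, and
  convergence for the topology of uniform-in-time weak convergence.\<close>

definition C_weak_L1 :: "real set \<Rightarrow> 'a measure \<Rightarrow> (real \<Rightarrow> 'a \<Rightarrow> real) set" where
  "C_weak_L1 I \<nu> = {f. (\<forall>t\<in>I. integrable \<nu> (f t)) \<and>
     (\<forall>g\<in>Linf \<nu>. continuous_on I (\<lambda>t. \<integral>x. f t x * g x \<partial>\<nu>))}"

definition tendsto_C_weak_L1 ::
  "real set \<Rightarrow> 'a measure \<Rightarrow> (nat \<Rightarrow> real \<Rightarrow> 'a \<Rightarrow> real) \<Rightarrow> (real \<Rightarrow> 'a \<Rightarrow> real) \<Rightarrow> bool" where
  "tendsto_C_weak_L1 I \<nu> F f \<longleftrightarrow>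
     (\<forall>n. F n \<in> C_weak_L1 I \<nu>) \<and> f \<in> C_weak_L1 I \<nu> \<and>
     (\<forall>g\<in>Linf \<nu>. uniform_limit I (\<lambda>n t. \<integral>x. F n t x * g x \<partial>\<nu>)
        (\<lambda>t. \<integral>x. f t x * g x \<partial>\<nu>) sequentially)"

text \<open>The Bochner space \<open>L\<^sup>\<infinity>(I; L\<^sup>1(\<nu>))\<close>: strong measurability is almost everywhere
  approximation, in the norm of \<open>L\<^sup>1(\<nu>)\<close>, by simple functions with values in \<open>L\<^sup>1(\<nu>)\<close>.\<close>

definition Linf_L1 :: "real set \<Rightarrow> 'a measure \<Rightarrow> (real \<Rightarrow> 'a \<Rightarrow> real) set" where
  "Linf_L1 I \<nu> = {f.
     (\<exists>s. (\<forall>n::nat. simple_function (lebesgue_on I) (s n) \<and> (\<forall>t\<in>I. integrable \<nu> (s n t))) \<and>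
        (AE t in lebesgue_on I.
           (\<lambda>n. \<integral>\<^sup>+x. ennreal \<bar>s n t x - f t x\<bar> \<partial>\<nu>) \<longlonglongrightarrow> 0)) \<and>
     (\<exists>C. AE t in lebesgue_on I. integrable \<nu> (f t) \<and> (\<integral>x. \<bar>f t x\<bar> \<partial>\<nu>) \<le> C)}"

text \<open>\<open>L\<^sup>\<infinity>([0,T]; M)\<close>, where \<open>M\<close> carries the weak-star topology.\<close>

definition Linf_measures :: "real \<Rightarrow> (real \<Rightarrow> real measure) set" where
  "Linf_measures T = {\<mu>.
     (\<forall>\<phi>\<in>Cc_half_line. (\<lambda>t. \<integral>x. \<phi> x \<partial>\<mu> t) \<in> borel_measurable (lebesgue_on {0..T})) \<and>
     (\<exists>C. AE t in lebesgue_on {0..T}.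
        finite_half_line_measure (\<mu> t) \<and> measure (\<mu> t) {0..} \<le> C)}"

text \<open>\<open>\<phi>t\<close> and \<open>\<phi>x\<close> are the partial derivatives of the test function \<open>\<phi>\<close> of class \<open>C\<^sup>1\<^sub>c\<close>;
  they are one-sided on the boundary of \<open>[0,T) \<times> [0,\<infinity>)\<close>.\<close>

definition C1c_test ::
  "real \<Rightarrow> (real \<times> real \<Rightarrow> real) \<Rightarrow> (real \<times> real \<Rightarrow> real) \<Rightarrow> (real \<times> real \<Rightarrow> real) \<Rightarrow> bool" where
  "C1c_test T \<phi> \<phi>t \<phi>x \<longleftrightarrow>
     (let D = {0..<T} \<times> {0..} in
        (\<forall>p\<in>D. (\<phi> has_derivative (\<lambda>(h, k). \<phi>t p * h + \<phi>x p * k)) (at p within D)) \<and>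
        continuous_on D \<phi>t \<and> continuous_on D \<phi>x \<and>
        (\<exists>K. compact K \<and> K \<subseteq> D \<and> (\<forall>p\<in>D - K. \<phi> p = 0)))"

text \<open>\<open>\<nu>\<close> below is the representative of \<open>\<mu>\<close> for which the mass balance holds at every time.\<close>

definition N_solution ::
  "(real \<Rightarrow> real) \<Rightarrow> (real \<Rightarrow> real) \<Rightarrow> real \<Rightarrow> real \<Rightarrow> real measure \<Rightarrow>
   (real \<Rightarrow> real) \<Rightarrow> real \<Rightarrow> real \<Rightarrow> (real \<Rightarrow> real measure) \<Rightarrow> bool" where
  "N_solution a b \<rho> uin \<mu>in N T m \<mu> \<longleftrightarrow>
     (\<forall>R>0. N \<in> Linf (lebesgue_on {0..R})) \<and>
     \<mu> \<in> Linf_measures T \<and>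
     (\<exists>u. continuous_on {0..T} u \<and> (\<forall>t\<in>{0..T}. 0 \<le> u t) \<and> u 0 = uin \<and>
        (INF t\<in>{0..T}. u t) > \<rho> \<and>
        (\<exists>\<nu>. (AE t in lebesgue_on {0..T}. \<nu> t = \<mu> t) \<and>
           (\<forall>t\<in>{0..T}. finite_half_line_measure (\<nu> t) \<and>
              integrable (\<nu> t) (\<lambda>x. x) \<and> u t + (\<integral>x. x \<partial>\<nu> t) = m)) \<and>
        (\<forall>\<phi> \<phi>t \<phi>x. C1c_test T \<phi> \<phi>t \<phi>x \<longrightarrow>
           (\<integral>t. (\<integral>x. \<phi>t (t, x) + (a x * u t - b x) * \<phi>x (t, x) \<partial>\<mu> t)
              \<partial>lebesgue_on {0..<T})
           + (\<integral>x. \<phi> (0, x) \<partial>\<mu>in)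
           + (\<integral>s. \<phi> (s, 0) * N (u s) \<partial>lebesgue_on {0..<T}) = 0))"

text \<open>In the second case only the values for \<open>u > \<rho>\<close> are meaningful; the value zero below
  \<open>\<rho>\<close> is an arbitrary locally bounded extension.\<close>

definition nucleation_rate ::
  "real \<Rightarrow> real \<Rightarrow> real \<Rightarrow> real \<Rightarrow> real \<Rightarrow> real \<Rightarrow> real \<Rightarrow> real \<Rightarrow> real" where
  "nucleation_rate \<eta> ra \<alpha> \<beta> abar bbar \<rho> u =
     (if \<eta> > ra then \<alpha> * u\<^sup>2
      else if u > \<rho> then
        \<alpha> * u\<^sup>2 * ((abar * u - bbar) / (abar * u - bbar + \<beta> / 2 powr \<eta>))
      else 0)"

end

theory Submission
  imports Defs "HOL-Analysis.Analysis" "HOL-Complex_Analysis.Great_Picard" "HOL-Real_Asymp.Real_Asymp"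
begin

lemma set_integrable_subset_borel:
  fixes f :: "real \<Rightarrow> real"
  assumes "integrable lborel f" "A \<in> sets borel"
  shows "set_integrable lborel A f"
  using assms unfolding set_integrable_def by (intro integrable_mult_indicator) auto

lemma set_integral_shrinking_tendsto_0:
  fixes h :: "real \<Rightarrow> real"
  assumes h: "integrable lborel h" and A: "\<And>i. A i \<in> sets borel"
    and ev: "AE x in lborel. eventually (\<lambda>i. x \<notin> A i) sequentially"
  shows "(\<lambda>i. LINT x:A i|lborel. h x) \<longlonglongrightarrow> 0"
proof -
  have "(\<lambda>i. \<integral>x. indicator (A i) x * h x \<partial>lborel) \<longlonglongrightarrow> integral\<^sup>L (lborel :: real measure) (\<lambda>x. (0::real))"
  proof (rule integral_dominated_convergence[where w="\<lambda>x. \<bar>h x\<bar>" and f="\<lambda>x. 0"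
        and s="\<lambda>i x. indicator (A i) x * h x"])
    show "AE x in lborel. (\<lambda>i. indicat_real (A i) x * h x) \<longlonglongrightarrow> 0"
      using ev by eventually_elim (auto intro!: tendsto_eventually elim!: eventually_mono)
    show "(\<lambda>x. indicat_real (A i) x * h x) \<in> borel_measurable lborel" for i
      using h A by auto
    show "integrable lborel (\<lambda>x. \<bar>h x\<bar>)" using h by simp
  qed (auto simp: indicator_def)
  then show ?thesis by (simp add: set_lebesgue_integral_def)
qed

lemma abs_set_integral_diff_le:
  fixes f :: "real \<Rightarrow> real"
  assumes f: "integrable lborel f" and nn: "\<And>x. 0 \<le> f x"
    and A: "A \<in> sets borel" and B: "B \<in> sets borel" and D: "D \<in> sets borel"
    and sub: "A - B \<subseteq> D" "B - A \<subseteq> D"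
  shows "\<bar>(LINT x:A|lborel. f x) - (LINT x:B|lborel. f x)\<bar> \<le> (LINT x:D|lborel. f x)"
proof -
  have i: "integrable lborel (\<lambda>x. indicator S x * f x)" if "S \<in> sets borel" for S :: "real set"
    using set_integrable_subset_borel[OF f that] by (simp add: set_integrable_def)
  have "\<bar>(LINT x:A|lborel. f x) - (LINT x:B|lborel. f x)\<bar>
      = \<bar>\<integral>x. indicator A x * f x - indicator B x * f x \<partial>lborel\<bar>"
    using i A B by (simp add: set_lebesgue_integral_def)
  also have "\<dots> \<le> (\<integral>x. \<bar>indicator A x * f x - indicator B x * f x\<bar> \<partial>lborel)"
    by (rule integral_abs_bound)
  also have "\<dots> \<le> (\<integral>x. indicator D x * f x \<partial>lborel)"
  proof (rule integral_mono)
    show "integrable lborel (\<lambda>x. \<bar>indicator A x * f x - indicator B x * f x\<bar>)"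
      using i[OF A] i[OF B] by simp
    show "\<bar>indicator A x * f x - indicator B x * f x\<bar> \<le> indicator D x * f x" for x
      using sub nn[of x] by (auto simp: indicator_def)
  qed (rule i[OF D])
  finally show ?thesis by (simp add: set_lebesgue_integral_def)
qed

definition equi_integrable :: "'i set \<Rightarrow> ('i \<Rightarrow> real \<Rightarrow> real) \<Rightarrow> bool" where
  "equi_integrable I F \<longleftrightarrow>
     (\<forall>i\<in>I. integrable lborel (F i) \<and> (\<forall>x. 0 \<le> F i x)) \<and>
     (\<forall>e>0. \<exists>h. integrable lborel h \<and> (\<forall>x. 0 \<le> h x) \<and>
        (\<forall>i\<in>I. \<forall>A\<in>sets borel. (LINT x:A|lborel. F i x) \<le> e + (LINT x:A|lborel. h x)))"

lemma equi_integrableD: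
  assumes "equi_integrable I F" "i \<in> I"
  shows "integrable lborel (F i)" "0 \<le> F i x"
  using assms unfolding equi_integrable_def by auto

lemma equi_integrable_shrinking:
  assumes F: "equi_integrable I F" and A: "\<And>k::nat. A k \<in> sets borel"
    and ev: "AE x in lborel. eventually (\<lambda>k. x \<notin> A k) sequentially" and e: "0 < (e::real)"
  shows "\<exists>k0. \<forall>i\<in>I. \<forall>k\<ge>k0. (LINT x:A k|lborel. F i x) < e"
proof -
  from e have "e/2 > 0" by simp
  then obtain h where h: "integrable lborel h" "\<forall>i\<in>I. \<forall>A\<in>sets borel. (LINT x:A|lborel. F i x) \<le> e/2 + (LINT x:A|lborel. h x)"
    using F unfolding equi_integrable_def by blast
  have "eventually (\<lambda>k. (LINT x:A k|lborel. h x) < e/2) sequentially"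
    using set_integral_shrinking_tendsto_0[OF h(1) A ev] \<open>e/2 > 0\<close> by (rule order_tendstoD)
  then obtain k0 where "\<And>k. k \<ge> k0 \<Longrightarrow> (LINT x:A k|lborel. h x) < e/2"
    by (auto simp: eventually_sequentially)
  with h(2) A have "\<forall>i\<in>I. \<forall>k\<ge>k0. (LINT x:A k|lborel. F i x) < e"
    by (metis add_le_less_mono field_sum_of_halves le_less_trans add_strict_left_mono)
  then show ?thesis ..
qed

lemma equi_integrable_bounded:
  assumes F: "equi_integrable I F"
  shows "\<exists>C>0. \<forall>i\<in>I. (\<integral>x. F i x \<partial>lborel) \<le> C \<and>
    (\<forall>A\<in>sets borel. 0 \<le> (LINT x:A|lborel. F i x) \<and> (LINT x:A|lborel. F i x) \<le> C)"
proof -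
  obtain h where h: "integrable lborel h" "\<forall>x. 0 \<le> h x" "\<forall>i\<in>I. \<forall>A\<in>sets borel. (LINT x:A|lborel. F i x) \<le> 1 + (LINT x:A|lborel. h x)"
    using F unfolding equi_integrable_def by (meson zero_less_one)
  have up: "(LINT x:A|lborel. F i x) \<le> 1 + (\<integral>x. h x \<partial>lborel)" if "i \<in> I" "A \<in> sets borel" for i A
  proof -
    have "(LINT x:A|lborel. h x) \<le> (\<integral>x. h x \<partial>lborel)"
      unfolding set_lebesgue_integral_def using h that set_integrable_subset_borel[OF h(1) that(2)]
      by (intro integral_mono) (auto simp: set_integrable_def indicator_def)
    then show ?thesis using h(3) that by fastforce
  qed
  show ?thesis
  proof (intro exI[of _ "1 + (\<integral>x. h x \<partial>lborel)"] conjI ballI)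
    have "0 \<le> (\<integral>x. h x \<partial>lborel)" using h(2) by simp
    then show "0 < 1 + (\<integral>x. h x \<partial>lborel)" by linarith
    show "(\<integral>x. F i x \<partial>lborel) \<le> 1 + (\<integral>x. h x \<partial>lborel)" if "i \<in> I" for i
      using up[OF that, of UNIV] by (simp add: set_lebesgue_integral_def)
    fix i and A :: "real set" assume *: "i \<in> I" "A \<in> sets borel"
    show "(LINT x:A|lborel. F i x) \<le> 1 + (\<integral>x. h x \<partial>lborel)" using up[OF *] .
    show "0 \<le> (LINT x:A|lborel. F i x)"
      using equi_integrableD[OF F *(1)] unfolding set_lebesgue_integral_def
      by (auto intro!: integral_nonneg_AE)
  qed
qed

lemma equi_integrable_reindex:
  assumes UI: "equi_integrable I F" and G: "\<And>j. j \<in> J \<Longrightarrow> \<phi> j \<in> I \<and> G j = F (\<phi> j)"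
  shows "equi_integrable J G"
  unfolding equi_integrable_def
proof (intro conjI ballI allI impI)
  fix j assume "j \<in> J"
  then show "integrable lborel (G j)" "0 \<le> G j x" for x
    using equi_integrableD[OF UI, of "\<phi> j"] G[of j] by auto
next
  fix e :: real assume "e > 0"
  then obtain h where h: "integrable lborel h" "\<forall>x. 0 \<le> h x"
    "\<forall>i\<in>I. \<forall>A\<in>sets borel. (LINT x:A|lborel. F i x) \<le> e + (LINT x:A|lborel. h x)"
    using UI unfolding equi_integrable_def by blast
  have "\<forall>j\<in>J. \<forall>A\<in>sets borel. (LINT x:A|lborel. G j x) \<le> e + (LINT x:A|lborel. h x)"
    using h(3) G by auto
  with h show "\<exists>h. integrable lborel h \<and> (\<forall>x. 0 \<le> h x) \<and> (\<forall>j\<in>J. \<forall>A\<in>sets borel.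
        (LINT x:A|lborel. G j x) \<le> e + (LINT x:A|lborel. h x))" by blast
qed

definition squeezed_ray :: "real \<Rightarrow> real set" where
  "squeezed_ray y = {x. x \<le> y * (1 + \<bar>x\<bar>)}"

lemma squeezed_ray_borel [measurable]: "squeezed_ray y \<in> sets borel"
  unfolding squeezed_ray_def by measurable

lemma squeezed_ray_eq_atMost:
  assumes "-1 < y" "y < 1"
  obtains a where "squeezed_ray y = {..a}"
proof (cases "y \<ge> 0")
  case True
  have "x \<le> y * (1 + \<bar>x\<bar>) \<longleftrightarrow> x \<le> y / (1 - y)" for x
  proof (cases "x \<ge> 0")
    case False
    moreover have "0 \<le> y / (1-y)" "0 \<le> y * (1 + \<bar>x\<bar>)" using True assms by auto
    ultimately show ?thesis by linarith
  qed (use assms in \<open>auto simp: field_simps\<close>)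
  then show ?thesis by (intro that[of "y/(1-y)"]) (auto simp: squeezed_ray_def)
next
  case False
  have "x \<le> y * (1 + \<bar>x\<bar>) \<longleftrightarrow> x \<le> y / (1 + y)" for x
  proof (cases "x \<ge> 0")
    case True
    moreover have "y / (1+y) < 0" "y * (1 + \<bar>x\<bar>) < 0" using False assms by (auto simp: divide_less_0_iff mult_less_0_iff)
    ultimately show ?thesis by linarith
  qed (use assms in \<open>auto simp: field_simps\<close>)
  then show ?thesis by (intro that[of "y/(1+y)"]) (auto simp: squeezed_ray_def)
qed

lemma atMost_eq_squeezed_ray:
  obtains y where "-1 \<le> y" "y \<le> 1" "{..a} = squeezed_ray y"
proof -
  have *: "x \<le> a \<longleftrightarrow> x * (1 + \<bar>a\<bar>) \<le> a * (1 + \<bar>x\<bar>)" for x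
  proof -
    consider "0 \<le> x" "0 \<le> a" | "0 \<le> x" "a < 0" | "x < 0" "0 \<le> a" | "x < 0" "a < 0" by linarith
    then show ?thesis
    proof cases
      case 2
      then have "0 \<le> x * (1 + \<bar>a\<bar>)" "a * (1 + \<bar>x\<bar>) < 0" by (auto simp: mult_less_0_iff)
      with 2 show ?thesis by linarith
    next
      case 3
      then have "x * (1 + \<bar>a\<bar>) \<le> 0" "0 \<le> a * (1 + \<bar>x\<bar>)" by (auto simp: mult_le_0_iff)
      with 3 show ?thesis by linarith
    qed (simp_all add: algebra_simps)
  qed
  have p: "0 < 1 + \<bar>a\<bar>" by linarith
  have "x \<le> a \<longleftrightarrow> x \<le> a / (1 + \<bar>a\<bar>) * (1 + \<bar>x\<bar>)" for x
    unfolding *[of x] times_divide_eq_left pos_le_divide_eq[OF p] ..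
  then have "{..a} = squeezed_ray (a / (1 + \<bar>a\<bar>))"
    unfolding squeezed_ray_def atMost_def by blast
  moreover have "-1 \<le> a / (1 + \<bar>a\<bar>)" "a / (1 + \<bar>a\<bar>) \<le> 1"
    by (simp_all add: pos_le_divide_eq[OF p] pos_divide_le_eq[OF p] abs_le_iff)
  ultimately show ?thesis using that by blast
qed

lemma subseq_Cauchy_on_rays:
  fixes F :: "nat \<Rightarrow> real \<Rightarrow> real \<Rightarrow> real"
  assumes UI: "equi_integrable (UNIV \<times> {0..T}) (\<lambda>(n,t). F n t)"
    and eq: "\<And>a e. e > 0 \<Longrightarrow> \<exists>d>0. \<forall>n. \<forall>s\<in>{0..T}. \<forall>t\<in>{0..T}. \<bar>s - t\<bar> < d \<longrightarrow>
      \<bar>(LINT x:{..a}|lborel. F n s x) - (LINT x:{..a}|lborel. F n t x)\<bar> < (e::real)"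
  obtains r where "strict_mono (r::nat\<Rightarrow>nat)"
    "\<And>a. uniformly_Cauchy_on {0..T} (\<lambda>n t. LINT x:{..a}|lborel. F (r n) t x)"
proof -
  define G where "G n p = (LINT x:squeezed_ray (snd p)|lborel. F n (fst p) x)" for n p
  define S where "S = {0..T} \<times> {-1..1::real}"
  obtain C where C: "\<And>n t A. t \<in> {0..T} \<Longrightarrow> A \<in> sets borel \<Longrightarrow> \<bar>LINT x:A|lborel. F n t x\<bar> \<le> C"
  proof -
    assume *: "\<And>C. (\<And>n t A. t \<in> {0..T} \<Longrightarrow> A \<in> sets borel \<Longrightarrow> \<bar>LINT x:A|lborel. F n t x\<bar> \<le> C) \<Longrightarrow> thesis"
    obtain C where C: "\<forall>i\<in>UNIV \<times> {0..T}. (\<integral>x. (case i of (n, t) \<Rightarrow> F n t) x \<partial>lborel) \<le> C \<and> (\<forall>A\<in>sets borel.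
        0 \<le> (LINT x:A|lborel. (case i of (n, t) \<Rightarrow> F n t) x) \<and> (LINT x:A|lborel. (case i of (n, t) \<Rightarrow> F n t) x) \<le> C)"
      using equi_integrable_bounded[OF UI] by blast
    show thesis
    proof (rule *[of C])
      fix n t and A :: "real set" assume "t \<in> {0..T}" "A \<in> sets borel"
      then show "\<bar>LINT x:A|lborel. F n t x\<bar> \<le> C" using bspec[OF C, of "(n,t)"] by auto
    qed
  qed
  have F: "integrable lborel (F n t)" "0 \<le> F n t x" if "t \<in> {0..T}" for n t x
    using equi_integrableD[OF UI, of "(n,t)"] that by auto
  obtain g r where g: "strict_mono (r::nat\<Rightarrow>nat)"
     "\<And>e. 0 < e \<Longrightarrow> \<exists>N. \<forall>n x. n \<ge> N \<and> x \<in> S \<longrightarrow> norm (G (r n) x - g x) < e"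
  proof (rule Arzela_Ascoli[of S G C])
    show "compact S" unfolding S_def by (intro compact_Times) auto
    show "norm (G n x) \<le> C" if "x \<in> S" for n x
      using that C by (auto simp: G_def S_def)
    fix p e assume p: "p \<in> S" and e: "(0::real) < e"
    obtain t0 y0 where p_eq: "p = (t0, y0)" by (cases p)
    have t0: "t0 \<in> {0..T}" and y0: "-1 \<le> y0" "y0 \<le> 1" using p by (auto simp: p_eq S_def)
    define B where "B k = {x. \<bar>x - y0 * (1 + \<bar>x\<bar>)\<bar> \<le> (1 / real (Suc k)) * (1 + \<bar>x\<bar>)}" for k
    have B: "B k \<in> sets borel" for k unfolding B_def by measurable
    have fin: "AE x in lborel. x \<notin> {y0/(1-y0), y0/(1+y0)}"
      by (intro AE_not_in finite_imp_null_set_lborel) auto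
    have "AE x in lborel. eventually (\<lambda>k. x \<notin> B k) sequentially"
      using fin
    proof eventually_elim
      case (elim x)
      have "x \<noteq> y0 * (1 + \<bar>x\<bar>)"
      proof
        assume *: "x = y0 * (1 + \<bar>x\<bar>)"
        show False
        proof (cases "x \<ge> 0")
          case True
          then have "x * (1 - y0) = y0" using * by (simp add: algebra_simps)
          moreover from this have "y0 \<noteq> 1" by auto
          ultimately show False using elim by (simp add: field_simps)
        next
          case False
          then have "x * (1 + y0) = y0" using * by (simp add: algebra_simps)
          moreover from this have "y0 \<noteq> -1" by auto
          ultimately show False using elim by (simp add: field_simps)
        qed
      qed
      then have pos: "\<bar>x - y0 * (1 + \<bar>x\<bar>)\<bar> > 0" by auto
      have "(\<lambda>k. (1 / real (Suc k)) * (1 + \<bar>x\<bar>)) \<longlonglongrightarrow> 0 * (1 + \<bar>x\<bar>)"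
        by (intro tendsto_intros LIMSEQ_Suc lim_1_over_n)
      then have "eventually (\<lambda>k. (1 / real (Suc k)) * (1 + \<bar>x\<bar>) < \<bar>x - y0 * (1 + \<bar>x\<bar>)\<bar>) sequentially"
        using pos by (auto dest!: order_tendstoD)
      then show ?case by eventually_elim (auto simp: B_def)
    qed
    then obtain k where k: "\<And>n t. t \<in> {0..T} \<Longrightarrow> (LINT x:B k|lborel. F n t x) < e/4"
    proof -
      assume ev: "AE x in lborel. eventually (\<lambda>k. x \<notin> B k) sequentially"
        and *: "\<And>k. (\<And>n t. t \<in> {0..T} \<Longrightarrow> (LINT x:B k|lborel. F n t x) < e/4) \<Longrightarrow> thesis"
      from e have "0 < e/4" by simp
      obtain k0 where k0: "\<forall>i\<in>UNIV \<times> {0..T}. \<forall>k\<ge>k0. (LINT x:B k|lborel. (case i of (n, t) \<Rightarrow> F n t) x) < e/4"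
        using equi_integrable_shrinking[OF UI B ev \<open>0 < e/4\<close>] by blast
      show thesis
      proof (rule *[of k0])
        fix n t assume "t \<in> {0..T}"
        then show "(LINT x:B k0|lborel. F n t x) < e/4" using bspec[OF k0, of "(n,t)"] by auto
      qed
    qed
    define d1 where "d1 = 1 / real (Suc k)"
    have d1: "0 < d1" "d1 \<le> 1" by (auto simp: d1_def)
    have sub: "squeezed_ray y - squeezed_ray y' \<subseteq> B k" if "\<bar>y - y0\<bar> \<le> d1" "\<bar>y' - y0\<bar> \<le> d1" for y y'
    proof
      fix x assume x: "x \<in> squeezed_ray y - squeezed_ray y'"
      have "y * (1 + \<bar>x\<bar>) \<le> (y0 + d1) * (1 + \<bar>x\<bar>)" "(y0 - d1) * (1 + \<bar>x\<bar>) \<le> y' * (1 + \<bar>x\<bar>)"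
        using that by (intro mult_right_mono; linarith)+
      with x show "x \<in> B k" unfolding B_def squeezed_ray_def d1_def[symmetric] by (auto simp: algebra_simps abs_if)
    qed
    have close: "\<bar>G n (t,y) - G n (t,y')\<bar> < e/4"
      if "\<bar>y - y0\<bar> \<le> d1" "\<bar>y' - y0\<bar> \<le> d1" "t \<in> {0..T}" for n t y y'
    proof -
      have "\<bar>G n (t,y) - G n (t,y')\<bar> \<le> (LINT x:B k|lborel. F n t x)"
        unfolding G_def fst_conv snd_conv using that by (intro abs_set_integral_diff_le F B sub squeezed_ray_borel) auto
      also have "\<dots> < e/4" using k that by auto
      finally show ?thesis .
    qed
    define y1 where "y1 = (if y0 \<ge> 0 then y0 - d1/2 else y0 + d1/2)"
    have y1: "-1 < y1" "y1 < 1" "\<bar>y1 - y0\<bar> \<le> d1" using y0 d1 by (auto simp: y1_def)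
    obtain a where a: "squeezed_ray y1 = {..a}" using squeezed_ray_eq_atMost y1 by metis
    obtain d2 where d2: "d2 > 0" "\<And>n s t. s \<in> {0..T} \<Longrightarrow> t \<in> {0..T} \<Longrightarrow> \<bar>s-t\<bar> < d2 \<Longrightarrow>
       \<bar>G n (s,y1) - G n (t,y1)\<bar> < e/4"
      using eq[of "e/4" a] e unfolding G_def by (auto simp: a)
    show "\<exists>d>0. \<forall>n q. q \<in> S \<and> norm (p - q) < d \<longrightarrow> norm (G n p - G n q) < e"
    proof (intro exI[of _ "min d1 d2"] conjI allI impI)
      fix n q assume q: "q \<in> S \<and> norm (p - q) < min d1 d2"
      obtain t y where q_eq: "q = (t,y)" by (cases q)
      have t: "t \<in> {0..T}" using q by (auto simp: S_def q_eq)
      have n: "\<bar>t0 - t\<bar> < min d1 d2" "\<bar>y0 - y\<bar> < min d1 d2"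
        using q norm_fst_le[of "t0-t" "y0-y"] norm_snd_le[of "y0-y" "t0-t"] by (auto simp: p_eq q_eq)
      have "\<bar>G n (t0,y0) - G n (t0,y1)\<bar> < e/4" "\<bar>G n (t,y1) - G n (t,y)\<bar> < e/4"
        "\<bar>G n (t0,y1) - G n (t,y1)\<bar> < e/4"
        proof -
        show "\<bar>G n (t0,y0) - G n (t0,y1)\<bar> < e/4" by (rule close) (use d1 y1 t0 in auto)
        show "\<bar>G n (t,y1) - G n (t,y)\<bar> < e/4" by (rule close) (use n d1 y1 t in auto)
        show "\<bar>G n (t0,y1) - G n (t,y1)\<bar> < e/4" by (rule d2(2)) (use n t t0 in auto)
      qed
      then show "norm (G n p - G n q) < e" unfolding p_eq q_eq real_norm_def using e by linarith
    qed (use d1 d2 in auto)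
  qed blast
  show ?thesis
  proof (rule that[OF g(1)])
    fix a
    obtain y where y: "-1 \<le> y" "y \<le> 1" "{..a} = squeezed_ray y" by (rule atMost_eq_squeezed_ray)
    show "uniformly_Cauchy_on {0..T} (\<lambda>n t. LINT x:{..a}|lborel. F (r n) t x)"
    proof (rule uniformly_Cauchy_onI)
      fix e :: real assume "e > 0"
      then obtain N where N: "\<And>n x. n \<ge> N \<Longrightarrow> x \<in> S \<Longrightarrow> \<bar>G (r n) x - g x\<bar> < e/2"
        using g(2)[of "e/2"] by auto
      show "\<exists>M. \<forall>t\<in>{0..T}. \<forall>m\<ge>M. \<forall>n\<ge>M. dist (LINT x:{..a}|lborel. F (r m) t x) (LINT x:{..a}|lborel. F (r n) t x) < e"
      proof (intro exI[of _ N] ballI allI impI)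
        fix t m n assume "t \<in> {0..T}" "N \<le> m" "N \<le> n"
        then have "\<bar>G (r m) (t,y) - g (t,y)\<bar> < e/2" "\<bar>G (r n) (t,y) - g (t,y)\<bar> < e/2"
          using y by (auto intro!: N simp: S_def simp del: less_divide_eq_numeral1)
        then have "\<bar>G (r m) (t,y) - G (r n) (t,y)\<bar> < e" by linarith
        then show "dist (LINT x:{..a}|lborel. F (r m) t x) (LINT x:{..a}|lborel. F (r n) t x) < e"
          by (simp add: G_def y(3) dist_real_def)
      qed
    qed
  qed
qed

text \<open>Dynkin\<close>

lemma uniformly_Cauchy_on_set_integral_Un:
  fixes F :: "nat \<Rightarrow> real \<Rightarrow> real \<Rightarrow> real"
  assumes UI: "equi_integrable (UNIV \<times> {0..T}) (\<lambda>(n,t). F n t)"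
    and A: "\<And>k::nat. A k \<in> sets borel" and mono: "incseq A"
    and C: "\<And>k. uniformly_Cauchy_on {0..T} (\<lambda>n t. LINT x:A k|lborel. F n t x)"
  shows "uniformly_Cauchy_on {0..T} (\<lambda>n t. LINT x:(\<Union>k. A k)|lborel. F n t x)"
proof (rule uniformly_Cauchy_onI)
  fix e :: real assume "e > 0"
  then have e: "0 < e/3" by simp
  let ?D = "\<lambda>k. (\<Union>k. A k) - A k"
  have D: "?D k \<in> sets borel" for k using A by auto
  have "eventually (\<lambda>k. x \<notin> ?D k) sequentially" for x
  proof (cases "x \<in> (\<Union>k. A k)")
    case True
    then obtain k where "x \<in> A k" by auto
    then have "x \<notin> ?D l" if "l \<ge> k" for l using incseqD[OF mono that] by auto
    then show ?thesis by (auto simp: eventually_sequentially)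
  qed auto
  then have ev: "AE x in lborel. eventually (\<lambda>k. x \<notin> ?D k) sequentially" by simp
  obtain k where k': "\<forall>i\<in>UNIV \<times> {0..T}. \<forall>k'\<ge>k. (LINT x:?D k'|lborel. (case i of (n, t) \<Rightarrow> F n t) x) < e/3"
    using equi_integrable_shrinking[OF UI D ev e] by blast
  have k: "(LINT x:?D k|lborel. F n t x) < e/3" if "t \<in> {0..T}" for n t
    using bspec[OF k', of "(n,t)"] that by (simp del: less_divide_eq_numeral1)
  have F: "integrable lborel (F n t)" "0 \<le> F n t x" if "t \<in> {0..T}" for n t x
    using equi_integrableD[OF UI, of "(n,t)"] that by auto
  have close: "\<bar>(LINT x:(\<Union>k. A k)|lborel. F n t x) - (LINT x:A k|lborel. F n t x)\<bar> < e/3" if "t \<in> {0..T}" for n t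
  proof -
    have "\<bar>(LINT x:(\<Union>k. A k)|lborel. F n t x) - (LINT x:A k|lborel. F n t x)\<bar> \<le> (LINT x:?D k|lborel. F n t x)"
      using F[OF that] A by (intro abs_set_integral_diff_le) auto
    also have "\<dots> < e/3" by (rule k) fact
    finally show ?thesis .
  qed
  from C[of k] e obtain M where M: "\<And>t m n. t \<in> {0..T} \<Longrightarrow> m \<ge> M \<Longrightarrow> n \<ge> M \<Longrightarrow>
      \<bar>(LINT x:A k|lborel. F m t x) - (LINT x:A k|lborel. F n t x)\<bar> < e/3"
    unfolding uniformly_Cauchy_on_def dist_real_def by blast
  show "\<exists>M. \<forall>t\<in>{0..T}. \<forall>m\<ge>M. \<forall>n\<ge>M. dist (LINT x:(\<Union>k. A k)|lborel. F m t x) (LINT x:(\<Union>k. A k)|lborel. F n t x) < e"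
  proof (intro exI[of _ M] ballI allI impI)
    fix t m n assume "t \<in> {0..T}" "M \<le> m" "M \<le> n"
    then show "dist (LINT x:(\<Union>k. A k)|lborel. F m t x) (LINT x:(\<Union>k. A k)|lborel. F n t x) < e"
      using close[of t m] close[of t n] M[of t m n] unfolding dist_real_def by linarith
  qed
qed

lemma uniformly_Cauchy_on_add:
  fixes f g :: "nat \<Rightarrow> 'a \<Rightarrow> real"
  assumes "uniformly_Cauchy_on S f" "uniformly_Cauchy_on S g"
  shows "uniformly_Cauchy_on S (\<lambda>n x. f n x + g n x)"
proof (rule uniformly_Cauchy_onI)
  fix e :: real assume "e > 0"
  then have "e/2 > 0" by simp
  with assms obtain M N where 
    M: "\<And>x m n. x \<in> S \<Longrightarrow> m \<ge> M \<Longrightarrow> n \<ge> M \<Longrightarrow> \<bar>f m x - f n x\<bar> < e/2" and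
    N: "\<And>x m n. x \<in> S \<Longrightarrow> m \<ge> N \<Longrightarrow> n \<ge> N \<Longrightarrow> \<bar>g m x - g n x\<bar> < e/2"
    unfolding uniformly_Cauchy_on_def dist_real_def by metis
  show "\<exists>M. \<forall>x\<in>S. \<forall>m\<ge>M. \<forall>n\<ge>M. dist (f m x + g m x) (f n x + g n x) < e"
  proof (intro exI[of _ "max M N"] ballI allI impI)
    fix x m n assume "x \<in> S" "max M N \<le> m" "max M N \<le> n"
    then show "dist (f m x + g m x) (f n x + g n x) < e"
      using M[of x m n] N[of x m n] unfolding dist_real_def max.bounded_iff by linarith
  qed
qed

lemma uniformly_Cauchy_on_mult_left:
  fixes f :: "nat \<Rightarrow> 'a \<Rightarrow> real"
  assumes "uniformly_Cauchy_on S f"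
  shows "uniformly_Cauchy_on S (\<lambda>n x. c * f n x)"
proof (rule uniformly_Cauchy_onI)
  fix e :: real assume "e > 0"
  then have "e/(\<bar>c\<bar>+1) > 0" by simp
  with assms obtain M where 
    M: "\<And>x m n. x \<in> S \<Longrightarrow> m \<ge> M \<Longrightarrow> n \<ge> M \<Longrightarrow> \<bar>f m x - f n x\<bar> < e/(\<bar>c\<bar>+1)"
    unfolding uniformly_Cauchy_on_def dist_real_def by metis
  show "\<exists>M. \<forall>x\<in>S. \<forall>m\<ge>M. \<forall>n\<ge>M. dist (c * f m x) (c * f n x) < e"
  proof (intro exI[of _ M] ballI allI impI)
    fix x m n assume "x \<in> S" "M \<le> m" "M \<le> n"
    then have "(\<bar>c\<bar>+1) * \<bar>f m x - f n x\<bar> < e"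
      using M[of x m n] by (simp add: pos_less_divide_eq mult.commute)
    moreover have "\<bar>c * f m x - c * f n x\<bar> = \<bar>c\<bar> * \<bar>f m x - f n x\<bar>"
      by (simp add: abs_mult flip: right_diff_distrib)
    moreover have "\<bar>c\<bar> * \<bar>f m x - f n x\<bar> \<le> (\<bar>c\<bar>+1) * \<bar>f m x - f n x\<bar>"
      by (intro mult_right_mono) auto
    ultimately show "dist (c * f m x) (c * f n x) < e"
      unfolding dist_real_def by linarith
  qed
qed

lemma Cauchy_on_rays_imp_Cauchy_on_borel:
  fixes F :: "nat \<Rightarrow> real \<Rightarrow> real \<Rightarrow> real"
  assumes UI: "equi_integrable (UNIV \<times> {0..T}) (\<lambda>(n,t). F n t)"
    and C: "\<And>a. uniformly_Cauchy_on {0..T} (\<lambda>n t. LINT x:{..a}|lborel. F n t x)"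
    and A: "A \<in> sets borel"
  shows "uniformly_Cauchy_on {0..T} (\<lambda>n t. LINT x:A|lborel. F n t x)"
proof -
  have F: "integrable lborel (F n t)" "0 \<le> F n t x" if "t \<in> {0..T}" for n t x
    using equi_integrableD[OF UI, of "(n,t)"] that by auto
  have Un: "(\<Union>k. {..real k}) = UNIV" using real_arch_simple by auto
  have univ: "uniformly_Cauchy_on {0..T} (\<lambda>n t. LINT x:UNIV|lborel. F n t x)"
    using uniformly_Cauchy_on_set_integral_Un[OF UI, of "\<lambda>k. {..real k}"] C
    by (auto simp: Un incseq_def)
  have congI: "uniformly_Cauchy_on {0..T} f" if "uniformly_Cauchy_on {0..T} g"
    "\<And>n t. t \<in> {0..T} \<Longrightarrow> f n t = g n t" for f g :: "nat \<Rightarrow> real \<Rightarrow> real"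
    using that unfolding uniformly_Cauchy_on_def by simp
  have *: "A \<in> sigma_sets UNIV (range (\<lambda>a. {..a::real}))"
    using A by (metis borel_eq_atMost sets_measure_of_conv subset_UNIV top_greatest Pow_UNIV)
  have **: "B \<in> sets borel" if "B \<in> sigma_sets UNIV (range (\<lambda>a. {..a::real}))" for B
    using that by (metis borel_eq_atMost sets_measure_of_conv subset_UNIV top_greatest Pow_UNIV)
  show ?thesis
  proof (rule sigma_sets_induct_disjoint[OF _ _ *])
    show "Int_stable (range (\<lambda>a. {..a::real}))"
      by (auto simp: Int_stable_def)
  next
    fix B assume compl: "B \<in> sigma_sets UNIV (range (\<lambda>a. {..a::real}))"
      "uniformly_Cauchy_on {0..T} (\<lambda>n t. LINT x:B|lborel. F n t x)"
    show "uniformly_Cauchy_on {0..T} (\<lambda>n t. LINT x:UNIV - B|lborel. F n t x)"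
    proof (rule congI[OF uniformly_Cauchy_on_add[OF univ uniformly_Cauchy_on_mult_left[OF compl(2), of "-1"]]])
      fix n t assume t: "t \<in> {0..T}"
      have "(LINT x:(UNIV - B) \<union> B|lborel. F n t x) = (LINT x:UNIV - B|lborel. F n t x) + (LINT x:B|lborel. F n t x)"
        using F[OF t] **[OF compl(1)] by (intro set_integral_Un set_integrable_subset_borel) auto
      then show "(LINT x:UNIV - B|lborel. F n t x) = (LINT x:UNIV|lborel. F n t x) + -1 * (LINT x:B|lborel. F n t x)"
        by simp
    qed
  next
    fix B :: "nat \<Rightarrow> real set" assume union: "disjoint_family B" "range B \<subseteq> sigma_sets UNIV (range (\<lambda>a. {..a::real}))"
      "\<And>i. uniformly_Cauchy_on {0..T} (\<lambda>n t. LINT x:B i|lborel. F n t x)"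
    have B: "B i \<in> sets borel" for i using union(2) ** by auto
    have part: "uniformly_Cauchy_on {0..T} (\<lambda>n t. LINT x:(\<Union>i<k. B i)|lborel. F n t x)" for k
    proof (induction k)
      case (Suc k)
      show ?case
      proof (rule congI[OF uniformly_Cauchy_on_add[OF Suc union(3)[of k]]])
        fix n t assume t: "t \<in> {0..T}"
        have "B i \<inter> B k = {}" if "i < k" for i
          using disjoint_family_onD[OF union(1), of i k] that by simp
        then have "(\<Union>i<k. B i) \<inter> B k = {}" by blast
        then have "(LINT x:(\<Union>i<k. B i) \<union> B k|lborel. F n t x) = (LINT x:(\<Union>i<k. B i)|lborel. F n t x) + (LINT x:B k|lborel. F n t x)"
          using F[OF t] B by (intro set_integral_Un set_integrable_subset_borel) auto
        then show "(LINT x:(\<Union>i<Suc k. B i)|lborel. F n t x) = (LINT x:(\<Union>i<k. B i)|lborel. F n t x) + (LINT x:B k|lborel. F n t x)"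
          by (simp add: lessThan_Suc Un_commute)
      qed
    qed (simp add: uniformly_Cauchy_on_def set_lebesgue_integral_def)
    have "(\<Union>k. \<Union>i<k. B i) = (\<Union>i. B i)" by auto
    then show "uniformly_Cauchy_on {0..T} (\<lambda>n t. LINT x:(\<Union>i. B i)|lborel. F n t x)"
      using uniformly_Cauchy_on_set_integral_Un[OF UI _ _ part, of "\<lambda>k. k"] B
      by (simp add: incseq_def UN_mono)
  qed (use C in \<open>auto simp: uniformly_Cauchy_on_def set_lebesgue_integral_def\<close>)
qed

lemma limit_density:
  fixes F :: "nat \<Rightarrow> real \<Rightarrow> real"
  assumes UI: "equi_integrable UNIV F"
    and conv: "\<And>A. A \<in> sets borel \<Longrightarrow> convergent (\<lambda>n. LINT x:A|lborel. F n x)"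
  obtains f where "integrable lborel f" "\<And>x. 0 \<le> f x"
    "\<And>A. A \<in> sets borel \<Longrightarrow> (\<lambda>n. LINT x:A|lborel. F n x) \<longlonglongrightarrow> (LINT x:A|lborel. f x)"
proof -
  define m where "m A = lim (\<lambda>n. LINT x:A|lborel. F n x)" for A
  have m: "(\<lambda>n. LINT x:A|lborel. F n x) \<longlonglongrightarrow> m A" if "A \<in> sets borel" for A
    using conv[OF that] by (simp add: m_def convergent_LIMSEQ_iff)
  note F = equi_integrableD[OF UI UNIV_I]
  obtain C where "\<forall>n\<in>UNIV. (\<integral>x. F n x \<partial>lborel) \<le> C \<and> (\<forall>A\<in>sets borel.
      0 \<le> (LINT x:A|lborel. F n x) \<and> (LINT x:A|lborel. F n x) \<le> C)"
    using equi_integrable_bounded[OF UI] by blast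
  then have C: "0 \<le> (LINT x:A|lborel. F n x) \<and> (LINT x:A|lborel. F n x) \<le> C" if "A \<in> sets borel" for n A
    using that by blast
  have m_nn: "0 \<le> m A" if "A \<in> sets borel" for A
    using m[OF that] C[OF that] by (auto intro: LIMSEQ_le_const)
  define N where "N = measure_of UNIV (sets borel) (\<lambda>A. ennreal (m A))"
  have meas: "countably_additive (sets borel) (\<lambda>A. ennreal (m A))" "positive (sets borel) (\<lambda>A. ennreal (m A))"
  proof -
    have "m {} = 0" using m[of "{}"] by (simp add: set_lebesgue_integral_def LIMSEQ_const_iff)
    then show pos: "positive (sets borel) (\<lambda>A. ennreal (m A))" by (simp add: positive_def)
    have add: "additive (sets borel) (\<lambda>A. ennreal (m A))"
    proof (unfold additive_def, intro ballI impI)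
      fix A B :: "real set" assume AB: "A \<in> sets borel" "B \<in> sets borel" "A \<inter> B = {}"
      have "(LINT x:A \<union> B|lborel. F n x) = (LINT x:A|lborel. F n x) + (LINT x:B|lborel. F n x)" for n
        using AB F by (intro set_integral_Un set_integrable_subset_borel) auto
      then have "m (A \<union> B) = m A + m B"
        using tendsto_add[OF m[OF AB(1)] m[OF AB(2)]] m[of "A \<union> B"] AB
        by (auto intro: LIMSEQ_unique)
      then show "ennreal (m (A \<union> B)) = ennreal (m A) + ennreal (m B)"
        using m_nn AB by (simp add: ennreal_plus)
    qed
    show "countably_additive (sets borel) (\<lambda>A. ennreal (m A))"
    proof (rule ring_of_sets.empty_continuous_imp_countably_additive[OF _ pos add])
      show "ring_of_sets (UNIV::real set) (sets borel)"
        using sets.ring_of_sets_axioms[of borel] by simp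
      fix A :: "nat \<Rightarrow> real set" assume A: "range A \<subseteq> sets borel" "decseq A" "(\<Inter>i. A i) = {}"
      have ev: "eventually (\<lambda>i. x \<notin> A i) sequentially" for x
      proof -
        from A(3) obtain i where "x \<notin> A i" by auto
        then have "x \<notin> A j" if "j \<ge> i" for j using decseqD[OF A(2) that] by auto
        then show ?thesis by (auto simp: eventually_sequentially)
      qed
      have "(\<lambda>i. m (A i)) \<longlonglongrightarrow> 0"
      proof (rule LIMSEQ_I)
        fix e :: real assume "0 < e"
        then have e: "0 < e/2" by simp
        have A': "A k \<in> sets borel" for k using A by auto
        have ev': "AE x in lborel. eventually (\<lambda>i. x \<notin> A i) sequentially" using ev by simp
        obtain k0 where k0: "\<And>n k. k \<ge> k0 \<Longrightarrow> (LINT x:A k|lborel. F n x) < e/2"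
          using equi_integrable_shrinking[OF UI A' ev' e] by blast
        have "norm (m (A k) - 0) < e" if "k \<ge> k0" for k
        proof -
          have "m (A k) \<le> e/2" using k0[OF that]
            by (intro LIMSEQ_le_const2[OF m[OF A']]) (auto intro!: exI[of _ 0] less_imp_le)
          then show ?thesis using m_nn[OF A'[of k]] \<open>0 < e\<close> by auto
        qed
        then show "\<exists>no. \<forall>n\<ge>no. norm (m (A n) - 0) < e" by blast
      qed
      then show "(\<lambda>i. ennreal (m (A i))) \<longlonglongrightarrow> 0"
        using tendsto_ennrealI[of _ 0] by simp
    qed auto
  qed
  have sN: "sets N = sets borel" "space N = UNIV" unfolding N_def
    using sets.sigma_sets_eq[of borel] by (auto simp: sets.space_closed sets_measure_of_conv)
  have eN: "emeasure N A = ennreal (m A)" if "A \<in> sets borel" for A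
    unfolding N_def using that meas sets.sigma_algebra_axioms[of borel]
    by (intro emeasure_measure_of_sigma) auto
  have "absolutely_continuous lborel N"
  proof (unfold absolutely_continuous_def, rule subsetI)
    fix A assume "A \<in> null_sets (lborel :: real measure)"
    then have A: "A \<in> sets borel" and null: "A \<in> null_sets lborel" by auto
    have "(LINT x:A|lborel. F n x) = 0" for n
      unfolding set_lebesgue_integral_def using AE_not_in[OF null]
      by (intro integral_eq_zero_AE) (auto elim!: eventually_mono)
    then have "m A = 0" using m[OF A] by (simp add: LIMSEQ_const_iff)
    then show "A \<in> null_sets N" using A eN[OF A] sN by (auto intro!: null_setsI)
  qed
  then obtain g where g: "g \<in> borel_measurable lborel" "density lborel g = N"
    using sigma_finite_lborel[THEN sigma_finite_measure.Radon_Nikodym, of N] sN by auto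
  have gA: "(\<integral>\<^sup>+x. g x * indicator A x \<partial>lborel) = ennreal (m A)" if "A \<in> sets borel" for A
    using eN[OF that] emeasure_density[OF g(1), of A] that by (simp add: g(2))
  have fin: "(\<integral>\<^sup>+x. g x \<partial>lborel) \<noteq> \<infinity>" using gA[of UNIV] by simp
  have AE: "AE x in lborel. g x \<noteq> \<infinity>" using nn_integral_PInf_AE[OF g(1) fin] by auto
  define f where "f x = enn2real (g x)" for x
  have fm: "f \<in> borel_measurable lborel" unfolding f_def using g(1) by measurable
  have fg: "AE x in lborel. ennreal (f x) = g x" using AE by eventually_elim (auto simp: f_def less_top)
  have fi: "integrable lborel f"
  proof (rule integrableI_nonneg)
    have "(\<integral>\<^sup>+x. ennreal (f x) \<partial>lborel) = (\<integral>\<^sup>+x. g x \<partial>lborel)" using fg by (intro nn_integral_cong_AE)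
    then show "(\<integral>\<^sup>+x. ennreal (f x) \<partial>lborel) < \<infinity>" using fin by (simp add: less_top)
  qed (use fm in \<open>auto simp: f_def\<close>)
  show ?thesis
  proof (rule that[of f])
    fix A :: "real set" assume A: "A \<in> sets borel"
    have "ennreal (LINT x:A|lborel. f x) = (\<integral>\<^sup>+x. ennreal (indicator A x * f x) \<partial>lborel)"
      unfolding set_lebesgue_integral_def using set_integrable_subset_borel[OF fi A]
      by (subst nn_integral_eq_integral) (auto simp: set_integrable_def f_def)
    also have "\<dots> = (\<integral>\<^sup>+x. g x * indicator A x \<partial>lborel)" using fg
      by (intro nn_integral_cong_AE) (auto simp: indicator_def)
    also have "\<dots> = ennreal (m A)" by (rule gA[OF A])
    finally have "(LINT x:A|lborel. f x) = m A"
      using m_nn[OF A] by (subst (asm) ennreal_inj) (auto simp: set_lebesgue_integral_def f_def intro!: integral_nonneg_AE)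
    then show "(\<lambda>n. LINT x:A|lborel. F n x) \<longlonglongrightarrow> (LINT x:A|lborel. f x)" using m[OF A] by simp
  qed (use fi in \<open>auto simp: f_def\<close>)
qed

lemma uniform_limit_finite_sum:
  fixes f :: "'i \<Rightarrow> 'n \<Rightarrow> 'a \<Rightarrow> 'b::real_normed_vector"
  assumes "finite Z" "\<And>z. z \<in> Z \<Longrightarrow> uniform_limit S (f z) (l z) F"
  shows "uniform_limit S (\<lambda>n x. \<Sum>z\<in>Z. f z n x) (\<lambda>x. \<Sum>z\<in>Z. l z x) F"
  using assms by (induction Z) (auto intro!: uniform_limit_intros)

lemma set_uniform_limit_imp_bounded:
  fixes F :: "nat \<Rightarrow> real \<Rightarrow> real \<Rightarrow> real"
  assumes UI: "equi_integrable (UNIV \<times> {0..T}) (\<lambda>(n,t). F n t)"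
    and f: "\<And>t. t \<in> {0..T} \<Longrightarrow> integrable lborel (f t)" "\<And>t x. t \<in> {0..T} \<Longrightarrow> 0 \<le> f t x"
    and conv: "\<And>A. A \<in> sets borel \<Longrightarrow> uniform_limit {0..T} (\<lambda>n t. LINT x:A|lborel. F n t x) (\<lambda>t. LINT x:A|lborel. f t x) sequentially"
    and g: "g \<in> borel_measurable borel" "\<And>x. \<bar>g x\<bar> \<le> (B::real)"
  shows "uniform_limit {0..T} (\<lambda>n t. \<integral>x. F n t x * g x \<partial>lborel) (\<lambda>t. \<integral>x. f t x * g x \<partial>lborel) sequentially"
proof (rule uniform_limitI)
  fix e :: real assume e: "e > 0"
  have F: "integrable lborel (F n t)" "0 \<le> F n t x" if "t \<in> {0..T}" for n t x
    using equi_integrableD[OF UI, of "(n,t)"] that by auto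
  obtain C where C0: "C > 0" and C': "\<forall>i\<in>UNIV \<times> {0..T}. (\<integral>x. (case i of (n, t) \<Rightarrow> F n t) x \<partial>lborel) \<le> C \<and>
      (\<forall>A\<in>sets borel. 0 \<le> (LINT x:A|lborel. (case i of (n, t) \<Rightarrow> F n t) x) \<and> (LINT x:A|lborel. (case i of (n, t) \<Rightarrow> F n t) x) \<le> C)"
    using equi_integrable_bounded[OF UI] by blast
  have C: "(\<integral>x. F n t x \<partial>lborel) \<le> C" if "t \<in> {0..T}" for n t using bspec[OF C', of "(n,t)"] that by simp
  have Cf: "(\<integral>x. f t x \<partial>lborel) \<le> C" if "t \<in> {0..T}" for t
    using tendsto_uniform_limitI[OF conv[of UNIV] that] C[OF that]
    by (intro LIMSEQ_le_const2[where X="\<lambda>n. \<integral>x. F n t x \<partial>lborel"]) (auto simp: set_lebesgue_integral_def)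
  obtain k :: nat where k: "k > 0" "C / real k < e/3"
  proof -
    obtain k :: nat where "C / (e/3) < real k" using reals_Archimedean2 by blast
    moreover from this have "real k > 0" using C0 e by (smt (verit) divide_pos_pos)
    ultimately show ?thesis using e by (intro that[of k]) (auto simp: field_simps)
  qed
  define G where "G x = real_of_int \<lfloor>real k * g x\<rfloor> / real k" for x
  define Z where "Z = {-\<lceil>real k * B\<rceil> - 1 .. \<lceil>real k * B\<rceil>}"
  define S where "S z = {x. \<lfloor>real k * g x\<rfloor> = z}" for z
  have S: "S z \<in> sets borel" for z unfolding S_def using g(1) by measurable
  have inZ: "\<lfloor>real k * g x\<rfloor> \<in> Z" for x
  proof -
    have "real k * \<bar>g x\<bar> \<le> real k * B" using g(2) by (intro mult_left_mono) auto
    then have "\<bar>real k * g x\<bar> \<le> real k * B" by (simp add: abs_mult)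
    then show ?thesis unfolding Z_def by (auto simp: le_floor_iff floor_le_iff abs_le_iff; linarith)
  qed
  have G_eq: "G x = (\<Sum>z\<in>Z. (real_of_int z / real k) * indicator (S z) x)" for x
  proof -
    have "(\<Sum>z\<in>Z. (real_of_int z / real k) * indicator (S z) x)
       = (\<Sum>z\<in>Z. if z = \<lfloor>real k * g x\<rfloor> then real_of_int z / real k else 0)"
      by (intro sum.cong) (auto simp: S_def)
    also have "\<dots> = G x" using inZ[of x] by (simp add: G_def Z_def)
    finally show ?thesis ..
  qed
  have Gg: "\<bar>g x - G x\<bar> \<le> 1 / real k" for x
  proof -
    have "\<bar>real k * g x - real_of_int \<lfloor>real k * g x\<rfloor>\<bar> \<le> 1" by linarith
    moreover have "real k * g x - real_of_int \<lfloor>real k * g x\<rfloor> = real k * (g x - G x)"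
      using k by (simp add: G_def field_simps)
    ultimately have "real k * \<bar>g x - G x\<bar> \<le> 1" using k(1) by (simp add: abs_mult)
    then show ?thesis using k(1) by (simp add: pos_le_divide_eq mult.commute)
  qed
  have Gm: "G \<in> borel_measurable borel" unfolding G_def using g(1) by measurable
  have int: "integrable lborel (\<lambda>x. p x * q x)" if "integrable lborel p" "q \<in> borel_measurable borel" "\<And>x. \<bar>q x\<bar> \<le> c" for p q :: "real \<Rightarrow> real" and c
  proof (rule Bochner_Integration.integrable_bound[where f="\<lambda>x. c * p x"])
    show "AE x in lborel. norm (p x * q x) \<le> norm (c * p x)"
    proof (intro AE_I2)
      fix x have "0 \<le> c" using that(3)[of x] by linarith
      then show "norm (p x * q x) \<le> norm (c * p x)" using mult_right_mono[OF that(3)[of x], of "\<bar>p x\<bar>"] by (simp add: abs_mult mult.commute)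
    qed
  qed (use that in auto)
  have GB: "\<bar>G x\<bar> \<le> B + 1 / real k" for x using Gg[of x] g(2)[of x] by linarith
  have close: "\<bar>(\<integral>x. p x * g x \<partial>lborel) - (\<integral>x. p x * G x \<partial>lborel)\<bar> < e/3"
    if p: "integrable lborel p" "\<And>x. 0 \<le> p x" "(\<integral>x. p x \<partial>lborel) \<le> C" for p
  proof -
    have "\<bar>(\<integral>x. p x * g x \<partial>lborel) - (\<integral>x. p x * G x \<partial>lborel)\<bar> = \<bar>\<integral>x. p x * (g x - G x) \<partial>lborel\<bar>"
      using int[OF p(1) g] int[OF p(1) Gm GB] by (simp add: right_diff_distrib)
    also have "\<dots> \<le> (\<integral>x. \<bar>p x * (g x - G x)\<bar> \<partial>lborel)" by (rule integral_abs_bound)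
    also have "\<dots> \<le> (\<integral>x. p x * (1 / real k) \<partial>lborel)"
    proof (rule integral_mono)
      show "integrable lborel (\<lambda>x. \<bar>p x * (g x - G x)\<bar>)"
        using g(1) Gm by (intro integrable_abs int[OF p(1) _ Gg]) auto
      show "\<bar>p x * (g x - G x)\<bar> \<le> p x * (1 / real k)" for x
        using mult_left_mono[OF Gg[of x] p(2)[of x]] p(2)[of x] by (simp add: abs_mult)
    qed (use p in auto)
    also have "\<dots> \<le> C / real k" using p(3) k by (simp add: divide_right_mono)
    finally show ?thesis using k by linarith
  qed
  have expand: "(\<integral>x. p x * G x \<partial>lborel) = (\<Sum>z\<in>Z. (real_of_int z / real k) * (LINT x:S z|lborel. p x))"
    if "integrable lborel p" for p :: "real \<Rightarrow> real"
  proof -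
    have i: "integrable lborel (\<lambda>x. indicator (S z) x * p x)" for z
      using set_integrable_subset_borel[OF that S] by (simp add: set_integrable_def)
    have "(\<integral>x. p x * G x \<partial>lborel) = (\<integral>x. (\<Sum>z\<in>Z. (real_of_int z / real k) * (indicator (S z) x * p x)) \<partial>lborel)"
      by (simp add: G_eq sum_distrib_left mult_ac)
    also have "\<dots> = (\<Sum>z\<in>Z. (real_of_int z / real k) * (LINT x:S z|lborel. p x))"
      using i by (subst Bochner_Integration.integral_sum) (auto simp: set_lebesgue_integral_def)
    finally show ?thesis .
  qed
  have "uniform_limit {0..T} (\<lambda>n t. \<Sum>z\<in>Z. (real_of_int z / real k) * (LINT x:S z|lborel. F n t x))
     (\<lambda>t. \<Sum>z\<in>Z. (real_of_int z / real k) * (LINT x:S z|lborel. f t x)) sequentially"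
    by (intro uniform_limit_finite_sum bounded_linear.uniform_limit[OF bounded_linear_mult_right] conv S) (simp add: Z_def)
  from uniform_limitD[OF this, of "e/3"] e
  have "\<forall>\<^sub>F n in sequentially. \<forall>t\<in>{0..T}. \<bar>(\<Sum>z\<in>Z. (real_of_int z / real k) * (LINT x:S z|lborel. F n t x))
     - (\<Sum>z\<in>Z. (real_of_int z / real k) * (LINT x:S z|lborel. f t x))\<bar> < e/3" by (simp add: dist_real_def)
  then show "\<forall>\<^sub>F n in sequentially. \<forall>t\<in>{0..T}. dist (\<integral>x. F n t x * g x \<partial>lborel) (\<integral>x. f t x * g x \<partial>lborel) < e"
  proof eventually_elim
    case (elim n)
    show ?case
    proof
      fix t assume t: "t \<in> {0..T}"
      show "dist (\<integral>x. F n t x * g x \<partial>lborel) (\<integral>x. f t x * g x \<partial>lborel) < e"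
        using bspec[OF elim t] close[OF F(1)[OF t] F(2)[OF t] C[OF t], of n] close[OF f(1)[OF t] f(2)[OF t] Cf[OF t]]
          expand[OF F(1)[OF t], of n] expand[OF f(1)[OF t]] unfolding dist_real_def by linarith
    qed
  qed
qed

lemma weak_L1_compactness:
  fixes F :: "nat \<Rightarrow> real \<Rightarrow> real \<Rightarrow> real"
  assumes UI: "equi_integrable (UNIV \<times> {0..T}) (\<lambda>(n,t). F n t)"
    and eq: "\<And>a e. e > 0 \<Longrightarrow> \<exists>d>0. \<forall>n. \<forall>s\<in>{0..T}. \<forall>t\<in>{0..T}. \<bar>s - t\<bar> < d \<longrightarrow>
      \<bar>(LINT x:{..a}|lborel. F n s x) - (LINT x:{..a}|lborel. F n t x)\<bar> < (e::real)"
  obtains r f where "strict_mono (r::nat\<Rightarrow>nat)"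
    "\<And>t. t \<in> {0..T} \<Longrightarrow> integrable lborel (f t)" "\<And>t x. t \<in> {0..T} \<Longrightarrow> 0 \<le> f t x"
    "\<And>g B. g \<in> borel_measurable borel \<Longrightarrow> (\<And>x. \<bar>g x\<bar> \<le> (B::real)) \<Longrightarrow>
      uniform_limit {0..T} (\<lambda>n t. \<integral>x. F (r n) t x * g x \<partial>lborel) (\<lambda>t. \<integral>x. f t x * g x \<partial>lborel) sequentially"
proof -
  obtain r where r: "strict_mono (r::nat\<Rightarrow>nat)"
    "\<And>a. uniformly_Cauchy_on {0..T} (\<lambda>n t. LINT x:{..a}|lborel. F (r n) t x)"
    using subseq_Cauchy_on_rays[OF UI eq] by blast
  have UIr: "equi_integrable (UNIV \<times> {0..T}) (\<lambda>(n,t). F (r n) t)"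
    by (rule equi_integrable_reindex[OF UI, of _ "\<lambda>(n,t). (r n, t)"]) auto
  note C = Cauchy_on_rays_imp_Cauchy_on_borel[OF UIr r(2)]
  have "\<exists>f. integrable lborel f \<and> (\<forall>x. 0 \<le> f x) \<and>
    (\<forall>A\<in>sets borel. (\<lambda>n. LINT x:A|lborel. F (r n) t x) \<longlonglongrightarrow> (LINT x:A|lborel. f x))" if t: "t \<in> {0..T}" for t
  proof -
    have UIt: "equi_integrable UNIV (\<lambda>n. F (r n) t)"
      by (rule equi_integrable_reindex[OF UIr, of _ "\<lambda>n. (n, t)"]) (use t in auto)
    have conv: "convergent (\<lambda>n. LINT x:A|lborel. F (r n) t x)" if "A \<in> sets borel" for A
      using uniformly_Cauchy_imp_Cauchy[OF C[OF that] t] by (simp add: Cauchy_convergent_iff)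
    show ?thesis by (rule limit_density[OF UIt conv]) auto
  qed
  then obtain f where f: "\<And>t. t \<in> {0..T} \<Longrightarrow> integrable lborel (f t) \<and> (\<forall>x. 0 \<le> f t x) \<and>
    (\<forall>A\<in>sets borel. (\<lambda>n. LINT x:A|lborel. F (r n) t x) \<longlonglongrightarrow> (LINT x:A|lborel. f t x))"
    by metis
  have ul: "uniform_limit {0..T} (\<lambda>n t. LINT x:A|lborel. F (r n) t x) (\<lambda>t. LINT x:A|lborel. f t x) sequentially"
    if A: "A \<in> sets borel" for A
  proof -
    have "uniformly_convergent_on {0..T} (\<lambda>n t. LINT x:A|lborel. F (r n) t x)"
      using C[OF A] by (rule Cauchy_uniformly_convergent)
    then obtain l where l: "uniform_limit {0..T} (\<lambda>n t. LINT x:A|lborel. F (r n) t x) l sequentially"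
      by (auto simp: uniformly_convergent_on_def)
    have "l t = (LINT x:A|lborel. f t x)" if "t \<in> {0..T}" for t
      using tendsto_uniform_limitI[OF l that] f[OF that] A by (meson LIMSEQ_unique)
    then show ?thesis using l unfolding uniform_limit_iff by simp
  qed
  show ?thesis
  proof (rule that[of r f])
    fix g :: "real \<Rightarrow> real" and B assume "g \<in> borel_measurable borel" "\<And>x. \<bar>g x\<bar> \<le> B"
    then show "uniform_limit {0..T} (\<lambda>n t. \<integral>x. F (r n) t x * g x \<partial>lborel) (\<lambda>t. \<integral>x. f t x * g x \<partial>lborel) sequentially"
      using f by (intro set_uniform_limit_imp_bounded[OF UIr _ _ ul]) auto
  qed (use r f in auto)
qed

definition clamp_abs :: "real \<Rightarrow> real \<Rightarrow> real" where
  "clamp_abs m y = max (- m) (min m y)"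

definition cutoff :: "real \<Rightarrow> real \<Rightarrow> real" where
  "cutoff m x = max 0 (min 1 (m + 1 - \<bar>x\<bar>))"

lemma continuous_L1_dense:
  fixes h :: "real \<Rightarrow> real"
  assumes h: "integrable lborel h" and e: "0 < (e::real)"
  obtains k R where "continuous_on UNIV k" "\<And>x. R < \<bar>x\<bar> \<Longrightarrow> k x = 0" "0 < R"
    "integrable lborel k" "(\<integral>x. \<bar>h x - k x\<bar> \<partial>lborel) < e"
proof -
  have [measurable]: "h \<in> borel_measurable borel" using h by auto
  have "h measurable_on UNIV"
    by (intro lebesgue_measurable_imp_measurable_on_real measurable_completion) auto
  then obtain N g where N: "negligible N" and g: "\<And>n. continuous_on UNIV (g n)"
    "\<And>x. x \<notin> N \<Longrightarrow> (\<lambda>n. g n x) \<longlonglongrightarrow> h x"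
    unfolding measurable_on_def by auto
  have AEg: "AE x in lborel. (\<lambda>n. g n x) \<longlonglongrightarrow> h x"
  proof -
    have "N \<in> null_sets lebesgue" using N by (simp add: negligible_iff_null_sets)
    then have "AE x in lborel. x \<notin> N"
      using AE_not_in[of N lebesgue] by (simp add: AE_completion_iff)
    then show ?thesis by eventually_elim (rule g(2))
  qed
  have [measurable]: "g n \<in> borel_measurable borel" for n using g(1) by (rule borel_measurable_continuous_onI)
  have cc: "continuous_on UNIV (cutoff m)" "continuous_on UNIV (clamp_abs m)" for m
    unfolding cutoff_def clamp_abs_def by (intro continuous_intros)+
  have [measurable]: "cutoff m \<in> borel_measurable borel" "clamp_abs m \<in> borel_measurable borel" for m
    using cc by (auto intro: borel_measurable_continuous_onI)
  have cut01: "0 \<le> cutoff m x" "cutoff m x \<le> 1" for m x unfolding cutoff_def by auto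
  have cut0: "cutoff m x = 0" if "\<bar>x\<bar> > m + 1" for m x using that by (auto simp: cutoff_def)
  define hm where "hm m x = clamp_abs (real m) (h x) * cutoff (real m) x" for m x
  have hmb: "\<bar>hm m x\<bar> \<le> \<bar>h x\<bar>" for m x
  proof -
    have "\<bar>hm m x\<bar> = \<bar>clamp_abs (real m) (h x)\<bar> * cutoff (real m) x" using cut01 by (simp add: hm_def abs_mult)
    also have "\<dots> \<le> \<bar>h x\<bar> * 1" using cut01 by (intro mult_mono) (auto simp: clamp_abs_def)
    finally show ?thesis by simp
  qed
  have "(\<lambda>m. \<integral>x. \<bar>h x - hm m x\<bar> \<partial>lborel) \<longlonglongrightarrow> integral\<^sup>L (lborel::real measure) (\<lambda>x. (0::real))"
  proof (rule integral_dominated_convergence[where w="\<lambda>x. 2 * \<bar>h x\<bar>"])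
    show "AE x in lborel. (\<lambda>m. \<bar>h x - hm m x\<bar>) \<longlonglongrightarrow> 0"
    proof (intro AE_I2 tendsto_eventually)
      fix x :: real
      obtain m0 :: nat where m0: "max \<bar>h x\<bar> \<bar>x\<bar> \<le> real m0" using real_arch_simple by blast
      have "hm m x = h x" if "m \<ge> m0" for m
      proof -
        have "max \<bar>h x\<bar> \<bar>x\<bar> \<le> real m" using m0 that by linarith
        then show ?thesis by (auto simp: hm_def clamp_abs_def cutoff_def)
      qed
      then show "\<forall>\<^sub>F m in sequentially. \<bar>h x - hm m x\<bar> = 0"
        unfolding eventually_sequentially by (metis abs_zero diff_self)
    qed
    show "AE x in lborel. norm \<bar>h x - hm m x\<bar> \<le> 2 * \<bar>h x\<bar>" for m
      using hmb[of m] by (intro AE_I2) (smt (verit) real_norm_def)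
    show "(\<lambda>x. \<bar>h x - hm m x\<bar>) \<in> borel_measurable lborel" for m unfolding hm_def by measurable
  qed (use h in auto)
  then have "eventually (\<lambda>m. (\<integral>x. \<bar>h x - hm m x\<bar> \<partial>lborel) < e/2) sequentially"
    using e by (auto dest!: order_tendstoD(2)[where a="e/2"])
  then obtain m where m: "(\<integral>x. \<bar>h x - hm m x\<bar> \<partial>lborel) < e/2" by (auto simp: eventually_sequentially)
  have box: "integrable lborel (indicator {-(real m+1)..real m+1} :: real \<Rightarrow> real)" by simp
  define k where "k n x = clamp_abs (real m) (g n x) * cutoff (real m) x" for n x
  have kb: "\<bar>clamp_abs (real m) y * cutoff (real m) x\<bar> \<le> real m * indicator {-(real m+1)..real m+1} x" for y x
  proof (cases "\<bar>x\<bar> > real m + 1")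
    case False
    have "\<bar>clamp_abs (real m) y\<bar> * \<bar>cutoff (real m) x\<bar> \<le> real m * 1"
      using cut01[of "real m" x] by (intro mult_mono) (auto simp: clamp_abs_def)
    with False show ?thesis by (auto simp: abs_mult indicator_def abs_le_iff)
  qed (simp add: cut0)
  have ki: "integrable lborel (k n)" for n
  proof (rule Bochner_Integration.integrable_bound[where f="\<lambda>x. real m * indicator {-(real m+1)..real m+1} x"])
    show "AE x in lborel. norm (k n x) \<le> norm (real m * indicator {-(real m+1)..real m+1} x)"
      using kb by (auto simp: k_def)
    show "k n \<in> borel_measurable lborel" unfolding k_def[abs_def] by measurable
  qed (use box in auto)
  have hmi: "integrable lborel (hm m)"
  proof (rule Bochner_Integration.integrable_bound[OF h])
    show "hm m \<in> borel_measurable lborel" unfolding hm_def[abs_def] by measurable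
  qed (use hmb in auto)
  have "(\<lambda>n. \<integral>x. \<bar>hm m x - k n x\<bar> \<partial>lborel) \<longlonglongrightarrow> integral\<^sup>L (lborel::real measure) (\<lambda>x. (0::real))"
  proof (rule integral_dominated_convergence[where w="\<lambda>x. 2 * (real m * indicator {-(real m+1)..real m+1} x)"])
    show "AE x in lborel. (\<lambda>n. \<bar>hm m x - k n x\<bar>) \<longlonglongrightarrow> 0" using AEg
    proof eventually_elim
      case (elim x)
      have "(\<lambda>n. \<bar>hm m x - k n x\<bar>) \<longlonglongrightarrow> \<bar>hm m x - hm m x\<bar>"
        unfolding k_def hm_def clamp_abs_def by (intro tendsto_intros elim)
      then show ?case by simp
    qed
    show "AE x in lborel. norm \<bar>hm m x - k n x\<bar> \<le> 2 * (real m * indicator {-(real m+1)..real m+1} x)" for n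
    proof (intro AE_I2)
      fix x show "norm \<bar>hm m x - k n x\<bar> \<le> 2 * (real m * indicator {-(real m+1)..real m+1} x)"
        using kb[of "h x" x] kb[of "g n x" x] unfolding hm_def k_def real_norm_def by linarith
    qed
    show "(\<lambda>x. \<bar>hm m x - k n x\<bar>) \<in> borel_measurable lborel" for n unfolding hm_def k_def by measurable
  qed (use box in auto)
  then have "eventually (\<lambda>n. (\<integral>x. \<bar>hm m x - k n x\<bar> \<partial>lborel) < e/2) sequentially"
    using e by (auto dest!: order_tendstoD(2)[where a="e/2"])
  then obtain n where n: "(\<integral>x. \<bar>hm m x - k n x\<bar> \<partial>lborel) < e/2" by (auto simp: eventually_sequentially)
  show ?thesis
  proof (rule that[of "k n" "real m + 1"])
    show "continuous_on UNIV (k n)" unfolding k_def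
      by (intro continuous_on_mult cc(1) continuous_on_compose2[OF cc(2)] g(1)) auto
    show "k n x = 0" if "real m + 1 < \<bar>x\<bar>" for x using cut0[OF that] by (simp add: k_def)
    have "(\<integral>x. \<bar>h x - k n x\<bar> \<partial>lborel) \<le> (\<integral>x. \<bar>h x - hm m x\<bar> + \<bar>hm m x - k n x\<bar> \<partial>lborel)"
      using h hmi ki by (intro integral_mono) auto
    also have "\<dots> < e" using h hmi ki m n by simp
    finally show "(\<integral>x. \<bar>h x - k n x\<bar> \<partial>lborel) < e" .
  qed (use ki in auto)
qed

text \<open>cells\<close>

definition grid_cell :: "nat \<Rightarrow> nat \<Rightarrow> real set" where
  "grid_cell n j = {real j / real n ..< (real j + 1) / real n}"

definition cell_average :: "nat \<Rightarrow> (real \<Rightarrow> real) \<Rightarrow> real \<Rightarrow> real" where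
  "cell_average n h x = (\<Sum>j<n*n. (real n * (LINT y:grid_cell n j|lborel. h y)) * indicator (grid_cell n j) x)"

definition weight_norm :: "(real \<Rightarrow> real) \<Rightarrow> real" where
  "weight_norm p = (\<integral>x. indicator {0..} x * (1 + x) * \<bar>p x\<bar> \<partial>lborel)"

definition weight_integrable :: "(real \<Rightarrow> real) \<Rightarrow> bool" where
  "weight_integrable p \<longleftrightarrow> p \<in> borel_measurable borel \<and> integrable lborel (\<lambda>x. indicator {0..} x * (1 + x) * \<bar>p x\<bar>)"

lemma grid_cell_borel [measurable]: "grid_cell n j \<in> sets borel"
  unfolding grid_cell_def by simp

lemma grid_cell_disjoint:
  assumes "n > 0" "x \<in> grid_cell n i" "x \<in> grid_cell n j" shows "i = j"
proof -
  have "real i \<le> n * x" "n * x < real i + 1" "real j \<le> n * x" "n * x < real j + 1"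
    using assms by (auto simp: grid_cell_def field_simps)
  then show ?thesis by linarith
qed

lemma grid_cell_UN:
  assumes "n > 0" shows "(\<Union>j<n*n. grid_cell n j) = {0..<real n}"
proof safe
  fix x j assume *: "j < n*n" "x \<in> grid_cell n j"
  then have "real j / real n \<le> x" "x < (real j + 1) / real n" by (auto simp: grid_cell_def)
  moreover have "real j + 1 \<le> real n * real n" using *(1) by (metis Suc_leI of_nat_Suc of_nat_le_iff of_nat_mult add.commute)
  then have "(real j + 1) / real n \<le> real n" using assms by (simp add: pos_divide_le_eq)
  moreover have "0 \<le> real j / real n" by simp
  ultimately have "0 \<le> x" "x < real n" by linarith+
  then show "x \<in> {0..<real n}" by simp
next
  fix x assume x: "x \<in> {0..<real n}"
  define j where "j = nat \<lfloor>real n * x\<rfloor>"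
  have "0 \<le> real n * x" using x by auto
  then have j: "real j \<le> real n * x" "real n * x < real j + 1" unfolding j_def by linarith+
  have "real n * x < real n * real n" using x assms by auto
  with j have "j < n * n" by (metis of_nat_less_iff of_nat_mult order.strict_trans1)
  moreover have "x \<in> grid_cell n j" using j assms by (auto simp: grid_cell_def field_simps)
  ultimately show "x \<in> (\<Union>j<n*n. grid_cell n j)" by blast
qed

lemma weight_integrable_cong_diff:
  assumes "weight_integrable p" "weight_integrable q"
  shows "weight_integrable (\<lambda>x. p x - q x)"
    "weight_norm (\<lambda>x. p x - q x) \<le> weight_norm p + weight_norm q"
    "weight_integrable (\<lambda>x. p x + q x)"
    "weight_norm (\<lambda>x. p x + q x) \<le> weight_norm p + weight_norm q"
proof -
  let ?w = "\<lambda>x::real. indicator {0..} x * (1 + x) :: real"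
  have w: "?w x \<ge> 0" for x by (auto simp: indicator_def)
  have i: "integrable lborel (\<lambda>x. ?w x * \<bar>p x\<bar> + ?w x * \<bar>q x\<bar>)" and [measurable]: "p \<in> borel_measurable borel" "q \<in> borel_measurable borel"
    using assms by (auto simp: weight_integrable_def)
  have b: "?w x * \<bar>p x - q x\<bar> \<le> ?w x * \<bar>p x\<bar> + ?w x * \<bar>q x\<bar>" "?w x * \<bar>p x + q x\<bar> \<le> ?w x * \<bar>p x\<bar> + ?w x * \<bar>q x\<bar>" for x
    unfolding distrib_left[symmetric] by (intro mult_left_mono w; linarith)+
  have nn: "0 \<le> ?w x * \<bar>y\<bar>" for x y using w by simp
  have i1: "integrable lborel (\<lambda>x. ?w x * \<bar>p x - q x\<bar>)" "integrable lborel (\<lambda>x. ?w x * \<bar>p x + q x\<bar>)"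
    using b nn by (auto intro!: Bochner_Integration.integrable_bound[OF i] AE_I2 simp: abs_of_nonneg)
  then show "weight_integrable (\<lambda>x. p x - q x)" "weight_integrable (\<lambda>x. p x + q x)" by (auto simp: weight_integrable_def)
  have "weight_norm p + weight_norm q = (\<integral>x. ?w x * \<bar>p x\<bar> + ?w x * \<bar>q x\<bar> \<partial>lborel)"
    using assms by (simp add: weight_norm_def weight_integrable_def)
  moreover have "weight_norm (\<lambda>x. p x - q x) \<le> (\<integral>x. ?w x * \<bar>p x\<bar> + ?w x * \<bar>q x\<bar> \<partial>lborel)"
    "weight_norm (\<lambda>x. p x + q x) \<le> (\<integral>x. ?w x * \<bar>p x\<bar> + ?w x * \<bar>q x\<bar> \<partial>lborel)"
    unfolding weight_norm_def using i i1 b by (auto intro!: integral_mono)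
  ultimately show "weight_norm (\<lambda>x. p x - q x) \<le> weight_norm p + weight_norm q"
    "weight_norm (\<lambda>x. p x + q x) \<le> weight_norm p + weight_norm q" by auto
qed

lemma integrable_nonneg_bound:
  fixes p g :: "real \<Rightarrow> real"
  assumes "integrable lborel g" "p \<in> borel_measurable borel" "\<And>x. 0 \<le> p x" "\<And>x. p x \<le> g x"
  shows "integrable lborel p"
proof (rule Bochner_Integration.integrable_bound[OF assms(1)])
  show "AE x in lborel. norm (p x) \<le> norm (g x)"
  proof (intro AE_I2)
    fix x show "norm (p x) \<le> norm (g x)" using assms(3,4)[of x] by simp
  qed
qed (use assms(2) in auto)

lemma weight_nonneg: "0 \<le> indicator {0..} x * (1 + x :: real)"
  by (auto simp: indicator_def)

lemma weight_norm_nonneg: "0 \<le> weight_norm p"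
  unfolding weight_norm_def
  by (intro integral_nonneg_AE AE_I2 mult_nonneg_nonneg[OF weight_nonneg] abs_ge_zero)

lemma weight_abs: "\<bar>indicator {0..} x * (1 + x) * p\<bar> = indicator {0..} x * (1 + x :: real) * \<bar>p\<bar>"
  by (cases "0 \<le> x") (auto simp: abs_mult)

lemma grid_cell_lower:
  assumes "n > 0" "x \<in> grid_cell n j"
  shows "0 \<le> x" "real j / real n \<le> x" "x < (real j + 1) / real n"
  using assms by (auto simp: grid_cell_def intro: order_trans[of 0 "real j / real n"])

lemma measure_grid_cell: "n > 0 \<Longrightarrow> measure lborel (grid_cell n j) = 1 / real n"
  by (auto simp: grid_cell_def diff_divide_distrib[symmetric] divide_right_mono)

lemma cell_average_eq:
  assumes "n > 0" "x \<in> grid_cell n j" "j < n * n"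
  shows "cell_average n h x = real n * (LINT y:grid_cell n j|lborel. h y)"
proof -
  have "cell_average n h x = (\<Sum>i<n*n. if i = j then real n * (LINT y:grid_cell n j|lborel. h y) else 0)"
    unfolding cell_average_def using grid_cell_disjoint[OF assms(1)] assms(2)
    by (intro sum.cong) (auto simp: indicator_def)
  then show ?thesis using assms(3) by simp
qed

lemma cell_average_outside:
  assumes "n > 0" "x \<notin> {0..<real n}" shows "cell_average n h x = 0"
proof -
  have "x \<notin> grid_cell n j" if "j < n*n" for j using assms grid_cell_UN[OF assms(1)] that by blast
  then show ?thesis unfolding cell_average_def by (intro sum.neutral) auto
qed

lemma weight_integrable_cell:
  assumes h: "weight_integrable h" and n: "n > 0"
  shows "set_integrable lborel (grid_cell n j) h"
  unfolding set_integrable_def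
proof (rule Bochner_Integration.integrable_bound)
  show "integrable lborel (\<lambda>x. indicator {0..} x * (1 + x) * \<bar>h x\<bar>)" using h by (simp add: weight_integrable_def)
  show "(\<lambda>x. indicat_real (grid_cell n j) x *\<^sub>R h x) \<in> borel_measurable lborel"
    using h by (auto simp: weight_integrable_def)
  show "AE x in lborel. norm (indicat_real (grid_cell n j) x *\<^sub>R h x) \<le> norm (indicator {0..} x * (1 + x) * \<bar>h x\<bar>)"
  proof (intro AE_I2)
    fix x :: real
    show "norm (indicat_real (grid_cell n j) x *\<^sub>R h x) \<le> norm (indicator {0..} x * (1 + x) * \<bar>h x\<bar>)"
      using grid_cell_lower[OF n, of x j] mult_right_mono[of 1 "1+x" "\<bar>h x\<bar>"]
      by (auto simp: indicator_def abs_mult)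
  qed
qed

lemma cell_average_bound:
  assumes h: "weight_integrable h" and n: "n > 0"
  shows "weight_integrable (cell_average n h)" "weight_norm (cell_average n h) \<le> 2 * weight_norm h"
proof -
  let ?w = "\<lambda>x::real. indicator {0..} x * (1 + x) :: real"
  let ?I = "\<lambda>j. LINT y:grid_cell n j|lborel. h y"
  let ?c = "\<lambda>j. real n * \<bar>?I j\<bar> * (1 + (real j + 1) / real n)"
  have [measurable]: "h \<in> borel_measurable borel" using h by (auto simp: weight_integrable_def)
  have [measurable]: "cell_average n h \<in> borel_measurable borel" unfolding cell_average_def by measurable
  have ci: "integrable lborel (indicator (grid_cell n j) :: real \<Rightarrow> real)" for j
    unfolding grid_cell_def by (intro integrable_real_indicator) (auto simp: divide_right_mono)
  have S: "integrable lborel (\<lambda>x. \<Sum>j<n*n. ?c j * indicator (grid_cell n j) x)"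
    by (intro Bochner_Integration.integrable_sum integrable_mult_right ci)
  have b: "?w x * \<bar>cell_average n h x\<bar> \<le> (\<Sum>j<n*n. ?c j * indicator (grid_cell n j) x)" for x
  proof (cases "x \<in> {0..<real n}")
    case True
    then obtain j where j: "j < n*n" "x \<in> grid_cell n j" using grid_cell_UN[OF n] by blast
    have "?w x * \<bar>cell_average n h x\<bar> = (1 + x) * (real n * \<bar>?I j\<bar>)"
      using True n by (simp add: cell_average_eq[OF n j(2,1)] abs_mult)
    also have "\<dots> \<le> (1 + (real j + 1) / real n) * (real n * \<bar>?I j\<bar>)"
      using grid_cell_lower[OF n j(2)] by (intro mult_right_mono) auto
    also have "\<dots> = ?c j * indicator (grid_cell n j) x" using j by simp
    also have "\<dots> \<le> (\<Sum>j<n*n. ?c j * indicator (grid_cell n j) x)"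
      using j by (intro member_le_sum) auto
    finally show ?thesis .
  qed (auto simp: cell_average_outside[OF n] intro!: sum_nonneg)
  have i: "integrable lborel (\<lambda>x. ?w x * \<bar>cell_average n h x\<bar>)"
    by (rule integrable_nonneg_bound[OF S _ _ b]) (auto intro!: mult_nonneg_nonneg weight_nonneg)
  then show "weight_integrable (cell_average n h)" by (simp add: weight_integrable_def)
  have wi: "integrable lborel (\<lambda>x. ?w x * \<bar>h x\<bar>)" using h by (simp add: weight_integrable_def)
  have wci: "integrable lborel (\<lambda>x. indicator (grid_cell n j) x * (?w x * \<bar>h x\<bar>))" for j
    using integrable_mult_indicator[OF _ wi, of "grid_cell n j"] by auto
  have "weight_norm (cell_average n h) \<le> (\<integral>x. (\<Sum>j<n*n. ?c j * indicator (grid_cell n j) x) \<partial>lborel)"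
    unfolding weight_norm_def by (intro integral_mono i S b)
  also have "\<dots> = (\<Sum>j<n*n. ?c j * (1 / real n))"
    using ci n by (subst Bochner_Integration.integral_sum) (auto simp: measure_grid_cell)
  also have "\<dots> \<le> (\<Sum>j<n*n. 2 * (\<integral>x. indicator (grid_cell n j) x * (?w x * \<bar>h x\<bar>) \<partial>lborel))"
  proof (rule sum_mono)
    fix j assume "j \<in> {..<n*n}"
    have hi: "integrable lborel (\<lambda>x. indicator (grid_cell n j) x * \<bar>h x\<bar>)"
      using integrable_abs[OF weight_integrable_cell[OF h n, of j, unfolded set_integrable_def]] by (simp add: abs_mult)
    have "\<bar>?I j\<bar> \<le> (\<integral>x. indicator (grid_cell n j) x * \<bar>h x\<bar> \<partial>lborel)"
      unfolding set_lebesgue_integral_def using integral_abs_bound[of lborel "\<lambda>x. indicator (grid_cell n j) x * h x"]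
      by (simp add: abs_mult)
    then have "?c j * (1 / real n) \<le> (1 + (real j + 1) / real n) * (\<integral>x. indicator (grid_cell n j) x * \<bar>h x\<bar> \<partial>lborel)"
    proof -
      assume *: "\<bar>?I j\<bar> \<le> (\<integral>x. indicator (grid_cell n j) x * \<bar>h x\<bar> \<partial>lborel)"
      have "?c j * (1 / real n) = (1 + (real j + 1) / real n) * \<bar>?I j\<bar>" using n by simp
      then show ?thesis using mult_left_mono[OF *, of "1 + (real j + 1) / real n"] by simp
    qed
    also have "\<dots> = (\<integral>x. (1 + (real j + 1) / real n) * (indicator (grid_cell n j) x * \<bar>h x\<bar>) \<partial>lborel)" by simp
    also have "\<dots> \<le> (\<integral>x. 2 * (indicator (grid_cell n j) x * (?w x * \<bar>h x\<bar>)) \<partial>lborel)"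
    proof (rule integral_mono)
      fix x
      show "(1 + (real j + 1) / real n) * (indicator (grid_cell n j) x * \<bar>h x\<bar>) \<le> 2 * (indicator (grid_cell n j) x * (?w x * \<bar>h x\<bar>))"
      proof (cases "x \<in> grid_cell n j")
        case True
        have "1 + (real j + 1) / real n \<le> 2 * (1 + x)"
        proof -
          have *: "1 + (a + b) \<le> 2 * (1 + x)" if "a \<le> x" "b \<le> 1" "0 \<le> x" for a b :: real
            using that by simp
          have "1 / real n \<le> 1" using n by simp
          from *[OF grid_cell_lower(2)[OF n True] this grid_cell_lower(1)[OF n True]]
          show ?thesis by (simp add: add_divide_distrib)
        qed
        then have "(1 + (real j + 1) / real n) * \<bar>h x\<bar> \<le> 2 * (1 + x) * \<bar>h x\<bar>" by (intro mult_right_mono) auto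
        then show ?thesis using True grid_cell_lower(1)[OF n True] by (simp add: mult.assoc algebra_simps)
      qed simp
    qed (use hi wci in auto)
    finally show "?c j * (1 / real n) \<le> 2 * (\<integral>x. indicator (grid_cell n j) x * (?w x * \<bar>h x\<bar>) \<partial>lborel)" by simp
  qed
  also have "\<dots> = 2 * (\<integral>x. (\<Sum>j<n*n. indicator (grid_cell n j) x * (?w x * \<bar>h x\<bar>)) \<partial>lborel)"
    by (subst Bochner_Integration.integral_sum[OF wci]) (simp add: sum_distrib_left)
  also have "\<dots> \<le> 2 * (\<integral>x. ?w x * \<bar>h x\<bar> \<partial>lborel)"
  proof (intro mult_left_mono integral_mono)
    fix x
    have "(\<Sum>j<n*n. indicator (grid_cell n j) x) \<le> (1::real)"
    proof (cases "\<exists>i<n*n. x \<in> grid_cell n i")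
      case True
      then obtain i where i: "i < n*n" "x \<in> grid_cell n i" by blast
      have "indicator (grid_cell n j) x = (if j = i then 1 else (0::real))" for j
        using grid_cell_disjoint[OF n _ i(2), of j] i(2) by (cases "x \<in> grid_cell n j") auto
      then show ?thesis using i by (simp only:) simp
    next
      case False
      then have "(\<Sum>j<n*n. indicator (grid_cell n j) x) = (0::real)" by (intro sum.neutral) (auto simp: indicator_def)
      then show ?thesis by simp
    qed
    moreover have "0 \<le> (\<Sum>j<n*n. indicator (grid_cell n j) x :: real)" by (intro sum_nonneg) auto
    moreover have "0 \<le> ?w x * \<bar>h x\<bar>" by (intro mult_nonneg_nonneg[OF weight_nonneg] abs_ge_zero)
    ultimately show "(\<Sum>j<n*n. indicator (grid_cell n j) x * (?w x * \<bar>h x\<bar>)) \<le> ?w x * \<bar>h x\<bar>"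
      unfolding sum_distrib_right[symmetric] by (intro mult_left_le_one_le)
    show "integrable lborel (\<lambda>x. \<Sum>j<n*n. indicator (grid_cell n j) x * (?w x * \<bar>h x\<bar>))"
      by (intro Bochner_Integration.integrable_sum wci)
  qed (use wi in auto)
  finally show "weight_norm (cell_average n h) \<le> 2 * weight_norm h" by (simp add: weight_norm_def)
qed

lemma cell_average_continuous_tendsto:
  assumes k: "continuous_on UNIV k" "\<And>x. R < \<bar>x\<bar> \<Longrightarrow> k x = 0" and R: "0 < R" and kw: "weight_integrable k"
  shows "(\<lambda>n. weight_norm (\<lambda>x. cell_average n k x - k x)) \<longlonglongrightarrow> 0"
proof (rule LIMSEQ_I)
  fix e0 :: real assume e0: "0 < e0"
  define e where "e = e0 / (2 * (R+2)^2)"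
  have e: "0 < e" using e0 R by (simp add: e_def)
  have "uniformly_continuous_on {-R-1..R+1} k"
    by (intro compact_uniformly_continuous continuous_on_subset[OF k(1)]) auto
  then obtain d where d: "0 < d" "\<And>x y. x \<in> {-R-1..R+1} \<Longrightarrow> y \<in> {-R-1..R+1} \<Longrightarrow> \<bar>y - x\<bar> < d \<Longrightarrow> \<bar>k y - k x\<bar> < e"
    unfolding uniformly_continuous_on_def dist_real_def using e by metis
  obtain N :: nat where N: "max (1/d) (R+1) < real N" using reals_Archimedean2 by blast
  have main: "weight_norm (\<lambda>x. cell_average n k x - k x) < e0" if nN: "n \<ge> N" for n
  proof -
    have nR: "1/d < real n" "R + 1 < real n" using N nN by (auto intro: less_le_trans)
    then have n: "n > 0" "real n > 1" using R by auto
    have nd: "1 / real n < d" using nR(1) d(1) n by (simp add: field_simps)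
    have n1: "1 / real n < 1" using n by simp
    have osc: "\<bar>k y - k x\<bar> \<le> e" if "\<bar>y - x\<bar> < 1 / real n" for x y
    proof (cases "\<bar>x\<bar> \<le> R + 1 \<and> \<bar>y\<bar> \<le> R + 1")
      case True
      then show ?thesis using d(2)[of x y] that nd by (auto simp: abs_le_iff)
    next
      case False
      then have "\<bar>x\<bar> > R" "\<bar>y\<bar> > R" using that n1 by linarith+
      then show ?thesis using k(2) e by simp
    qed
    have pt: "\<bar>cell_average n k x - k x\<bar> \<le> e" if x0: "x \<ge> 0" for x
    proof (cases "x < real n")
      case True
      with x0 have "x \<in> {0..<real n}" by simp
      then obtain j where j: "j < n*n" "x \<in> grid_cell n j" unfolding grid_cell_UN[OF n(1), symmetric] by blast
      have ci: "set_integrable lborel (grid_cell n j) (\<lambda>y. c)" for c :: real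
        unfolding set_integrable_def grid_cell_def
        by (intro integrable_scaleR_left integrable_real_indicator) (auto simp: divide_right_mono)
      have cI: "(LINT y:grid_cell n j|lborel. c) = c / real n" for c :: real
        using measure_grid_cell[OF n(1), of j] by (simp add: set_lebesgue_integral_def)
      note ki = weight_integrable_cell[OF kw n(1), of j]
      have "cell_average n k x - k x = real n * (LINT y:grid_cell n j|lborel. k y - k x)"
        using n by (simp add: cell_average_eq[OF n(1) j(2,1)] set_integral_diff[OF ki ci] cI right_diff_distrib)
      moreover have "\<bar>LINT y:grid_cell n j|lborel. k y - k x\<bar> \<le> (LINT y:grid_cell n j|lborel. e)"
      proof -
        have "\<bar>LINT y:grid_cell n j|lborel. k y - k x\<bar> \<le> (\<integral>y. \<bar>indicator (grid_cell n j) y * (k y - k x)\<bar> \<partial>lborel)"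
          unfolding set_lebesgue_integral_def using integral_abs_bound[of lborel "\<lambda>y. indicator (grid_cell n j) y * (k y - k x)"] by simp
        also have "\<dots> \<le> (LINT y:grid_cell n j|lborel. e)"
          unfolding set_lebesgue_integral_def
        proof (rule integral_mono)
          show "integrable lborel (\<lambda>y. \<bar>indicator (grid_cell n j) y * (k y - k x)\<bar>)"
            using set_integral_diff(1)[OF ki ci[of "k x"]] by (auto simp: set_integrable_def)
          show "integrable lborel (\<lambda>y. indicat_real (grid_cell n j) y *\<^sub>R e)"
            using ci[of e] by (simp add: set_integrable_def)
          fix y
          show "\<bar>indicator (grid_cell n j) y * (k y - k x)\<bar> \<le> indicat_real (grid_cell n j) y *\<^sub>R e"
          proof (cases "y \<in> grid_cell n j")
            case True
            have "\<bar>y - x\<bar> < 1 / real n"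
              using grid_cell_lower[OF n(1) True] grid_cell_lower[OF n(1) j(2)] unfolding add_divide_distrib by linarith
            then show ?thesis using osc True by simp
          qed simp
        qed
        finally show ?thesis .
      qed
      ultimately have "\<bar>cell_average n k x - k x\<bar> \<le> real n * (e / real n)"
        using n by (simp only: abs_mult abs_of_nat cI mult_left_mono of_nat_0_le_iff)
      then show ?thesis using n by simp
    next
      case False
      then show ?thesis using cell_average_outside[OF n(1), of x k] k(2)[of x] nR e by auto
    qed
    have zero: "cell_average n k x - k x = 0" if xR: "x > R + 1" for x
    proof (cases "x < real n")
      case True
      with xR R have "x \<in> {0..<real n}" by simp
      then obtain j where j: "j < n*n" "x \<in> grid_cell n j" unfolding grid_cell_UN[OF n(1), symmetric] by blast
      have "k y = 0" if "y \<in> grid_cell n j" for y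
      proof -
        have "\<bar>y - x\<bar> < 1 / real n"
          using grid_cell_lower[OF n(1) that] grid_cell_lower[OF n(1) j(2)] unfolding add_divide_distrib by linarith
        then show ?thesis using \<open>x > R + 1\<close> n1 by (intro k(2)) linarith
      qed
      then have "(LINT y:grid_cell n j|lborel. k y) = 0" unfolding set_lebesgue_integral_def
        by (intro integral_eq_zero_AE AE_I2) (auto simp: indicator_def)
      then show ?thesis using k(2)[of x] xR R by (simp add: cell_average_eq[OF n(1) j(2,1)])
    next
      case False
      then show ?thesis using cell_average_outside[OF n(1), of x k] k(2)[of x] xR R by auto
    qed
    have box: "integrable lborel (\<lambda>x. (e * (R+2)) * indicator {0..R+1} x)"
      using R by (intro integrable_mult_right integrable_real_indicator) auto
    have "weight_norm (\<lambda>x. cell_average n k x - k x) \<le> (\<integral>x. (e * (R+2)) * indicator {0..R+1} x \<partial>lborel)"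
      unfolding weight_norm_def
    proof (rule integral_mono[OF _ box])
      show "integrable lborel (\<lambda>x. indicator {0..} x * (1 + x) * \<bar>cell_average n k x - k x\<bar>)"
        using weight_integrable_cong_diff(1)[OF cell_average_bound(1)[OF kw n(1)] kw] by (simp add: weight_integrable_def)
      fix x :: real
      show "indicator {0..} x * (1 + x) * \<bar>cell_average n k x - k x\<bar> \<le> (e * (R+2)) * indicator {0..R+1} x"
      proof (cases "0 \<le> x \<and> x \<le> R + 1")
        case True
        then have "(1 + x) * \<bar>cell_average n k x - k x\<bar> \<le> (R+2) * e" using pt[of x] by (intro mult_mono) auto
        then show ?thesis using True by (simp add: mult.commute)
      qed (use zero[of x] in \<open>auto simp: indicator_def\<close>)
    qed
    also have "\<dots> = e * (R+2) * (R+1)" using R by simp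
    also have "\<dots> \<le> e * (R+2)^2" using R e by (simp add: power2_eq_square mult_left_mono)
    also have "\<dots> < e0" using R e0 by (simp add: e_def)
    finally show ?thesis .
  qed
  then show "\<exists>no. \<forall>n\<ge>no. norm (weight_norm (\<lambda>x. cell_average n k x - k x) - 0) < e0"
    using weight_norm_nonneg main by (intro exI[of _ N]) auto
qed

lemma cell_average_diff:
  assumes "weight_integrable p" "weight_integrable q" "n > 0"
  shows "cell_average n (\<lambda>x. p x - q x) x = cell_average n p x - cell_average n q x"
  unfolding cell_average_def
  using set_integral_diff(2)[OF weight_integrable_cell[OF assms(1,3)] weight_integrable_cell[OF assms(2,3)]]
  by (simp add: sum_subtractf right_diff_distrib left_diff_distrib)

lemma cell_average_tendsto:
  assumes h: "weight_integrable h"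
  shows "(\<lambda>n. weight_norm (\<lambda>x. cell_average n h x - h x)) \<longlonglongrightarrow> 0"
proof (rule LIMSEQ_I)
  fix e :: real assume "0 < e"
  then have e: "0 < e/4" by simp
  have [measurable]: "h \<in> borel_measurable borel" using h by (auto simp: weight_integrable_def)
  let ?w = "\<lambda>x::real. indicator {0..} x * (1 + x) :: real"
  have i0: "integrable lborel (\<lambda>x. ?w x * h x)"
    using h by (subst integrable_abs_iff[symmetric]) (auto simp: weight_integrable_def weight_abs)
  obtain k0 R where k0: "continuous_on UNIV k0" "\<And>x. R < \<bar>x\<bar> \<Longrightarrow> k0 x = 0" "0 < R"
    "integrable lborel k0" "(\<integral>x. \<bar>?w x * h x - k0 x\<bar> \<partial>lborel) < e/4"
    by (rule continuous_L1_dense[OF i0 e]) blast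
  define k where "k x = k0 x / (1 + \<bar>x\<bar>)" for x
  have kc: "continuous_on UNIV k" unfolding k_def by (intro continuous_intros k0) auto
  have k0z: "k x = 0" if "R < \<bar>x\<bar>" for x using k0(2)[OF that] by (simp add: k_def)
  have [measurable]: "k \<in> borel_measurable borel" using kc by (rule borel_measurable_continuous_onI)
  have wk: "?w x * k x = indicator {0..} x * k0 x" for x by (auto simp: indicator_def k_def)
  have "integrable lborel (\<lambda>x. \<bar>indicator {0..} x * k0 x\<bar>)" using k0(4) integrable_mult_indicator[of "{0..}" lborel k0] by auto
  also have "(\<lambda>x. \<bar>indicator {0..} x * k0 x\<bar>) = (\<lambda>x. ?w x * \<bar>k x\<bar>)"
    unfolding wk[symmetric] weight_abs ..
  finally have kw: "weight_integrable k" by (simp add: weight_integrable_def)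
  have hk: "weight_norm (\<lambda>x. h x - k x) < e/4"
  proof -
    have "weight_norm (\<lambda>x. h x - k x) \<le> (\<integral>x. \<bar>?w x * h x - k0 x\<bar> \<partial>lborel)"
      unfolding weight_norm_def
    proof (rule integral_mono)
      show "integrable lborel (\<lambda>x. ?w x * \<bar>h x - k x\<bar>)"
        using weight_integrable_cong_diff(1)[OF h kw] by (simp add: weight_integrable_def)
      show "?w x * \<bar>h x - k x\<bar> \<le> \<bar>?w x * h x - k0 x\<bar>" for x
      proof (cases "x \<ge> 0")
        case True
        then have "(1 + x) * \<bar>h x - k x\<bar> = \<bar>(1 + x) * h x - (1 + x) * k x\<bar>" by (simp add: abs_mult flip: right_diff_distrib)
        then show ?thesis using True by (simp add: k_def)
      qed simp
    qed (use \<open>integrable lborel (\<lambda>x. ?w x * h x)\<close> k0 in auto)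
    with k0(5) show ?thesis by linarith
  qed
  have "(\<lambda>n. weight_norm (\<lambda>x. cell_average n k x - k x)) \<longlonglongrightarrow> 0"
    by (rule cell_average_continuous_tendsto[OF kc k0z k0(3) kw])
  then obtain N where N: "\<And>n. n \<ge> N \<Longrightarrow> weight_norm (\<lambda>x. cell_average n k x - k x) < e/4"
    using e weight_norm_nonneg unfolding LIMSEQ_iff by (metis abs_of_nonneg diff_zero real_norm_def)
  have "weight_norm (\<lambda>x. cell_average n h x - h x) < e" if n: "n \<ge> max 1 N" for n
  proof -
    have n0: "n > 0" using n by simp
    let ?A = "\<lambda>x. cell_average n h x - cell_average n k x" and ?B = "\<lambda>x. cell_average n k x - k x" and ?C = "\<lambda>x. h x - k x"
    have A: "weight_integrable ?A" "weight_norm ?A \<le> 2 * weight_norm ?C"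
      using cell_average_bound[OF weight_integrable_cong_diff(1)[OF h kw] n0]
      by (simp_all add: cell_average_diff[OF h kw n0, abs_def])
    have B: "weight_integrable ?B" using weight_integrable_cong_diff(1)[OF cell_average_bound(1)[OF kw n0] kw] .
    have AB: "weight_integrable (\<lambda>x. ?A x + ?B x)" "weight_norm (\<lambda>x. ?A x + ?B x) \<le> weight_norm ?A + weight_norm ?B"
      using weight_integrable_cong_diff(3,4)[OF A(1) B] .
    have "weight_norm (\<lambda>x. (?A x + ?B x) - ?C x) \<le> weight_norm (\<lambda>x. ?A x + ?B x) + weight_norm ?C"
      by (rule weight_integrable_cong_diff(2)[OF AB(1) weight_integrable_cong_diff(1)[OF h kw]])
    moreover have "(\<lambda>x. (?A x + ?B x) - ?C x) = (\<lambda>x. cell_average n h x - h x)" by auto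
    ultimately show ?thesis using A(2) AB(2) hk N[of n] n by simp
  qed
  then show "\<exists>no. \<forall>n\<ge>no. norm (weight_norm (\<lambda>x. cell_average n h x - h x) - 0) < e"
    using weight_norm_nonneg by (intro exI[of _ "max 1 N"]) auto
qed

lemma simple_function_cell_sum:
  fixes J :: nat
  assumes "\<And>j. j < J \<Longrightarrow> simple_function M (c j :: 'a \<Rightarrow> real)"
  shows "simple_function M (\<lambda>t. \<lambda>x::real. \<Sum>j<J. c j t * indicator (A j) x :: real)"
  using assms
proof (induction J)
  case (Suc J)
  have "simple_function M (\<lambda>t. \<lambda>x::real. \<Sum>j<J. c j t * indicator (A j) x :: real)"
    by (rule Suc.IH) (use Suc.prems in auto)
  from simple_function_compose2[OF this Suc.prems[of J], of "\<lambda>p q x. p x + q * indicator (A J) x"]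
  show ?case by simp
qed simp

lemma weakly_measurable_simple_approx:
  fixes f :: "real \<Rightarrow> real \<Rightarrow> real"
  assumes f: "\<And>t. t \<in> space M \<Longrightarrow> weight_integrable (f t)"
    and meas: "\<And>n j. n > 0 \<Longrightarrow> (\<lambda>t. LINT x:grid_cell n j|lborel. f t x) \<in> borel_measurable M"
    and bd: "\<And>n j t. n > 0 \<Longrightarrow> t \<in> space M \<Longrightarrow> \<bar>LINT x:grid_cell n j|lborel. f t x\<bar> \<le> C"
  obtains s where "\<And>n::nat. simple_function M (s n)" "\<And>n t. t \<in> space M \<Longrightarrow> weight_integrable (s n t)"
    "\<And>t. t \<in> space M \<Longrightarrow> (\<lambda>n. weight_norm (\<lambda>x. s n t x - f t x)) \<longlonglongrightarrow> 0"
proof -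
  define q where "q n = real ((n + 1) ^ 4)" for n :: nat
  define c where "c n j t = real_of_int \<lfloor>q n * (real n * (LINT x:grid_cell n j|lborel. f t x))\<rfloor> / q n" for n j t
  define s0 where "s0 n t x = (\<Sum>j<n*n. c n j t * indicator (grid_cell n j) x)" for n t x
  have q: "q n > 0" for n by (simp add: q_def)
  have c: "simple_function M (c n j)" if n: "n > 0" for n j
  proof (rule simple_function_borel_measurable)
    note [measurable] = meas[OF n]
    show "c n j \<in> borel_measurable M" unfolding c_def by measurable
    let ?B = "q n * (real n * C)"
    have "c n j ` space M \<subseteq> (\<lambda>z. real_of_int z / q n) ` {-\<lceil>?B\<rceil> - 1 .. \<lceil>?B\<rceil>}"
    proof safe
      fix t assume t: "t \<in> space M"
      have "\<bar>q n * (real n * (LINT x:grid_cell n j|lborel. f t x))\<bar> \<le> ?B"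
        using bd[OF n t, of j] q[of n] by (simp add: abs_mult mult_left_mono)
      then have "\<lfloor>q n * (real n * (LINT x:grid_cell n j|lborel. f t x))\<rfloor> \<in> {-\<lceil>?B\<rceil> - 1 .. \<lceil>?B\<rceil>}"
        by (auto simp: le_floor_iff floor_le_iff abs_le_iff; linarith)
      then show "c n j t \<in> (\<lambda>z. real_of_int z / q n) ` {-\<lceil>?B\<rceil> - 1 .. \<lceil>?B\<rceil>}" by (auto simp: c_def)
    qed
    then show "finite (c n j ` space M)" by (rule finite_subset) auto
  qed
  have diff: "weight_integrable (\<lambda>x. s0 n t x - cell_average n (f t) x)"
    "weight_norm (\<lambda>x. s0 n t x - cell_average n (f t) x) \<le> 1 / (real n + 1)" if n: "n > 0" for n t
  proof -
    let ?p = "\<lambda>x. s0 n t x - cell_average n (f t) x"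
    have [measurable]: "?p \<in> borel_measurable borel" unfolding s0_def cell_average_def by measurable
    have b: "indicator {0..} x * (1 + x) * \<bar>?p x\<bar> \<le> ((1 + real n) / q n) * indicator {0..<real n} x" for x
    proof (cases "x \<in> {0..<real n}")
      case True
      then obtain j where j: "j < n*n" "x \<in> grid_cell n j" using grid_cell_UN[OF n] by blast
      have "s0 n t x = (\<Sum>i<n*n. if i = j then c n j t else 0)"
        unfolding s0_def using grid_cell_disjoint[OF n] j(2) by (intro sum.cong) (auto simp: indicator_def)
      then have "s0 n t x = c n j t" using j by simp
      moreover have "\<bar>real_of_int \<lfloor>q n * y\<rfloor> / q n - y\<bar> \<le> 1 / q n" for y
      proof -
        have "\<bar>real_of_int \<lfloor>q n * y\<rfloor> - q n * y\<bar> \<le> 1" by linarith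
        moreover have "real_of_int \<lfloor>q n * y\<rfloor> - q n * y = q n * (real_of_int \<lfloor>q n * y\<rfloor> / q n - y)"
          using q[of n] by (simp add: right_diff_distrib)
        ultimately have "q n * \<bar>real_of_int \<lfloor>q n * y\<rfloor> / q n - y\<bar> \<le> 1" using q[of n] by (simp add: abs_mult)
        then show ?thesis using q[of n] by (simp add: pos_le_divide_eq mult.commute)
      qed
      ultimately have "\<bar>?p x\<bar> \<le> 1 / q n" by (simp add: cell_average_eq[OF n j(2,1)] c_def)
      then have "(1 + x) * \<bar>?p x\<bar> \<le> (1 + real n) * (1 / q n)" using True by (intro mult_mono) auto
      then show ?thesis using True by simp
    next
      case False
      then have "x \<notin> grid_cell n j" if "j < n * n" for j using grid_cell_UN[OF n] that by blast
      then have "s0 n t x = 0" unfolding s0_def by (intro sum.neutral) auto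
      then show ?thesis using cell_average_outside[OF n False] False by simp
    qed
    have box: "integrable lborel (\<lambda>x. ((1 + real n) / q n) * indicator {0..<real n} x)"
      by (intro integrable_mult_right integrable_real_indicator) auto
    have i: "integrable lborel (\<lambda>x. indicator {0..} x * (1 + x) * \<bar>?p x\<bar>)"
    proof (rule Bochner_Integration.integrable_bound[OF box])
      show "AE x in lborel. norm (indicator {0..} x * (1 + x) * \<bar>?p x\<bar>) \<le> norm ((1 + real n) / q n * indicat_real {0..<real n} x)"
      proof (intro AE_I2)
        fix x :: real
        have "0 \<le> indicator {0..} x * (1 + x) * \<bar>?p x\<bar>" by (intro mult_nonneg_nonneg[OF weight_nonneg] abs_ge_zero)
        then show "norm (indicator {0..} x * (1 + x) * \<bar>?p x\<bar>) \<le> norm ((1 + real n) / q n * indicat_real {0..<real n} x)"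
          using b[of x] by (simp only: real_norm_def)
      qed
    qed measurable
    then show "weight_integrable ?p" by (simp add: weight_integrable_def)
    have "weight_norm ?p \<le> (\<integral>x. ((1 + real n) / q n) * indicator {0..<real n} x \<partial>lborel)"
      unfolding weight_norm_def by (intro integral_mono i box b)
    also have "\<dots> = ((1 + real n) / q n) * real n" by simp
    also have "\<dots> \<le> 1 / (real n + 1)"
    proof -
      have "(1 + real n) * real n * (real n + 1) \<le> (real n + 1) * (real n + 1) * (real n + 1) * (real n + 1)"
        by (intro mult_mono) (auto simp: algebra_simps)
      also have "\<dots> = q n" by (simp add: q_def power4_eq_xxxx algebra_simps)
      finally have "(1 + real n) * real n * (real n + 1) \<le> q n" .
      then show ?thesis using q[of n] by (simp add: field_simps)
    qed
    finally show "weight_norm ?p \<le> 1 / (real n + 1)" .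
  qed
  have s0w: "weight_integrable (s0 n t)" if n: "n > 0" and t: "t \<in> space M" for n t
    using weight_integrable_cong_diff(3)[OF diff(1)[OF n, of t] cell_average_bound(1)[OF f[OF t] n]] by simp
  show ?thesis
  proof (rule that[of "\<lambda>n. s0 (Suc n)"])
    show "simple_function M (s0 (Suc n))" for n
      using simple_function_cell_sum[of "Suc n * Suc n" M "c (Suc n)" "grid_cell (Suc n)"] c[of "Suc n"]
      unfolding s0_def[abs_def] by auto
    show "weight_integrable (s0 (Suc n) t)" if "t \<in> space M" for n t using s0w that by simp
    fix t assume t: "t \<in> space M"
    have "(\<lambda>n. weight_norm (\<lambda>x. s0 (Suc n) t x - f t x)) \<longlonglongrightarrow> 0"
    proof (rule tendsto_sandwich[OF _ _ tendsto_const])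
      show "\<forall>\<^sub>F n in sequentially. 0 \<le> weight_norm (\<lambda>x. s0 (Suc n) t x - f t x)" using weight_norm_nonneg by simp
      show "\<forall>\<^sub>F n in sequentially. weight_norm (\<lambda>x. s0 (Suc n) t x - f t x) \<le>
          1 / real (Suc n) + weight_norm (\<lambda>x. cell_average (Suc n) (f t) x - f t x)"
      proof (intro always_eventually allI)
        fix n
        have "weight_norm (\<lambda>x. (s0 (Suc n) t x - cell_average (Suc n) (f t) x) + (cell_average (Suc n) (f t) x - f t x))
          \<le> weight_norm (\<lambda>x. s0 (Suc n) t x - cell_average (Suc n) (f t) x) + weight_norm (\<lambda>x. cell_average (Suc n) (f t) x - f t x)"
          by (intro weight_integrable_cong_diff(4) diff weight_integrable_cong_diff(1) cell_average_bound(1) f t) auto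
        moreover have "1 / (real (Suc n) + 1) \<le> 1 / real (Suc n)" by (intro divide_left_mono) auto
        ultimately show "weight_norm (\<lambda>x. s0 (Suc n) t x - f t x) \<le>
          1 / real (Suc n) + weight_norm (\<lambda>x. cell_average (Suc n) (f t) x - f t x)"
          using diff(2)[of "Suc n" t] by simp
      qed
      have "(\<lambda>n. 1 / real (Suc n) + weight_norm (\<lambda>x. cell_average (Suc n) (f t) x - f t x)) \<longlonglongrightarrow> 0 + 0"
        by (intro tendsto_add LIMSEQ_Suc[OF lim_1_over_n] LIMSEQ_Suc[OF cell_average_tendsto[OF f[OF t]]])
      then show "(\<lambda>n. 1 / real (Suc n) + weight_norm (\<lambda>x. cell_average (Suc n) (f t) x - f t x)) \<longlonglongrightarrow> 0" by simp
    qed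
    then show "(\<lambda>n. weight_norm (\<lambda>x. s0 (Suc n) t x - f t x)) \<longlonglongrightarrow> 0" .
  qed
qed

lemma derivative_le_imp_growth_le:
  fixes Z :: "real \<Rightarrow> real"
  assumes "0 \<le> t" "\<And>r. 0 \<le> r \<Longrightarrow> r \<le> t \<Longrightarrow> (Z has_real_derivative Z' r) (at r within {0..})"
    and "\<And>r. 0 \<le> r \<Longrightarrow> r \<le> t \<Longrightarrow> Z' r \<le> D"
  shows "Z t \<le> Z 0 + D * t"
proof (cases "t = 0")
  case False
  then have "0 < t" using assms by simp
  have "(Z has_derivative (*) (Z' x)) (at x within {0..t})" if "0 \<le> x" "x \<le> t" for x
    using assms(2)[OF that] by (auto simp: has_field_derivative_def intro: has_derivative_subset)
  from mvt_very_simple[OF less_imp_le[OF \<open>0 < t\<close>] this] obtain x where x: "x \<in> {0..t}" "Z t - Z 0 = Z' x * (t - 0)"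
    by blast
  then have "Z t - Z 0 \<le> D * t" using assms(1) assms(3)[of x] by (simp add: mult_right_mono)
  then show ?thesis by simp
qed simp

lemma derivative_bounded_imp_lipschitz:
  fixes Z :: "real \<Rightarrow> real"
  assumes "0 \<le> r" "r \<le> t" "\<And>x. 0 \<le> x \<Longrightarrow> x \<le> t \<Longrightarrow> (Z has_real_derivative Z' x) (at x within {0..})"
    and "\<And>x. 0 \<le> x \<Longrightarrow> x \<le> t \<Longrightarrow> \<bar>Z' x\<bar> \<le> D"
  shows "\<bar>Z t - Z r\<bar> \<le> D * (t - r)"
proof (cases "t = r")
  case False
  then have "r < t" using assms by simp
  have "(Z has_derivative (*) (Z' x)) (at x within {r..t})" if "r \<le> x" "x \<le> t" for x
    using assms(3)[of x] that assms(1) by (auto simp: has_field_derivative_def intro: has_derivative_subset)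
  from mvt_very_simple[OF less_imp_le[OF \<open>r < t\<close>] this] obtain x where x: "x \<in> {r..t}" "Z t - Z r = Z' x * (t - r)"
    by blast
  then show ?thesis using assms(1,2) assms(4)[of x] by (simp add: abs_mult mult_right_mono)
qed simp

lemma damped_derivative_bound:
  fixes Z :: "real \<Rightarrow> real"
  assumes t: "0 \<le> t" and Z: "\<And>r. 0 \<le> r \<Longrightarrow> r \<le> t \<Longrightarrow> (Z has_real_derivative Z' r) (at r within {0..})"
    and b: "\<And>r. 0 \<le> r \<Longrightarrow> r \<le> t \<Longrightarrow> Z' r \<le> C - k * Z r" and k: "0 < k"
  shows "Z t \<le> max (Z 0) (C / k)"
proof -
  have "exp (k*t) * (Z t - C/k) \<le> exp (k*0) * (Z 0 - C/k) + 0 * t"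
  proof (rule derivative_le_imp_growth_le[OF t, where Z'="\<lambda>r. exp (k*r) * k * (Z r - C/k) + exp (k*r) * Z' r"])
    fix r assume r: "0 \<le> r" "r \<le> t"
    show "((\<lambda>r. exp (k*r) * (Z r - C/k)) has_real_derivative exp (k*r) * k * (Z r - C/k) + exp (k*r) * Z' r) (at r within {0..})"
      by (rule derivative_eq_intros Z[OF r] refl | simp add: algebra_simps)+
    have "exp (k*r) * Z' r \<le> exp (k*r) * (C - k * Z r)" using b[OF r] by (intro mult_left_mono) auto
    then show "exp (k*r) * k * (Z r - C/k) + exp (k*r) * Z' r \<le> 0" using k by (simp add: algebra_simps)
  qed
  then have *: "exp (k*t) * (Z t - C/k) \<le> Z 0 - C/k" by simp
  show ?thesis
  proof (cases "Z t \<le> C/k")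
    case False
    have "1 * (Z t - C/k) \<le> exp (k*t) * (Z t - C/k)" using False t k by (intro mult_right_mono) auto
    with * show ?thesis by simp
  qed auto
qed

lemma sum_by_parts_flux:
  fixes w J :: "nat \<Rightarrow> real"
  assumes "2 \<le> N"
  shows "(\<Sum>i=2..N. w i * (J (i-1) - J i)) = w 2 * J 1 + (\<Sum>i=2..<N. (w (i+1) - w i) * J i) - w N * J N"
  using assms by (induction N rule: dec_induct) (auto simp: algebra_simps)

lemma geometric_sum_by_parts:
  fixes F G :: "nat \<Rightarrow> real"
  assumes "2 \<le> N" and F: "\<And>i. i \<ge> 2 \<Longrightarrow> F i = a * G i - b * G (i+1)"
  shows "(\<Sum>i=2..N. \<theta>^i * (F (i-1) - F i)) = \<theta>^2 * F 1 - (1-\<theta>) * (\<Sum>i=2..N. \<theta>^(i-1) * ((\<theta> * a - b) * G i))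
     - (1-\<theta>) * \<theta> * b * G 2 - \<theta>^(N+1) * a * G N + \<theta>^N * b * G (N+1)"
  using assms(1)
proof (induction N rule: dec_induct)
  case base
  have F2: "F 2 = a * G 2 - b * G 3" using F[of 2] by simp
  have "(\<Sum>i=2..2. \<theta>^i * (F (i-1) - F i)) = \<theta>^2 * (F 1 - (a * G 2 - b * G 3))" using F2 by simp
  then show ?case by (simp add: algebra_simps power2_eq_square power3_eq_cube eval_nat_numeral)
next
  case (step n)
  have Fn: "F n = a * G n - b * G (n+1)" "F (Suc n) = a * G (n+1) - b * G (n+2)" using F[of n] F[of "n+1"] step by auto
  have S1: "(\<Sum>i=2..Suc n. \<theta>^i * (F (i-1) - F i)) = (\<Sum>i=2..n. \<theta>^i * (F (i-1) - F i)) + \<theta>^(n+1) * (F n - F (Suc n))"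
    and S2: "(\<Sum>i=2..Suc n. \<theta>^(i-1) * ((\<theta> * a - b) * G i)) = (\<Sum>i=2..n. \<theta>^(i-1) * ((\<theta> * a - b) * G i)) + \<theta>^n * ((\<theta> * a - b) * G (n+1))"
    using step(1) by auto
  show ?case unfolding S1 S2 step(3) Fn by (simp add: algebra_simps)
qed

lemma powr_tangent_below:
  fixes x y :: real
  assumes "0 \<le> x" "0 \<le> y" "0 < \<delta>"
  shows "(1 + \<delta>) * x powr \<delta> * (y - x) \<le> y powr (1+\<delta>) - x powr (1+\<delta>)"
proof (cases "x = 0 \<or> y = 0")
  case True
  then show ?thesis
  proof
    assume y: "y = 0"
    have "x powr (1+\<delta>) \<le> (1 + \<delta>) * x powr \<delta> * x" using assms by (cases "x = 0") (auto simp: powr_add mult.commute)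
    then show ?thesis using y by simp
  qed (use assms in auto)
next
  case False
  then have pos: "0 < x" "0 < y" using assms by auto
  have "((\<lambda>y. y powr (1+\<delta>)) has_real_derivative (1+\<delta>) * x powr (1+\<delta>-1)) (at x)"
    using pos by (intro has_real_derivative_powr)
  then have "((\<lambda>y. y powr (1+\<delta>)) has_real_derivative (1+\<delta>) * x powr \<delta>) (at x within {0<..})"
    by (auto intro: has_field_derivative_at_within)
  from convex_on_imp_above_tangent[OF powr_convex _ _ _ this, of y] show ?thesis
    using pos assms by (auto simp: interior_open)
qed

lemma has_real_derivative_powr_at_0:
  fixes x :: real
  assumes "0 \<le> x" "0 < \<delta>"
  shows "((\<lambda>y. y powr (1+\<delta>)) has_real_derivative (1+\<delta>) * x powr \<delta>) (at x within {0..})"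
proof (cases "x = 0")
  case True
  have "((\<lambda>y. (y powr (1+\<delta>) - 0) / (y - 0)) \<longlongrightarrow> 0) (at 0 within {0..})"
  proof (rule Lim_transform_eventually)
    have "((\<lambda>y::real. y powr \<delta>) \<longlongrightarrow> 0 powr \<delta>) (at 0 within {0..})"
      using assms by (intro tendsto_powr2 tendsto_const tendsto_ident_at) (auto simp: eventually_at_filter)
    then show "((\<lambda>y::real. y powr \<delta>) \<longlongrightarrow> 0) (at 0 within {0..})" by simp
    show "\<forall>\<^sub>F y in at 0 within {0..}. y powr \<delta> = (y powr (1+\<delta>) - 0) / (y - 0)"
      by (auto simp: eventually_at_filter powr_add)
  qed
  then show ?thesis using True by (simp add: has_field_derivative_iff)
next
  case False
  then have "x > 0" using assms by simp
  then have "((\<lambda>y. y powr (1+\<delta>)) has_real_derivative (1+\<delta>) * x powr (1+\<delta>-1)) (at x)"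
    by (rule has_real_derivative_powr)
  then show ?thesis by (auto intro: has_field_derivative_at_within)
qed

locale BD_power_law =
  fixes \<eta> \<epsilon> A B abar bbar s M :: real and ae be :: "nat \<Rightarrow> real"
    and u :: "real \<Rightarrow> real" and c :: "nat \<Rightarrow> real \<Rightarrow> real"
  assumes eps: "0 < \<epsilon>" "\<epsilon> \<le> 1" and s: "0 < s" "s < 1" and eta: "s \<le> \<eta>"
    and AB: "0 < A" "0 < B" and ab: "0 < abar" "0 < bbar"
    and ae: "\<And>i. 2 \<le> i \<Longrightarrow> ae i = abar * (\<epsilon> * real i) powr s"
    and be: "\<And>i. 3 \<le> i \<Longrightarrow> be i = bbar * (\<epsilon> * real i) powr s"
    and sol: "BD_solution \<eta> \<epsilon> A B ae be u c"
    and mass: "\<And>t N. 0 \<le> t \<Longrightarrow> u t + (\<Sum>i=2..N. \<epsilon>\<^sup>2 * real i * c i t) \<le> M"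
begin

definition J :: "nat \<Rightarrow> real \<Rightarrow> real" where "J i t = BD_flux \<eta> \<epsilon> A B ae be u c i t"

definition g :: "nat \<Rightarrow> real \<Rightarrow> real" where "g i t = (\<epsilon> * real i) powr s * c i t"

definition \<kappa> :: real where "\<kappa> = \<epsilon> powr (\<eta> - s) * B / 2 powr s"

lemma J_ge2: "2 \<le> i \<Longrightarrow> J i t = abar * u t * g i t - bbar * g (i+1) t"
  by (simp add: J_def BD_flux_def ae be g_def)

lemma J_1: "J 1 t = A * (u t)\<^sup>2 - \<kappa> * g 2 t"
proof -
  have "\<kappa> * g 2 t = \<epsilon> powr (\<eta> - s) * \<epsilon> powr s * B * c 2 t"
    using eps by (simp add: \<kappa>_def g_def powr_mult)
  also have "\<epsilon> powr (\<eta> - s) * \<epsilon> powr s = \<epsilon> powr \<eta>" using eps by (simp flip: powr_add)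
  finally show ?thesis by (simp add: J_def BD_flux_def)
qed

lemma kappa_nonneg: "0 \<le> \<kappa>" using AB by (simp add: \<kappa>_def)

lemma kappa_le: "\<kappa> \<le> B"
proof -
  have "\<epsilon> powr (\<eta> - s) \<le> 1" using eps eta by (intro powr_le1) auto
  moreover have "1 \<le> 2 powr s" using s by (intro ge_one_powr_ge_zero) auto
  ultimately have "\<epsilon> powr (\<eta> - s) * B / 2 powr s \<le> 1 * B / 1" using AB by (intro frac_le mult_right_mono) auto
  then show ?thesis by (simp add: \<kappa>_def)
qed

lemma u_nonneg: "0 \<le> t \<Longrightarrow> 0 \<le> u t" and c_nonneg: "2 \<le> i \<Longrightarrow> 0 \<le> t \<Longrightarrow> 0 \<le> c i t"
  and u_cont: "continuous_on {0..} u" and c_cont: "2 \<le> i \<Longrightarrow> continuous_on {0..} (c i)"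
  using sol by (auto simp: BD_solution_def)

lemma g_nonneg: "2 \<le> i \<Longrightarrow> 0 \<le> t \<Longrightarrow> 0 \<le> g i t"
  by (simp add: g_def c_nonneg)

lemma g_cont: "2 \<le> i \<Longrightarrow> continuous_on {0..} (g i)"
  unfolding g_def by (intro continuous_intros c_cont)

lemma J_cont: assumes "1 \<le> i" shows "continuous_on {0..} (J i)"
proof (cases "i = 1")
  case True
  have "J 1 = (\<lambda>t. A * (u t)\<^sup>2 - \<kappa> * g 2 t)" by (rule ext) (rule J_1)
  moreover have "continuous_on {0..} (\<lambda>t. A * (u t)\<^sup>2 - \<kappa> * g 2 t)" by (intro continuous_intros u_cont g_cont) auto
  ultimately show ?thesis by (simp add: True)
next
  case False
  then have "2 \<le> i" using assms by simp
  moreover have "continuous_on {0..} (\<lambda>t. abar * u t * g i t - bbar * g (i+1) t)"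
    using \<open>2 \<le> i\<close> by (intro continuous_intros u_cont g_cont) auto
  moreover have "J i = (\<lambda>t. abar * u t * g i t - bbar * g (i+1) t)" by (rule ext) (rule J_ge2[OF \<open>2 \<le> i\<close>])
  ultimately show ?thesis by simp
qed

lemma u_le: assumes "0 \<le> t" shows "u t \<le> M"
  using mass[OF assms, of 1] by simp

lemma M_nonneg: "0 \<le> M" using u_le[of 0] u_nonneg[of 0] by simp

lemma c_deriv: "2 \<le> i \<Longrightarrow> 0 \<le> t \<Longrightarrow> (c i has_real_derivative (1 / \<epsilon>) * (J (i-1) t - J i t)) (at t within {0..})"
  using sol by (auto simp: BD_solution_def Let_def J_def)

lemma u_deriv: "0 \<le> t \<Longrightarrow> (u has_real_derivative - \<epsilon> * J 1 t - \<epsilon> * (\<Sum>i. J (Suc i) t)) (at t within {0..})"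
  and J_summable: "0 \<le> t \<Longrightarrow> summable (\<lambda>i. J (Suc i) t)"
  using sol by (auto simp: BD_solution_def Let_def J_def)

lemma mass_sum_le: "0 \<le> t \<Longrightarrow> (\<Sum>i=2..N. \<epsilon>\<^sup>2 * real i * c i t) \<le> M"
  using mass[of t N] u_nonneg[of t] by linarith

lemma weighted_deriv:
  assumes "0 \<le> t"
  shows "((\<lambda>t. \<Sum>i=2..N. w i * (\<epsilon> * c i t)) has_real_derivative (\<Sum>i=2..N. w i * (J (i-1) t - J i t))) (at t within {0..})"
proof -
  have "((\<lambda>t. \<Sum>i=2..N. w i * (\<epsilon> * c i t)) has_real_derivative (\<Sum>i=2..N. w i * (\<epsilon> * ((1 / \<epsilon>) * (J (i-1) t - J i t))))) (at t within {0..})"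
    using assms by (intro DERIV_sum DERIV_cmult c_deriv) auto
  then show ?thesis using eps by simp
qed

lemma g_tail:
  assumes "0 < e"
  obtains N0 where "2 \<le> N0" "\<And>N t. N0 \<le> N \<Longrightarrow> 0 \<le> t \<Longrightarrow> g N t \<le> e"
proof -
  have b: "g N t \<le> (\<epsilon> * real N) powr (s-1) * (M / \<epsilon>)" if "2 \<le> N" "0 \<le> t" for N t
  proof -
    have "\<epsilon>\<^sup>2 * real N * c N t \<le> (\<Sum>i=2..N. \<epsilon>\<^sup>2 * real i * c i t)"
      using that by (intro member_le_sum) (auto intro!: mult_nonneg_nonneg c_nonneg)
    also have "\<dots> \<le> M" using mass_sum_le that by simp
    finally have *: "(\<epsilon> * real N) * c N t \<le> M / \<epsilon>" using eps by (simp add: field_simps power2_eq_square)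
    have "g N t = (\<epsilon> * real N) powr (s-1) * ((\<epsilon> * real N) * c N t)"
      using eps that by (simp add: g_def powr_diff)
    then show ?thesis using mult_left_mono[OF *, of "(\<epsilon> * real N) powr (s-1)"] by simp
  qed
  have "((\<lambda>N. (\<epsilon> * real N) powr (s-1) * (M / \<epsilon>)) \<longlongrightarrow> 0 * (M / \<epsilon>)) sequentially"
  proof (intro tendsto_mult tendsto_const tendsto_neg_powr)
    show "filterlim (\<lambda>N. \<epsilon> * real N) at_top sequentially"
      by (rule filterlim_tendsto_pos_mult_at_top[OF tendsto_const eps(1) filterlim_real_sequentially])
  qed (use s in auto)
  then have "eventually (\<lambda>N. (\<epsilon> * real N) powr (s-1) * (M / \<epsilon>) < e) sequentially"
    using assms by (auto dest!: order_tendstoD(2)[where a=e])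
  then obtain N1 where "\<And>N. N1 \<le> N \<Longrightarrow> (\<epsilon> * real N) powr (s-1) * (M / \<epsilon>) < e"
    by (auto simp: eventually_sequentially)
  then have N1: "(\<epsilon> * real N) powr (s-1) * (M / \<epsilon>) < e" if "N1 \<le> N" for N using that by blast
  show ?thesis
  proof (rule that[of "max 2 N1"])
    fix N t assume N: "max 2 N1 \<le> N" and t: "(0::real) \<le> t"
    have "g N t < e" by (rule le_less_trans[OF b N1]) (use N t in auto)
    then show "g N t \<le> e" by simp
  qed simp
qed

lemma J1_le: "0 \<le> t \<Longrightarrow> J 1 t \<le> A * M\<^sup>2"
proof -
  assume t: "0 \<le> t"
  have "(u t)\<^sup>2 \<le> M\<^sup>2" using u_le[OF t] u_nonneg[OF t] by (intro power_mono)
  then have "A * (u t)\<^sup>2 \<le> A * M\<^sup>2" using AB by simp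
  moreover have "0 \<le> \<kappa> * g 2 t" using kappa_nonneg g_nonneg t by simp
  ultimately show ?thesis unfolding J_1 by linarith
qed

lemma number_bound:
  assumes init: "\<And>N. (\<Sum>i=2..N. \<epsilon> * c i 0) \<le> P" and t: "0 \<le> t"
  shows "(\<Sum>i=2..N. \<epsilon> * c i t) \<le> P + A * M\<^sup>2 * t"
proof (rule field_le_epsilon)
  fix e :: real assume e: "0 < e"
  define d where "d = e / (bbar * (t + 1))"
  have d: "0 < d" using e ab t by (simp add: d_def)
  obtain N0 where N0: "2 \<le> N0" "\<And>N t. N0 \<le> N \<Longrightarrow> 0 \<le> t \<Longrightarrow> g N t \<le> d" by (rule g_tail[OF d]) blast
  define N' where "N' = max N N0"
  have N': "2 \<le> N'" using N0 by (simp add: N'_def)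
  have "(\<Sum>i=2..N. \<epsilon> * c i t) \<le> (\<Sum>i=2..N'. \<epsilon> * c i t)"
    using t eps by (intro sum_mono2) (auto simp: N'_def c_nonneg)
  also have "\<dots> = (\<Sum>i=2..N'. 1 * (\<epsilon> * c i t))" by simp
  also have "\<dots> \<le> (\<Sum>i=2..N'. 1 * (\<epsilon> * c i 0)) + (A * M\<^sup>2 + bbar * d) * t"
  proof (rule derivative_le_imp_growth_le[OF t weighted_deriv])
    fix r assume r: "0 \<le> r" "r \<le> t"
    have "(\<Sum>i=2..N'. 1 * (J (i-1) r - J i r)) = J 1 r - J N' r"
      using sum_by_parts_flux[OF N', of "\<lambda>_. 1" "\<lambda>i. J i r"] by simp
    moreover have "0 \<le> abar * u r * g N' r" using ab u_nonneg g_nonneg N' r by simp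
    moreover have "bbar * g (N'+1) r \<le> bbar * d" using N0(2)[of "N'+1" r] r ab by (simp add: N'_def)
    ultimately show "(\<Sum>i=2..N'. 1 * (J (i-1) r - J i r)) \<le> A * M\<^sup>2 + bbar * d"
      using J1_le[OF r(1)] J_ge2[OF N', of r] by linarith
  qed simp
  also have "(A * M\<^sup>2 + bbar * d) * t \<le> A * M\<^sup>2 * t + e"
  proof -
    have "bbar * d * t = e * (t / (t+1))" using ab t by (simp add: d_def)
    also have "\<dots> \<le> e * 1" using t e by (intro mult_left_mono) auto
    finally show ?thesis by (simp add: distrib_right)
  qed
  finally show "(\<Sum>i=2..N. \<epsilon> * c i t) \<le> P + A * M\<^sup>2 * t + e" using init[of N'] by simp
qed

lemma sum_g_le:
  assumes "0 \<le> t" and Q: "\<And>N. (\<Sum>i=2..N. \<epsilon> * c i t) \<le> Q"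
  shows "(\<Sum>i=2..N. \<epsilon> * g i t) \<le> Q + M"
proof -
  have "(\<Sum>i=2..N. \<epsilon> * g i t) \<le> (\<Sum>i=2..N. \<epsilon> * c i t + \<epsilon>\<^sup>2 * real i * c i t)"
  proof (rule sum_mono)
    fix i assume i: "i \<in> {2..N}"
    let ?x = "\<epsilon> * real i"
    have x: "0 < ?x" using eps i by simp
    have "?x powr s \<le> 1 + ?x"
    proof (cases "?x \<le> 1")
      case True
      then have "?x powr s \<le> 1" using x s by (intro powr_le1) auto
      then show ?thesis using x by linarith
    next
      case False
      then have "?x powr s \<le> ?x powr 1" using s by (intro powr_mono) auto
      then show ?thesis using x by simp
    qed
    then have "?x powr s * (\<epsilon> * c i t) \<le> (1 + ?x) * (\<epsilon> * c i t)"
      using c_nonneg[of i t] i assms eps by (intro mult_right_mono) auto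
    then show "\<epsilon> * g i t \<le> \<epsilon> * c i t + \<epsilon>\<^sup>2 * real i * c i t"
      by (simp add: g_def algebra_simps power2_eq_square)
  qed
  also have "\<dots> \<le> Q + M" using Q[of N] mass_sum_le[OF assms(1), of N] by (simp add: sum.distrib)
  finally show ?thesis .
qed

lemma sum_abs_J_le:
  assumes t: "0 \<le> t" and Q: "\<And>N. (\<Sum>i=2..N. \<epsilon> * c i t) \<le> Q"
  shows "(\<Sum>i=2..N. \<epsilon> * \<bar>J i t\<bar>) \<le> (abar * M + bbar) * (Q + M)"
proof -
  have g: "(\<Sum>i=2..N. \<epsilon> * g (i+1) t) \<le> Q + M"
  proof -
    have "(\<Sum>i=2..N. \<epsilon> * g (i+1) t) = (\<Sum>i=3..N+1. \<epsilon> * g i t)"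
      using sum.shift_bounds_cl_nat_ivl[of "\<lambda>i. \<epsilon> * g i t" 2 1 N] by (simp add: numeral_3_eq_3)
    also have "\<dots> \<le> (\<Sum>i=2..N+1. \<epsilon> * g i t)" using eps t by (intro sum_mono2) (auto simp: g_nonneg)
    also have "\<dots> \<le> Q + M" by (rule sum_g_le[OF t Q])
    finally show ?thesis .
  qed
  have "(\<Sum>i=2..N. \<epsilon> * \<bar>J i t\<bar>) \<le> (\<Sum>i=2..N. abar * M * (\<epsilon> * g i t) + bbar * (\<epsilon> * g (i+1) t))"
  proof (rule sum_mono)
    fix i assume i: "i \<in> {2..N}"
    have "abar * u t * g i t \<le> abar * M * g i t"
      using i t ab by (intro mult_right_mono mult_left_mono u_le g_nonneg) auto
    moreover have "0 \<le> abar * u t * g i t" "0 \<le> bbar * g (i+1) t" using i t ab u_nonneg g_nonneg by auto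
    ultimately have "\<bar>J i t\<bar> \<le> abar * M * g i t + bbar * g (i+1) t" using J_ge2[of i t] i by (auto simp: abs_le_iff)
    then have "\<epsilon> * \<bar>J i t\<bar> \<le> \<epsilon> * (abar * M * g i t + bbar * g (i+1) t)" using eps by (intro mult_left_mono) auto
    then show "\<epsilon> * \<bar>J i t\<bar> \<le> abar * M * (\<epsilon> * g i t) + bbar * (\<epsilon> * g (i+1) t)" by (simp add: algebra_simps)
  qed
  also have "\<dots> = abar * M * (\<Sum>i=2..N. \<epsilon> * g i t) + bbar * (\<Sum>i=2..N. \<epsilon> * g (i+1) t)"
    by (simp add: sum.distrib sum_distrib_left)
  also have "\<dots> \<le> abar * M * (Q + M) + bbar * (Q + M)"
    using g sum_g_le[OF t Q, of N] ab M_nonneg by (intro add_mono mult_left_mono) auto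
  finally show ?thesis by (simp add: distrib_right)
qed

definition u_rate :: "real \<Rightarrow> real" where
  "u_rate Q = 2 * (A * M\<^sup>2 + B * Q) + (abar * M + bbar) * (Q + M)"

lemma u_deriv_bound:
  assumes t: "0 \<le> t" and Q: "\<And>N. (\<Sum>i=2..N. \<epsilon> * c i t) \<le> Q"
  shows "\<bar>- \<epsilon> * J 1 t - \<epsilon> * (\<Sum>i. J (Suc i) t)\<bar> \<le> u_rate Q"
proof -
  have J1: "\<epsilon> * \<bar>J 1 t\<bar> \<le> A * M\<^sup>2 + B * Q"
  proof -
    have "(u t)\<^sup>2 \<le> M\<^sup>2" using u_le[OF t] u_nonneg[OF t] by (intro power_mono)
    then have "A * (u t)\<^sup>2 \<le> A * M\<^sup>2" using AB by simp
    moreover have "\<epsilon> * (A * (u t)\<^sup>2) \<le> 1 * (A * (u t)\<^sup>2)" using eps AB by (intro mult_right_mono) auto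
    ultimately have 1: "\<epsilon> * (A * (u t)\<^sup>2) \<le> A * M\<^sup>2" by linarith
    have "\<epsilon> powr \<eta> * B * (\<epsilon> * c 2 t) \<le> 1 * B * (\<epsilon> * c 2 t)"
      using eps eta s AB t by (intro mult_right_mono powr_le1) (auto simp: c_nonneg)
    also have "\<dots> \<le> B * Q" using Q[of 2] AB by simp
    finally have 2: "\<epsilon> * (\<epsilon> powr \<eta> * B * c 2 t) \<le> B * Q" by (simp add: mult_ac)
    have "J 1 t = A * (u t)\<^sup>2 - \<epsilon> powr \<eta> * B * c 2 t" by (simp add: J_def BD_flux_def)
    moreover have "0 \<le> A * (u t)\<^sup>2" "0 \<le> \<epsilon> powr \<eta> * B * c 2 t" using AB c_nonneg[of 2 t] t by auto
    ultimately have "\<bar>J 1 t\<bar> \<le> A * (u t)\<^sup>2 + \<epsilon> powr \<eta> * B * c 2 t" by linarith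
    then have "\<epsilon> * \<bar>J 1 t\<bar> \<le> \<epsilon> * (A * (u t)\<^sup>2 + \<epsilon> powr \<eta> * B * c 2 t)" using eps by (intro mult_left_mono) auto
    then show ?thesis using 1 2 by (simp add: distrib_left)
  qed
  have "\<bar>\<epsilon> * (\<Sum>i. J (Suc i) t)\<bar> \<le> A * M\<^sup>2 + B * Q + (abar * M + bbar) * (Q + M)"
  proof (rule LIMSEQ_le_const2)
    show "(\<lambda>n. \<bar>\<epsilon> * (\<Sum>i<n. J (Suc i) t)\<bar>) \<longlonglongrightarrow> \<bar>\<epsilon> * (\<Sum>i. J (Suc i) t)\<bar>"
      by (intro tendsto_intros summable_LIMSEQ J_summable t)
    show "\<exists>N. \<forall>n\<ge>N. \<bar>\<epsilon> * (\<Sum>i<n. J (Suc i) t)\<bar> \<le> A * M\<^sup>2 + B * Q + (abar * M + bbar) * (Q + M)"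
    proof (intro exI[of _ 1] allI impI)
      fix n :: nat assume n: "1 \<le> n"
      have "(\<Sum>i<n. J (Suc i) t) = (\<Sum>i=1..n. J i t)"
        by (simp add: sum.atLeast1_atMost_eq)
      also have "\<dots> = J 1 t + (\<Sum>i=2..n. J i t)" using n by (simp add: sum.atLeast_Suc_atMost numeral_2_eq_2)
      finally have "\<bar>\<epsilon> * (\<Sum>i<n. J (Suc i) t)\<bar> = \<bar>\<epsilon> * J 1 t + (\<Sum>i=2..n. \<epsilon> * J i t)\<bar>"
        by (simp add: distrib_left sum_distrib_left)
      also have "\<dots> \<le> \<bar>\<epsilon> * J 1 t\<bar> + (\<Sum>i=2..n. \<bar>\<epsilon> * J i t\<bar>)"
        by (intro order_trans[OF abs_triangle_ineq] add_left_mono sum_abs)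
      also have "\<dots> \<le> A * M\<^sup>2 + B * Q + (abar * M + bbar) * (Q + M)"
        using J1 sum_abs_J_le[OF t Q, of n] eps by (simp add: abs_mult)
      finally show "\<bar>\<epsilon> * (\<Sum>i<n. J (Suc i) t)\<bar> \<le> A * M\<^sup>2 + B * Q + (abar * M + bbar) * (Q + M)" .
    qed
  qed
  moreover have "\<bar>- \<epsilon> * J 1 t\<bar> \<le> A * M\<^sup>2 + B * Q" using J1 eps by (simp add: abs_mult)
  ultimately have "\<bar>- \<epsilon> * J 1 t\<bar> + \<bar>\<epsilon> * (\<Sum>i. J (Suc i) t)\<bar>
      \<le> (A * M\<^sup>2 + B * Q) + (A * M\<^sup>2 + B * Q + (abar * M + bbar) * (Q + M))" by (intro add_mono)
  then have "\<bar>- \<epsilon> * J 1 t - \<epsilon> * (\<Sum>i. J (Suc i) t)\<bar>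
      \<le> (A * M\<^sup>2 + B * Q) + (A * M\<^sup>2 + B * Q + (abar * M + bbar) * (Q + M))"
    by (rule order_trans[OF abs_triangle_ineq4])
  then show ?thesis by (simp add: u_rate_def)
qed

end

lemma of_nat_mult_power_le:
  fixes r :: real
  assumes "0 \<le> r" "r < 1"
  shows "real n * r ^ n \<le> 1 / (1 - r)"
proof -
  have "real n * r ^ n = (\<Sum>k<n. r ^ n)" by simp
  also have "\<dots> \<le> (\<Sum>k<n. r ^ k)" using assms by (intro sum_mono power_decreasing) auto
  also have "\<dots> = (1 - r ^ n) / (1 - r)" using assms by (simp add: sum_gp_strict)
  also have "\<dots> \<le> 1 / (1 - r)" using assms by (intro divide_right_mono) auto
  finally show ?thesis .
qed

context BD_power_law
begin

definition v :: "real \<Rightarrow> real" where "v t = abar * u t - bbar"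

lemma convex_flux_le:
  assumes t: "0 \<le> t" and v: "0 < v t" and N: "2 \<le> N"
    and G: "\<And>x. 0 \<le> x \<Longrightarrow> 0 \<le> G x" and G'0: "\<And>x. 0 \<le> x \<Longrightarrow> 0 \<le> G' x"
    and tangent: "\<And>x y. 0 \<le> x \<Longrightarrow> 0 \<le> y \<Longrightarrow> G' x * (y - x) \<le> G y - (G x :: real)"
    and \<theta>: "0 < \<theta>" "\<theta> < 1"
  shows "(\<Sum>i=2..N. \<theta>^i * (G' (g i t) * (J (i-1) t - J i t)))
     \<le> v t * G (A * (u t)\<^sup>2 / v t) - (1-\<theta>) * (\<Sum>i=2..N. \<theta>^(i-1) * ((\<theta> * (abar * u t) - bbar) * G (g i t)))
       + bbar * G (g (N+1) t)"
proof -
  let ?a = "abar * u t" and ?s = "A * (u t)\<^sup>2 / v t"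
  have a: "0 < ?a" using v ab by (simp add: v_def)
  have s0: "0 \<le> ?s" using AB v by simp
  define F where "F i = (if i = 1 then v t * G ?s else ?a * G (g i t) - bbar * G (g (i+1) t))" for i :: nat
  have gg: "0 \<le> g i t" if "2 \<le> i" for i using g_nonneg that t by simp
  have point: "G' (g i t) * (J (i-1) t - J i t) \<le> F (i-1) - F i" if i: "2 \<le> i" for i
  proof (cases "i = 2")
    case True
    have "J 1 t - J 2 t \<le> v t * (?s - g 2 t) + bbar * (g 3 t - g 2 t)"
    proof -
      have "0 \<le> \<kappa> * g 2 t" using kappa_nonneg gg by simp
      moreover have "v t * (?s - g 2 t) = A * (u t)\<^sup>2 - v t * g 2 t" using v by (simp add: right_diff_distrib)
      moreover have "J 2 t = abar * u t * g 2 t - bbar * g 3 t" using J_ge2[of 2 t] by simp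
      ultimately have "J 1 t - J 2 t = v t * (?s - g 2 t) + bbar * (g 3 t - g 2 t) - \<kappa> * g 2 t"
        unfolding J_1 by (simp add: v_def left_diff_distrib right_diff_distrib)
      then show ?thesis using \<open>0 \<le> \<kappa> * g 2 t\<close> by linarith
    qed
    then have "G' (g 2 t) * (J 1 t - J 2 t) \<le> G' (g 2 t) * (v t * (?s - g 2 t) + bbar * (g 3 t - g 2 t))"
      using G'0 gg by (intro mult_left_mono) auto
    also have "\<dots> = v t * (G' (g 2 t) * (?s - g 2 t)) + bbar * (G' (g 2 t) * (g 3 t - g 2 t))" by (simp add: algebra_simps)
    also have "\<dots> \<le> v t * (G ?s - G (g 2 t)) + bbar * (G (g 3 t) - G (g 2 t))"
      using v ab s0 gg[of 2] gg[of 3] by (intro add_mono mult_left_mono tangent) auto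
    also have "\<dots> = F 1 - F 2"
    proof -
      have "F 2 = ?a * G (g 2 t) - bbar * G (g 3 t)" by (simp add: F_def eval_nat_numeral)
      then show ?thesis by (simp add: F_def v_def algebra_simps)
    qed
    finally show ?thesis using True by simp
  next
    case False
    then have i3: "3 \<le> i" using i by simp
    have JJ: "J (i-1) t - J i t = ?a * (g (i-1) t - g i t) + bbar * (g (i+1) t - g i t)"
    proof -
      have "J (i-1) t = ?a * g (i-1) t - bbar * g i t" using J_ge2[of "i-1" t] i3 by simp
      moreover have "J i t = ?a * g i t - bbar * g (i+1) t" using J_ge2[of i t] i3 by simp
      ultimately show ?thesis by (simp add: left_diff_distrib right_diff_distrib)
    qed
    have "G' (g i t) * (J (i-1) t - J i t) = ?a * (G' (g i t) * (g (i-1) t - g i t)) + bbar * (G' (g i t) * (g (i+1) t - g i t))"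
      unfolding JJ by (simp add: algebra_simps)
    also have "\<dots> \<le> ?a * (G (g (i-1) t) - G (g i t)) + bbar * (G (g (i+1) t) - G (g i t))"
      using a ab i3 gg[of i] gg[of "i-1"] gg[of "i+1"] by (intro add_mono mult_left_mono tangent) auto
    also have "\<dots> = F (i-1) - F i"
    proof -
      have "F (i-1) = ?a * G (g (i-1) t) - bbar * G (g i t)" using i3 by (auto simp: F_def)
      moreover have "F i = ?a * G (g i t) - bbar * G (g (i+1) t)" using i3 by (auto simp: F_def)
      ultimately show ?thesis by (simp add: right_diff_distrib)
    qed
    finally show ?thesis .
  qed
  have "(\<Sum>i=2..N. \<theta>^i * (G' (g i t) * (J (i-1) t - J i t))) \<le> (\<Sum>i=2..N. \<theta>^i * (F (i-1) - F i))"
    using point \<theta> by (intro sum_mono mult_left_mono) auto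
  also have "\<dots> = \<theta>^2 * F 1 - (1-\<theta>) * (\<Sum>i=2..N. \<theta>^(i-1) * ((\<theta> * ?a - bbar) * G (g i t)))
     - (1-\<theta>) * \<theta> * bbar * G (g 2 t) - \<theta>^(N+1) * ?a * G (g N t) + \<theta>^N * bbar * G (g (N+1) t)"
    by (rule geometric_sum_by_parts[OF N, where G="\<lambda>i. G (g i t)"]) (simp add: F_def)
  also have "\<dots> \<le> v t * G ?s - (1-\<theta>) * (\<Sum>i=2..N. \<theta>^(i-1) * ((\<theta> * ?a - bbar) * G (g i t))) + bbar * G (g (N+1) t)"
  proof -
    have "\<theta>^2 * F 1 \<le> 1 * F 1" using \<theta> v G s0 by (intro mult_right_mono power_le_one) (auto simp: F_def)
    moreover have "F 1 = v t * G ?s" by (simp add: F_def)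
    moreover have "0 \<le> (1-\<theta>) * \<theta> * bbar * G (g 2 t)" "0 \<le> \<theta>^(N+1) * ?a * G (g N t)"
      using \<theta> ab a G gg N by auto
    moreover have "\<theta>^N * (bbar * G (g (N+1) t)) \<le> 1 * (bbar * G (g (N+1) t))"
      using \<theta> ab G gg[of "N+1"] N by (intro mult_right_mono power_le_one) auto
    ultimately show ?thesis by (simp add: mult.assoc)
  qed
  finally show ?thesis .
qed

lemma exponential_moment:
  assumes ustar: "\<And>r. 0 \<le> r \<Longrightarrow> r \<le> t \<Longrightarrow> ustar \<le> u r" and t: "0 \<le> t"
    and \<theta>: "0 < \<theta>" "\<theta> < 1" and k: "0 < \<theta> * (abar * ustar) - bbar"
    and init: "\<And>N. (\<Sum>i=2..N. \<theta>^i * (\<epsilon> powr s * c i 0)) \<le> H"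
  shows "(\<Sum>i=2..N. \<theta>^i * (\<epsilon> powr s * c i t)) \<le> max H ((A * M\<^sup>2 + bbar) / ((1-\<theta>) * (\<theta> * (abar * ustar) - bbar)))"
proof -
  define k0 where "k0 = (1-\<theta>) * (\<theta> * (abar * ustar) - bbar)"
  have k0: "0 < k0" using \<theta> k by (simp add: k0_def)
  have us: "0 < abar * ustar" using k ab \<theta> by (smt (verit) zero_less_mult_iff)
  have vpos: "0 < v r" "\<theta> * (abar * ustar) - bbar \<le> \<theta> * (abar * u r) - bbar" if "0 \<le> r" "r \<le> t" for r
  proof -
    have le: "abar * ustar \<le> abar * u r" using ustar[OF that] ab by simp
    then show "\<theta> * (abar * ustar) - bbar \<le> \<theta> * (abar * u r) - bbar" using \<theta> by simp
    have "\<theta> * (abar * ustar) \<le> 1 * (abar * ustar)" using \<theta> us by (intro mult_right_mono) auto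
    then show "0 < v r" using le k by (simp add: v_def)
  qed
  obtain N0 where N0: "2 \<le> N0" "\<And>N t. N0 \<le> N \<Longrightarrow> 0 \<le> t \<Longrightarrow> g N t \<le> 1" by (rule g_tail[of 1]) auto
  define N' where "N' = max N N0"
  have N': "2 \<le> N'" "N0 \<le> N'" "N \<le> N'" using N0 by (auto simp: N'_def)
  have ep: "0 < \<epsilon> powr (s-1)" using eps by simp
  have eps_s: "\<epsilon> powr s = \<epsilon> powr (s-1) * \<epsilon>" using eps by (simp add: powr_diff)
  let ?E = "\<lambda>r. \<Sum>i=2..N'. \<theta>^i * (\<epsilon> * c i r)"
  have scale: "(\<Sum>i=2..K. \<theta>^i * (\<epsilon> powr s * c i r)) = \<epsilon> powr (s-1) * (\<Sum>i=2..K. \<theta>^i * (\<epsilon> * c i r))" for K r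
    by (simp add: eps_s sum_distrib_left mult_ac)
  have "?E t \<le> max (?E 0) ((A * M\<^sup>2 + bbar) / (k0 * \<epsilon> powr (s-1)))"
  proof (rule damped_derivative_bound[OF t weighted_deriv])
    fix r assume r: "0 \<le> r" "r \<le> t"
    have "(\<Sum>i=2..N'. \<theta>^i * (J (i-1) r - J i r)) = (\<Sum>i=2..N'. \<theta>^i * (1 * (J (i-1) r - J i r)))" by simp
    also have "\<dots> \<le> v r * (A * (u r)\<^sup>2 / v r) - (1-\<theta>) * (\<Sum>i=2..N'. \<theta>^(i-1) * ((\<theta> * (abar * u r) - bbar) * g i r)) + bbar * g (N'+1) r"
      by (rule convex_flux_le[OF r(1) vpos(1)[OF r] N'(1) _ _ _ \<theta>, where G="\<lambda>x. x" and G'="\<lambda>_. 1"]) auto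
    also have "\<dots> \<le> (A * M\<^sup>2 + bbar) - k0 * \<epsilon> powr (s-1) * ?E r"
    proof -
      have "(u r)\<^sup>2 \<le> M\<^sup>2" using u_le[OF r(1)] u_nonneg[OF r(1)] by (intro power_mono)
      then have 1: "v r * (A * (u r)\<^sup>2 / v r) \<le> A * M\<^sup>2" using vpos(1)[OF r] AB by simp
      have 2: "bbar * g (N'+1) r \<le> bbar * 1" using N0(2)[of "N'+1" r] N' r ab by (intro mult_left_mono) auto
      have "\<epsilon> powr (s-1) * ?E r \<le> (\<Sum>i=2..N'. \<theta>^(i-1) * g i r)"
      proof -
        have "\<theta>^i * (\<epsilon> powr s * c i r) \<le> \<theta>^(i-1) * g i r" if "i \<in> {2..N'}" for i
        proof -
          have "\<epsilon> powr s \<le> (\<epsilon> * real i) powr s" using eps s that by (intro powr_mono2) auto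
          then have "\<epsilon> powr s * c i r \<le> g i r" unfolding g_def using c_nonneg[of i r] that r by (intro mult_right_mono) auto
          moreover have "\<theta>^i \<le> \<theta>^(i-1)" using \<theta> by (intro power_decreasing) auto
          ultimately show ?thesis using \<theta> c_nonneg[of i r] that r by (intro mult_mono) auto
        qed
        then show ?thesis unfolding scale[symmetric] by (rule sum_mono)
      qed
      then have "(1-\<theta>) * ((\<theta> * (abar * ustar) - bbar) * (\<epsilon> powr (s-1) * ?E r))
          \<le> (1-\<theta>) * ((\<theta> * (abar * u r) - bbar) * (\<Sum>i=2..N'. \<theta>^(i-1) * g i r))"
      proof (intro mult_left_mono mult_mono vpos(2)[OF r])
        show "0 \<le> \<theta> * (abar * u r) - bbar" using vpos(2)[OF r] k by linarith
        show "0 \<le> \<epsilon> powr (s-1) * ?E r" using \<theta> eps r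
          by (intro mult_nonneg_nonneg sum_nonneg c_nonneg) auto
      qed (use \<theta> in auto)
      also have "(1-\<theta>) * ((\<theta> * (abar * u r) - bbar) * (\<Sum>i=2..N'. \<theta>^(i-1) * g i r))
          = (1-\<theta>) * (\<Sum>i=2..N'. \<theta>^(i-1) * ((\<theta> * (abar * u r) - bbar) * g i r))"
        by (simp add: sum_distrib_left mult_ac)
      finally show ?thesis using 1 2 by (simp add: k0_def mult.assoc)
    qed
    finally show "(\<Sum>i=2..N'. \<theta>^i * (J (i-1) r - J i r)) \<le> (A * M\<^sup>2 + bbar) - k0 * \<epsilon> powr (s-1) * ?E r" .
  qed (use k0 ep in auto)
  then have "\<epsilon> powr (s-1) * ?E t \<le> \<epsilon> powr (s-1) * max (?E 0) ((A * M\<^sup>2 + bbar) / (k0 * \<epsilon> powr (s-1)))"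
    using ep by simp
  also have "\<dots> = max (\<epsilon> powr (s-1) * ?E 0) ((A * M\<^sup>2 + bbar) / k0)"
    using ep by (simp add: max_mult_distrib_left)
  also have "\<dots> \<le> max H ((A * M\<^sup>2 + bbar) / k0)" using init[of N'] unfolding scale by (intro max.mono) auto
  finally have "(\<Sum>i=2..N'. \<theta>^i * (\<epsilon> powr s * c i t)) \<le> max H ((A * M\<^sup>2 + bbar) / k0)" unfolding scale .
  moreover have "(\<Sum>i=2..N. \<theta>^i * (\<epsilon> powr s * c i t)) \<le> (\<Sum>i=2..N'. \<theta>^i * (\<epsilon> powr s * c i t))"
    using t \<theta> N' by (intro sum_mono2) (auto intro!: mult_nonneg_nonneg c_nonneg)
  ultimately show ?thesis by (simp add: k0_def)
qed

lemma power_moment: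
  assumes ustar: "\<And>r. 0 \<le> r \<Longrightarrow> r \<le> t \<Longrightarrow> ustar \<le> u r" and t: "0 \<le> t"
    and k: "bbar \<le> exp (- \<epsilon>) * (abar * ustar)" and d: "0 < \<delta>"
    and init: "\<And>N. (\<Sum>i=2..N. \<epsilon> * c i 0 powr (1+\<delta>)) \<le> P" and sd: "s * \<delta> \<le> 1"
  shows "(\<Sum>i=2..N. exp (- (\<epsilon> * real i)) * (\<epsilon> * ((\<epsilon> * real i) powr (s*\<delta>) * c i t powr (1+\<delta>))))
     \<le> P + ((abar * ustar - bbar) powr (-\<delta>) * (A * M\<^sup>2) powr (1+\<delta>) + bbar) * t"
proof -
  define \<theta> where "\<theta> = exp (- \<epsilon>)"
  have \<theta>: "0 < \<theta>" "\<theta> < 1" using eps by (auto simp: \<theta>_def)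
  have th: "exp (- (\<epsilon> * real i)) = \<theta>^i" for i by (simp add: \<theta>_def exp_of_nat_mult[symmetric] mult.commute)
  let ?G = "\<lambda>y::real. y powr (1+\<delta>)" and ?G' = "\<lambda>y::real. (1+\<delta>) * y powr \<delta>"
  have us: "0 < abar * ustar" using k ab \<theta> by (smt (verit) \<theta>_def zero_less_mult_iff)
  have vs: "0 < abar * ustar - bbar"
  proof -
    have "exp (- \<epsilon>) * (abar * ustar) < 1 * (abar * ustar)" using us \<theta> by (intro mult_strict_right_mono) (auto simp: \<theta>_def)
    then show ?thesis using k by simp
  qed
  have vr: "abar * ustar - bbar \<le> v r" "bbar \<le> \<theta> * (abar * u r)" if "0 \<le> r" "r \<le> t" for r
  proof -
    have le: "abar * ustar \<le> abar * u r" using ustar[OF that] ab by simp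
    then show "abar * ustar - bbar \<le> v r" by (simp add: v_def)
    have "\<theta> * (abar * ustar) \<le> \<theta> * (abar * u r)" using mult_left_mono[OF le, of \<theta>] \<theta> by simp
    with k show "bbar \<le> \<theta> * (abar * u r)" unfolding \<theta>_def by linarith
  qed
  obtain N0 where N0: "2 \<le> N0" "\<And>N t. N0 \<le> N \<Longrightarrow> 0 \<le> t \<Longrightarrow> g N t \<le> 1" by (rule g_tail[of 1]) auto
  define N' where "N' = max N N0"
  have N': "2 \<le> N'" "N0 \<le> N'" "N \<le> N'" using N0 by (auto simp: N'_def)
  define w where "w i = \<theta>^i * (\<epsilon> * (\<epsilon> * real i) powr (- s))" for i
  let ?E = "\<lambda>r. \<Sum>i=2..N'. w i * ?G (g i r)"
  have summand: "w i * ?G (g i r) = exp (- (\<epsilon> * real i)) * (\<epsilon> * ((\<epsilon> * real i) powr (s*\<delta>) * c i r powr (1+\<delta>)))"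
    if "2 \<le> i" "0 \<le> r" for i r
  proof -
    have p: "0 < \<epsilon> * real i" using eps that by simp
    have "?G (g i r) = ((\<epsilon> * real i) powr s) powr (1+\<delta>) * c i r powr (1+\<delta>)"
      using c_nonneg[OF that] p unfolding g_def by (intro powr_mult)
    also have "((\<epsilon> * real i) powr s) powr (1+\<delta>) = (\<epsilon> * real i) powr s * (\<epsilon> * real i) powr (s*\<delta>)"
      by (simp add: powr_powr distrib_left powr_add)
    also have "(\<epsilon> * real i) powr (-s) * (\<dots> * c i r powr (1+\<delta>)) = (\<epsilon> * real i) powr (s*\<delta>) * c i r powr (1+\<delta>)"
      using p by (simp add: powr_minus field_simps)
    finally have *: "(\<epsilon> * real i) powr (-s) * ?G (g i r) = (\<epsilon> * real i) powr (s*\<delta>) * c i r powr (1+\<delta>)" by simp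
    show ?thesis unfolding w_def th *[symmetric] by simp
  qed
  let ?D = "(abar * ustar - bbar) powr (-\<delta>) * (A * M\<^sup>2) powr (1+\<delta>) + bbar"
  have "?E t \<le> ?E 0 + ?D * t"
  proof (rule derivative_le_imp_growth_le[OF t])
    fix r assume r: "0 \<le> r" "r \<le> t"
    have gd: "((\<lambda>r. ?G (g i r)) has_real_derivative ?G' (g i r) * ((\<epsilon> * real i) powr s * ((1/\<epsilon>) * (J (i-1) r - J i r)))) (at r within {0..})"
      if i: "2 \<le> i" for i
    proof -
      have 1: "(g i has_real_derivative (\<epsilon> * real i) powr s * ((1/\<epsilon>) * (J (i-1) r - J i r))) (at r within {0..})"
        unfolding g_def[abs_def] by (intro DERIV_cmult c_deriv i r)
      have 2: "(?G has_real_derivative ?G' (g i r)) (at (g i r) within g i ` {0..})"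
        by (rule DERIV_subset[OF has_real_derivative_powr_at_0]) (use g_nonneg i r d in auto)
      show ?thesis using DERIV_image_chain[OF 2 1] by (simp only: o_def)
    qed
    show "(?E has_real_derivative (\<Sum>i=2..N'. w i * (?G' (g i r) * ((\<epsilon> * real i) powr s * ((1/\<epsilon>) * (J (i-1) r - J i r)))))) (at r within {0..})"
      by (intro DERIV_sum DERIV_cmult gd) auto
    have "(\<Sum>i=2..N'. w i * (?G' (g i r) * ((\<epsilon> * real i) powr s * ((1/\<epsilon>) * (J (i-1) r - J i r)))))
        = (\<Sum>i=2..N'. \<theta>^i * (?G' (g i r) * (J (i-1) r - J i r)))"
    proof (rule sum.cong[OF refl])
      fix i assume i: "i \<in> {2..N'}"
      have "w i * ((\<epsilon> * real i) powr s * (1/\<epsilon>)) = \<theta>^i"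
      proof -
        have "w i * ((\<epsilon> * real i) powr s * (1/\<epsilon>)) = \<theta>^i * (((\<epsilon> * real i) powr (-s) * (\<epsilon> * real i) powr s) * (\<epsilon> * (1/\<epsilon>)))"
          by (simp only: w_def mult_ac)
        also have "(\<epsilon> * real i) powr (-s) * (\<epsilon> * real i) powr s = 1" unfolding powr_add[symmetric] using eps i by simp
        finally show ?thesis using eps by simp
      qed
      then show "w i * (?G' (g i r) * ((\<epsilon> * real i) powr s * ((1/\<epsilon>) * (J (i-1) r - J i r)))) = \<theta>^i * (?G' (g i r) * (J (i-1) r - J i r))"
      proof -
        assume *: "w i * ((\<epsilon> * real i) powr s * (1/\<epsilon>)) = \<theta>^i"
        have "w i * (?G' (g i r) * ((\<epsilon> * real i) powr s * ((1/\<epsilon>) * (J (i-1) r - J i r))))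
          = (w i * ((\<epsilon> * real i) powr s * (1/\<epsilon>))) * (?G' (g i r) * (J (i-1) r - J i r))" by (simp only: mult_ac)
        then show ?thesis unfolding * .
      qed
    qed
    also have "\<dots> \<le> v r * ?G (A * (u r)\<^sup>2 / v r) - (1-\<theta>) * (\<Sum>i=2..N'. \<theta>^(i-1) * ((\<theta> * (abar * u r) - bbar) * ?G (g i r))) + bbar * ?G (g (N'+1) r)"
      using vr(1)[OF r] vs d
      by (intro convex_flux_le[OF r(1) _ N'(1) _ _ _ \<theta>]) (auto intro: powr_tangent_below)
    also have "\<dots> \<le> ?D"
    proof -
      have "0 \<le> (1-\<theta>) * (\<Sum>i=2..N'. \<theta>^(i-1) * ((\<theta> * (abar * u r) - bbar) * ?G (g i r)))"
        using \<theta> vr(2)[OF r] by (intro mult_nonneg_nonneg sum_nonneg) auto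
      moreover have "bbar * ?G (g (N'+1) r) \<le> bbar * 1"
        using N0(2)[of "N'+1" r] N' r ab d g_nonneg[of "N'+1" r] by (intro mult_left_mono powr_le1) auto
      moreover have "v r * ?G (A * (u r)\<^sup>2 / v r) \<le> (abar * ustar - bbar) powr (-\<delta>) * (A * M\<^sup>2) powr (1+\<delta>)"
      proof -
        have vp: "0 < v r" using vs vr(1)[OF r] by linarith
        have "(u r)\<^sup>2 \<le> M\<^sup>2" using u_le[OF r(1)] u_nonneg[OF r(1)] by (intro power_mono)
        then have "?G (A * (u r)\<^sup>2) \<le> ?G (A * M\<^sup>2)" using AB d by (intro powr_mono2) auto
        moreover have "v r powr (-\<delta>) \<le> (abar * ustar - bbar) powr (-\<delta>)" using vr(1)[OF r] vs d by (intro powr_mono2') auto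
        moreover have "v r * ?G (A * (u r)\<^sup>2 / v r) = v r powr (-\<delta>) * ?G (A * (u r)\<^sup>2)"
          using vp AB by (simp add: powr_divide powr_minus powr_add field_simps)
        ultimately show ?thesis by (simp add: mult_mono)
      qed
      ultimately show ?thesis by linarith
    qed
    finally show "(\<Sum>i=2..N'. w i * (?G' (g i r) * ((\<epsilon> * real i) powr s * ((1/\<epsilon>) * (J (i-1) r - J i r))))) \<le> ?D" .
  qed
  also have "?E 0 \<le> (\<Sum>i=2..N'. \<epsilon> * c i 0 powr (1+\<delta>))"
  proof (rule sum_mono)
    fix i assume i: "i \<in> {2..N'}"
    let ?x = "\<epsilon> * real i"
    have x: "0 < ?x" using eps i by simp
    have "?x powr (s*\<delta>) \<le> exp ?x"
    proof (cases "?x \<le> 1")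
      case True
      then have "?x powr (s*\<delta>) \<le> 1" using x s d by (intro powr_le1) auto
      then show ?thesis using x by (meson one_le_exp_iff order_trans less_imp_le)
    next
      case False
      then have "?x powr (s*\<delta>) \<le> ?x powr 1" using sd by (intro powr_mono) auto
      then show ?thesis using x exp_ge_add_one_self[of ?x] by (simp only: powr_one)
    qed
    then have "exp (- ?x) * ?x powr (s*\<delta>) \<le> 1" by (simp add: exp_minus field_simps)
    then have "exp (- ?x) * ?x powr (s*\<delta>) * (\<epsilon> * c i 0 powr (1+\<delta>)) \<le> 1 * (\<epsilon> * c i 0 powr (1+\<delta>))"
      using eps by (intro mult_right_mono) auto
    then show "w i * ?G (g i 0) \<le> \<epsilon> * c i 0 powr (1+\<delta>)" using summand[of i 0] i by (simp add: mult_ac)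
  qed
  also have "\<dots> \<le> P" by (rule init)
  finally have "?E t \<le> P + ?D * t" by simp
  moreover have "(\<Sum>i=2..N. w i * ?G (g i t)) \<le> ?E t"
    using \<theta> eps N' by (intro sum_mono2) (auto simp: w_def)
  ultimately show ?thesis using summand t by simp
qed

lemma two_moment_le:
  assumes t: "0 \<le> t" and \<theta>: "0 < \<theta>" and H: "\<And>N. (\<Sum>i=2..N. \<theta>^i * (\<epsilon> powr s * c i t)) \<le> H"
  shows "g 2 t \<le> 2 * H / \<theta>^2"
proof -
  have "\<theta>^2 * (\<epsilon> powr s * c 2 t) \<le> H" using H[of 2] by simp
  then have "\<epsilon> powr s * c 2 t \<le> H / \<theta>^2" using \<theta> by (simp add: field_simps)
  moreover have "(\<epsilon> * 2) powr s \<le> \<epsilon> powr s * 2"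
  proof -
    have "(2::real) powr s \<le> 2 powr 1" using s by (intro powr_mono) auto
    then show ?thesis using eps by (simp add: powr_mult)
  qed
  then have "g 2 t \<le> \<epsilon> powr s * 2 * c 2 t" unfolding g_def using c_nonneg[of 2 t] t by (simp add: mult_right_mono)
  ultimately show ?thesis by simp
qed

lemma boundary_flux_equilibrates:
  assumes ustar: "\<And>r. 0 \<le> r \<Longrightarrow> r \<le> T \<Longrightarrow> ustar \<le> u r" and us: "0 < ustar" and T: "0 \<le> T"
    and \<theta>: "0 < \<theta>" "\<theta> < 1" and q: "bbar / (abar * ustar) < \<theta>"
    and H: "\<And>N r. 0 \<le> r \<Longrightarrow> r \<le> T \<Longrightarrow> (\<Sum>i=2..N. \<theta>^i * (\<epsilon> powr s * c i r)) \<le> H"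
    and u': "\<And>r. 0 \<le> r \<Longrightarrow> r \<le> T \<Longrightarrow> (u has_real_derivative u' r) (at r within {0..})"
      "\<And>r. 0 \<le> r \<Longrightarrow> r \<le> T \<Longrightarrow> \<bar>u' r\<bar> \<le> L"
    and \<psi>: "\<And>r. 0 \<le> r \<Longrightarrow> r \<le> T \<Longrightarrow> (\<psi> has_real_derivative \<psi>' r) (at r within {0..})"
      "\<And>r. 0 \<le> r \<Longrightarrow> r \<le> T \<Longrightarrow> \<bar>\<psi> r\<bar> \<le> C0" "\<And>r. 0 \<le> r \<Longrightarrow> r \<le> T \<Longrightarrow> \<bar>\<psi>' r\<bar> \<le> C1"
  shows "\<bar>integral {0..T} (\<lambda>r. \<psi> r * (J 1 r - v r * g 2 r))\<bar>
    \<le> \<epsilon> powr (1-s) * (2 * C0 * H / \<theta>^2 + T * (C1 * H / \<theta>^2 + C0 * bbar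
         + C0 * (bbar * L / (abar * ustar^2)) * (H / (\<theta>^3 * (1 - bbar / (abar * ustar) / \<theta>)))))"
proof -
  define q0 where "q0 = bbar / (abar * ustar)"
  define qr where "qr r = bbar / (abar * u r)" for r
  define q' where "q' r = - (bbar * u' r / (abar * (u r)^2))" for r
  define \<rho> where "\<rho> = q0 / \<theta>"
  have q0: "0 < q0" "q0 < \<theta>" using q ab us by (auto simp: q0_def)
  have \<rho>: "0 < \<rho>" "\<rho> < 1" using q0 \<theta> by (auto simp: \<rho>_def)
  have C0: "0 \<le> C0" using \<psi>(2)[of 0] T by linarith
  have C1: "0 \<le> C1" using \<psi>(3)[of 0] T by linarith
  have L: "0 \<le> L" using u'(2)[of 0] T by linarith
  have H0: "0 \<le> H" using H[of 0 0] T by simp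
  have up: "0 < u r" if "0 \<le> r" "r \<le> T" for r using ustar[OF that] us by linarith
  have qq: "0 < qr r" "qr r \<le> q0" "abar * u r * qr r = bbar" if r: "0 \<le> r" "r \<le> T" for r
  proof -
    show "0 < qr r" using ab up[OF r] by (simp add: qr_def)
    show "abar * u r * qr r = bbar" using ab up[OF r] by (simp add: qr_def)
    show "qr r \<le> q0" unfolding qr_def q0_def using ab us ustar[OF r] by (intro divide_left_mono mult_left_mono mult_pos_pos up[OF r]) auto
  qed
  have q'b: "\<bar>q' r\<bar> \<le> bbar * L / (abar * ustar^2)" if r: "0 \<le> r" "r \<le> T" for r
  proof -
    have "\<bar>q' r\<bar> = bbar * \<bar>u' r\<bar> / (abar * (u r)^2)" using ab by (simp add: q'_def abs_mult)
    also have "\<dots> \<le> bbar * L / (abar * ustar^2)"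
      using ab us ustar[OF r] u'(2)[OF r] L by (intro frac_le mult_left_mono power_mono mult_nonneg_nonneg) auto
    finally show ?thesis .
  qed
  have qd: "(qr has_real_derivative q' r) (at r within {0..})" if r: "0 \<le> r" "r \<le> T" for r
    unfolding qr_def[abs_def] q'_def using ab up[OF r]
    by (auto intro!: derivative_eq_intros u'(1)[OF r] simp: field_simps power2_eq_square)
  have es: "0 < \<epsilon> powr (1-s)" using eps by simp
  obtain N0 where N0: "2 \<le> N0" "\<And>N t. N0 \<le> N \<Longrightarrow> 0 \<le> t \<Longrightarrow> g N t \<le> \<epsilon> powr (1-s)"
    by (rule g_tail[OF es]) blast
  define N where "N = N0"
  have N: "2 \<le> N" using N0 by (simp add: N_def)
  define Q where "Q r = (\<Sum>i=2..N. qr r ^ (i-2) * (\<epsilon> * c i r))" for r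
  define R where "R r = (\<Sum>i=2..N. (real (i-2) * qr r ^ (i-2-1) * q' r) * (\<epsilon> * c i r))" for r
  define E where "E r = qr r ^ (N-2) * (bbar * g (N+1) r - bbar * g N r)" for r
  have esum: "(\<Sum>i=2..N. \<theta>^i * (\<epsilon> * c i r)) \<le> \<epsilon> powr (1-s) * H" if r: "0 \<le> r" "r \<le> T" for r
  proof -
    have "\<epsilon> = \<epsilon> powr (1-s) * \<epsilon> powr s" using eps by (simp flip: powr_add)
    then have summand: "\<theta>^i * (\<epsilon> * c i r) = \<epsilon> powr (1-s) * (\<theta>^i * (\<epsilon> powr s * c i r))" for i
      by (metis (no_types, opaque_lifting) mult.assoc mult.left_commute)
    have "(\<Sum>i=2..N. \<theta>^i * (\<epsilon> * c i r)) = \<epsilon> powr (1-s) * (\<Sum>i=2..N. \<theta>^i * (\<epsilon> powr s * c i r))"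
      by (simp only: summand sum_distrib_left)
    then show ?thesis using H[OF r, of N] es by simp
  qed
  have Qb: "\<bar>Q r\<bar> \<le> \<epsilon> powr (1-s) * H / \<theta>^2" if r: "0 \<le> r" "r \<le> T" for r
  proof -
    have "qr r ^ (i-2) * (\<epsilon> * c i r) \<le> (\<theta>^i * (\<epsilon> * c i r)) / \<theta>^2" if i: "i \<in> {2..N}" for i
    proof -
      have "qr r ^ (i-2) \<le> \<theta>^(i-2)" using qq[OF r] q0 by (intro power_mono) auto
      also have "\<dots> = \<theta>^i / \<theta>^2" using i \<theta> by (simp add: power_diff)
      finally have "qr r ^ (i-2) * (\<epsilon> * c i r) \<le> \<theta>^i / \<theta>^2 * (\<epsilon> * c i r)"
        using eps c_nonneg[of i r] i r by (intro mult_right_mono) auto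
      then show ?thesis by simp
    qed
    then have "Q r \<le> (\<Sum>i=2..N. (\<theta>^i * (\<epsilon> * c i r)) / \<theta>^2)" unfolding Q_def by (intro sum_mono)
    also have "\<dots> = (\<Sum>i=2..N. \<theta>^i * (\<epsilon> * c i r)) / \<theta>^2" by (simp add: sum_divide_distrib)
    also have "\<dots> \<le> \<epsilon> powr (1-s) * H / \<theta>^2" using esum[OF r] by (simp add: divide_right_mono)
    finally have "Q r \<le> \<epsilon> powr (1-s) * H / \<theta>^2" .
    moreover have "0 \<le> Q r" unfolding Q_def using qq[OF r] eps r
      by (intro sum_nonneg mult_nonneg_nonneg c_nonneg) auto
    ultimately show ?thesis by simp
  qed
  have Rb: "\<bar>R r\<bar> \<le> \<epsilon> powr (1-s) * ((bbar * L / (abar * ustar^2)) * (H / (\<theta>^3 * (1 - \<rho>))))" if r: "0 \<le> r" "r \<le> T" for r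
  proof -
    let ?B = "bbar * L / (abar * ustar^2)"
    have B: "0 \<le> ?B" using ab L by simp
    have "\<bar>(real (i-2) * qr r ^ (i-2-1) * q' r) * (\<epsilon> * c i r)\<bar> \<le> ?B * (1 / (\<theta>^3 * (1 - \<rho>))) * (\<theta>^i * (\<epsilon> * c i r))"
      if i: "i \<in> {2..N}" for i
    proof (cases "i = 2")
      case True
      have "0 \<le> ?B * (1 / (\<theta>^3 * (1 - \<rho>))) * (\<theta>^i * (\<epsilon> * c i r))"
        using B \<theta> \<rho> eps c_nonneg[of i r] r i by (intro mult_nonneg_nonneg) auto
      then show ?thesis using True by simp
    next
      case False
      define n where "n = i - 3"
      have i3: "i = n + 3" using i False by (simp add: n_def)
      have "real (Suc n) * \<rho> ^ n \<le> 1 / (1 - \<rho>)"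
      proof -
        have "real (Suc n) * \<rho> ^ n = (\<Sum>k<Suc n. \<rho> ^ n)" by simp
        also have "\<dots> \<le> (\<Sum>k<Suc n. \<rho> ^ k)" using \<rho> by (intro sum_mono power_decreasing) auto
        also have "\<dots> = (1 - \<rho> ^ Suc n) / (1 - \<rho>)" using \<rho> by (subst sum_gp_strict) auto
        also have "\<dots> \<le> 1 / (1 - \<rho>)" using \<rho> by (intro divide_right_mono) auto
        finally show ?thesis .
      qed
      then have *: "real (Suc n) * \<rho> ^ n * \<theta>^n \<le> 1 / (1 - \<rho>) * \<theta>^n" using \<theta> by (intro mult_right_mono) auto
      have "real (Suc n) * qr r ^ n \<le> real (Suc n) * q0 ^ n" using qq[OF r] by (intro mult_left_mono power_mono) auto
      also have "\<dots> = real (Suc n) * \<rho> ^ n * \<theta>^n" using \<theta> by (simp add: \<rho>_def power_divide)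
      finally have 1: "real (Suc n) * qr r ^ n \<le> 1 / (1 - \<rho>) * \<theta>^n" using * by linarith
      have "\<bar>(real (i-2) * qr r ^ (i-2-1) * q' r) * (\<epsilon> * c i r)\<bar> = (real (Suc n) * qr r ^ n) * \<bar>q' r\<bar> * (\<epsilon> * c i r)"
        using qq[OF r] eps c_nonneg[of i r] i r by (simp add: i3 abs_mult)
      also have "\<dots> \<le> (1 / (1 - \<rho>) * \<theta>^n) * ?B * (\<epsilon> * c i r)"
      proof (rule mult_right_mono)
        show "(real (Suc n) * qr r ^ n) * \<bar>q' r\<bar> \<le> (1 / (1 - \<rho>) * \<theta>^n) * ?B"
          by (rule mult_mono[OF 1 q'b[OF r]]) (use \<rho> \<theta> in auto)
      qed (use eps c_nonneg[of i r] i r in auto)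
      also have "\<theta>^n = \<theta>^i / \<theta>^3" using \<theta> by (simp add: i3 power_add)
      finally show ?thesis by (simp add: mult_ac)
    qed
    then have "\<bar>R r\<bar> \<le> (\<Sum>i=2..N. ?B * (1 / (\<theta>^3 * (1 - \<rho>))) * (\<theta>^i * (\<epsilon> * c i r)))"
      unfolding R_def by (intro order_trans[OF sum_abs] sum_mono)
    also have "\<dots> = ?B * (1 / (\<theta>^3 * (1 - \<rho>))) * (\<Sum>i=2..N. \<theta>^i * (\<epsilon> * c i r))" by (simp add: sum_distrib_left)
    also have "\<dots> \<le> ?B * (1 / (\<theta>^3 * (1 - \<rho>))) * (\<epsilon> powr (1-s) * H)"
      by (intro mult_left_mono esum[OF r] mult_nonneg_nonneg[OF B]) (use \<theta> \<rho> in auto)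
    finally show ?thesis by (simp add: mult_ac)
  qed
  have Eb: "\<bar>E r\<bar> \<le> \<epsilon> powr (1-s) * bbar" if r: "0 \<le> r" "r \<le> T" for r
  proof -
    have "bbar * g (N+1) r \<le> bbar * \<epsilon> powr (1-s)" "bbar * g N r \<le> bbar * \<epsilon> powr (1-s)"
      using N0(2) r ab by (auto simp: N_def)
    moreover have "0 \<le> bbar * g (N+1) r" "0 \<le> bbar * g N r" using ab g_nonneg N r by auto
    ultimately have b: "\<bar>bbar * g (N+1) r - bbar * g N r\<bar> \<le> bbar * \<epsilon> powr (1-s)" by linarith
    have "qr r ^ (N-2) \<le> 1" using qq[OF r] q0 \<theta> by (intro power_le_one) auto
    then have "qr r ^ (N-2) * \<bar>bbar * g (N+1) r - bbar * g N r\<bar> \<le> 1 * (bbar * \<epsilon> powr (1-s))"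
      using b by (intro mult_mono) auto
    then show ?thesis using qq[OF r] by (simp add: E_def abs_mult mult.commute)
  qed
  have flux: "(\<Sum>i=2..N. qr r ^ (i-2) * (J (i-1) r - J i r)) = (J 1 r - v r * g 2 r) + E r" if r: "0 \<le> r" "r \<le> T" for r
  proof -
    have "(\<Sum>i=2..N'. qr r ^ (i-2) * (J (i-1) r - J i r))
        = (J 1 r - v r * g 2 r) + qr r ^ (N'-2) * (bbar * g (N'+1) r - bbar * g N' r)" if "2 \<le> N'" for N'
      using that
    proof (induction N' rule: dec_induct)
      case base
      show ?case using J_ge2[of 2 r] by (simp add: v_def algebra_simps)
    next
      case (step n)
      have "Suc n - 2 = Suc (n - 2)" using step(1) by arith
      then have q1: "qr r ^ (Suc n - 2) = qr r ^ (n-2) * qr r" by (simp only: power_Suc mult.commute)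
      have q2: "qr r ^ (n-2) * qr r * (abar * u r * x) = qr r ^ (n-2) * (bbar * x)" for x
        using qq(3)[OF r] by (metis (no_types, opaque_lifting) mult.assoc mult.commute)
      have Jn: "J n r = abar * u r * g n r - bbar * g (n+1) r" "J (Suc n) r = abar * u r * g (n+1) r - bbar * g (n+2) r"
        using J_ge2[of n r] J_ge2[of "n+1" r] step(1) by auto
      have "(\<Sum>i=2..Suc n. qr r ^ (i-2) * (J (i-1) r - J i r))
          = (\<Sum>i=2..n. qr r ^ (i-2) * (J (i-1) r - J i r)) + qr r ^ (n-2) * qr r * (J n r - J (Suc n) r)"
        using step(1) q1 by simp
      also have "qr r ^ (n-2) * qr r * (J n r - J (Suc n) r)
         = qr r ^ (n-2) * qr r * (abar * u r * g n r) - qr r ^ (n-2) * qr r * (abar * u r * g (n+1) r)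
           + qr r ^ (n-2) * qr r * (bbar * g (n+2) r - bbar * g (n+1) r)"
        unfolding Jn by (simp add: algebra_simps)
      finally show ?case unfolding q2 step(3) q1 by (simp add: algebra_simps)
    qed
    from this[OF N] show ?thesis by (simp add: E_def)
  qed
  have Qd: "(Q has_real_derivative ((J 1 r - v r * g 2 r) + E r) + R r) (at r within {0..})" if r: "0 \<le> r" "r \<le> T" for r
  proof -
    have "(Q has_real_derivative (\<Sum>i=2..N. (real (i-2) * qr r ^ (i-2-1) * q' r) * (\<epsilon> * c i r)
        + (\<epsilon> * ((1/\<epsilon>) * (J (i-1) r - J i r))) * qr r ^ (i-2))) (at r within {0..})"
      unfolding Q_def[abs_def]
    proof (intro DERIV_sum)
      fix i assume "i \<in> {2..N}"
      then have i: "2 \<le> i" by simp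
      have "((\<lambda>r. qr r ^ (i-2)) has_real_derivative real (i-2) * qr r ^ (i-2-1) * q' r) (at r within {0..})"
        using DERIV_power[OF qd[OF r], of "i-2"] by (simp add: mult_ac)
      from DERIV_mult[OF this DERIV_cmult[OF c_deriv[OF i r(1)], of \<epsilon>]]
      show "((\<lambda>r. qr r ^ (i-2) * (\<epsilon> * c i r)) has_real_derivative (real (i-2) * qr r ^ (i-2-1) * q' r) * (\<epsilon> * c i r)
        + (\<epsilon> * ((1/\<epsilon>) * (J (i-1) r - J i r))) * qr r ^ (i-2)) (at r within {0..})" .
    qed
    also have "(\<Sum>i=2..N. (real (i-2) * qr r ^ (i-2-1) * q' r) * (\<epsilon> * c i r)
        + (\<epsilon> * ((1/\<epsilon>) * (J (i-1) r - J i r))) * qr r ^ (i-2)) = R r + (\<Sum>i=2..N. qr r ^ (i-2) * (J (i-1) r - J i r))"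
      using eps by (simp add: sum.distrib R_def mult.commute)
    finally show ?thesis using flux[OF r] by (simp add: add.commute)
  qed
  let ?X = "\<lambda>r. J 1 r - v r * g 2 r"
  let ?K = "\<epsilon> powr (1-s) * (C1 * H / \<theta>^2 + C0 * bbar + C0 * (bbar * L / (abar * ustar^2)) * (H / (\<theta>^3 * (1 - \<rho>))))"
  have fund: "((\<lambda>r. \<psi>' r * Q r + (?X r + E r + R r) * \<psi> r) has_integral \<psi> T * Q T - \<psi> 0 * Q 0) {0..T}"
  proof (rule fundamental_theorem_of_calculus[OF T])
    fix r assume "r \<in> {0..T}"
    then have r: "0 \<le> r" "r \<le> T" by auto
    have "((\<lambda>r. \<psi> r * Q r) has_real_derivative \<psi>' r * Q r + (?X r + E r + R r) * \<psi> r) (at r within {0..T})"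
      using DERIV_subset[OF DERIV_mult[OF \<psi>(1)[OF r] Qd[OF r]], of "{0..T}"] by auto
    then show "((\<lambda>r. \<psi> r * Q r) has_vector_derivative \<psi>' r * Q r + (?X r + E r + R r) * \<psi> r) (at r within {0..T})"
      by (simp add: has_real_derivative_iff_has_vector_derivative)
  qed
  have "continuous_on {0..T} (\<lambda>r. \<psi> r * ?X r)"
  proof -
    have "continuous_on {0..T} \<psi>"
    proof (rule DERIV_continuous_on)
      fix r assume "r \<in> {0..T}"
      then show "(\<psi> has_real_derivative \<psi>' r) (at r within {0..T})" by (intro DERIV_subset[OF \<psi>(1)]) auto
    qed
    moreover have "continuous_on {0..T} ?X" unfolding v_def
      by (intro continuous_intros continuous_on_subset[OF J_cont] continuous_on_subset[OF u_cont] continuous_on_subset[OF g_cont]) auto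
    ultimately show ?thesis by (rule continuous_on_mult)
  qed
  then have X: "((\<lambda>r. \<psi> r * ?X r) has_integral integral {0..T} (\<lambda>r. \<psi> r * ?X r)) {0..T}"
    by (intro integrable_integral integrable_continuous_real)
  have rest: "((\<lambda>r. \<psi>' r * Q r + E r * \<psi> r + R r * \<psi> r) has_integral
      (\<psi> T * Q T - \<psi> 0 * Q 0) - integral {0..T} (\<lambda>r. \<psi> r * ?X r)) {0..T}"
    using has_integral_diff[OF fund X] by (simp add: algebra_simps)
  have "norm ((\<psi> T * Q T - \<psi> 0 * Q 0) - integral {0..T} (\<lambda>r. \<psi> r * ?X r)) \<le> ?K * measure lborel (cbox 0 T)"
  proof (rule has_integral_bound)
    show "((\<lambda>r. \<psi>' r * Q r + E r * \<psi> r + R r * \<psi> r) has_integral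
      (\<psi> T * Q T - \<psi> 0 * Q 0) - integral {0..T} (\<lambda>r. \<psi> r * ?X r)) (cbox 0 T)" using rest by simp
    show "0 \<le> ?K" using C0 C1 H0 L \<theta> \<rho> ab us by (intro mult_nonneg_nonneg add_nonneg_nonneg divide_nonneg_nonneg) auto
    fix r assume "r \<in> cbox 0 T"
    then have r: "0 \<le> r" "r \<le> T" by auto
    have "\<bar>\<psi>' r * Q r\<bar> \<le> C1 * (\<epsilon> powr (1-s) * H / \<theta>^2)" unfolding abs_mult using \<psi>(3)[OF r] Qb[OF r] C1 by (intro mult_mono) auto
    moreover have "\<bar>E r * \<psi> r\<bar> \<le> (\<epsilon> powr (1-s) * bbar) * C0" unfolding abs_mult using \<psi>(2)[OF r] Eb[OF r] ab by (intro mult_mono) auto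
    moreover have "\<bar>R r * \<psi> r\<bar> \<le> (\<epsilon> powr (1-s) * ((bbar * L / (abar * ustar^2)) * (H / (\<theta>^3 * (1 - \<rho>))))) * C0"
      unfolding abs_mult using \<psi>(2)[OF r] Rb[OF r] C0 by (intro mult_mono order_trans[OF abs_ge_zero Rb[OF r]]) auto
    ultimately have "\<bar>\<psi>' r * Q r + E r * \<psi> r + R r * \<psi> r\<bar> \<le> C1 * (\<epsilon> powr (1-s) * H / \<theta>^2) + (\<epsilon> powr (1-s) * bbar) * C0
       + (\<epsilon> powr (1-s) * ((bbar * L / (abar * ustar^2)) * (H / (\<theta>^3 * (1 - \<rho>))))) * C0" by linarith
    also have "\<dots> = ?K" by (simp add: algebra_simps)
    finally show "norm (\<psi>' r * Q r + E r * \<psi> r + R r * \<psi> r) \<le> ?K" by simp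
  qed
  then have b1: "\<bar>(\<psi> T * Q T - \<psi> 0 * Q 0) - integral {0..T} (\<lambda>r. \<psi> r * ?X r)\<bar> \<le> ?K * T" using T by simp
  have "\<bar>\<psi> r * Q r\<bar> \<le> C0 * (\<epsilon> powr (1-s) * H / \<theta>^2)" if r: "0 \<le> r" "r \<le> T" for r
    unfolding abs_mult by (rule mult_mono[OF \<psi>(2)[OF r] Qb[OF r] C0 abs_ge_zero])
  from this[OF T order_refl] this[OF order_refl T]
  have "\<bar>\<psi> T * Q T\<bar> \<le> C0 * (\<epsilon> powr (1-s) * H / \<theta>^2)" "\<bar>\<psi> 0 * Q 0\<bar> \<le> C0 * (\<epsilon> powr (1-s) * H / \<theta>^2)" .
  then have "\<bar>integral {0..T} (\<lambda>r. \<psi> r * ?X r)\<bar> \<le> 2 * (C0 * (\<epsilon> powr (1-s) * H / \<theta>^2)) + ?K * T"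
    using b1 by linarith
  also have "\<dots> = \<epsilon> powr (1-s) * (2 * C0 * H / \<theta>^2 + T * (C1 * H / \<theta>^2 + C0 * bbar
         + C0 * (bbar * L / (abar * ustar^2)) * (H / (\<theta>^3 * (1 - \<rho>)))))" by (simp add: algebra_simps)
  finally show ?thesis unfolding \<rho>_def q0_def .
qed

lemma abs_J1_le:
  assumes t: "0 \<le> t" and G: "g 2 t \<le> G"
  shows "\<bar>J 1 t\<bar> \<le> A * M\<^sup>2 + B * G"
proof -
  have "(u t)\<^sup>2 \<le> M\<^sup>2" using u_le[OF t] u_nonneg[OF t] by (intro power_mono)
  then have "A * (u t)\<^sup>2 \<le> A * M\<^sup>2" using AB by simp
  moreover have "0 \<le> A * (u t)\<^sup>2" using AB by simp
  moreover have "\<kappa> * g 2 t \<le> B * G" using kappa_le kappa_nonneg AB G g_nonneg[of 2 t] t by (intro mult_mono) auto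
  moreover have "0 \<le> \<kappa> * g 2 t" using kappa_nonneg g_nonneg t by simp
  ultimately show ?thesis unfolding J_1 by linarith
qed

lemma flux_against_weights_le:
  assumes t: "0 \<le> t" and Q: "\<And>N. (\<Sum>i=2..N. \<epsilon> * c i t) \<le> Q" and J1: "\<bar>J 1 t\<bar> \<le> j1"
    and w: "\<bar>w 2\<bar> \<le> W" "\<And>i. 2 \<le> i \<Longrightarrow> \<bar>w (i+1) - w i\<bar> \<le> D * \<epsilon>" "w N = 0" and N: "2 \<le> N" and D: "0 \<le> D"
  shows "\<bar>\<Sum>i=2..N. w i * (J (i-1) t - J i t)\<bar> \<le> W * j1 + D * ((abar * M + bbar) * (Q + M))"
proof -
  have "\<bar>\<Sum>i=2..<N. (w (i+1) - w i) * J i t\<bar> \<le> (\<Sum>i=2..<N. \<bar>(w (i+1) - w i) * J i t\<bar>)" by (rule sum_abs)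
  also have "\<dots> \<le> (\<Sum>i=2..<N. D * (\<epsilon> * \<bar>J i t\<bar>))"
  proof (rule sum_mono)
    fix i assume "i \<in> {2..<N}"
    then have "\<bar>w (i+1) - w i\<bar> * \<bar>J i t\<bar> \<le> D * \<epsilon> * \<bar>J i t\<bar>" using w(2)[of i] by (intro mult_right_mono) auto
    then show "\<bar>(w (i+1) - w i) * J i t\<bar> \<le> D * (\<epsilon> * \<bar>J i t\<bar>)" by (simp add: abs_mult mult.assoc)
  qed
  also have "\<dots> \<le> (\<Sum>i=2..N. D * (\<epsilon> * \<bar>J i t\<bar>))" using D eps by (intro sum_mono2) auto
  also have "\<dots> = D * (\<Sum>i=2..N. \<epsilon> * \<bar>J i t\<bar>)" by (simp add: sum_distrib_left)
  also have "\<dots> \<le> D * ((abar * M + bbar) * (Q + M))" by (intro mult_left_mono sum_abs_J_le[OF t Q] D)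
  finally have 1: "\<bar>\<Sum>i=2..<N. (w (i+1) - w i) * J i t\<bar> \<le> D * ((abar * M + bbar) * (Q + M))" .
  have 2: "\<bar>w 2 * J 1 t\<bar> \<le> W * j1" unfolding abs_mult using w(1) J1 by (intro mult_mono order_trans[OF abs_ge_zero w(1)]) auto
  show ?thesis
    using sum_by_parts_flux[OF N, of w "\<lambda>i. J i t"] w(3) order_trans[OF abs_triangle_ineq add_mono[OF 2 1]] by simp
qed

lemma tail_mass_le:
  assumes t: "0 \<le> t" and R: "2 \<le> R"
    and init: "\<And>N. (\<Sum>i=2..N. max (\<epsilon> * real i - R) 0 * (\<epsilon> * c i 0)) \<le> P"
  shows "(\<Sum>i=2..N. max (\<epsilon> * real i - R) 0 * (\<epsilon> * c i t)) \<le> P + abar * M\<^sup>2 * (R/2) powr (s-1) * t"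
proof (rule field_le_epsilon)
  fix e :: real assume e: "0 < e"
  define L where "L = \<epsilon> * real N"
  have L: "0 \<le> L" using eps by (simp add: L_def)
  define w where "w i = min (max (\<epsilon> * real i - R) 0) L" for i
  define d where "d = e / (bbar * (L + 1) * (t + 1))"
  have d: "0 < d" using e ab t L by (simp add: d_def)
  obtain N0 where N0: "2 \<le> N0" "\<And>N t. N0 \<le> N \<Longrightarrow> 0 \<le> t \<Longrightarrow> g N t \<le> d" by (rule g_tail[OF d]) blast
  define N' where "N' = max N N0"
  have N': "2 \<le> N'" "N0 \<le> N'" "N \<le> N'" using N0 by (auto simp: N'_def)
  have w0: "0 \<le> w i" "w i \<le> L" for i using L by (auto simp: w_def)
  let ?C = "abar * M\<^sup>2 * (R/2) powr (s-1)"
  have "(\<Sum>i=2..N. max (\<epsilon> * real i - R) 0 * (\<epsilon> * c i t)) = (\<Sum>i=2..N. w i * (\<epsilon> * c i t))"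
  proof (rule sum.cong[OF refl])
    fix i assume "i \<in> {2..N}"
    then have "\<epsilon> * real i \<le> L" using eps by (simp add: L_def)
    then have "max (\<epsilon> * real i - R) 0 \<le> L" using R L by simp
    then show "max (\<epsilon> * real i - R) 0 * (\<epsilon> * c i t) = w i * (\<epsilon> * c i t)" by (simp add: w_def min_absorb1)
  qed
  also have "\<dots> \<le> (\<Sum>i=2..N'. w i * (\<epsilon> * c i t))"
    using t eps N' w0 by (intro sum_mono2) (auto intro!: mult_nonneg_nonneg c_nonneg)
  also have "\<dots> \<le> (\<Sum>i=2..N'. w i * (\<epsilon> * c i 0)) + (?C + L * (bbar * d)) * t"
  proof (rule derivative_le_imp_growth_le[OF t weighted_deriv])
    fix r assume r: "0 \<le> r" "r \<le> t"
    have w2: "w 2 = 0" using R eps by (simp add: w_def L)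
    have "(\<Sum>i=2..<N'. (w (i+1) - w i) * J i r) \<le> (\<Sum>i=2..<N'. (abar * M * (R/2) powr (s-1)) * (\<epsilon>\<^sup>2 * real i * c i r))"
    proof (rule sum_mono)
      fix i assume i: "i \<in> {2..<N'}"
      have ci: "0 \<le> c i r" "0 \<le> g i r" using c_nonneg[of i r] g_nonneg[of i r] i r by auto
      have ei: "\<epsilon> * real (i+1) = \<epsilon> * real i + \<epsilon>" by (simp add: algebra_simps)
      have inc: "0 \<le> w (i+1) - w i" "w (i+1) - w i \<le> \<epsilon>" using eps unfolding w_def ei by auto
      have Rhs: "0 \<le> (abar * M * (R/2) powr (s-1)) * (\<epsilon>\<^sup>2 * real i * c i r)" using ab M_nonneg ci by auto
      show "(w (i+1) - w i) * J i r \<le> (abar * M * (R/2) powr (s-1)) * (\<epsilon>\<^sup>2 * real i * c i r)"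
      proof (cases "\<epsilon> * real i + \<epsilon> \<le> R")
        case True
        then have "w (i+1) - w i = 0" using eps L unfolding w_def ei by auto
        then show ?thesis using Rhs by simp
      next
        case False
        let ?x = "\<epsilon> * real i"
        have x: "R/2 \<le> ?x" "0 < ?x" using False eps R by auto
        have "J i r \<le> abar * u r * g i r" using J_ge2[of i r] i ab g_nonneg[of "i+1" r] r by simp
        then have "(w (i+1) - w i) * J i r \<le> (w (i+1) - w i) * (abar * u r * g i r)" using inc by (intro mult_left_mono)
        also have "\<dots> \<le> \<epsilon> * (abar * M * g i r)"
          using inc ab u_le[OF r(1)] u_nonneg[OF r(1)] ci eps by (intro mult_mono mult_right_mono mult_left_mono) auto
        also have "g i r = ?x powr (s-1) * (?x * c i r)" using x by (simp add: g_def powr_diff)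
        also have "\<epsilon> * (abar * M * (?x powr (s-1) * (?x * c i r))) \<le> \<epsilon> * (abar * M * ((R/2) powr (s-1) * (?x * c i r)))"
          using eps ab M_nonneg ci x R s by (intro mult_left_mono mult_right_mono powr_mono2') auto
        finally show ?thesis by (simp add: power2_eq_square mult_ac)
      qed
    qed
    also have "\<dots> = (abar * M * (R/2) powr (s-1)) * (\<Sum>i=2..<N'. \<epsilon>\<^sup>2 * real i * c i r)" by (simp add: sum_distrib_left)
    also have "\<dots> \<le> (abar * M * (R/2) powr (s-1)) * M"
    proof (intro mult_left_mono)
      have "(\<Sum>i=2..<N'. \<epsilon>\<^sup>2 * real i * c i r) \<le> (\<Sum>i=2..N'. \<epsilon>\<^sup>2 * real i * c i r)"
        using r by (intro sum_mono2) (auto intro!: mult_nonneg_nonneg c_nonneg)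
      also have "\<dots> \<le> M" by (rule mass_sum_le[OF r(1)])
      finally show "(\<Sum>i=2..<N'. \<epsilon>\<^sup>2 * real i * c i r) \<le> M" .
    qed (use ab M_nonneg in auto)
    finally have 1: "(\<Sum>i=2..<N'. (w (i+1) - w i) * J i r) \<le> ?C" by (simp add: power2_eq_square mult_ac)
    have 2: "- (w N' * J N' r) \<le> L * (bbar * d)"
    proof -
      have "bbar * g (N'+1) r \<le> bbar * d" using N0(2)[of "N'+1" r] N' r ab by simp
      moreover have "0 \<le> abar * u r * g N' r" using ab u_nonneg g_nonneg N' r by simp
      ultimately have "- J N' r \<le> bbar * d" using J_ge2[OF N'(1), of r] by linarith
      then have "w N' * (- J N' r) \<le> w N' * (bbar * d)" using w0 by (intro mult_left_mono)
      also have "\<dots> \<le> L * (bbar * d)" using w0 ab d by (intro mult_right_mono) auto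
      finally show ?thesis by simp
    qed
    show "(\<Sum>i=2..N'. w i * (J (i-1) r - J i r)) \<le> ?C + L * (bbar * d)"
      using sum_by_parts_flux[OF N'(1), of w "\<lambda>i. J i r"] 1 2 w2 by simp
  qed
  also have "(\<Sum>i=2..N'. w i * (\<epsilon> * c i 0)) \<le> (\<Sum>i=2..N'. max (\<epsilon> * real i - R) 0 * (\<epsilon> * c i 0))"
    using eps by (intro sum_mono mult_right_mono) (auto simp: w_def c_nonneg)
  also have "\<dots> \<le> P" by (rule init)
  also have "(?C + L * (bbar * d)) * t \<le> ?C * t + e"
  proof -
    have "L * (bbar * d) * t = e * ((L / (L+1)) * (t / (t+1)))" using ab t L by (simp add: d_def)
    also have "\<dots> \<le> e * (1 * 1)" using t e L by (intro mult_left_mono mult_mono) auto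
    finally show ?thesis by (simp add: distrib_right)
  qed
  finally show "(\<Sum>i=2..N. max (\<epsilon> * real i - R) 0 * (\<epsilon> * c i t)) \<le> P + ?C * t + e" by simp
qed

end

definition size_cell :: "real \<Rightarrow> nat \<Rightarrow> real set" where
  "size_cell \<epsilon> i = {(real i - 1/2) * \<epsilon> ..< (real i + 1/2) * \<epsilon>}"

lemma size_cell_borel [measurable]: "size_cell \<epsilon> i \<in> sets borel"
  unfolding size_cell_def by simp

lemma measure_size_cell:
  assumes "0 < \<epsilon>" shows "measure lborel (size_cell \<epsilon> i) = \<epsilon>" "emeasure lborel (size_cell \<epsilon> i) = ennreal \<epsilon>"
proof -
  have le: "(real i - 1/2) * \<epsilon> \<le> (real i + 1/2) * \<epsilon>" using assms by (intro mult_right_mono) auto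
  have d: "(real i + 1/2) * \<epsilon> - (real i - 1/2) * \<epsilon> = \<epsilon>" by (simp add: algebra_simps)
  show "measure lborel (size_cell \<epsilon> i) = \<epsilon>" unfolding size_cell_def measure_lborel_Ico[OF le] d ..
  show "emeasure lborel (size_cell \<epsilon> i) = ennreal \<epsilon>" unfolding size_cell_def emeasure_lborel_Ico[OF le] d ..
qed

lemma size_cell_iff_floor:
  assumes "0 < \<epsilon>" shows "x \<in> size_cell \<epsilon> i \<longleftrightarrow> int i = \<lfloor>x / \<epsilon> + 1/2\<rfloor>"
proof -
  have "x \<in> size_cell \<epsilon> i \<longleftrightarrow> real i - 1/2 \<le> x / \<epsilon> \<and> x / \<epsilon> < real i + 1/2"
    using assms by (simp add: size_cell_def pos_le_divide_eq pos_divide_less_eq)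
  also have "\<dots> \<longleftrightarrow> int i = \<lfloor>x / \<epsilon> + 1/2\<rfloor>" by linarith
  finally show ?thesis .
qed

lemma size_cell_unique: "0 < \<epsilon> \<Longrightarrow> x \<in> size_cell \<epsilon> i \<Longrightarrow> x \<in> size_cell \<epsilon> j \<Longrightarrow> i = j"
  using size_cell_iff_floor[of \<epsilon> x i] size_cell_iff_floor[of \<epsilon> x j] by simp

lemma step_fun_eq:
  assumes "0 < \<epsilon>"
  shows "step_fun \<epsilon> k w x = (if int k \<le> \<lfloor>x / \<epsilon> + 1/2\<rfloor> then w (nat \<lfloor>x / \<epsilon> + 1/2\<rfloor>) else 0)"
proof -
  define j where "j = \<lfloor>x / \<epsilon> + 1/2\<rfloor>"
  have ind: "indicator {(real i - 1/2) * \<epsilon> ..< (real i + 1/2) * \<epsilon>} x = (if int i = j then 1 else 0 :: real)" for i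
    using size_cell_iff_floor[OF assms, of x i] by (simp add: size_cell_def indicator_def j_def)
  have "step_fun \<epsilon> k w x = (\<Sum>\<^sub>\<infinity>i\<in>{k..}. w i * (if int i = j then 1 else 0))"
    unfolding step_fun_def ind ..
  also have "\<dots> = (\<Sum>\<^sub>\<infinity>i\<in>{k..} \<inter> {nat j}. w i * (if int i = j then 1 else 0))"
    by (rule infsum_cong_neutral) auto
  also have "\<dots> = (if nat j \<in> {k..} then w (nat j) * (if int (nat j) = j then 1 else 0) else 0)"
    by (cases "nat j \<in> {k..}") auto
  also have "\<dots> = (if int k \<le> j then w (nat j) else 0)" by auto
  finally show ?thesis by (simp only: j_def)
qed

lemma step_fun_cell:
  assumes "0 < \<epsilon>" "x \<in> size_cell \<epsilon> i" "k \<le> i" shows "step_fun \<epsilon> k w x = w i"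
proof -
  have "\<lfloor>x / \<epsilon> + 1/2\<rfloor> = int i" using size_cell_iff_floor[OF assms(1), of x i] assms(2) by simp
  then show ?thesis unfolding step_fun_eq[OF assms(1)] using assms(3) by (simp only:) simp
qed

lemma step_fun_no_cell:
  assumes "0 < \<epsilon>" "\<And>i. k \<le> i \<Longrightarrow> x \<notin> size_cell \<epsilon> i" shows "step_fun \<epsilon> k w x = 0"
proof -
  define j where "j = \<lfloor>x / \<epsilon> + 1/2\<rfloor>"
  have "\<not> int k \<le> j"
  proof
    assume j: "int k \<le> j"
    then have "int (nat j) = j" by simp
    then have "int (nat j) = \<lfloor>x / \<epsilon> + 1/2\<rfloor>" by (simp only: j_def)
    then have "x \<in> size_cell \<epsilon> (nat j)" using size_cell_iff_floor[OF assms(1)] by blast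
    moreover have "k \<le> nat j" using j by simp
    ultimately show False using assms(2) by blast
  qed
  then show ?thesis unfolding step_fun_eq[OF assms(1)] j_def by simp
qed

lemma step_fun_measurable [measurable]:
  assumes "0 < \<epsilon>" shows "step_fun \<epsilon> k w \<in> borel_measurable borel"
proof -
  have f: "(\<lambda>x. \<lfloor>x / \<epsilon> + 1/2\<rfloor>) \<in> measurable borel (count_space (UNIV::int set))" by measurable
  have "(\<lambda>j::int. if int k \<le> j then w (nat j) else 0) \<in> measurable (count_space UNIV) borel" by simp
  from measurable_compose[OF f this] show ?thesis
    by (simp add: step_fun_eq[OF assms, abs_def])
qed

lemma size_cell_bounds:
  assumes "0 < \<epsilon>" "2 \<le> i" "x \<in> size_cell \<epsilon> i"
  shows "0 < x" "\<bar>x - \<epsilon> * real i\<bar> \<le> \<epsilon>" "\<epsilon> * real i / 2 \<le> x" "x \<le> 2 * (\<epsilon> * real i)" "\<epsilon> \<le> x"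
proof -
  have x: "\<epsilon> * real i - \<epsilon>/2 \<le> x" "x < \<epsilon> * real i + \<epsilon>/2" using assms(3) by (auto simp: size_cell_def algebra_simps)
  have i: "\<epsilon> * 2 \<le> \<epsilon> * real i" using assms by (intro mult_left_mono) auto
  show "0 < x" "\<bar>x - \<epsilon> * real i\<bar> \<le> \<epsilon>" "\<epsilon> * real i / 2 \<le> x" "x \<le> 2 * (\<epsilon> * real i)" "\<epsilon> \<le> x"
    using x i assms(1) by linarith+
qed

lemma step_fun_neg:
  assumes "0 < \<epsilon>" "x \<le> 0" shows "step_fun \<epsilon> 2 w x = 0"
proof (rule step_fun_no_cell[OF assms(1)])
  fix i :: nat assume "2 \<le> i"
  then show "x \<notin> size_cell \<epsilon> i" using size_cell_bounds(1)[OF assms(1), of i x] assms(2) by linarith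
qed

lemma step_fun_nonneg: "0 < \<epsilon> \<Longrightarrow> (\<And>i. 2 \<le> i \<Longrightarrow> 0 \<le> w i) \<Longrightarrow> 0 \<le> step_fun \<epsilon> 2 w x"
  by (auto simp: step_fun_eq le_nat_iff)

lemma step_fun_comp: "0 < \<epsilon> \<Longrightarrow> F 0 = 0 \<Longrightarrow> F (step_fun \<epsilon> k w x) = step_fun \<epsilon> k (\<lambda>i. F (w i)) x"
  by (simp add: step_fun_eq)

lemma step_fun_truncated:
  assumes e: "0 < \<epsilon>" and z: "(real N + 1/2) * \<epsilon> \<le> x \<Longrightarrow> h x = 0"
  shows "step_fun \<epsilon> 2 w x * h x = (\<Sum>i=2..N. w i * (indicator (size_cell \<epsilon> i) x * h x))"
proof (cases "\<exists>i\<in>{2..N}. x \<in> size_cell \<epsilon> i")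
  case True
  then obtain i where i: "i \<in> {2..N}" "x \<in> size_cell \<epsilon> i" by blast
  have "indicator (size_cell \<epsilon> j) x = (if j = i then 1 else (0::real))" for j
    using size_cell_unique[OF e _ i(2), of j] i(2) by (cases "x \<in> size_cell \<epsilon> j") auto
  then have "(\<Sum>j=2..N. w j * (indicator (size_cell \<epsilon> j) x * h x)) = (\<Sum>j=2..N. if j = i then w i * h x else 0)"
    by (intro sum.cong) auto
  then show ?thesis using step_fun_cell[OF e i(2), of 2 w] i(1) by simp
next
  case False
  then have "(\<Sum>i=2..N. w i * (indicator (size_cell \<epsilon> i) x * h x)) = 0" by (intro sum.neutral) auto
  moreover have "step_fun \<epsilon> 2 w x * h x = 0"
  proof (cases "(real N + 1/2) * \<epsilon> \<le> x")
    case False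
    have "x \<notin> size_cell \<epsilon> i" if "2 \<le> i" for i
    proof (cases "i \<le> N")
      case i: False
      then have "(real N + 1/2) * \<epsilon> \<le> (real i - 1/2) * \<epsilon>" using e by (intro mult_right_mono) auto
      then show ?thesis using \<open>\<not> (real N + 1/2) * \<epsilon> \<le> x\<close> by (auto simp: size_cell_def)
    qed (use \<open>\<not> (\<exists>i\<in>{2..N}. x \<in> size_cell \<epsilon> i)\<close> that in auto)
    then show ?thesis using step_fun_no_cell[OF e] by simp
  qed (use z in auto)
  ultimately show ?thesis by simp
qed

lemma step_integral_truncated:
  assumes e: "0 < \<epsilon>" and z: "\<And>x. (real N + 1/2) * \<epsilon> \<le> x \<Longrightarrow> h x = 0"
    and h: "\<And>i. i \<in> {2..N} \<Longrightarrow> set_integrable lborel (size_cell \<epsilon> i) h"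
  shows "(\<integral>x. step_fun \<epsilon> 2 w x * h x \<partial>lborel) = (\<Sum>i=2..N. w i * (LINT x:size_cell \<epsilon> i|lborel. h x))"
    "integrable lborel (\<lambda>x. step_fun \<epsilon> 2 w x * h x)"
proof -
  have i: "integrable lborel (\<lambda>x. w i * (indicator (size_cell \<epsilon> i) x * h x))" if "i \<in> {2..N}" for i
    using h[OF that] by (simp add: set_integrable_def)
  have eq: "(\<lambda>x. step_fun \<epsilon> 2 w x * h x) = (\<lambda>x. \<Sum>i=2..N. w i * (indicator (size_cell \<epsilon> i) x * h x))"
  proof
    fix x show "step_fun \<epsilon> 2 w x * h x = (\<Sum>i=2..N. w i * (indicator (size_cell \<epsilon> i) x * h x))"
      by (rule step_fun_truncated[OF e]) (rule z)
  qed
  show "(\<integral>x. step_fun \<epsilon> 2 w x * h x \<partial>lborel) = (\<Sum>i=2..N. w i * (LINT x:size_cell \<epsilon> i|lborel. h x))"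
    unfolding eq by (subst Bochner_Integration.integral_sum[OF i]) (auto simp: set_lebesgue_integral_def)
  show "integrable lborel (\<lambda>x. step_fun \<epsilon> 2 w x * h x)"
    unfolding eq by (rule Bochner_Integration.integrable_sum[OF i])
qed

lemma nn_integral_step:
  assumes e: "0 < \<epsilon>" and w: "\<And>i. 2 \<le> i \<Longrightarrow> 0 \<le> w i" and h: "h \<in> borel_measurable borel" "\<And>x. 0 < x \<Longrightarrow> 0 \<le> h x"
  shows "(\<integral>\<^sup>+x. ennreal (step_fun \<epsilon> 2 w x * h x) \<partial>lborel)
    = (\<Sum>i. \<integral>\<^sup>+x. ennreal (w (i+2) * h x) * indicator (size_cell \<epsilon> (i+2)) x \<partial>lborel)"
proof -
  note [measurable] = h(1)
  have "ennreal (step_fun \<epsilon> 2 w x * h x) = (\<Sum>i. ennreal (w (i+2) * h x) * indicator (size_cell \<epsilon> (i+2)) x)" for x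
  proof (cases "\<exists>i\<ge>2. x \<in> size_cell \<epsilon> i")
    case True
    then obtain i where i: "2 \<le> i" "x \<in> size_cell \<epsilon> i" by blast
    define trm where "trm j = ennreal (w (j+2) * h x) * indicator (size_cell \<epsilon> (j+2)) x" for j
    have "(\<Sum>j. trm j) = (\<Sum>j\<in>{i-2}. trm j)"
    proof (rule suminf_finite)
      fix j assume "j \<notin> {i-2}"
      then have "x \<notin> size_cell \<epsilon> (j+2)" using size_cell_unique[OF e i(2), of "j+2"] i(1) by fastforce
      then show "trm j = 0" by (simp add: trm_def)
    qed simp
    also have "\<dots> = trm (i-2)" by simp
    also have "\<dots> = ennreal (w i * h x)"
    proof -
      have e2: "i - 2 + 2 = i" using i by simp
      show ?thesis unfolding trm_def e2 using i by simp
    qed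
    finally show ?thesis using step_fun_cell[OF e i(2,1), of w] by (simp add: trm_def)
  next
    case False
    then have "x \<notin> size_cell \<epsilon> (j+2)" for j by simp
    then show ?thesis using step_fun_no_cell[OF e, of 2 x w] False by simp
  qed
  then show ?thesis by (simp add: nn_integral_suminf)
qed

lemma ennreal_suminf_le_iff: "(\<Sum>i. f i :: ennreal) \<le> C \<longleftrightarrow> (\<forall>n. (\<Sum>i<n. f i) \<le> C)"
  by (auto simp: suminf_eq_SUP SUP_le_iff)

lemma sum_shift_two: "(\<Sum>i<n. f (i+2)) = (\<Sum>i=2..n+1. f i)" for f :: "nat \<Rightarrow> 'a::comm_monoid_add"
  by (induction n) (auto simp: eval_nat_numeral)

lemma step_integral_le:
  assumes e: "0 < \<epsilon>" and w: "\<And>i. 2 \<le> i \<Longrightarrow> 0 \<le> w i" and h: "h \<in> borel_measurable borel" "\<And>x. 0 < x \<Longrightarrow> 0 \<le> h x"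
    and b: "\<And>i x. 2 \<le> i \<Longrightarrow> x \<in> size_cell \<epsilon> i \<Longrightarrow> h x \<le> b i"
    and C: "\<And>N. (\<Sum>i=2..N. w i * (\<epsilon> * b i)) \<le> C"
  shows "integrable lborel (\<lambda>x. step_fun \<epsilon> 2 w x * h x)" "(\<integral>x. step_fun \<epsilon> 2 w x * h x \<partial>lborel) \<le> C"
    "0 \<le> step_fun \<epsilon> 2 w x * h x"
proof -
  note [measurable] = h(1) step_fun_measurable[OF e]
  have nn: "0 \<le> step_fun \<epsilon> 2 w x * h x" for x
    using step_fun_neg[OF e, of x w] step_fun_nonneg[OF e, of w x] w h(2)[of x] by (cases "x \<le> 0") auto
  then show "0 \<le> step_fun \<epsilon> 2 w x * h x" .
  have C0: "0 \<le> C" using C[of 0] by simp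
  have b0: "0 \<le> b i" if "2 \<le> i" for i
  proof -
    have x: "\<epsilon> * real i \<in> size_cell \<epsilon> i" using e by (simp add: size_cell_def algebra_simps)
    have "0 < \<epsilon> * real i" using e that by simp
    then show ?thesis using b[OF that x] h(2) by (meson order_trans)
  qed
  have eq: "(\<integral>\<^sup>+x. ennreal (step_fun \<epsilon> 2 w x * h x) \<partial>lborel)
    = (\<Sum>i. \<integral>\<^sup>+x. ennreal (w (i+2) * h x) * indicator (size_cell \<epsilon> (i+2)) x \<partial>lborel)"
    by (rule nn_integral_step[OF e w h])
  have "(\<integral>\<^sup>+x. ennreal (step_fun \<epsilon> 2 w x * h x) \<partial>lborel) \<le> ennreal C"
    unfolding eq ennreal_suminf_le_iff
  proof
    fix n
    have "(\<Sum>i<n. \<integral>\<^sup>+x. ennreal (w (i+2) * h x) * indicator (size_cell \<epsilon> (i+2)) x \<partial>lborel)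
       \<le> (\<Sum>i<n. ennreal (w (i+2) * (\<epsilon> * b (i+2))))"
    proof (rule sum_mono)
      fix i
      have "(\<integral>\<^sup>+x. ennreal (w (i+2) * h x) * indicator (size_cell \<epsilon> (i+2)) x \<partial>lborel)
         \<le> (\<integral>\<^sup>+x. ennreal (w (i+2) * b (i+2)) * indicator (size_cell \<epsilon> (i+2)) x \<partial>lborel)"
      proof (rule nn_integral_mono)
        fix x show "ennreal (w (i+2) * h x) * indicator (size_cell \<epsilon> (i+2)) x \<le> ennreal (w (i+2) * b (i+2)) * indicator (size_cell \<epsilon> (i+2)) x"
          using b[of "i+2" x] w[of "i+2"] by (auto simp: indicator_def intro!: ennreal_leI mult_left_mono)
      qed
      also have "\<dots> = ennreal (w (i+2) * b (i+2)) * ennreal \<epsilon>"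
        by (simp add: nn_integral_cmult_indicator measure_size_cell[OF e])
      also have "\<dots> = ennreal (w (i+2) * (\<epsilon> * b (i+2)))"
        using w[of "i+2"] b0[of "i+2"] e by (simp add: ennreal_mult[symmetric] mult_ac)
      finally show "(\<integral>\<^sup>+x. ennreal (w (i+2) * h x) * indicator (size_cell \<epsilon> (i+2)) x \<partial>lborel) \<le> ennreal (w (i+2) * (\<epsilon> * b (i+2)))" .
    qed
    also have "\<dots> = ennreal (\<Sum>i<n. w (i+2) * (\<epsilon> * b (i+2)))"
      using w b0 e by (intro sum_ennreal) auto
    also have "\<dots> \<le> ennreal C" using C[of "n+1"] by (intro ennreal_leI) (simp only: sum_shift_two[of "\<lambda>i. w i * (\<epsilon> * b i)"])
    finally show "(\<Sum>i<n. \<integral>\<^sup>+x. ennreal (w (i+2) * h x) * indicator (size_cell \<epsilon> (i+2)) x \<partial>lborel) \<le> ennreal C" .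
  qed
  then have fin: "(\<integral>\<^sup>+x. ennreal (step_fun \<epsilon> 2 w x * h x) \<partial>lborel) \<le> ennreal C" .
  show i: "integrable lborel (\<lambda>x. step_fun \<epsilon> 2 w x * h x)"
    using fin nn by (intro integrableI_nonneg) (auto intro: le_less_trans simp: ennreal_less_top)
  show "(\<integral>x. step_fun \<epsilon> 2 w x * h x \<partial>lborel) \<le> C"
    using fin nn_integral_eq_integral[OF i] nn C0 by (simp add: ennreal_le_iff)
qed

lemma step_sum_le:
  assumes e: "0 < \<epsilon>" and w: "\<And>i. 2 \<le> i \<Longrightarrow> 0 \<le> w i" and h: "h \<in> borel_measurable borel" "\<And>x. 0 < x \<Longrightarrow> 0 \<le> h x"
    and b: "\<And>i x. 2 \<le> i \<Longrightarrow> x \<in> size_cell \<epsilon> i \<Longrightarrow> b i \<le> h x" "\<And>i. 2 \<le> i \<Longrightarrow> 0 \<le> b i"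
    and C: "(\<integral>\<^sup>+x. ennreal (step_fun \<epsilon> 2 w x * h x) \<partial>lborel) \<le> ennreal C" "0 \<le> C"
  shows "(\<Sum>i=2..N. w i * (\<epsilon> * b i)) \<le> C"
proof -
  have "ennreal (\<Sum>i<N. w (i+2) * (\<epsilon> * b (i+2))) = (\<Sum>i<N. ennreal (w (i+2) * (\<epsilon> * b (i+2))))"
    using w b e by (intro sum_ennreal[symmetric]) auto
  also have "\<dots> \<le> (\<Sum>i<N. \<integral>\<^sup>+x. ennreal (w (i+2) * h x) * indicator (size_cell \<epsilon> (i+2)) x \<partial>lborel)"
  proof (rule sum_mono)
    fix i
    have "ennreal (w (i+2) * (\<epsilon> * b (i+2))) = ennreal (w (i+2) * b (i+2)) * ennreal \<epsilon>"
      using w[of "i+2"] b(2)[of "i+2"] e by (simp add: ennreal_mult[symmetric] mult_ac)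
    also have "\<dots> = (\<integral>\<^sup>+x. ennreal (w (i+2) * b (i+2)) * indicator (size_cell \<epsilon> (i+2)) x \<partial>lborel)"
      by (simp add: nn_integral_cmult_indicator measure_size_cell[OF e])
    also have "\<dots> \<le> (\<integral>\<^sup>+x. ennreal (w (i+2) * h x) * indicator (size_cell \<epsilon> (i+2)) x \<partial>lborel)"
    proof (rule nn_integral_mono)
      fix x show "ennreal (w (i+2) * b (i+2)) * indicator (size_cell \<epsilon> (i+2)) x \<le> ennreal (w (i+2) * h x) * indicator (size_cell \<epsilon> (i+2)) x"
        using b(1)[of "i+2" x] w[of "i+2"] by (auto simp: indicator_def intro!: ennreal_leI mult_left_mono)
    qed
    finally show "ennreal (w (i+2) * (\<epsilon> * b (i+2))) \<le> (\<integral>\<^sup>+x. ennreal (w (i+2) * h x) * indicator (size_cell \<epsilon> (i+2)) x \<partial>lborel)" .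
  qed
  also have "\<dots> \<le> ennreal C"
  proof -
    have eq: "(\<integral>\<^sup>+x. ennreal (step_fun \<epsilon> 2 w x * h x) \<partial>lborel)
      = (\<Sum>i. \<integral>\<^sup>+x. ennreal (w (i+2) * h x) * indicator (size_cell \<epsilon> (i+2)) x \<partial>lborel)"
      by (rule nn_integral_step[OF e w h])
    show ?thesis using C(1) unfolding eq ennreal_suminf_le_iff by blast
  qed
  finally have "(\<Sum>i<N. w (i+2) * (\<epsilon> * b (i+2))) \<le> C" using C(2) by (simp add: ennreal_le_iff)
  then have "(\<Sum>i=2..N+1. w i * (\<epsilon> * b i)) \<le> C" by (simp only: sum_shift_two[of "\<lambda>i. w i * (\<epsilon> * b i)"])
  moreover have "(\<Sum>i=2..N. w i * (\<epsilon> * b i)) \<le> (\<Sum>i=2..N+1. w i * (\<epsilon> * b i))"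
    using w b e by (intro sum_mono2) auto
  ultimately show ?thesis by linarith
qed

lemma step_first_moment:
  assumes e: "0 < \<epsilon>" and w: "\<And>i. 2 \<le> i \<Longrightarrow> 0 \<le> w i"
    and S: "((\<lambda>i. \<epsilon>\<^sup>2 * real i * w i) has_sum S) {2..}"
  shows "integrable lborel (\<lambda>x. step_fun \<epsilon> 2 w x * x)" "(\<integral>x. step_fun \<epsilon> 2 w x * x \<partial>lborel) = S"
proof -
  note [measurable] = step_fun_measurable[OF e]
  have cell: "(\<integral>\<^sup>+x. ennreal (w (i+2) * x) * indicator (size_cell \<epsilon> (i+2)) x \<partial>lborel) = ennreal (\<epsilon>\<^sup>2 * real (i+2) * w (i+2))" for i
  proof -
    let ?a = "(real (i+2) - 1/2) * \<epsilon>" and ?b = "(real (i+2) + 1/2) * \<epsilon>"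
    have ab: "?a \<le> ?b" using e by (intro mult_right_mono) auto
    have a0: "0 \<le> ?a" using e by simp
    have "(\<integral>\<^sup>+x. ennreal (w (i+2) * x) * indicator (size_cell \<epsilon> (i+2)) x \<partial>lborel)
       = (\<integral>\<^sup>+x. ennreal (w (i+2) * x) * indicator {?a..?b} x \<partial>lborel)"
    proof (rule nn_integral_cong_AE)
      have "AE x in lborel. x \<noteq> ?b" by (rule AE_lborel_singleton)
      then show "AE x in lborel. ennreal (w (i+2) * x) * indicator (size_cell \<epsilon> (i+2)) x = ennreal (w (i+2) * x) * indicator {?a..?b} x"
        by eventually_elim (auto simp: size_cell_def indicator_def)
    qed
    also have "\<dots> = ennreal (w (i+2) * ?b^2/2 - w (i+2) * ?a^2/2)"
    proof (rule nn_integral_FTC_Icc)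
      fix x assume x: "x \<in> {?a..?b}"
      show "((\<lambda>x. w (i+2) * x^2/2) has_real_derivative w (i+2) * x) (at x)"
        by (auto intro!: derivative_eq_intros)
      have "0 \<le> x" using x a0 by (simp only: atLeastAtMost_iff) linarith
      then show "0 \<le> w (i+2) * x" using w[of "i+2"] by simp
    qed (use ab in auto)
    also have "w (i+2) * ?b^2/2 - w (i+2) * ?a^2/2 = \<epsilon>\<^sup>2 * real (i+2) * w (i+2)" by (simp add: field_simps power2_eq_square)
    finally show ?thesis .
  qed
  have "((\<lambda>i. \<epsilon>\<^sup>2 * real (i+2) * w (i+2)) has_sum S) UNIV"
  proof -
    have "bij_betw (\<lambda>i. i + 2) UNIV {2::nat..}"
      by (rule bij_betwI[where g="\<lambda>i. i - 2"]) auto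
    from has_sum_reindex_bij_betw[OF this, of "\<lambda>i. \<epsilon>\<^sup>2 * real i * w i" S] S show ?thesis by simp
  qed
  then have "(\<lambda>i. \<epsilon>\<^sup>2 * real (i+2) * w (i+2)) sums S" by (rule has_sum_imp_sums)
  then have "(\<Sum>i. ennreal (\<epsilon>\<^sup>2 * real (i+2) * w (i+2))) = ennreal S"
    using w by (intro suminf_ennreal_eq) auto
  then have nn: "(\<integral>\<^sup>+x. ennreal (step_fun \<epsilon> 2 w x * x) \<partial>lborel) = ennreal S"
  proof -
    have eq: "(\<integral>\<^sup>+x. ennreal (step_fun \<epsilon> 2 w x * x) \<partial>lborel)
      = (\<Sum>i. \<integral>\<^sup>+x. ennreal (w (i+2) * x) * indicator (size_cell \<epsilon> (i+2)) x \<partial>lborel)"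
      by (rule nn_integral_step[OF e w]) auto
    assume *: "(\<Sum>i. ennreal (\<epsilon>\<^sup>2 * real (i+2) * w (i+2))) = ennreal S"
    show ?thesis unfolding eq cell by (rule *)
  qed
  have S0: "0 \<le> S" using has_sum_nonneg[OF S] w by auto
  have pos: "0 \<le> step_fun \<epsilon> 2 w x * x" for x
    using step_fun_neg[OF e, of x w] step_fun_nonneg[OF e, of w x] w by (cases "x \<le> 0") auto
  have "(\<integral>\<^sup>+x. ennreal (step_fun \<epsilon> 2 w x * x) \<partial>lborel) = ennreal S \<longleftrightarrow>
    integrable lborel (\<lambda>x. step_fun \<epsilon> 2 w x * x) \<and> (\<integral>x. step_fun \<epsilon> 2 w x * x \<partial>lborel) = S"
    using pos S0 by (intro nn_integral_eq_integrable) auto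
  with nn show "integrable lborel (\<lambda>x. step_fun \<epsilon> 2 w x * x)" "(\<integral>x. step_fun \<epsilon> 2 w x * x \<partial>lborel) = S" by auto
qed

text \<open>half line\<close>

lemma half_line_measurable_iff:
  "h \<in> borel_measurable half_line \<longleftrightarrow> (\<lambda>x. indicator {0..} x * h x :: real) \<in> borel_measurable borel"
  by (subst borel_measurable_restrict_space_iff) auto

lemma integral_half_line: "(\<integral>x. h x \<partial>half_line) = (\<integral>x. indicator {0..} x * h x \<partial>lborel)" for h :: "real \<Rightarrow> real"
  by (subst integral_restrict_space) auto

lemma integrable_half_line: "integrable half_line h \<longleftrightarrow> integrable lborel (\<lambda>x. indicator {0..} x * h x)" for h :: "real \<Rightarrow> real"
  by (subst integrable_restrict_space) auto

lemma integral_density_half_line: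
  fixes f h :: "real \<Rightarrow> real"
  assumes f: "f \<in> borel_measurable borel" "\<And>x. 0 \<le> x \<Longrightarrow> 0 \<le> f x"
    and h: "(\<lambda>x. indicator {0..} x * h x) \<in> borel_measurable borel"
  shows "(\<integral>x. h x \<partial>density half_line (\<lambda>x. ennreal (f x))) = (\<integral>x. f x * (indicator {0..} x * h x) \<partial>lborel)"
    "integrable (density half_line (\<lambda>x. ennreal (f x))) h \<longleftrightarrow> integrable lborel (\<lambda>x. f x * (indicator {0..} x * h x))"
proof -
  have fm: "f \<in> borel_measurable half_line" using f(1) by (simp add: half_line_measurable_iff)
  have hm: "h \<in> borel_measurable half_line" using h by (simp add: half_line_measurable_iff)
  have nn: "AE x in half_line. 0 \<le> f x" using f(2) by (intro AE_I2) (auto simp: space_restrict_space)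
  show "(\<integral>x. h x \<partial>density half_line (\<lambda>x. ennreal (f x))) = (\<integral>x. f x * (indicator {0..} x * h x) \<partial>lborel)"
    unfolding integral_density[OF hm fm nn] integral_half_line by (simp add: mult_ac)
  show "integrable (density half_line (\<lambda>x. ennreal (f x))) h \<longleftrightarrow> integrable lborel (\<lambda>x. f x * (indicator {0..} x * h x))"
    unfolding integrable_density[OF hm fm nn] by (simp add: integrable_half_line mult_ac)
qed

lemma integrable_from_truncations:
  fixes h :: "real \<Rightarrow> real"
  assumes h: "h \<in> borel_measurable borel" "\<And>x. 0 \<le> h x"
    and i: "\<And>k::nat. integrable lborel (\<lambda>x. h x * indicator {..<real k} x)"
    and C: "\<And>k::nat. (\<integral>x. h x * indicator {..<real k} x \<partial>lborel) \<le> C"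
  shows "integrable lborel h" "(\<integral>x. h x \<partial>lborel) \<le> C"
proof -
  note [measurable] = h(1)
  have C0: "0 \<le> C"
  proof -
    have "0 \<le> (\<integral>x. h x * indicator {..<real 0} x \<partial>lborel)" using h by (intro integral_nonneg_AE) auto
    then show ?thesis using C[of 0] by linarith
  qed
  have "(\<integral>\<^sup>+x. ennreal (h x) \<partial>lborel) = (\<integral>\<^sup>+x. liminf (\<lambda>k. ennreal (h x * indicator {..<real k} x)) \<partial>lborel)"
  proof (rule nn_integral_cong)
    fix x
    have "(\<lambda>k. ennreal (h x * indicator {..<real k} x)) \<longlonglongrightarrow> ennreal (h x)"
    proof (rule tendsto_eventually)
      obtain k0 :: nat where "x < real k0" using reals_Archimedean2 by blast
      then have "h x * indicator {..<real k} x = h x" if "k \<ge> k0" for k using that by (simp add: indicator_def)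
      then show "\<forall>\<^sub>F k in sequentially. ennreal (h x * indicator {..<real k} x) = ennreal (h x)"
        unfolding eventually_sequentially by (intro exI[of _ k0] allI impI) (simp only:)
    qed
    then show "ennreal (h x) = liminf (\<lambda>k. ennreal (h x * indicator {..<real k} x))"
      by (simp add: lim_imp_Liminf)
  qed
  also have "\<dots> \<le> liminf (\<lambda>k. \<integral>\<^sup>+x. ennreal (h x * indicator {..<real k} x) \<partial>lborel)"
    by (rule nn_integral_liminf) measurable
  also have "\<dots> \<le> ennreal C"
  proof (rule Liminf_le)
    have "(\<integral>\<^sup>+x. ennreal (h x * indicator {..<real k} x) \<partial>lborel) \<le> ennreal C" for k
      using nn_integral_eq_integral[OF i[of k]] h(2) C[of k] by (simp add: ennreal_leI)
    then show "\<forall>\<^sub>F k in sequentially. (\<integral>\<^sup>+x. ennreal (h x * indicator {..<real k} x) \<partial>lborel) \<le> ennreal C" by simp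
  qed simp
  finally have fin: "(\<integral>\<^sup>+x. ennreal (h x) \<partial>lborel) \<le> ennreal C" .
  show hi: "integrable lborel h"
    using fin h by (intro integrableI_nonneg) (auto intro: le_less_trans simp: ennreal_less_top)
  show "(\<integral>x. h x \<partial>lborel) \<le> C"
    using fin nn_integral_eq_integral[OF hi] h(2) C0 by (simp add: ennreal_le_iff)
qed

lemma integrable_mult_bounded:
  fixes p q :: "real \<Rightarrow> real"
  assumes "integrable lborel p" "q \<in> borel_measurable borel" "\<And>x. \<bar>q x\<bar> \<le> C"
  shows "integrable lborel (\<lambda>x. p x * q x)"
proof (rule Bochner_Integration.integrable_bound[where f="\<lambda>x. C * p x"])
  show "AE x in lborel. norm (p x * q x) \<le> norm (C * p x)"
  proof (intro AE_I2)
    fix x have "0 \<le> C" using assms(3)[of x] by linarith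
    then show "norm (p x * q x) \<le> norm (C * p x)"
      using mult_right_mono[OF assms(3)[of x], of "\<bar>p x\<bar>"] by (simp add: abs_mult mult.commute)
  qed
qed (use assms in auto)

lemma abs_integral_mult_le:
  fixes p q r :: "real \<Rightarrow> real"
  assumes "integrable lborel (\<lambda>x. p x * r x)" "q \<in> borel_measurable borel" "p \<in> borel_measurable borel"
    and "\<And>x. 0 \<le> p x" "\<And>x. p x \<noteq> 0 \<Longrightarrow> \<bar>q x\<bar> \<le> r x"
  shows "integrable lborel (\<lambda>x. p x * q x)" "\<bar>\<integral>x. p x * q x \<partial>lborel\<bar> \<le> (\<integral>x. p x * r x \<partial>lborel)"
proof -
  have b: "\<bar>p x * q x\<bar> \<le> p x * r x" for x
    using assms(4)[of x] assms(5)[of x] by (cases "p x = 0") (auto simp: abs_mult intro: mult_left_mono)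
  show i: "integrable lborel (\<lambda>x. p x * q x)"
  proof (rule Bochner_Integration.integrable_bound[OF assms(1)])
    show "AE x in lborel. norm (p x * q x) \<le> norm (p x * r x)"
    proof (intro AE_I2)
      fix x show "norm (p x * q x) \<le> norm (p x * r x)" using b[of x] by simp
    qed
  qed (use assms in auto)
  have "\<bar>\<integral>x. p x * q x \<partial>lborel\<bar> \<le> (\<integral>x. \<bar>p x * q x\<bar> \<partial>lborel)" by (rule integral_abs_bound)
  also have "\<dots> \<le> (\<integral>x. p x * r x \<partial>lborel)" by (intro integral_mono integrable_abs i assms(1) b)
  finally show "\<bar>\<integral>x. p x * q x \<partial>lborel\<bar> \<le> (\<integral>x. p x * r x \<partial>lborel)" .
qed

locale BD_limit_setting =
  fixes \<eta> s abar bbar \<alpha> \<beta> m uin T M ustar \<theta> Q H L Ax Bx :: real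
    and \<epsilon> A B me :: "nat \<Rightarrow> real" and ae be :: "nat \<Rightarrow> nat \<Rightarrow> real"
    and u :: "nat \<Rightarrow> real \<Rightarrow> real" and c :: "nat \<Rightarrow> nat \<Rightarrow> real \<Rightarrow> real"
    and f :: "real \<Rightarrow> real \<Rightarrow> real" and \<mu>in :: "real measure"
  assumes bd: "\<And>n. BD_power_law \<eta> (\<epsilon> n) (A n) (B n) abar bbar s M (ae n) (be n) (u n) (c n)"
    and eps_lim: "\<epsilon> \<longlonglongrightarrow> 0" and A_lim: "A \<longlonglongrightarrow> \<alpha>" and B_lim: "B \<longlonglongrightarrow> \<beta>"
    and Ax: "\<And>n. A n \<le> Ax" and Bx: "\<And>n. B n \<le> Bx" and beta_pos: "0 < \<beta>"
    and T: "0 < T"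
    and mass_balance: "\<And>n t. 0 \<le> t \<Longrightarrow> ((\<lambda>i. (\<epsilon> n)\<^sup>2 * real i * c n i t) has_sum (me n - u n t)) {2..}"
    and me_lim: "me \<longlonglongrightarrow> m" and uin_lim: "(\<lambda>n. u n 0) \<longlonglongrightarrow> uin"
    and tail: "\<And>e. 0 < e \<Longrightarrow> \<exists>R>0. \<forall>n. \<forall>t\<in>{0..T}.
        (\<integral>x. step_fun (\<epsilon> n) 2 (\<lambda>i. c n i t) x * (indicator {R..} x * x) \<partial>lborel) \<le> e"
    and conv: "\<And>g C. g \<in> borel_measurable borel \<Longrightarrow> (\<And>x. \<bar>g x\<bar> \<le> (C::real)) \<Longrightarrow>
        uniform_limit {0..T} (\<lambda>n t. \<integral>x. step_fun (\<epsilon> n) 2 (\<lambda>i. c n i t) x * g x \<partial>lborel)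
          (\<lambda>t. \<integral>x. f t x * g x \<partial>lborel) sequentially"
    and f_int: "\<And>t. t \<in> {0..T} \<Longrightarrow> integrable lborel (f t)"
    and f_nn: "\<And>t x. t \<in> {0..T} \<Longrightarrow> 0 \<le> f t x"
    and f_neg: "\<And>t x. x < 0 \<Longrightarrow> f t x = 0"
    and u_low: "\<And>n t. t \<in> {0..T} \<Longrightarrow> ustar \<le> u n t" and ustar: "0 < ustar" "bbar < abar * ustar"
    and theta: "0 < \<theta>" "\<theta> < 1" "bbar / (abar * ustar) < \<theta>"
    and number: "\<And>n t N. t \<in> {0..T} \<Longrightarrow> (\<Sum>i=2..N. \<epsilon> n * c n i t) \<le> Q"
    and moment: "\<And>n t N. t \<in> {0..T} \<Longrightarrow> (\<Sum>i=2..N. \<theta>^i * (\<epsilon> n powr s * c n i t)) \<le> H"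
    and u_lipschitz: "\<And>n t. t \<in> {0..T} \<Longrightarrow> \<exists>u'. (u n has_real_derivative u') (at t within {0..}) \<and> \<bar>u'\<bar> \<le> L"
    and init: "weak_star_tendsto (\<lambda>n. density half_line (\<lambda>x. ennreal (step_fun (\<epsilon> n) 2 (\<lambda>i. c n i 0) x))) \<mu>in sequentially"
begin

abbreviation F :: "nat \<Rightarrow> real \<Rightarrow> real \<Rightarrow> real" where
  "F n t x \<equiv> step_fun (\<epsilon> n) 2 (\<lambda>i. c n i t) x"

lemma eps_pos: "0 < \<epsilon> n" "\<epsilon> n \<le> 1" using BD_power_law.eps[OF bd] by auto

lemma c_nn: "2 \<le> i \<Longrightarrow> 0 \<le> t \<Longrightarrow> 0 \<le> c n i t" using BD_power_law.c_nonneg[OF bd] .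

lemma F_meas [measurable]: "F n t \<in> borel_measurable borel" using eps_pos by measurable

lemma F_nn: "0 \<le> t \<Longrightarrow> 0 \<le> F n t x"
  using step_fun_nonneg[OF eps_pos(1)[of n], of "\<lambda>i. c n i t" x] c_nn by blast

lemma F_neg: "x \<le> 0 \<Longrightarrow> F n t x = 0" using step_fun_neg[OF eps_pos(1)] .

lemma F_int: assumes "t \<in> {0..T}" shows "integrable lborel (F n t)" "(\<integral>x. F n t x \<partial>lborel) \<le> Q"
proof -
  have w: "0 \<le> c n i t" if "2 \<le> i" for i using c_nn that assms by auto
  have "(\<Sum>i=2..N. c n i t * (\<epsilon> n * 1)) \<le> Q" for N using number[OF assms, of n N] by (simp add: mult.commute)
  note * = step_integral_le[where h="\<lambda>_. 1" and b="\<lambda>_. 1" and C=Q and w="\<lambda>i. c n i t" and \<epsilon>="\<epsilon> n", OF eps_pos(1) w _ _ _ this]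
  show "integrable lborel (F n t)" "(\<integral>x. F n t x \<partial>lborel) \<le> Q" using * by auto
qed

lemma Q_nn: "0 \<le> Q" using number[of 0 0 0] T by simp

lemma F_moment: assumes "0 \<le> t"
  shows "integrable lborel (\<lambda>x. F n t x * x)" "(\<integral>x. F n t x * x \<partial>lborel) = me n - u n t" "me n - u n t \<le> M"
proof -
  have w: "0 \<le> c n i t" if "2 \<le> i" for i using c_nn that assms by auto
  show i: "integrable lborel (\<lambda>x. F n t x * x)" "(\<integral>x. F n t x * x \<partial>lborel) = me n - u n t"
    using step_first_moment[OF eps_pos(1)[of n] w mass_balance[OF assms]] by auto
  have "(\<Sum>i\<in>Z. (\<epsilon> n)\<^sup>2 * real i * c n i t) \<le> M" if Z: "finite Z" "Z \<subseteq> {2..}" for Z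
  proof -
    obtain N where "Z \<subseteq> {..N}" using Z(1) by (meson finite_nat_iff_bounded_le)
    then have "(\<Sum>i\<in>Z. (\<epsilon> n)\<^sup>2 * real i * c n i t) \<le> (\<Sum>i=2..N. (\<epsilon> n)\<^sup>2 * real i * c n i t)"
      using Z(2) by (intro sum_mono2) (auto intro!: mult_nonneg_nonneg w)
    also have "\<dots> \<le> M" using BD_power_law.mass_sum_le[OF bd assms] .
    finally show ?thesis .
  qed
  then show "me n - u n t \<le> M"
    by (intro has_sum_le_finite_sums[OF mass_balance[OF assms]])
qed

lemma M_nn: "0 \<le> M" using BD_power_law.M_nonneg[OF bd[of 0]] .

lemma f_meas: "t \<in> {0..T} \<Longrightarrow> f t \<in> borel_measurable borel" using f_int by auto

lemma F_growth_int:
  assumes t: "t \<in> {0..T}" and g: "g \<in> borel_measurable borel" "\<And>x. 0 < x \<Longrightarrow> \<bar>g x\<bar> \<le> C * (1 + x)"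
  shows "integrable lborel (\<lambda>x. F n t x * g x)"
proof (rule abs_integral_mult_le(1)[where r="\<lambda>x. C * (1 + x)"])
  have "integrable lborel (\<lambda>x. C * (F n t x + F n t x * x))" using F_int[OF t] F_moment[of t] t by auto
  then show "integrable lborel (\<lambda>x. F n t x * (C * (1 + x)))" by (simp add: algebra_simps)
  show "0 \<le> F n t x" for x using F_nn t by auto
  show "\<bar>g x\<bar> \<le> C * (1 + x)" if "F n t x \<noteq> 0" for x using g(2) F_neg[of x n t] that by (cases "x \<le> 0") auto
qed (use g F_meas in auto)

lemma f_moment:
  assumes t: "t \<in> {0..T}"
  shows "integrable lborel (\<lambda>x. f t x * x)" "(\<integral>x. f t x * x \<partial>lborel) \<le> M" "0 \<le> f t x * x"
proof -
  note [measurable] = f_meas[OF t]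
  have nn: "0 \<le> f t x * x" for x using f_nn[OF t, of x] f_neg[of x t] by (cases "x < 0") auto
  then show "0 \<le> f t x * x" .
  define gk where "gk k x = indicator {0..<real k} x * x" for k :: nat and x :: real
  have gm: "gk k \<in> borel_measurable borel" "\<bar>gk k x\<bar> \<le> real k" for k x
    unfolding gk_def[abs_def] by (measurable, auto simp: indicator_def)
  have eq: "f t x * x * indicator {..<real k} x = f t x * gk k x" for k x
    using f_neg[of x t] by (cases "x < 0") (auto simp: gk_def indicator_def)
  have i: "integrable lborel (\<lambda>x. f t x * gk k x)" for k using integrable_mult_bounded[OF f_int[OF t] gm] .
  have b: "(\<integral>x. f t x * gk k x \<partial>lborel) \<le> M" for k
  proof (rule LIMSEQ_le_const2[OF tendsto_uniform_limitI[OF conv[OF gm] t]])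
    have "(\<integral>x. F n t x * gk k x \<partial>lborel) \<le> (\<integral>x. F n t x * x \<partial>lborel)" for n
    proof (rule integral_mono[OF integrable_mult_bounded[OF F_int(1)[OF t] gm] F_moment(1)])
      show "F n t x * gk k x \<le> F n t x * x" for x
        using F_nn[of t n x] F_neg[of x n t] t by (cases "x \<le> 0") (auto simp: gk_def indicator_def)
    qed (use t in auto)
    also have "(\<integral>x. F n t x * x \<partial>lborel) \<le> M" for n using F_moment[of t n] t by simp
    finally show "\<exists>N. \<forall>n\<ge>N. (\<integral>x. F n t x * gk k x \<partial>lborel) \<le> M" by blast
  qed
  show "integrable lborel (\<lambda>x. f t x * x)" "(\<integral>x. f t x * x \<partial>lborel) \<le> M"
    by (rule integrable_from_truncations[OF _ nn, where C=M]; simp add: eq i b)+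
qed

lemma f_tail:
  assumes R: "0 < R" "\<And>n t. t \<in> {0..T} \<Longrightarrow> (\<integral>x. F n t x * (indicator {R..} x * x) \<partial>lborel) \<le> e" and t: "t \<in> {0..T}"
  shows "(\<integral>x. f t x * (indicator {R..} x * x) \<partial>lborel) \<le> e"
proof -
  note [measurable] = f_meas[OF t]
  define gk where "gk k x = indicator {R..<real k} x * x" for k :: nat and x :: real
  have gm: "gk k \<in> borel_measurable borel" "\<bar>gk k x\<bar> \<le> real k" for k x
    unfolding gk_def[abs_def] using R(1) by (measurable, auto simp: indicator_def)
  have nn: "0 \<le> f t x * (indicator {R..} x * x)" for x using f_nn[OF t, of x] R(1) by (auto simp: indicator_def)
  have eq: "f t x * (indicator {R..} x * x) * indicator {..<real k} x = f t x * gk k x" for k x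
    by (auto simp: gk_def indicator_def)
  have i: "integrable lborel (\<lambda>x. f t x * gk k x)" for k using integrable_mult_bounded[OF f_int[OF t] gm] .
  have b: "(\<integral>x. f t x * gk k x \<partial>lborel) \<le> e" for k
  proof (rule LIMSEQ_le_const2[OF tendsto_uniform_limitI[OF conv[OF gm] t]])
    have "(\<integral>x. F n t x * gk k x \<partial>lborel) \<le> (\<integral>x. F n t x * (indicator {R..} x * x) \<partial>lborel)" for n
    proof (rule integral_mono[OF integrable_mult_bounded[OF F_int(1)[OF t] gm]])
      show "integrable lborel (\<lambda>x. F n t x * (indicator {R..} x * x))"
        by (rule F_growth_int[OF t, where C=1]) (auto simp: indicator_def)
      show "F n t x * gk k x \<le> F n t x * (indicator {R..} x * x)" for x
        using F_nn[of t n x] R(1) t by (auto simp: gk_def indicator_def)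
    qed
    also have "(\<integral>x. F n t x * (indicator {R..} x * x) \<partial>lborel) \<le> e" for n using R(2)[OF t] .
    finally show "\<exists>N. \<forall>n\<ge>N. (\<integral>x. F n t x * gk k x \<partial>lborel) \<le> e" by blast
  qed
  show ?thesis by (rule integrable_from_truncations(2)[OF _ nn, where C=e]) (simp_all add: eq i b)
qed

lemma f_growth_int:
  assumes t: "t \<in> {0..T}" and g: "g \<in> borel_measurable borel" "\<And>x. 0 < x \<Longrightarrow> \<bar>g x\<bar> \<le> C * (1 + x)" "g 0 = 0 \<or> \<bar>g 0\<bar> \<le> C"
  shows "integrable lborel (\<lambda>x. f t x * g x)"
proof (rule abs_integral_mult_le(1)[where r="\<lambda>x. C * (1 + x)"])
  have "integrable lborel (\<lambda>x. C * (f t x + f t x * x))" using f_int[OF t] f_moment[OF t] by auto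
  then show "integrable lborel (\<lambda>x. f t x * (C * (1 + x)))" by (simp add: algebra_simps)
  have C: "0 \<le> C" using g(2)[of 1] by simp
  show "\<bar>g x\<bar> \<le> C * (1 + x)" if "f t x \<noteq> 0" for x
  proof -
    have "\<not> x < 0" using f_neg that by blast
    then consider "x = 0" | "0 < x" by linarith
    then show ?thesis using g C by cases auto
  qed
qed (use g f_meas[OF t] f_nn[OF t] in auto)

lemma growth_tail:
  assumes e: "0 < e" and C: "0 \<le> C"
  obtains R where "1 \<le> R"
    "\<And>n t g. t \<in> {0..T} \<Longrightarrow> g \<in> borel_measurable borel \<Longrightarrow> (\<And>x. 0 < x \<Longrightarrow> \<bar>g x\<bar> \<le> C * (1 + x)) \<Longrightarrow>
       \<bar>\<integral>x. F n t x * (indicator {R..} x * g x) \<partial>lborel\<bar> \<le> e"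
    "\<And>t g. t \<in> {0..T} \<Longrightarrow> g \<in> borel_measurable borel \<Longrightarrow> (\<And>x. 0 < x \<Longrightarrow> \<bar>g x\<bar> \<le> C * (1 + x)) \<Longrightarrow>
       \<bar>\<integral>x. f t x * (indicator {R..} x * g x) \<partial>lborel\<bar> \<le> e"
proof -
  define e' where "e' = e / (2 * (C + 1))"
  have e': "0 < e'" using e C by (simp add: e'_def)
  obtain R0 where R0: "0 < R0" "\<And>n t. t \<in> {0..T} \<Longrightarrow> (\<integral>x. F n t x * (indicator {R0..} x * x) \<partial>lborel) \<le> e'"
    using tail[OF e'] by blast
  define R where "R = max 1 R0"
  have R: "1 \<le> R" "R0 \<le> R" by (auto simp: R_def)
  have small: "2 * C * e' \<le> e" using e C by (simp add: e'_def field_simps)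
  have bound: "\<bar>indicator {R..} x * g x\<bar> \<le> 2 * C * (indicator {R0..} x * x)"
    if "\<And>x. 0 < x \<Longrightarrow> \<bar>g x\<bar> \<le> C * (1 + x)" for g :: "real \<Rightarrow> real" and x
  proof (cases "R \<le> x")
    case True
    then have "\<bar>g x\<bar> \<le> C * (1 + x)" using that R by auto
    also have "\<dots> \<le> C * (2 * x)" using True R C by (intro mult_left_mono) auto
    finally show ?thesis using True R by simp
  next
    case False
    then show ?thesis using C R0(1) by (auto simp: indicator_def)
  qed
  show ?thesis
  proof (rule that[OF R(1)])
    fix n t and g :: "real \<Rightarrow> real" assume t: "t \<in> {0..T}" and g: "g \<in> borel_measurable borel" "\<And>x. 0 < x \<Longrightarrow> \<bar>g x\<bar> \<le> C * (1 + x)"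
    note [measurable] = g(1)
    have i: "integrable lborel (\<lambda>x. F n t x * (indicator {R0..} x * x))"
      by (rule F_growth_int[OF t, where C=1]) (auto simp: indicator_def)
    have i2: "integrable lborel (\<lambda>x. F n t x * (2 * C * (indicator {R0..} x * x)))"
      using integrable_mult_right[OF i, of "2*C"] by (simp add: mult_ac)
    have "\<bar>\<integral>x. F n t x * (indicator {R..} x * g x) \<partial>lborel\<bar> \<le> (\<integral>x. F n t x * (2 * C * (indicator {R0..} x * x)) \<partial>lborel)"
      by (rule abs_integral_mult_le(2)[OF i2 _ _ _ bound[OF g(2)]]) (use F_nn t in auto)
    also have "\<dots> = 2 * C * (\<integral>x. F n t x * (indicator {R0..} x * x) \<partial>lborel)"
      by (subst integral_mult_right_zero[symmetric]) (simp add: mult_ac)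
    also have "\<dots> \<le> 2 * C * e'" using R0(2)[OF t] C by (intro mult_left_mono) auto
    finally show "\<bar>\<integral>x. F n t x * (indicator {R..} x * g x) \<partial>lborel\<bar> \<le> e" using small by linarith
  next
    fix t and g :: "real \<Rightarrow> real" assume t: "t \<in> {0..T}" and g: "g \<in> borel_measurable borel" "\<And>x. 0 < x \<Longrightarrow> \<bar>g x\<bar> \<le> C * (1 + x)"
    note [measurable] = g(1) f_meas[OF t]
    have i: "integrable lborel (\<lambda>x. f t x * (indicator {R0..} x * x))"
      by (rule f_growth_int[OF t, where C=1]) (auto simp: indicator_def)
    have i2: "integrable lborel (\<lambda>x. f t x * (2 * C * (indicator {R0..} x * x)))"
      using integrable_mult_right[OF i, of "2*C"] by (simp add: mult_ac)
    have "\<bar>\<integral>x. f t x * (indicator {R..} x * g x) \<partial>lborel\<bar> \<le> (\<integral>x. f t x * (2 * C * (indicator {R0..} x * x)) \<partial>lborel)"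
      by (rule abs_integral_mult_le(2)[OF i2 _ _ _ bound[OF g(2)]]) (use f_nn t in auto)
    also have "\<dots> = 2 * C * (\<integral>x. f t x * (indicator {R0..} x * x) \<partial>lborel)"
      by (subst integral_mult_right_zero[symmetric]) (simp add: mult_ac)
    also have "\<dots> \<le> 2 * C * e'" using f_tail[OF R0 t] C by (intro mult_left_mono) auto
    finally show "\<bar>\<integral>x. f t x * (indicator {R..} x * g x) \<partial>lborel\<bar> \<le> e" using small by linarith
  qed
qed

lemma conv_growth:
  assumes g: "g \<in> borel_measurable borel" "\<And>x. 0 < x \<Longrightarrow> \<bar>g x\<bar> \<le> C * (1 + x)" "g 0 = 0"
  shows "uniform_limit {0..T} (\<lambda>n t. \<integral>x. F n t x * g x \<partial>lborel) (\<lambda>t. \<integral>x. f t x * g x \<partial>lborel) sequentially"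
proof (rule uniform_limitI)
  fix e :: real assume e: "0 < e"
  note [measurable] = g(1)
  have C: "0 \<le> C" using g(2)[of 1] by simp
  have e3: "0 < e/3" using e by simp
  obtain R where R: "1 \<le> R"
    "\<And>n t g. t \<in> {0..T} \<Longrightarrow> g \<in> borel_measurable borel \<Longrightarrow> (\<And>x. 0 < x \<Longrightarrow> \<bar>g x\<bar> \<le> C * (1 + x)) \<Longrightarrow>
       \<bar>\<integral>x. F n t x * (indicator {R..} x * g x) \<partial>lborel\<bar> \<le> e/3"
    "\<And>t g. t \<in> {0..T} \<Longrightarrow> g \<in> borel_measurable borel \<Longrightarrow> (\<And>x. 0 < x \<Longrightarrow> \<bar>g x\<bar> \<le> C * (1 + x)) \<Longrightarrow>
       \<bar>\<integral>x. f t x * (indicator {R..} x * g x) \<partial>lborel\<bar> \<le> e/3"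
    by (rule growth_tail[OF e3 C]) blast
  define g0 where "g0 x = indicator {0..<R} x * g x" for x
  define g1 where "g1 x = indicator {R..} x * g x" for x
  have m: "g0 \<in> borel_measurable borel" "g1 \<in> borel_measurable borel" unfolding g0_def[abs_def] g1_def[abs_def] by measurable
  have b0: "\<bar>g0 x\<bar> \<le> C * (1 + R)" for x
  proof (cases "0 < x \<and> x < R")
    case True
    then have "\<bar>g x\<bar> \<le> C * (1 + x)" using g(2) by simp
    also have "\<dots> \<le> C * (1 + R)" using True C by (intro mult_left_mono) auto
    finally show ?thesis using True by (simp add: g0_def)
  next
    case False
    then have "g0 x = 0" using g(3) by (cases "x = 0") (auto simp: g0_def indicator_def)
    then show ?thesis using C R(1) by simp
  qed
  have splitF: "(\<integral>x. F n t x * g x \<partial>lborel) = (\<integral>x. F n t x * g0 x \<partial>lborel) + (\<integral>x. F n t x * g1 x \<partial>lborel)" if t: "t \<in> {0..T}" for n t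
  proof -
    have "F n t x * g x = F n t x * g0 x + F n t x * g1 x" for x
      using F_neg[of x n t] R(1) by (cases "x \<le> 0") (auto simp: g0_def g1_def indicator_def)
    moreover have "integrable lborel (\<lambda>x. F n t x * g0 x)" by (rule integrable_mult_bounded[OF F_int(1)[OF t] m(1) b0])
    moreover have "integrable lborel (\<lambda>x. F n t x * g1 x)"
      using g(2) C by (intro F_growth_int[OF t m(2), of C]) (auto simp: g1_def indicator_def)
    ultimately show ?thesis by (simp add: Bochner_Integration.integral_add)
  qed
  have splitf: "(\<integral>x. f t x * g x \<partial>lborel) = (\<integral>x. f t x * g0 x \<partial>lborel) + (\<integral>x. f t x * g1 x \<partial>lborel)" if t: "t \<in> {0..T}" for t
  proof -
    have "f t x * g x = f t x * g0 x + f t x * g1 x" for x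
      using f_neg[of x t] R(1) by (cases "x < 0") (auto simp: g0_def g1_def indicator_def)
    moreover have "integrable lborel (\<lambda>x. f t x * g0 x)" by (rule integrable_mult_bounded[OF f_int[OF t] m(1) b0])
    moreover have "integrable lborel (\<lambda>x. f t x * g1 x)"
      using g(2,3) C R(1) by (intro f_growth_int[OF t m(2), of C]) (auto simp: g1_def indicator_def)
    ultimately show ?thesis by (simp add: Bochner_Integration.integral_add)
  qed
  have "\<forall>\<^sub>F n in sequentially. \<forall>t\<in>{0..T}. dist (\<integral>x. F n t x * g0 x \<partial>lborel) (\<integral>x. f t x * g0 x \<partial>lborel) < e/3"
    by (rule uniform_limitD[OF conv[OF m(1) b0] e3])
  then show "\<forall>\<^sub>F n in sequentially. \<forall>t\<in>{0..T}. dist (\<integral>x. F n t x * g x \<partial>lborel) (\<integral>x. f t x * g x \<partial>lborel) < e"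
  proof eventually_elim
    case (elim n)
    show ?case
    proof
      fix t assume t: "t \<in> {0..T}"
      have "\<bar>\<integral>x. F n t x * g1 x \<partial>lborel\<bar> \<le> e/3" unfolding g1_def using R(2)[OF t g(1,2)] .
      moreover have "\<bar>\<integral>x. f t x * g1 x \<partial>lborel\<bar> \<le> e/3" unfolding g1_def using R(3)[OF t g(1,2)] .
      ultimately show "dist (\<integral>x. F n t x * g x \<partial>lborel) (\<integral>x. f t x * g x \<partial>lborel) < e"
        using bspec[OF elim t] e unfolding splitF[OF t] splitf[OF t] dist_real_def by linarith
    qed
  qed
qed

end

lemma compact_support_uniformly_continuous:
  fixes k :: "real \<Rightarrow> real"
  assumes k: "continuous_on {0..} k" "\<And>x. R \<le> x \<Longrightarrow> k x = 0" and R: "0 < R"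
  shows "0 < e \<Longrightarrow> \<exists>d>0. \<forall>x\<ge>0. \<forall>y\<ge>0. \<bar>x - y\<bar> < d \<longrightarrow> \<bar>k x - k y\<bar> < e"
    and "\<exists>C\<ge>0. \<forall>x\<ge>0. \<bar>k x\<bar> \<le> C"
proof -
  have kc: "continuous_on {0..R+1} k" using k(1) by (rule continuous_on_subset) auto
  then have "uniformly_continuous_on {0..R+1} k" by (intro compact_uniformly_continuous) auto
  moreover assume e: "0 < e"
  ultimately obtain d where d: "0 < d" "\<And>x y. x \<in> {0..R+1} \<Longrightarrow> y \<in> {0..R+1} \<Longrightarrow> \<bar>y - x\<bar> < d \<Longrightarrow> \<bar>k y - k x\<bar> < e"
    unfolding uniformly_continuous_on_def dist_real_def by metis
  have "\<bar>k x - k y\<bar> < e" if "0 \<le> x" "0 \<le> y" "\<bar>x - y\<bar> < min d 1" for x y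
  proof (cases "x \<le> R + 1 \<and> y \<le> R + 1")
    case True
    then show ?thesis using d(2)[of y x] that by auto
  next
    case False
    then have "R \<le> x" "R \<le> y" using that by linarith+
    then show ?thesis using k(2) e by simp
  qed
  then show "\<exists>d>0. \<forall>x\<ge>0. \<forall>y\<ge>0. \<bar>x - y\<bar> < d \<longrightarrow> \<bar>k x - k y\<bar> < e"
    using d(1) by (intro exI[of _ "min d 1"]) auto
next
  have "compact (k ` {0..R})" using k(1) by (intro compact_continuous_image continuous_on_subset[OF k(1)]) auto
  then obtain C where C: "\<And>x. x \<in> {0..R} \<Longrightarrow> \<bar>k x\<bar> \<le> C"
    using compact_imp_bounded[THEN bounded_iff[THEN iffD1]] by (metis imageI real_norm_def)
  have "\<bar>k x\<bar> \<le> C" if "0 \<le> x" for x using C[of x] C[of 0] k(2)[of x] that R by (cases "x \<le> R") auto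
  moreover have "0 \<le> C" using C[of 0] R by simp
  ultimately show "\<exists>C\<ge>0. \<forall>x\<ge>0. \<bar>k x\<bar> \<le> C" by blast
qed

lemma half_line_continuous_measurable:
  fixes k :: "real \<Rightarrow> real"
  assumes "continuous_on {0..} k" shows "(\<lambda>x. indicator {0..} x * k x) \<in> borel_measurable borel"
  using borel_measurable_continuous_on_indicator[OF _ assms] by simp

context BD_limit_setting
begin

lemma F_weak_continuous:
  assumes g: "g \<in> borel_measurable borel" "\<And>x. 0 < x \<Longrightarrow> \<bar>g x\<bar> \<le> C * (1 + x)"
  shows "continuous_on {0..T} (\<lambda>t. \<integral>x. F n t x * g x \<partial>lborel)"
proof -
  note [measurable] = g(1)
  interpret N: BD_power_law \<eta> "\<epsilon> n" "A n" "B n" abar bbar s M "ae n" "be n" "u n" "c n" by (rule bd)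
  have C: "0 \<le> C" using g(2)[of 1] by simp
  define r where "r N = (real N + 1/2) * \<epsilon> n" for N
  define G where "G N t = (\<integral>x. F n t x * (indicator {..<r N} x * g x) \<partial>lborel)" for N t
  have m: "(\<lambda>x. indicator {..<r N} x * g x) \<in> borel_measurable borel" for N by measurable
  have cellint: "set_integrable lborel (size_cell (\<epsilon> n) i) (\<lambda>x. indicator {..<r N} x * g x)" if "2 \<le> i" for i N
  proof -
    define q where "q x = indicator (size_cell (\<epsilon> n) i) x * (indicator {..<r N} x * g x)" for x
    have "\<bar>q x\<bar> \<le> C * (1 + 2 * (\<epsilon> n * real i))" for x
    proof (cases "x \<in> size_cell (\<epsilon> n) i")
      case True
      note b = size_cell_bounds[OF eps_pos(1) that True]
      have "\<bar>g x\<bar> \<le> C * (1 + x)" using g(2) b by simp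
      also have "\<dots> \<le> C * (1 + 2 * (\<epsilon> n * real i))" using b C by (intro mult_left_mono) auto
      finally have "\<bar>g x\<bar> \<le> C * (1 + 2 * (\<epsilon> n * real i))" .
      moreover have "\<bar>q x\<bar> \<le> \<bar>g x\<bar>" by (auto simp: q_def indicator_def)
      ultimately show ?thesis by linarith
    next
      case False
      then show ?thesis using C eps_pos[of n] by (simp add: q_def)
    qed
    moreover have "q \<in> borel_measurable borel" unfolding q_def[abs_def] by measurable
    moreover have "integrable lborel (indicator (size_cell (\<epsilon> n) i) :: real \<Rightarrow> real)"
      using measure_size_cell[OF eps_pos(1)[of n], of i] by (intro integrable_real_indicator) auto
    ultimately have "integrable lborel (\<lambda>x. indicator (size_cell (\<epsilon> n) i) x * q x)" by (intro integrable_mult_bounded)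
    moreover have "(\<lambda>x. indicator (size_cell (\<epsilon> n) i) x * q x) = q" by (auto simp: q_def indicator_def)
    ultimately have "integrable lborel q" by simp
    then show ?thesis by (simp add: set_integrable_def q_def[abs_def])
  qed
  have Gsum: "G N t = (\<Sum>i=2..N. c n i t * (LINT x:size_cell (\<epsilon> n) i|lborel. indicator {..<r N} x * g x))" for N t
    unfolding G_def
  proof (rule step_integral_truncated(1)[OF eps_pos(1)])
    show "indicator {..<r N} x * g x = 0" if "(real N + 1/2) * \<epsilon> n \<le> x" for x using that by (simp add: r_def)
  qed (rule cellint, simp)
  have Gc: "continuous_on {0..T} (G N)" for N
    unfolding Gsum[abs_def] by (intro continuous_intros continuous_on_subset[OF N.c_cont]) auto
  have "uniform_limit {0..T} G (\<lambda>t. \<integral>x. F n t x * g x \<partial>lborel) sequentially"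
  proof (rule uniform_limitI)
    fix e :: real assume e: "0 < e"
    then have e2: "0 < e/2" by simp
    obtain R where R: "1 \<le> R"
      "\<And>n t g. t \<in> {0..T} \<Longrightarrow> g \<in> borel_measurable borel \<Longrightarrow> (\<And>x. 0 < x \<Longrightarrow> \<bar>g x\<bar> \<le> C * (1 + x)) \<Longrightarrow>
         \<bar>\<integral>x. F n t x * (indicator {R..} x * g x) \<partial>lborel\<bar> \<le> e/2"
      by (rule growth_tail[OF e2 C]) blast
    obtain N0 :: nat where N0: "R / \<epsilon> n < real N0" using reals_Archimedean2 by blast
    have "\<forall>t\<in>{0..T}. dist (G N t) (\<integral>x. F n t x * g x \<partial>lborel) < e" if N: "N \<ge> N0" for N
    proof
      fix t assume t: "t \<in> {0..T}"
      have "R / \<epsilon> n \<le> real N + 1/2" using N0 N by linarith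
      then have rR: "R \<le> r N" using eps_pos(1)[of n] by (simp add: r_def pos_divide_le_eq)
      define g' where "g' x = indicator {r N..} x * g x" for x
      have g': "g' \<in> borel_measurable borel" "\<And>x. 0 < x \<Longrightarrow> \<bar>g' x\<bar> \<le> C * (1 + x)"
        using g C by (auto simp: g'_def[abs_def] indicator_def)
      have gg: "indicator {R..} x * g' x = g' x" for x using rR by (auto simp: g'_def indicator_def)
      have "(\<integral>x. F n t x * g x \<partial>lborel) = G N t + (\<integral>x. F n t x * g' x \<partial>lborel)"
      proof -
        have "F n t x * g x = F n t x * (indicator {..<r N} x * g x) + F n t x * g' x" for x
          by (auto simp: g'_def indicator_def)
        moreover have "integrable lborel (\<lambda>x. F n t x * (indicator {..<r N} x * g x))"
          using g C by (intro F_growth_int[OF t, of _ C]) (auto simp: indicator_def)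
        moreover have "integrable lborel (\<lambda>x. F n t x * g' x)" by (rule F_growth_int[OF t g'])
        ultimately show ?thesis by (simp add: G_def)
      qed
      moreover have "\<bar>\<integral>x. F n t x * g' x \<partial>lborel\<bar> \<le> e/2" using R(2)[OF t g'] by (simp add: gg)
      ultimately show "dist (G N t) (\<integral>x. F n t x * g x \<partial>lborel) < e" using e by (simp add: dist_real_def)
    qed
    then show "\<forall>\<^sub>F N in sequentially. \<forall>t\<in>{0..T}. dist (G N t) (\<integral>x. F n t x * g x \<partial>lborel) < e"
      unfolding eventually_sequentially by blast
  qed
  from uniform_limit_theorem[OF always_eventually this] show ?thesis using Gc by auto
qed

lemma f_weak_continuous:
  assumes g: "g \<in> borel_measurable borel" "\<And>x. 0 < x \<Longrightarrow> \<bar>g x\<bar> \<le> C * (1 + x)" "g 0 = 0"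
  shows "continuous_on {0..T} (\<lambda>t. \<integral>x. f t x * g x \<partial>lborel)"
  by (rule uniform_limit_theorem[OF always_eventually conv_growth[OF g]])
    (use F_weak_continuous[OF g(1,2)] in auto)

lemma f_bounded_weak_continuous:
  assumes g: "g \<in> borel_measurable borel" "\<And>x. \<bar>g x\<bar> \<le> C"
  shows "continuous_on {0..T} (\<lambda>t. \<integral>x. f t x * g x \<partial>lborel)"
proof (rule uniform_limit_theorem[OF always_eventually conv[OF g]])
  have "\<bar>g x\<bar> \<le> C * (1 + x)" if "0 < x" for x
  proof -
    have "0 \<le> C" using g(2)[of 0] by linarith
    then have "C * 1 \<le> C * (1 + x)" using that by (intro mult_left_mono) auto
    then show ?thesis using g(2)[of x] by linarith
  qed
  then show "\<forall>n. continuous_on {0..T} (\<lambda>t. \<integral>x. F n t x * g x \<partial>lborel)" using F_weak_continuous[OF g(1)] by blast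
qed simp

definition ul :: "real \<Rightarrow> real" where "ul t = m - (\<integral>x. f t x * x \<partial>lborel)"

lemma u_uniform_limit: "uniform_limit {0..T} u ul sequentially"
proof (rule uniform_limitI)
  fix e :: real assume "0 < e"
  then have e: "0 < e/2" by simp
  have "uniform_limit {0..T} (\<lambda>n t. \<integral>x. F n t x * x \<partial>lborel) (\<lambda>t. \<integral>x. f t x * x \<partial>lborel) sequentially"
    by (rule conv_growth[where C=1]) auto
  from uniform_limitD[OF this e] tendstoD[OF me_lim e]
  show "\<forall>\<^sub>F n in sequentially. \<forall>t\<in>{0..T}. dist (u n t) (ul t) < e"
  proof eventually_elim
    case (elim n)
    show ?case
    proof
      fix t assume t: "t \<in> {0..T}"
      have "u n t = me n - (\<integral>x. F n t x * x \<partial>lborel)" using F_moment[of t n] t by simp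
      then show "dist (u n t) (ul t) < e" using bspec[OF elim(1) t] elim(2) unfolding ul_def dist_real_def by linarith
    qed
  qed
qed

lemma ul_cont: "continuous_on {0..T} ul"
proof (rule uniform_limit_theorem[OF always_eventually u_uniform_limit])
  show "\<forall>n. continuous_on {0..T} (u n)"
    by (auto intro!: continuous_on_subset[OF BD_power_law.u_cont[OF bd]])
qed simp

lemma u_tendsto: "t \<in> {0..T} \<Longrightarrow> (\<lambda>n. u n t) \<longlonglongrightarrow> ul t"
  using tendsto_uniform_limitI[OF u_uniform_limit] .

lemma ul_low: "t \<in> {0..T} \<Longrightarrow> ustar \<le> ul t"
  using u_low by (intro LIMSEQ_le_const[OF u_tendsto]) auto

lemma ul_init: "ul 0 = uin"
  using LIMSEQ_unique[OF u_tendsto[of 0] uin_lim] T by simp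

lemma riemann_sum_tendsto:
  assumes k: "continuous_on {0..} k" "\<And>x. R \<le> x \<Longrightarrow> k x = 0" and R: "0 < R" and t: "t \<in> {0..T}"
    and N: "\<And>n. R \<le> \<epsilon> n * real (N n)"
  shows "(\<lambda>n. \<Sum>i=2..N n. k (\<epsilon> n * real i) * (\<epsilon> n * c n i t)) \<longlonglongrightarrow> (\<integral>x. f t x * (indicator {0..} x * k x) \<partial>lborel)"
proof -
  let ?k = "\<lambda>x. indicator {0..} x * k x"
  have km: "?k \<in> borel_measurable borel" by (rule half_line_continuous_measurable[OF k(1)])
  have "\<exists>C\<ge>0. \<forall>x\<ge>0. \<bar>k x\<bar> \<le> C"
    by (rule compact_support_uniformly_continuous(2)[of k R]) (use k R in auto)
  then obtain C where "0 \<le> C" "\<forall>x\<ge>0. \<bar>k x\<bar> \<le> C" by blast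
  then have C: "0 \<le> C" "\<And>x. 0 \<le> x \<Longrightarrow> \<bar>k x\<bar> \<le> C" by simp_all
  have kb: "\<bar>?k x\<bar> \<le> C" for x using C by (auto simp: indicator_def)
  have lim: "(\<lambda>n. \<integral>x. F n t x * ?k x \<partial>lborel) \<longlonglongrightarrow> (\<integral>x. f t x * ?k x \<partial>lborel)"
    by (rule tendsto_uniform_limitI[OF conv[OF km kb] t])
  have "(\<lambda>n. (\<Sum>i=2..N n. k (\<epsilon> n * real i) * (\<epsilon> n * c n i t)) - (\<integral>x. F n t x * ?k x \<partial>lborel)) \<longlonglongrightarrow> 0"
  proof (rule LIMSEQ_I)
    fix e :: real assume e: "0 < e"
    then have eQ: "0 < e / (Q + 1)" using Q_nn by simp
    obtain d where d0: "0 < d" "\<forall>x\<ge>0. \<forall>y\<ge>0. \<bar>x - y\<bar> < d \<longrightarrow> \<bar>k x - k y\<bar> < e / (Q + 1)"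
    proof -
      have "\<exists>d>0. \<forall>x\<ge>0. \<forall>y\<ge>0. \<bar>x - y\<bar> < d \<longrightarrow> \<bar>k x - k y\<bar> < e / (Q + 1)"
        by (rule compact_support_uniformly_continuous(1)[of k R]) (use k R eQ in auto)
      then show ?thesis using that by blast
    qed
    have d: "0 < d" "\<And>x y. 0 \<le> x \<Longrightarrow> 0 \<le> y \<Longrightarrow> \<bar>x - y\<bar> < d \<Longrightarrow> \<bar>k x - k y\<bar> < e / (Q + 1)"
      using d0 by simp_all
    obtain n0 where n0: "\<And>n. n \<ge> n0 \<Longrightarrow> \<epsilon> n < d"
      using order_tendstoD(2)[OF eps_lim d(1)] by (auto simp: eventually_sequentially)
    have "norm ((\<Sum>i=2..N n. k (\<epsilon> n * real i) * (\<epsilon> n * c n i t)) - (\<integral>x. F n t x * ?k x \<partial>lborel) - 0) < e" if n: "n \<ge> n0" for n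
    proof -
      let ?cell = "size_cell (\<epsilon> n)"
      have ind: "integrable lborel (indicator (?cell i) :: real \<Rightarrow> real)" for i
        using measure_size_cell[OF eps_pos(1)[of n], of i] by (intro integrable_real_indicator) auto
      have si: "set_integrable lborel (?cell i) ?k" for i
        unfolding set_integrable_def using integrable_mult_bounded[OF ind km kb] by simp
      have "(\<integral>x. F n t x * ?k x \<partial>lborel) = (\<Sum>i=2..N n. c n i t * (LINT x:?cell i|lborel. ?k x))"
      proof (rule step_integral_truncated(1)[OF eps_pos(1)])
        fix x assume "(real (N n) + 1/2) * \<epsilon> n \<le> x"
        moreover have "R \<le> (real (N n) + 1/2) * \<epsilon> n" using N[of n] eps_pos[of n] by (simp add: algebra_simps)
        ultimately have "R \<le> x" by linarith
        then show "?k x = 0" using k(2) by simp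
      qed (rule si)
      moreover have "\<bar>k (\<epsilon> n * real i) * (\<epsilon> n * c n i t) - c n i t * (LINT x:?cell i|lborel. ?k x)\<bar> \<le> (e / (Q+1)) * (\<epsilon> n * c n i t)"
        if i: "i \<in> {2..N n}" for i
      proof -
        have i2: "2 \<le> i" using i by simp
        have cint: "(LINT x:?cell i|lborel. y) = \<epsilon> n * y" for y :: real
          using measure_size_cell[OF eps_pos(1)[of n], of i] by (simp add: set_lebesgue_integral_def)
        have ci: "set_integrable lborel (?cell i) (\<lambda>x. y)" for y :: real
          unfolding set_integrable_def by (intro integrable_scaleR_left ind)
        have "\<bar>(LINT x:?cell i|lborel. k (\<epsilon> n * real i)) - (LINT x:?cell i|lborel. ?k x)\<bar>
            = \<bar>LINT x:?cell i|lborel. (k (\<epsilon> n * real i) - ?k x)\<bar>"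
          by (subst set_integral_diff(2)[OF ci si]) simp
        also have "\<dots> \<le> (\<integral>x. \<bar>indicator (?cell i) x * (k (\<epsilon> n * real i) - ?k x)\<bar> \<partial>lborel)"
          unfolding set_lebesgue_integral_def using integral_abs_bound[of lborel "\<lambda>x. indicator (?cell i) x * (k (\<epsilon> n * real i) - ?k x)"] by simp
        also have "\<dots> \<le> (LINT x:?cell i|lborel. e / (Q+1))"
          unfolding set_lebesgue_integral_def
        proof (rule integral_mono)
          show "integrable lborel (\<lambda>x. \<bar>indicator (?cell i) x * (k (\<epsilon> n * real i) - ?k x)\<bar>)"
            using set_integral_diff(1)[OF ci[of "k (\<epsilon> n * real i)"] si] unfolding set_integrable_def by (intro integrable_abs) simp
          show "integrable lborel (\<lambda>x. indicat_real (?cell i) x *\<^sub>R (e / (Q+1)))" by (intro integrable_scaleR_left ind)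
          fix x
          show "\<bar>indicator (?cell i) x * (k (\<epsilon> n * real i) - ?k x)\<bar> \<le> indicat_real (?cell i) x *\<^sub>R (e / (Q+1))"
          proof (cases "x \<in> ?cell i")
            case True
            note b = size_cell_bounds[OF eps_pos(1) i2 True]
            have "\<bar>\<epsilon> n * real i - x\<bar> < d" using b(2) n0[OF n] by linarith
            then have "\<bar>k (\<epsilon> n * real i) - k x\<bar> < e / (Q+1)" using b(1) eps_pos[of n] by (intro d(2)) auto
            then show ?thesis using True b(1) by simp
          qed simp
        qed
        finally have "\<bar>\<epsilon> n * k (\<epsilon> n * real i) - (LINT x:?cell i|lborel. ?k x)\<bar> \<le> \<epsilon> n * (e / (Q+1))" unfolding cint .
        then have "c n i t * \<bar>\<epsilon> n * k (\<epsilon> n * real i) - (LINT x:?cell i|lborel. ?k x)\<bar> \<le> c n i t * (\<epsilon> n * (e / (Q+1)))"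
          using c_nn[OF i2, of t n] t by (intro mult_left_mono) auto
        moreover have "c n i t * \<bar>\<epsilon> n * k (\<epsilon> n * real i) - (LINT x:?cell i|lborel. ?k x)\<bar>
           = \<bar>k (\<epsilon> n * real i) * (\<epsilon> n * c n i t) - c n i t * (LINT x:?cell i|lborel. ?k x)\<bar>"
        proof -
          have "k (\<epsilon> n * real i) * (\<epsilon> n * c n i t) - c n i t * (LINT x:?cell i|lborel. ?k x)
             = c n i t * (\<epsilon> n * k (\<epsilon> n * real i) - (LINT x:?cell i|lborel. ?k x))" by (simp add: algebra_simps)
          then show ?thesis using c_nn[OF i2, of t n] t by (simp add: abs_mult)
        qed
        ultimately show ?thesis by (simp add: mult_ac)
      qed
      ultimately have "\<bar>(\<Sum>i=2..N n. k (\<epsilon> n * real i) * (\<epsilon> n * c n i t)) - (\<integral>x. F n t x * ?k x \<partial>lborel)\<bar>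
         \<le> (\<Sum>i=2..N n. (e / (Q+1)) * (\<epsilon> n * c n i t))"
        by (simp only: sum_subtractf[symmetric]) (intro order_trans[OF sum_abs] sum_mono)
      also have "\<dots> = (e / (Q+1)) * (\<Sum>i=2..N n. \<epsilon> n * c n i t)" by (simp add: sum_distrib_left)
      also have "\<dots> \<le> (e / (Q+1)) * Q" using number[OF t, of n "N n"] e Q_nn by (intro mult_left_mono) auto
      also have "\<dots> < e" using e Q_nn by (simp add: field_simps)
      finally show ?thesis by simp
    qed
    then show "\<exists>no. \<forall>n\<ge>no. norm ((\<Sum>i=2..N n. k (\<epsilon> n * real i) * (\<epsilon> n * c n i t)) - (\<integral>x. F n t x * ?k x \<partial>lborel) - 0) < e" by blast
  qed
  from tendsto_add[OF this lim] show ?thesis by simp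
qed

end

lemma C1c_test_partials:
  assumes "C1c_test T \<phi> \<phi>t \<phi>x" "0 \<le> t" "t < T" "0 \<le> x"
  shows "((\<lambda>r. \<phi> (r, x)) has_real_derivative \<phi>t (t, x)) (at t within {0..})"
    "((\<lambda>y. \<phi> (t, y)) has_real_derivative \<phi>x (t, x)) (at x within {0..})"
proof -
  let ?D = "{0..<T} \<times> {0..} :: (real \<times> real) set"
  have d: "(\<phi> has_derivative (\<lambda>(h, k). \<phi>t (t, x) * h + \<phi>x (t, x) * k)) (at (t, x) within ?D)"
    using assms by (auto simp: C1c_test_def Let_def)
  have "((\<lambda>r. \<phi> (r, x)) has_derivative (\<lambda>h. (\<lambda>(h, k). \<phi>t (t, x) * h + \<phi>x (t, x) * k) (h, 0))) (at t within {0..<T})"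
  proof (rule has_derivative_in_compose[where f="\<lambda>r. (r, x)"])
    show "((\<lambda>r. (r, x)) has_derivative (\<lambda>h. (h, 0))) (at t within {0..<T})"
      by (intro derivative_intros)
    show "(\<phi> has_derivative (\<lambda>(h, k). \<phi>t (t, x) * h + \<phi>x (t, x) * k)) (at (t, x) within (\<lambda>r. (r, x)) ` {0..<T})"
      by (rule has_derivative_subset[OF d]) (use assms in auto)
  qed
  then have "((\<lambda>r. \<phi> (r, x)) has_real_derivative \<phi>t (t, x)) (at t within {0..<T})"
    by (simp add: has_field_derivative_def)
  moreover have "at t within {0..<T} = at t within {0..}"
    by (rule at_within_nhd[where S="{..<T}"]) (use assms in auto)
  ultimately show "((\<lambda>r. \<phi> (r, x)) has_real_derivative \<phi>t (t, x)) (at t within {0..})" by simp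
  have "((\<lambda>y. \<phi> (t, y)) has_derivative (\<lambda>k. (\<lambda>(h, k). \<phi>t (t, x) * h + \<phi>x (t, x) * k) (0, k))) (at x within {0..})"
  proof (rule has_derivative_in_compose[where f="\<lambda>y. (t, y)"])
    show "((\<lambda>y. (t, y)) has_derivative (\<lambda>k. (0, k))) (at x within {0..})"
      by (intro derivative_intros)
    show "(\<phi> has_derivative (\<lambda>(h, k). \<phi>t (t, x) * h + \<phi>x (t, x) * k)) (at (t, x) within (\<lambda>y. (t, y)) ` {0..})"
      by (rule has_derivative_subset[OF d]) (use assms in auto)
  qed
  then show "((\<lambda>y. \<phi> (t, y)) has_real_derivative \<phi>x (t, x)) (at x within {0..})"
    by (simp add: has_field_derivative_def)
qed

lemma real_derivative_zero_on_right_nhd: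
  fixes h :: "real \<Rightarrow> real"
  assumes "(h has_real_derivative d) (at t within {0..})" "0 \<le> t" "t < b" "\<And>r. t \<le> r \<Longrightarrow> r < b \<Longrightarrow> h r = 0"
  shows "d = 0"
proof -
  let ?S = "{t..(t+b)/2}"
  have "(h has_real_derivative d) (at t within ?S)" by (rule DERIV_subset[OF assms(1)]) (use assms in auto)
  moreover have "(h has_real_derivative 0) (at t within ?S)"
    by (rule has_field_derivative_transform_within[OF DERIV_const[of 0] zero_less_one]) (use assms in auto)
  moreover have "at t within ?S \<noteq> bot" using assms(3) by (simp add: at_within_Icc_at_right trivial_limit_at_right_real)
  ultimately show ?thesis unfolding has_real_derivative_iff_has_vector_derivative
    using vector_derivative_unique_within by metis
qed

lemma C1c_test_support:
  assumes \<phi>: "C1c_test T \<phi> \<phi>t \<phi>x" and T: "0 < T"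
  obtains T1 R C where "0 < T1" "T1 < T" "0 < R" "0 \<le> C"
    "\<And>t x. 0 \<le> t \<Longrightarrow> t < T \<Longrightarrow> 0 \<le> x \<Longrightarrow> T1 \<le> t \<or> R \<le> x \<Longrightarrow> \<phi> (t,x) = 0 \<and> \<phi>t (t,x) = 0 \<and> \<phi>x (t,x) = 0"
    "\<And>t x. 0 \<le> t \<Longrightarrow> t < T \<Longrightarrow> 0 \<le> x \<Longrightarrow> \<bar>\<phi> (t,x)\<bar> \<le> C \<and> \<bar>\<phi>t (t,x)\<bar> \<le> C \<and> \<bar>\<phi>x (t,x)\<bar> \<le> C"
proof -
  let ?D = "{0..<T} \<times> {0..} :: (real \<times> real) set"
  note \<phi>' = \<phi>[unfolded C1c_test_def Let_def]
  note diff = \<phi>'[THEN conjunct1]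
  note ct = \<phi>'[THEN conjunct2, THEN conjunct1]
  note cx = \<phi>'[THEN conjunct2, THEN conjunct2, THEN conjunct1]
  obtain K where K0: "compact K" "K \<subseteq> ?D" "\<forall>p\<in>?D - K. \<phi> p = 0"
    using \<phi>'[THEN conjunct2, THEN conjunct2, THEN conjunct2] by (elim exE conjE) (rule that)
  then have K: "compact K" "K \<subseteq> ?D" "\<And>p. p \<in> ?D - K \<Longrightarrow> \<phi> p = 0" by simp_all
  have cf: "continuous_on ?D \<phi>"
    unfolding continuous_on_eq_continuous_within
  proof
    fix p assume "p \<in> ?D"
    then have "(\<phi> has_derivative (\<lambda>(h, k). \<phi>t p * h + \<phi>x p * k)) (at p within ?D)"
      using diff by (rule bspec[rotated])
    then show "continuous (at p within ?D) \<phi>" by (rule has_derivative_continuous)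
  qed
  obtain T1 where T1: "0 < T1" "T1 < T" "\<And>p. p \<in> K \<Longrightarrow> fst p < T1"
  proof (cases "K = {}")
    case True
    then show ?thesis using T that[of "T/2"] by auto
  next
    case False
    have "compact (fst ` K)" using K(1) by (intro compact_continuous_image continuous_intros) auto
    then obtain z where z: "z \<in> fst ` K" "\<And>y. y \<in> fst ` K \<Longrightarrow> y \<le> z"
      using compact_attains_sup[of "fst ` K"] False by auto
    have zz: "0 \<le> z" "z < T" using z(1) K(2) by auto
    show ?thesis
    proof (rule that[of "(z+T)/2"])
      show "fst p < (z + T) / 2" if "p \<in> K" for p using z(2)[of "fst p"] that zz by auto
    qed (use zz in auto)
  qed
  obtain R where R: "0 < R" "\<And>p. p \<in> K \<Longrightarrow> snd p < R"
  proof -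
    have "bounded (snd ` K)" using K(1) by (intro compact_imp_bounded compact_continuous_image continuous_intros) auto
    then obtain b where b: "\<forall>y\<in>snd ` K. norm y \<le> b" unfolding bounded_iff by blast
    show ?thesis
    proof (rule that[of "\<bar>b\<bar> + 1"])
      fix p assume "p \<in> K"
      then have "norm (snd p) \<le> b" using b by blast
      then show "snd p < \<bar>b\<bar> + 1" by simp
    qed simp
  qed
  have z0: "\<phi> (t,x) = 0" if "0 \<le> t" "t < T" "0 \<le> x" "T1 \<le> t \<or> R \<le> x" for t x
  proof (rule K(3))
    have "(t,x) \<notin> K" using T1(3)[of "(t,x)"] R(2)[of "(t,x)"] that by auto
    then show "(t,x) \<in> ?D - K" using that by auto
  qed
  have z: "\<phi> (t,x) = 0 \<and> \<phi>t (t,x) = 0 \<and> \<phi>x (t,x) = 0" if tx: "0 \<le> t" "t < T" "0 \<le> x" "T1 \<le> t \<or> R \<le> x" for t x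
  proof (intro conjI)
    show "\<phi> (t,x) = 0" using z0 tx by blast
    show "\<phi>t (t,x) = 0"
      by (rule real_derivative_zero_on_right_nhd[OF C1c_test_partials(1)[OF \<phi> tx(1-3)], of T]) (use tx in \<open>auto intro!: z0\<close>)
    show "\<phi>x (t,x) = 0"
      by (rule real_derivative_zero_on_right_nhd[OF C1c_test_partials(2)[OF \<phi> tx(1-3)], of "x+1"]) (use tx in \<open>auto intro!: z0\<close>)
  qed
  have sub: "{0..T1} \<times> {0..R} \<subseteq> ?D" using T1 by auto
  have "\<exists>C. \<forall>p\<in>{0..T1} \<times> {0..R}. \<bar>h p\<bar> \<le> C" if "continuous_on ?D h" for h :: "real \<times> real \<Rightarrow> real"
  proof -
    have "compact (h ` ({0..T1} \<times> {0..R}))"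
      by (intro compact_continuous_image continuous_on_subset[OF that sub] compact_Times) auto
    from compact_imp_bounded[OF this] show ?thesis unfolding bounded_iff by auto
  qed
  from this[OF cf] this[OF ct] this[OF cx] obtain C1 C2 C3 where C:
    "\<And>p. p \<in> {0..T1} \<times> {0..R} \<Longrightarrow> \<bar>\<phi> p\<bar> \<le> C1" "\<And>p. p \<in> {0..T1} \<times> {0..R} \<Longrightarrow> \<bar>\<phi>t p\<bar> \<le> C2" "\<And>p. p \<in> {0..T1} \<times> {0..R} \<Longrightarrow> \<bar>\<phi>x p\<bar> \<le> C3"
    by blast
  define C where "C = \<bar>C1\<bar> + \<bar>C2\<bar> + \<bar>C3\<bar>"
  show ?thesis
  proof (rule that[OF T1(1,2) R(1) _ z])
    show "0 \<le> C" by (simp add: C_def)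
    fix t x assume tx: "0 \<le> t" "t < T" "0 \<le> (x::real)"
    show "\<bar>\<phi> (t,x)\<bar> \<le> C \<and> \<bar>\<phi>t (t,x)\<bar> \<le> C \<and> \<bar>\<phi>x (t,x)\<bar> \<le> C"
    proof (cases "T1 \<le> t \<or> R \<le> x")
      case True
      then show ?thesis using z[OF tx True] by (simp add: C_def)
    next
      case False
      then have "(t,x) \<in> {0..T1} \<times> {0..R}" using tx by auto
      then show ?thesis using C[of "(t,x)"] unfolding C_def by fastforce
    qed
  qed
qed

lemma increment_le_derivative_bound:
  fixes k0 k1 :: "real \<Rightarrow> real"
  assumes k: "\<And>x. 0 \<le> x \<Longrightarrow> (k0 has_real_derivative k1 x) (at x within {0..})" and x: "0 \<le> x" "x < y"
  obtains z where "x \<le> z" "z \<le> y" "k0 y - k0 x = (y - x) * k1 z"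
proof -
  have "(k0 has_derivative (*) (k1 z)) (at z within {x..y})" if "x \<le> z" "z \<le> y" for z
    using k[of z] that x by (auto simp: has_field_derivative_def intro: has_derivative_subset)
  from mvt_very_simple[OF less_imp_le[OF x(2)] this] obtain z where "z \<in> {x..y}" "k0 y - k0 x = k1 z * (y - x)" by blast
  then show ?thesis using that[of z] by (auto simp: mult.commute)
qed

context BD_limit_setting
begin

definition gg :: "nat \<Rightarrow> nat \<Rightarrow> real \<Rightarrow> real" where "gg n = BD_power_law.g (\<epsilon> n) s (c n)"
definition JJ :: "nat \<Rightarrow> nat \<Rightarrow> real \<Rightarrow> real" where
  "JJ n = BD_power_law.J \<eta> (\<epsilon> n) (A n) (B n) (ae n) (be n) (u n) (c n)"

lemma gg_eq: "gg n i t = (\<epsilon> n * real i) powr s * c n i t"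
  by (simp add: gg_def BD_power_law.g_def[OF bd])

lemma gg_nn: "2 \<le> i \<Longrightarrow> 0 \<le> t \<Longrightarrow> 0 \<le> gg n i t"
  unfolding gg_def by (rule BD_power_law.g_nonneg[OF bd])

lemma gg_sum: assumes t: "t \<in> {0..T}" shows "(\<Sum>i=2..N. \<epsilon> n * gg n i t) \<le> Q + M"
  unfolding gg_def by (rule BD_power_law.sum_g_le[OF bd _ number[OF t]]) (use t in auto)

lemma s01: "0 < s" "s < 1" using BD_power_law.s[OF bd] by auto
lemma ab: "0 < abar" "0 < bbar" using BD_power_law.ab[OF bd] by auto

lemma weighted_flux_sum_tendsto:
  assumes k1: "continuous_on {0..} k1" "\<And>x. R \<le> x \<Longrightarrow> k1 x = 0" and R: "0 < R" and t: "t \<in> {0..T}"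
    and N: "\<And>n. R \<le> \<epsilon> n * real (N n)"
    and d: "\<And>n i. 2 \<le> i \<Longrightarrow> \<exists>z. 0 \<le> z \<and> \<bar>z - \<epsilon> n * real i\<bar> \<le> \<epsilon> n \<and> d n i = \<epsilon> n * k1 z"
  shows "(\<lambda>n. \<Sum>i=2..N n. d n i * gg n i t) \<longlonglongrightarrow> (\<integral>x. f t x * (indicator {0..} x * (k1 x * x powr s)) \<partial>lborel)"
proof -
  have cont: "continuous_on {0..} (\<lambda>x. k1 x * x powr s)"
    using s01 by (intro continuous_intros k1 continuous_on_powr') auto
  have lim: "(\<lambda>n. \<Sum>i=2..N n. (k1 (\<epsilon> n * real i) * (\<epsilon> n * real i) powr s) * (\<epsilon> n * c n i t))
      \<longlonglongrightarrow> (\<integral>x. f t x * (indicator {0..} x * (k1 x * x powr s)) \<partial>lborel)"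
    by (rule riemann_sum_tendsto[OF cont _ R t N]) (simp add: k1)
  have "(\<lambda>n. (\<Sum>i=2..N n. d n i * gg n i t) - (\<Sum>i=2..N n. (k1 (\<epsilon> n * real i) * (\<epsilon> n * real i) powr s) * (\<epsilon> n * c n i t))) \<longlonglongrightarrow> 0"
  proof (rule LIMSEQ_I)
    fix e :: real assume e: "0 < e"
    have QM: "0 \<le> Q + M" using Q_nn M_nn by simp
    have eQ: "0 < e / (Q + M + 1)" using e QM by simp
    have "\<exists>d>0. \<forall>x\<ge>0. \<forall>y\<ge>0. \<bar>x - y\<bar> < d \<longrightarrow> \<bar>k1 x - k1 y\<bar> < e / (Q + M + 1)"
      by (rule compact_support_uniformly_continuous(1)[of k1 R]) (use k1 R eQ in auto)
    then obtain \<delta> where \<delta>: "0 < \<delta>" "\<And>x y. 0 \<le> x \<Longrightarrow> 0 \<le> y \<Longrightarrow> \<bar>x - y\<bar> < \<delta> \<Longrightarrow> \<bar>k1 x - k1 y\<bar> < e / (Q + M + 1)"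
      by blast
    obtain n0 where n0: "\<And>n. n \<ge> n0 \<Longrightarrow> \<epsilon> n < \<delta>"
      using order_tendstoD(2)[OF eps_lim \<delta>(1)] by (auto simp: eventually_sequentially)
    have "norm ((\<Sum>i=2..N n. d n i * gg n i t) - (\<Sum>i=2..N n. (k1 (\<epsilon> n * real i) * (\<epsilon> n * real i) powr s) * (\<epsilon> n * c n i t)) - 0) < e"
      if n: "n \<ge> n0" for n
    proof -
      have term_le: "\<bar>d n i * gg n i t - (k1 (\<epsilon> n * real i) * (\<epsilon> n * real i) powr s) * (\<epsilon> n * c n i t)\<bar> \<le> e / (Q + M + 1) * (\<epsilon> n * gg n i t)"
        if i: "i \<in> {2..N n}" for i
      proof -
        obtain z where z: "0 \<le> z" "\<bar>z - \<epsilon> n * real i\<bar> \<le> \<epsilon> n" "d n i = \<epsilon> n * k1 z" using d[of i n] i by auto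
        have "\<bar>z - \<epsilon> n * real i\<bar> < \<delta>" using z(2) n0[OF n] by linarith
        then have "\<bar>k1 z - k1 (\<epsilon> n * real i)\<bar> < e / (Q + M + 1)" using z(1) eps_pos[of n] by (intro \<delta>(2)) auto
        then have "\<bar>k1 z - k1 (\<epsilon> n * real i)\<bar> * (\<epsilon> n * gg n i t) \<le> e / (Q + M + 1) * (\<epsilon> n * gg n i t)"
          using eps_pos[of n] gg_nn[of i t n] i t by (intro mult_right_mono) auto
        moreover have "d n i * gg n i t - (k1 (\<epsilon> n * real i) * (\<epsilon> n * real i) powr s) * (\<epsilon> n * c n i t)
            = (k1 z - k1 (\<epsilon> n * real i)) * (\<epsilon> n * gg n i t)"
          unfolding z(3) gg_eq by (simp add: algebra_simps)
        ultimately show ?thesis using eps_pos[of n] gg_nn[of i t n] i t by (simp add: abs_mult)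
      qed
      have "\<bar>(\<Sum>i=2..N n. d n i * gg n i t) - (\<Sum>i=2..N n. (k1 (\<epsilon> n * real i) * (\<epsilon> n * real i) powr s) * (\<epsilon> n * c n i t))\<bar>
         \<le> (\<Sum>i=2..N n. e / (Q + M + 1) * (\<epsilon> n * gg n i t))"
        unfolding sum_subtractf[symmetric] by (intro order_trans[OF sum_abs] sum_mono term_le)
      also have "\<dots> = e / (Q + M + 1) * (\<Sum>i=2..N n. \<epsilon> n * gg n i t)" by (simp add: sum_distrib_left)
      also have "\<dots> \<le> e / (Q + M + 1) * (Q + M)" using gg_sum[OF t] eQ by (intro mult_left_mono) auto
      also have "\<dots> < e" using e QM by (simp add: field_simps)
      finally show ?thesis by simp
    qed
    then show "\<exists>no. \<forall>n\<ge>no. norm ((\<Sum>i=2..N n. d n i * gg n i t) - (\<Sum>i=2..N n. (k1 (\<epsilon> n * real i) * (\<epsilon> n * real i) powr s) * (\<epsilon> n * c n i t)) - 0) < e"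
      by blast
  qed
  from tendsto_add[OF this lim] show ?thesis by simp
qed

definition g2max :: real where "g2max = 2 * H / \<theta>^2"

lemma gg2_le: assumes t: "t \<in> {0..T}" shows "gg n 2 t \<le> g2max"
  unfolding gg_def g2max_def by (rule BD_power_law.two_moment_le[OF bd _ theta(1) moment[OF t]]) (use t in auto)

definition j1max :: real where "j1max = Ax * M\<^sup>2 + Bx * g2max"

lemma abs_JJ1_le: assumes t: "t \<in> {0..T}" shows "\<bar>JJ n 1 t\<bar> \<le> j1max"
proof -
  have "\<bar>JJ n 1 t\<bar> \<le> A n * M\<^sup>2 + B n * g2max"
    unfolding JJ_def by (rule BD_power_law.abs_J1_le[OF bd _ gg2_le[OF t, unfolded gg_def]]) (use t in auto)
  also have "\<dots> \<le> j1max" unfolding j1max_def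
    using gg2_le[OF t, of n] gg_nn[of 2 t n] t Ax Bx by (intro add_mono mult_right_mono) auto
  finally show ?thesis .
qed

lemma JJ_ge2: "2 \<le> i \<Longrightarrow> JJ n i t = abar * u n t * gg n i t - bbar * gg n (i+1) t"
  unfolding JJ_def gg_def by (rule BD_power_law.J_ge2[OF bd])

lemma test_flux_tendsto:
  assumes k: "\<And>x. 0 \<le> x \<Longrightarrow> (k0 has_real_derivative k1 x) (at x within {0..})"
    and k1: "continuous_on {0..} k1" "\<And>x. R \<le> x \<Longrightarrow> k1 x = 0" "\<And>x. R \<le> x \<Longrightarrow> k0 x = 0"
    and R: "0 < R" and t: "t \<in> {0..T}" and N: "\<And>n. R \<le> \<epsilon> n * real (N n)" "\<And>n. 2 \<le> N n"
  shows "(\<lambda>n. (\<Sum>i=2..N n. k0 (\<epsilon> n * real i) * (JJ n (i-1) t - JJ n i t)) - k0 (\<epsilon> n * 2) * JJ n 1 t)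
     \<longlonglongrightarrow> (abar * ul t - bbar) * (\<integral>x. f t x * (indicator {0..} x * (k1 x * x powr s)) \<partial>lborel)"
proof -
  let ?I = "\<integral>x. f t x * (indicator {0..} x * (k1 x * x powr s)) \<partial>lborel"
  define d1 where "d1 n i = k0 (\<epsilon> n * real (i+1)) - k0 (\<epsilon> n * real i)" for n i
  define d2 where "d2 n i = k0 (\<epsilon> n * real i) - k0 (\<epsilon> n * real (i-1))" for n i
  have l1: "(\<lambda>n. \<Sum>i=2..N n. d1 n i * gg n i t) \<longlonglongrightarrow> ?I"
  proof (rule weighted_flux_sum_tendsto[OF k1(1) _ R t N(1)])
    fix n i :: nat assume i: "2 \<le> i"
    have "\<epsilon> n * real i < \<epsilon> n * real (i+1)" "0 \<le> \<epsilon> n * real i" using eps_pos[of n] by auto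
    then obtain z where z: "\<epsilon> n * real i \<le> z" "z \<le> \<epsilon> n * real (i+1)" "d1 n i = (\<epsilon> n * real (i+1) - \<epsilon> n * real i) * k1 z"
      using increment_le_derivative_bound[OF k, of "\<epsilon> n * real i" "\<epsilon> n * real (i+1)"] unfolding d1_def by metis
    have "\<epsilon> n * real (i+1) = \<epsilon> n * real i + \<epsilon> n" by (simp add: algebra_simps)
    then show "\<exists>z\<ge>0. \<bar>z - \<epsilon> n * real i\<bar> \<le> \<epsilon> n \<and> d1 n i = \<epsilon> n * k1 z"
      using z order_trans[OF \<open>0 \<le> \<epsilon> n * real i\<close> z(1)] by (intro exI[of _ z]) auto
  qed (rule k1(2))
  have l2: "(\<lambda>n. \<Sum>i=2..N n. d2 n i * gg n i t) \<longlonglongrightarrow> ?I"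
  proof (rule weighted_flux_sum_tendsto[OF k1(1) _ R t N(1)])
    fix n i :: nat assume i: "2 \<le> i"
    have e: "\<epsilon> n * real i = \<epsilon> n * real (i-1) + \<epsilon> n" using i by (simp add: algebra_simps of_nat_diff)
    have "\<epsilon> n * real (i-1) < \<epsilon> n * real i" "0 \<le> \<epsilon> n * real (i-1)" using eps_pos[of n] e by auto
    then obtain z where z: "\<epsilon> n * real (i-1) \<le> z" "z \<le> \<epsilon> n * real i" "d2 n i = (\<epsilon> n * real i - \<epsilon> n * real (i-1)) * k1 z"
      using increment_le_derivative_bound[OF k, of "\<epsilon> n * real (i-1)" "\<epsilon> n * real i"] unfolding d2_def by metis
    show "\<exists>z\<ge>0. \<bar>z - \<epsilon> n * real i\<bar> \<le> \<epsilon> n \<and> d2 n i = \<epsilon> n * k1 z"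
      using z e order_trans[OF \<open>0 \<le> \<epsilon> n * real (i-1)\<close> z(1)] by (intro exI[of _ z]) auto
  qed (rule k1(2))
  have "\<exists>C\<ge>0. \<forall>x\<ge>0. \<bar>k1 x\<bar> \<le> C"
    by (rule compact_support_uniformly_continuous(2)[of k1 R]) (use k1 R in auto)
  then obtain C where C: "0 \<le> C" "\<And>x. 0 \<le> x \<Longrightarrow> \<bar>k1 x\<bar> \<le> C" by blast
  have l3: "(\<lambda>n. d2 n 2 * gg n 2 t) \<longlonglongrightarrow> 0"
  proof (rule Lim_null_comparison)
    show "\<forall>\<^sub>F n in sequentially. norm (d2 n 2 * gg n 2 t) \<le> \<epsilon> n * (C * g2max)"
    proof (intro always_eventually allI)
      fix n
      obtain z where z: "\<epsilon> n \<le> z" "d2 n 2 = \<epsilon> n * k1 z"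
        using increment_le_derivative_bound[OF k, of "\<epsilon> n" "\<epsilon> n * 2"] eps_pos[of n] unfolding d2_def by (auto simp: algebra_simps)
      have "\<bar>k1 z\<bar> * gg n 2 t \<le> C * g2max"
        using C(2)[of z] z(1) eps_pos[of n] gg2_le[OF t, of n] gg_nn[of 2 t n] C(1) t by (intro mult_mono) auto
      then show "norm (d2 n 2 * gg n 2 t) \<le> \<epsilon> n * (C * g2max)"
        using eps_pos[of n] gg_nn[of 2 t n] t z(2) by (simp add: abs_mult mult.assoc)
    qed
    show "(\<lambda>n. \<epsilon> n * (C * g2max)) \<longlonglongrightarrow> 0" using tendsto_mult_right[OF eps_lim, of "C * g2max"] by simp
  qed
  have eq: "(\<Sum>i=2..N n. k0 (\<epsilon> n * real i) * (JJ n (i-1) t - JJ n i t)) - k0 (\<epsilon> n * 2) * JJ n 1 t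
      = abar * u n t * (\<Sum>i=2..N n. d1 n i * gg n i t) - bbar * ((\<Sum>i=2..N n. d2 n i * gg n i t) - d2 n 2 * gg n 2 t)" for n
  proof -
    have z: "k0 (\<epsilon> n * real (N n)) = 0" "k0 (\<epsilon> n * real (N n + 1)) = 0"
      using N(1)[of n] eps_pos[of n] by (auto intro!: k1(3) simp: algebra_simps)
    have "(\<Sum>i=2..N n. k0 (\<epsilon> n * real i) * (JJ n (i-1) t - JJ n i t)) = k0 (\<epsilon> n * 2) * JJ n 1 t + (\<Sum>i=2..<N n. d1 n i * JJ n i t)"
      using sum_by_parts_flux[OF N(2)[of n], of "\<lambda>i. k0 (\<epsilon> n * real i)" "\<lambda>i. JJ n i t"] z(1) by (simp add: d1_def)
    also have "(\<Sum>i=2..<N n. d1 n i * JJ n i t) = (\<Sum>i=2..<N n. abar * u n t * (d1 n i * gg n i t) - bbar * (d2 n (i+1) * gg n (i+1) t))"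
      by (intro sum.cong refl) (simp add: JJ_ge2 d1_def d2_def algebra_simps)
    also have "\<dots> = abar * u n t * (\<Sum>i=2..<N n. d1 n i * gg n i t) - bbar * (\<Sum>i=2..<N n. d2 n (i+1) * gg n (i+1) t)"
      by (simp add: sum_subtractf sum_distrib_left)
    also have "(\<Sum>i=2..<N n. d1 n i * gg n i t) = (\<Sum>i=2..N n. d1 n i * gg n i t)"
    proof -
      have "{2..N n} = insert (N n) {2..<N n}" using N(2)[of n] by auto
      then show ?thesis using z by (simp add: d1_def)
    qed
    also have "(\<Sum>i=2..<N n. d2 n (i+1) * gg n (i+1) t) = (\<Sum>i=2..N n. d2 n i * gg n i t) - d2 n 2 * gg n 2 t"
    proof -
      have "(\<Sum>i=2..<N n. d2 n (i+1) * gg n (i+1) t) = (\<Sum>i=2+1..<N n+1. d2 n i * gg n i t)"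
        by (subst sum.shift_bounds_nat_ivl) simp
      also have "{2+1..<N n+1} = {2..N n} - {2}" by auto
      finally show ?thesis using N(2)[of n] by (simp add: sum_diff1)
    qed
    finally show ?thesis by simp
  qed
  have "(\<lambda>n. abar * u n t * (\<Sum>i=2..N n. d1 n i * gg n i t) - bbar * ((\<Sum>i=2..N n. d2 n i * gg n i t) - d2 n 2 * gg n 2 t))
      \<longlonglongrightarrow> abar * ul t * ?I - bbar * (?I - 0)"
    by (intro tendsto_intros l1 l2 l3 u_tendsto t)
  then show ?thesis unfolding eq by (simp add: algebra_simps)
qed

end

context BD_limit_setting
begin

definition kap :: "nat \<Rightarrow> real" where "kap n = BD_power_law.\<kappa> \<eta> (\<epsilon> n) (B n) s"

definition kap_lim :: real where "kap_lim = (if \<eta> > s then 0 else \<beta> / 2 powr s)"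

definition Nrate :: "real \<Rightarrow> real" where
  "Nrate w = \<alpha> * w\<^sup>2 * ((abar * w - bbar) / (abar * w - bbar + kap_lim))"

lemma kap_eq: "kap n = \<epsilon> n powr (\<eta> - s) * B n / 2 powr s"
  by (simp add: kap_def BD_power_law.\<kappa>_def[OF bd])

lemma kap_nn: "0 \<le> kap n"
  unfolding kap_def by (rule BD_power_law.kappa_nonneg[OF bd])

lemma kap_tendsto: "kap \<longlonglongrightarrow> kap_lim"
proof (cases "\<eta> > s")
  case True
  have "(\<lambda>n. \<epsilon> n powr (\<eta> - s)) \<longlonglongrightarrow> 0"
  proof -
    have "(\<lambda>n. \<epsilon> n powr (\<eta> - s)) \<longlonglongrightarrow> 0 powr (\<eta> - s)"
      using True eps_pos by (intro tendsto_powr2 eps_lim tendsto_const) (auto simp: less_imp_le)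
    then show ?thesis by simp
  qed
  then have "(\<lambda>n. \<epsilon> n powr (\<eta> - s) * B n / 2 powr s) \<longlonglongrightarrow> 0 * \<beta> / 2 powr s"
    by (intro tendsto_intros B_lim) auto
  then show ?thesis using True by (simp add: kap_lim_def kap_eq[abs_def])
next
  case False
  then have "\<eta> - s = 0" using BD_power_law.eta[OF bd] by simp
  have kB: "kap n = B n / 2 powr s" for n unfolding kap_eq using eps_pos[of n] \<open>\<eta> - s = 0\<close> by simp
  have "(\<lambda>n. B n / 2 powr s) \<longlonglongrightarrow> \<beta> / 2 powr s" by (intro tendsto_intros B_lim) auto
  moreover have "kap = (\<lambda>n. B n / 2 powr s)" using kB by (rule ext)
  ultimately show ?thesis using False by (simp add: kap_lim_def)
qed

lemma kap_lim_nn: "0 \<le> kap_lim" using beta_pos by (simp add: kap_lim_def)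

definition vmin :: real where "vmin = abar * ustar - bbar"

lemma vmin_pos: "0 < vmin" using ustar by (simp add: vmin_def)

lemma v_low: "t \<in> {0..T} \<Longrightarrow> vmin \<le> abar * u n t - bbar"
  using u_low[of t n] ab by (simp add: vmin_def)

lemma ul_v_low: "t \<in> {0..T} \<Longrightarrow> vmin \<le> abar * ul t - bbar"
  using ul_low[of t] ab by (simp add: vmin_def)

lemma u_cont: "S \<subseteq> {0..} \<Longrightarrow> continuous_on S (u n)"
  by (rule continuous_on_subset[OF BD_power_law.u_cont[OF bd]])

lemma JJ_cont: "1 \<le> i \<Longrightarrow> S \<subseteq> {0..} \<Longrightarrow> continuous_on S (JJ n i)"
  unfolding JJ_def by (rule continuous_on_subset[OF BD_power_law.J_cont[OF bd]])

lemma gg_cont: "2 \<le> i \<Longrightarrow> S \<subseteq> {0..} \<Longrightarrow> continuous_on S (gg n i)"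
  unfolding gg_def by (rule continuous_on_subset[OF BD_power_law.g_cont[OF bd]])

lemma JJ_1: "JJ n 1 t = A n * (u n t)\<^sup>2 - kap n * gg n 2 t"
  unfolding JJ_def kap_def gg_def by (rule BD_power_law.J_1[OF bd])

lemma quasi_steady_defect_tendsto:
  assumes T1: "0 \<le> T1" "T1 \<le> T"
    and \<psi>: "\<And>r. 0 \<le> r \<Longrightarrow> r \<le> T1 \<Longrightarrow> (\<psi> has_real_derivative \<psi>' r) (at r within {0..})"
      "\<And>r. 0 \<le> r \<Longrightarrow> r \<le> T1 \<Longrightarrow> \<bar>\<psi> r\<bar> \<le> C" "\<And>r. 0 \<le> r \<Longrightarrow> r \<le> T1 \<Longrightarrow> \<bar>\<psi>' r\<bar> \<le> C"
  shows "(\<lambda>n. integral {0..T1} (\<lambda>r. \<psi> r * (kap n / (abar * u n r - bbar + kap n)) * (JJ n 1 r - (abar * u n r - bbar) * gg n 2 r))) \<longlonglongrightarrow> 0"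
proof -
  have C: "0 \<le> C" using \<psi>(2)[of 0] T1 by simp
  define C1 where "C1 = C + C * (abar * L / vmin)"
  define K where "K = 2 * C * H / \<theta>^2 + T1 * (C1 * H / \<theta>^2 + C * bbar
         + C * (bbar * L / (abar * ustar^2)) * (H / (\<theta>^3 * (1 - bbar / (abar * ustar) / \<theta>))))"
  have L: "0 \<le> L" using u_lipschitz[of 0 0] T by fastforce
  have bound: "\<bar>integral {0..T1} (\<lambda>r. \<psi> r * (kap n / (abar * u n r - bbar + kap n)) * (JJ n 1 r - (abar * u n r - bbar) * gg n 2 r))\<bar>
     \<le> \<epsilon> n powr (1-s) * K" for n
  proof -
    interpret N: BD_power_law \<eta> "\<epsilon> n" "A n" "B n" abar bbar s M "ae n" "be n" "u n" "c n" by (rule bd)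
    have "\<forall>t\<in>{0..T}. \<exists>u'. (u n has_real_derivative u') (at t within {0..}) \<and> \<bar>u'\<bar> \<le> L" using u_lipschitz by blast
    then obtain u' where u': "\<And>r. r \<in> {0..T} \<Longrightarrow> (u n has_real_derivative u' r) (at r within {0..}) \<and> \<bar>u' r\<bar> \<le> L" by metis
    let ?w = "\<lambda>r. abar * u n r - bbar + kap n"
    have w: "vmin \<le> ?w r" "0 < ?w r" "kap n \<le> ?w r" if "0 \<le> r" "r \<le> T1" for r
      using v_low[of r n] kap_nn[of n] vmin_pos that T1 by auto
    define \<Psi> where "\<Psi> r = \<psi> r * (kap n / ?w r)" for r
    define \<Psi>' where "\<Psi>' r = \<psi>' r * (kap n / ?w r) - \<psi> r * (kap n / ?w r) * ((abar * u' r) / ?w r)" for r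
    have ratio: "0 \<le> kap n / ?w r" "kap n / ?w r \<le> 1" if "0 \<le> r" "r \<le> T1" for r
      using w[OF that] kap_nn by auto
    have "\<bar>integral {0..T1} (\<lambda>r. \<Psi> r * (N.J 1 r - N.v r * N.g 2 r))\<bar>
      \<le> \<epsilon> n powr (1-s) * (2 * C * H / \<theta>^2 + T1 * (C1 * H / \<theta>^2 + C * bbar
         + C * (bbar * L / (abar * ustar^2)) * (H / (\<theta>^3 * (1 - bbar / (abar * ustar) / \<theta>)))))"
    proof (rule N.boundary_flux_equilibrates[OF _ ustar(1) T1(1) theta])
      fix r assume r: "0 \<le> r" "r \<le> T1"
      then have rT: "r \<in> {0..T}" using T1 by auto
      show "ustar \<le> u n r" using u_low[OF rT] .
      show "(\<Sum>i=2..N. \<theta>^i * (\<epsilon> n powr s * c n i r)) \<le> H" for N using moment[OF rT] .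
      show "(u n has_real_derivative u' r) (at r within {0..})" "\<bar>u' r\<bar> \<le> L" using u'[OF rT] by auto
      show "\<bar>\<Psi> r\<bar> \<le> C"
        using mult_mono[OF \<psi>(2)[OF r] ratio(2)[OF r] C ratio(1)[OF r]]
        by (simp only: \<Psi>_def abs_mult[of "\<psi> r"] abs_of_nonneg[OF ratio(1)[OF r]] mult_1_right)
      show "(\<Psi> has_real_derivative \<Psi>' r) (at r within {0..})"
      proof -
        have "(?w has_real_derivative abar * u' r) (at r within {0..})"
          using u'[OF rT] by (auto intro!: derivative_eq_intros)
        then have "((\<lambda>r. kap n / ?w r) has_real_derivative - (kap n * (abar * u' r)) / (?w r)^2) (at r within {0..})"
          using DERIV_divide[OF DERIV_const[of "kap n"], of ?w "abar * u' r" r "{0..}"] w(2)[OF r] by (simp add: power2_eq_square)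
        from DERIV_mult[OF \<psi>(1)[OF r] this] show ?thesis
          unfolding \<Psi>_def[abs_def] \<Psi>'_def by (simp add: power2_eq_square mult_ac)
      qed
      have "\<bar>\<Psi>' r\<bar> \<le> \<bar>\<psi>' r\<bar> * (kap n / ?w r) + \<bar>\<psi> r\<bar> * (kap n / ?w r) * (abar * \<bar>u' r\<bar> / ?w r)"
        unfolding \<Psi>'_def using ratio[OF r] w(2)[OF r] ab
        by (intro order_trans[OF abs_triangle_ineq4]) (simp add: abs_mult abs_of_nonneg[OF kap_nn])
      also have "\<dots> \<le> C * 1 + C * 1 * (abar * L / vmin)"
        using \<psi>(2,3)[OF r] ratio[OF r] w[OF r] vmin_pos u'[OF rT] ab C L
        by (intro add_mono mult_mono frac_le mult_left_mono) auto
      finally show "\<bar>\<Psi>' r\<bar> \<le> C1" by (simp add: C1_def)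
    qed
    then show ?thesis unfolding K_def \<Psi>_def N.v_def JJ_def gg_def .
  qed
  have "(\<lambda>n. \<epsilon> n powr (1-s) * K) \<longlonglongrightarrow> 0 powr (1-s) * K"
    using s01 eps_pos by (intro tendsto_intros tendsto_powr2 eps_lim) (auto simp: less_imp_le)
  then have "(\<lambda>n. \<epsilon> n powr (1-s) * K) \<longlonglongrightarrow> 0" by simp
  then show ?thesis
    by (rule Lim_null_comparison[rotated]) (intro always_eventually allI, simp only: real_norm_def bound)
qed

lemma boundary_flux_weak_limit:
  assumes T1: "0 \<le> T1" "T1 \<le> T"
    and \<psi>: "\<And>r. 0 \<le> r \<Longrightarrow> r \<le> T1 \<Longrightarrow> (\<psi> has_real_derivative \<psi>' r) (at r within {0..})"
      "\<And>r. 0 \<le> r \<Longrightarrow> r \<le> T1 \<Longrightarrow> \<bar>\<psi> r\<bar> \<le> C" "\<And>r. 0 \<le> r \<Longrightarrow> r \<le> T1 \<Longrightarrow> \<bar>\<psi>' r\<bar> \<le> C"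
  shows "(\<lambda>n. integral {0..T1} (\<lambda>r. \<psi> r * JJ n 1 r)) \<longlonglongrightarrow> (LINT r|lebesgue_on {0..T1}. \<psi> r * Nrate (ul r))"
proof -
  have C: "0 \<le> C" using \<psi>(2)[of 0] T1 by simp
  have sub: "{0..T1} \<subseteq> {0..}" "{0..T1} \<subseteq> {0..T}" using T1 by auto
  let ?w = "\<lambda>n r. abar * u n r - bbar + kap n"
  have w: "vmin \<le> abar * u n r - bbar" "0 < ?w n r" if "r \<in> {0..T1}" for n r
    using v_low[of r n] kap_nn[of n] vmin_pos that T1 by auto
  have wne: "?w n r \<noteq> 0" if "r \<in> {0..T1}" for n r using w(2)[OF that, of n] by simp
  define h where "h n r = \<psi> r * (A n * (u n r)\<^sup>2 * ((abar * u n r - bbar) / ?w n r))" for n r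
  define X where "X n r = \<psi> r * (kap n / ?w n r) * (JJ n 1 r - (abar * u n r - bbar) * gg n 2 r)" for n r
  have \<psi>c: "continuous_on {0..T1} \<psi>"
  proof (rule DERIV_continuous_on)
    fix r assume "r \<in> {0..T1}"
    then show "(\<psi> has_real_derivative \<psi>' r) (at r within {0..T1})" by (intro DERIV_subset[OF \<psi>(1)]) auto
  qed
  have hc: "continuous_on {0..T1} (h n)" for n
    unfolding h_def using wne by (intro continuous_intros \<psi>c u_cont[OF sub(1)]) blast
  have Xc: "continuous_on {0..T1} (X n)" for n
    unfolding X_def using wne by (intro continuous_intros \<psi>c u_cont[OF sub(1)] JJ_cont[OF _ sub(1)] gg_cont[OF _ sub(1)]) (blast, simp_all)
  have eq: "\<psi> r * JJ n 1 r = h n r + X n r" if r: "r \<in> {0..T1}" for n r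
  proof -
    let ?v = "abar * u n r - bbar" and ?W = "?w n r"
    have W: "?W \<noteq> 0" using w(2)[OF r, of n] by simp
    have "JJ n 1 r * ?W = A n * (u n r)\<^sup>2 * ?v + kap n * (JJ n 1 r - ?v * gg n 2 r)"
      unfolding JJ_1 by (simp add: algebra_simps)
    then have "JJ n 1 r = (A n * (u n r)\<^sup>2 * ?v + kap n * (JJ n 1 r - ?v * gg n 2 r)) / ?W"
      using W by (simp add: nonzero_eq_divide_eq)
    also have "\<dots> = A n * (u n r)\<^sup>2 * (?v / ?W) + (kap n / ?W) * (JJ n 1 r - ?v * gg n 2 r)"
      by (simp add: add_divide_distrib)
    finally have "\<psi> r * JJ n 1 r = \<psi> r * (A n * (u n r)\<^sup>2 * (?v / ?W) + (kap n / ?W) * (JJ n 1 r - ?v * gg n 2 r))" by simp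
    then show ?thesis by (simp add: h_def X_def distrib_left mult.assoc)
  qed
  have split: "integral {0..T1} (\<lambda>r. \<psi> r * JJ n 1 r) = (LINT r|lebesgue_on {0..T1}. h n r) + integral {0..T1} (X n)" for n
  proof -
    have "integral {0..T1} (\<lambda>r. \<psi> r * JJ n 1 r) = integral {0..T1} (\<lambda>r. h n r + X n r)"
      by (rule integral_cong) (rule eq)
    also have "\<dots> = integral {0..T1} (h n) + integral {0..T1} (X n)"
      by (intro Henstock_Kurzweil_Integration.integral_add integrable_continuous_real hc Xc)
    also have "integral {0..T1} (h n) = (LINT r|lebesgue_on {0..T1}. h n r)"
      by (rule lebesgue_integral_eq_integral[symmetric, OF continuous_imp_integrable_real[OF hc]]) auto
    finally show ?thesis .
  qed
  have "(\<lambda>n. LINT r|lebesgue_on {0..T1}. h n r) \<longlonglongrightarrow> (LINT r|lebesgue_on {0..T1}. \<psi> r * Nrate (ul r))"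
  proof (rule integral_dominated_convergence[where w="\<lambda>_. C * (Ax * M\<^sup>2)"])
    show hm: "h n \<in> borel_measurable (lebesgue_on {0..T1})" for n
      using continuous_imp_integrable_real[OF hc] by auto
    have lim: "(\<lambda>n. h n r) \<longlonglongrightarrow> \<psi> r * Nrate (ul r)" if r: "r \<in> {0..T1}" for r
    proof -
      have rT: "r \<in> {0..T}" using r T1 by auto
      have "abar * ul r - bbar + kap_lim \<noteq> 0" using ul_v_low[OF rT] vmin_pos kap_lim_nn by linarith
      then show ?thesis unfolding h_def Nrate_def
        by (intro tendsto_intros u_tendsto[OF rT] A_lim kap_tendsto)
    qed
    then show "AE r in lebesgue_on {0..T1}. (\<lambda>n. h n r) \<longlonglongrightarrow> \<psi> r * Nrate (ul r)"
      by (intro AE_I2) (simp add: space_restrict_space)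
    show "(\<lambda>r. \<psi> r * Nrate (ul r)) \<in> borel_measurable (lebesgue_on {0..T1})"
      by (rule borel_measurable_LIMSEQ_real[OF _ hm]) (use lim in \<open>simp add: space_restrict_space\<close>)
    show "integrable (lebesgue_on {0..T1}) (\<lambda>_. C * (Ax * M\<^sup>2))"
      by (rule continuous_imp_integrable_real) auto
    show "AE r in lebesgue_on {0..T1}. norm (h n r) \<le> C * (Ax * M\<^sup>2)" for n
    proof (intro AE_I2)
      fix r assume "r \<in> space (lebesgue_on {0..T1})"
      then have r: "r \<in> {0..T1}" by simp
      have r0: "0 \<le> r" "r \<le> T1" using r by auto
      have q: "0 \<le> (abar * u n r - bbar) / ?w n r" "(abar * u n r - bbar) / ?w n r \<le> 1"
        using w[OF r, of n] vmin_pos kap_nn[of n] by auto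
      have "(u n r)\<^sup>2 \<le> M\<^sup>2"
        using BD_power_law.u_le[OF bd r0(1)] BD_power_law.u_nonneg[OF bd r0(1)] by (intro power_mono)
      moreover have "0 \<le> Ax" using Ax[of n] BD_power_law.AB(1)[OF bd, of n] by linarith
      ultimately have hA: "A n * (u n r)\<^sup>2 \<le> Ax * M\<^sup>2" using Ax BD_power_law.AB(1)[OF bd, of n] by (intro mult_mono) auto
      have "0 \<le> A n * (u n r)\<^sup>2" using BD_power_law.AB(1)[OF bd, of n] by simp
      have up: "A n * (u n r)\<^sup>2 * ((abar * u n r - bbar) / ?w n r) \<le> Ax * M\<^sup>2 * 1"
        by (rule mult_mono[OF hA q(2) _ q(1)]) (use \<open>0 \<le> Ax\<close> in auto)
      have lo: "0 \<le> A n * (u n r)\<^sup>2 * ((abar * u n r - bbar) / ?w n r)"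
        by (rule mult_nonneg_nonneg[OF \<open>0 \<le> A n * (u n r)\<^sup>2\<close> q(1)])
      have "\<bar>\<psi> r\<bar> * \<bar>A n * (u n r)\<^sup>2 * ((abar * u n r - bbar) / ?w n r)\<bar> \<le> C * (Ax * M\<^sup>2)"
        using mult_mono[OF \<psi>(2)[OF r0] up C lo] unfolding abs_of_nonneg[OF lo] by (simp only: mult_1_right)
      then show "norm (h n r) \<le> C * (Ax * M\<^sup>2)" by (simp only: h_def real_norm_def abs_mult)
    qed
  qed
  moreover have "(\<lambda>n. integral {0..T1} (X n)) \<longlonglongrightarrow> 0"
    unfolding X_def[abs_def] by (rule quasi_steady_defect_tendsto[OF T1 \<psi>])
  ultimately have "(\<lambda>n. (LINT r|lebesgue_on {0..T1}. h n r) + integral {0..T1} (X n)) \<longlonglongrightarrow> (LINT r|lebesgue_on {0..T1}. \<psi> r * Nrate (ul r)) + 0"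
    by (rule tendsto_add)
  then show ?thesis unfolding split by simp
qed

lemma lebesgue_on_extend_zero:
  fixes h :: "real \<Rightarrow> real"
  assumes "T1 < T" "\<And>t. T1 < t \<Longrightarrow> t < T \<Longrightarrow> h t = 0"
  shows "(LINT t|lebesgue_on {0..<T}. h t) = (LINT t|lebesgue_on {0..T1}. h t)"
proof -
  have "(LINT t|lebesgue_on {0..<T}. h t) = (LINT t|lebesgue. indicator {0..<T} t *\<^sub>R h t)"
    by (rule integral_restrict_space) auto
  also have "(\<lambda>t. indicator {0..<T} t *\<^sub>R h t) = (\<lambda>t. indicator {0..T1} t *\<^sub>R h t)"
    using assms by (auto simp: indicator_def fun_eq_iff)
  also have "(LINT t|lebesgue. indicator {0..T1} t *\<^sub>R h t) = (LINT t|lebesgue_on {0..T1}. h t)"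
    by (rule integral_restrict_space[symmetric]) auto
  finally show ?thesis .
qed

lemma weak_equation:
  assumes \<phi>: "C1c_test T \<phi> \<phi>t \<phi>x"
  shows "(LINT t|lebesgue_on {0..<T}. (\<integral>x. f t x * (indicator {0..} x * (\<phi>t (t,x) + (abar * x powr s * ul t - bbar * x powr s) * \<phi>x (t,x))) \<partial>lborel))
    + (\<integral>x. \<phi> (0, x) \<partial>\<mu>in) + (LINT r|lebesgue_on {0..<T}. \<phi> (r, 0) * Nrate (ul r)) = 0"
proof -
  obtain T1 R C where T1: "0 < T1" "T1 < T" and R: "0 < R" and C: "0 \<le> C" and
    z: "\<And>t x. 0 \<le> t \<Longrightarrow> t < T \<Longrightarrow> 0 \<le> x \<Longrightarrow> T1 \<le> t \<or> R \<le> x \<Longrightarrow> \<phi> (t,x) = 0 \<and> \<phi>t (t,x) = 0 \<and> \<phi>x (t,x) = 0" and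
    b: "\<And>t x. 0 \<le> t \<Longrightarrow> t < T \<Longrightarrow> 0 \<le> x \<Longrightarrow> \<bar>\<phi> (t,x)\<bar> \<le> C \<and> \<bar>\<phi>t (t,x)\<bar> \<le> C \<and> \<bar>\<phi>x (t,x)\<bar> \<le> C"
    by (rule C1c_test_support[OF \<phi> T]) blast
  note \<phi>' = \<phi>[unfolded C1c_test_def Let_def]
  note ct = \<phi>'[THEN conjunct2, THEN conjunct1]
  note cx = \<phi>'[THEN conjunct2, THEN conjunct2, THEN conjunct1]
  have sub: "{0..T1} \<subseteq> {0..}" by auto
  have in_T: "t \<in> {0..T}" "0 \<le> t" "t < T" if "t \<in> {0..T1}" for t using that T1 by auto
  have d_x: "((\<lambda>y. \<phi> (t, y)) has_real_derivative \<phi>x (t, x)) (at x within {0..})" if "t \<in> {0..T1}" "0 \<le> x" for t x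
    using C1c_test_partials(2)[OF \<phi>] in_T[OF that(1)] that(2) by blast
  have d_t: "((\<lambda>r. \<phi> (r, x)) has_real_derivative \<phi>t (t, x)) (at t within {0..})" if "t \<in> {0..T1}" "0 \<le> x" for t x
    using C1c_test_partials(1)[OF \<phi>] in_T[OF that(1)] that(2) by blast
  have ctx: "continuous_on {0..} (\<lambda>x. \<phi>t (t,x))" "continuous_on {0..} (\<lambda>x. \<phi>x (t,x))" if "t \<in> {0..T1}" for t
    using in_T[OF that] by (auto intro!: continuous_on_compose2[OF ct] continuous_on_compose2[OF cx] continuous_intros)
  have cf: "continuous_on {0..} (\<lambda>x. \<phi> (t,x))" if "t \<in> {0..T1}" for t
    using d_x[OF that] by (intro DERIV_continuous_on) auto
  have ctt: "continuous_on {0..T1} (\<lambda>t. \<phi>t (t,x))" if "0 \<le> x" for x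
    using that T1 by (auto intro!: continuous_on_compose2[OF ct] continuous_intros)
  have cft: "continuous_on {0..T1} (\<lambda>t. \<phi> (t,x))" if "0 \<le> x" for x
  proof (rule DERIV_continuous_on)
    fix t assume "t \<in> {0..T1}"
    then show "((\<lambda>t. \<phi> (t,x)) has_real_derivative \<phi>t (t,x)) (at t within {0..T1})"
      by (intro DERIV_subset[OF d_t[OF _ that]]) auto
  qed
  define N where "N n = nat \<lceil>R / \<epsilon> n\<rceil> + 2" for n
  have N: "2 \<le> N n" "R \<le> \<epsilon> n * real (N n)" for n
  proof -
    have "R / \<epsilon> n \<le> real (N n)" unfolding N_def by linarith
    then show "R \<le> \<epsilon> n * real (N n)" using eps_pos[of n] by (simp add: pos_divide_le_eq mult.commute)
  qed (simp add: N_def)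
  define S where "S n t = (\<Sum>i=2..N n. \<phi> (t, \<epsilon> n * real i) * (\<epsilon> n * c n i t))" for n t
  define P1 where "P1 n t = (\<Sum>i=2..N n. \<phi>t (t, \<epsilon> n * real i) * (\<epsilon> n * c n i t))" for n t
  define P2 where "P2 n t = (\<Sum>i=2..N n. \<phi> (t, \<epsilon> n * real i) * (JJ n (i-1) t - JJ n i t))" for n t
  define An where "An n t = P1 n t + (P2 n t - \<phi> (t, \<epsilon> n * 2) * JJ n 1 t)" for n t
  define G where "G t = (\<integral>x. f t x * (indicator {0..} x * (\<phi>t (t,x) + (abar * x powr s * ul t - bbar * x powr s) * \<phi>x (t,x))) \<partial>lborel)" for t
  have ei: "0 \<le> \<epsilon> n * real i" for n i using eps_pos[of n] by simp
  have Sd: "(S n has_real_derivative P1 n t + P2 n t) (at t within {0..})" if t: "t \<in> {0..T1}" for n t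
  proof -
    have "(S n has_real_derivative (\<Sum>i=2..N n. \<phi>t (t, \<epsilon> n * real i) * (\<epsilon> n * c n i t)
       + (\<epsilon> n * ((1 / \<epsilon> n) * (JJ n (i-1) t - JJ n i t))) * \<phi> (t, \<epsilon> n * real i))) (at t within {0..})"
      unfolding S_def[abs_def]
    proof (intro DERIV_sum DERIV_mult d_t[OF t ei] DERIV_cmult)
      fix i assume "i \<in> {2..N n}"
      then show "(c n i has_real_derivative (1 / \<epsilon> n) * (JJ n (i-1) t - JJ n i t)) (at t within {0..})"
        unfolding JJ_def using t by (intro BD_power_law.c_deriv[OF bd]) auto
    qed
    also have "(\<Sum>i=2..N n. \<phi>t (t, \<epsilon> n * real i) * (\<epsilon> n * c n i t)
       + (\<epsilon> n * ((1 / \<epsilon> n) * (JJ n (i-1) t - JJ n i t))) * \<phi> (t, \<epsilon> n * real i)) = P1 n t + P2 n t"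
      using eps_pos[of n] by (simp add: P1_def P2_def sum.distrib mult.commute)
    finally show ?thesis .
  qed
  have ccont: "continuous_on {0..T1} (c n i)" if "2 \<le> i" for n i
    using BD_power_law.c_cont[OF bd that] by (rule continuous_on_subset) auto
  have i1: "1 \<le> i - 1" if "i \<in> {2..N n}" for i n
  proof -
    have "2 \<le> i" using that by simp
    then show ?thesis by arith
  qed
  have P1c: "continuous_on {0..T1} (P1 n)" and P2c: "continuous_on {0..T1} (P2 n)" for n
    unfolding P1_def P2_def by (intro continuous_intros ctt cft ei ccont JJ_cont[OF _ sub]; (erule i1 | simp))+
  have Bc: "continuous_on {0..T1} (\<lambda>t. \<phi> (t, \<epsilon> n * 2) * JJ n 1 t)" for n
    using ei[of n 2] by (intro continuous_intros cft JJ_cont[OF _ sub]) auto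
  have Anc: "continuous_on {0..T1} (An n)" for n
    unfolding An_def by (intro continuous_intros P1c P2c Bc)
  have S_end: "S n T1 = 0" for n
    unfolding S_def using z[of T1] T1 ei by (intro sum.neutral) auto
  have FTC: "integral {0..T1} (An n) = - S n 0 - integral {0..T1} (\<lambda>t. \<phi> (t, \<epsilon> n * 2) * JJ n 1 t)" for n
  proof -
    have "((\<lambda>t. P1 n t + P2 n t) has_integral (S n T1 - S n 0)) {0..T1}"
    proof (rule fundamental_theorem_of_calculus)
      fix t assume "t \<in> {0..T1}"
      then have "(S n has_real_derivative P1 n t + P2 n t) (at t within {0..T1})" by (intro DERIV_subset[OF Sd]) auto
      then show "(S n has_vector_derivative P1 n t + P2 n t) (at t within {0..T1})"
        by (simp add: has_real_derivative_iff_has_vector_derivative)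
    qed (use T1 in auto)
    then have 1: "integral {0..T1} (\<lambda>t. P1 n t + P2 n t) = - S n 0" using S_end by (simp add: integral_unique)
    have "integral {0..T1} (An n) = integral {0..T1} (\<lambda>t. (P1 n t + P2 n t) - \<phi> (t, \<epsilon> n * 2) * JJ n 1 t)"
      by (rule integral_cong) (simp add: An_def)
    also have "\<dots> = integral {0..T1} (\<lambda>t. P1 n t + P2 n t) - integral {0..T1} (\<lambda>t. \<phi> (t, \<epsilon> n * 2) * JJ n 1 t)"
      by (intro Henstock_Kurzweil_Integration.integral_diff integrable_continuous_real continuous_intros P1c P2c Bc)
    finally show ?thesis using 1 by simp
  qed
  have A_lim: "(\<lambda>n. An n t) \<longlonglongrightarrow> G t" if t: "t \<in> {0..T1}" for t
  proof -
    note tT = in_T[OF t]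
    have zz: "R \<le> x \<Longrightarrow> \<phi> (t,x) = 0" "R \<le> x \<Longrightarrow> \<phi>t (t,x) = 0" "R \<le> x \<Longrightarrow> \<phi>x (t,x) = 0" for x
      using z[OF tT(2,3), of x] R by auto
    have l1: "(\<lambda>n. P1 n t) \<longlonglongrightarrow> (\<integral>x. f t x * (indicator {0..} x * \<phi>t (t,x)) \<partial>lborel)"
      unfolding P1_def by (rule riemann_sum_tendsto[OF ctx(1)[OF t] zz(2) R tT(1) N(2)])
    have l2: "(\<lambda>n. P2 n t - \<phi> (t, \<epsilon> n * 2) * JJ n 1 t) \<longlonglongrightarrow> (abar * ul t - bbar) * (\<integral>x. f t x * (indicator {0..} x * (\<phi>x (t,x) * x powr s)) \<partial>lborel)"
      unfolding P2_def by (rule test_flux_tendsto[OF d_x[OF t] ctx(2)[OF t] zz(3,1) R tT(1) N(2,1)])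
    have bd_int: "integrable lborel (\<lambda>x. f t x * (indicator {0..} x * k x))"
      if k: "continuous_on {0..} k" "\<And>x. R \<le> x \<Longrightarrow> k x = 0" for k :: "real \<Rightarrow> real"
    proof -
      have "\<exists>C\<ge>0. \<forall>x\<ge>0. \<bar>k x\<bar> \<le> C"
        by (rule compact_support_uniformly_continuous(2)[of k R]) (use k R in auto)
      then obtain C where "\<And>x. 0 \<le> x \<Longrightarrow> \<bar>k x\<bar> \<le> C" "0 \<le> C" by blast
      then show ?thesis
        by (intro integrable_mult_bounded[OF f_int[OF tT(1)] half_line_continuous_measurable[OF k(1)], of C]) (auto simp: indicator_def)
    qed
    have cxs: "continuous_on {0..} (\<lambda>x. \<phi>x (t,x) * x powr s)"
      using s01 by (intro continuous_intros ctx(2)[OF t] continuous_on_powr') auto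
    note i1 = bd_int[OF ctx(1)[OF t] zz(2)]
    have i2: "integrable lborel (\<lambda>x. f t x * (indicator {0..} x * (\<phi>x (t,x) * x powr s)))"
      by (rule bd_int[OF cxs]) (simp add: zz)
    have "G t = (\<integral>x. f t x * (indicator {0..} x * \<phi>t (t,x)) + (abar * ul t - bbar) * (f t x * (indicator {0..} x * (\<phi>x (t,x) * x powr s))) \<partial>lborel)"
      unfolding G_def by (intro Bochner_Integration.integral_cong refl) (simp add: algebra_simps)
    also have "\<dots> = (\<integral>x. f t x * (indicator {0..} x * \<phi>t (t,x)) \<partial>lborel) + (abar * ul t - bbar) * (\<integral>x. f t x * (indicator {0..} x * (\<phi>x (t,x) * x powr s)) \<partial>lborel)"
      using i1 i2 by simp
    finally show ?thesis unfolding An_def using tendsto_add[OF l1 l2] by simp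
  qed
  define D where "D = C * Q + (C * j1max + C * ((abar * M + bbar) * (Q + M))) + C * j1max"
  have A_bd: "\<bar>An n t\<bar> \<le> D" if t: "t \<in> {0..T1}" for n t
  proof -
    note tT = in_T[OF t]
    have p1: "\<bar>P1 n t\<bar> \<le> C * Q"
    proof -
      have "\<bar>P1 n t\<bar> \<le> (\<Sum>i=2..N n. C * (\<epsilon> n * c n i t))" unfolding P1_def
      proof (intro order_trans[OF sum_abs] sum_mono)
        fix i assume "i \<in> {2..N n}"
        then have "0 \<le> \<epsilon> n * c n i t" using c_nn[of i t n] eps_pos[of n] t by simp
        then show "\<bar>\<phi>t (t, \<epsilon> n * real i) * (\<epsilon> n * c n i t)\<bar> \<le> C * (\<epsilon> n * c n i t)"
          unfolding abs_mult[of "\<phi>t (t, \<epsilon> n * real i)"] using b[OF tT(2,3) ei[of n i]] by (simp add: mult_right_mono)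
      qed
      also have "\<dots> = C * (\<Sum>i=2..N n. \<epsilon> n * c n i t)" by (simp add: sum_distrib_left)
      also have "\<dots> \<le> C * Q" using number[OF tT(1)] C by (intro mult_left_mono) auto
      finally show ?thesis .
    qed
    have p2: "\<bar>P2 n t\<bar> \<le> C * j1max + C * ((abar * M + bbar) * (Q + M))"
      unfolding P2_def JJ_def
    proof (rule BD_power_law.flux_against_weights_le[OF bd tT(2) number[OF tT(1)] abs_JJ1_le[OF tT(1), unfolded JJ_def]])
      show "\<bar>\<phi> (t, \<epsilon> n * real 2)\<bar> \<le> C" using b[OF tT(2,3) ei[of n 2]] by simp
      show "\<phi> (t, \<epsilon> n * real (N n)) = 0" using z[OF tT(2,3) ei, of n "N n"] N(2) by simp
      fix i :: nat
      have "\<epsilon> n * real i < \<epsilon> n * real (i+1)" using eps_pos[of n] by simp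
      then obtain y where y: "\<epsilon> n * real i \<le> y" "\<phi> (t, \<epsilon> n * real (i+1)) - \<phi> (t, \<epsilon> n * real i) = (\<epsilon> n * real (i+1) - \<epsilon> n * real i) * \<phi>x (t, y)"
        using increment_le_derivative_bound[OF d_x[OF t] ei] by metis
      have "\<epsilon> n * real (i+1) - \<epsilon> n * real i = \<epsilon> n" by (simp add: algebra_simps)
      then show "\<bar>\<phi> (t, \<epsilon> n * real (i+1)) - \<phi> (t, \<epsilon> n * real i)\<bar> \<le> C * \<epsilon> n"
        using y(2) b[OF tT(2,3) order_trans[OF ei y(1)]] eps_pos[of n] by (simp add: abs_mult mult.commute mult_right_mono)
    qed (use N C in auto)
    have p3: "\<bar>\<phi> (t, \<epsilon> n * 2) * JJ n 1 t\<bar> \<le> C * j1max"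
      unfolding abs_mult using b[OF tT(2,3) ei[of n 2]] abs_JJ1_le[OF tT(1)] C by (intro mult_mono) auto
    show ?thesis unfolding An_def D_def using p1 p2 p3 by linarith
  qed
  have lim1: "(\<lambda>n. LINT t|lebesgue_on {0..T1}. An n t) \<longlonglongrightarrow> (LINT t|lebesgue_on {0..T1}. G t)"
  proof (rule integral_dominated_convergence[where w="\<lambda>_. D"])
    show m: "An n \<in> borel_measurable (lebesgue_on {0..T1})" for n
      using continuous_imp_integrable_real[OF Anc] by auto
    show "AE t in lebesgue_on {0..T1}. (\<lambda>n. An n t) \<longlonglongrightarrow> G t"
      using A_lim by (intro AE_I2) (simp add: space_restrict_space)
    show "G \<in> borel_measurable (lebesgue_on {0..T1})"
      by (rule borel_measurable_LIMSEQ_real[OF _ m]) (use A_lim in \<open>simp add: space_restrict_space\<close>)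
    show "integrable (lebesgue_on {0..T1}) (\<lambda>_. D)" by (rule continuous_imp_integrable_real) auto
    show "AE t in lebesgue_on {0..T1}. norm (An n t) \<le> D" for n
      using A_bd by (intro AE_I2) (simp add: space_restrict_space)
  qed
  have lim2: "(\<lambda>n. S n 0) \<longlonglongrightarrow> (\<integral>x. \<phi> (0, x) \<partial>\<mu>in)"
  proof -
    have 0: "0 \<in> {0..T1}" using T1 by simp
    note tT = in_T[OF 0]
    have zz: "R \<le> x \<Longrightarrow> \<phi> (0,x) = 0" for x using z[OF tT(2,3), of x] R by auto
    let ?k = "\<lambda>x. indicator {0..} x * \<phi> (0,x)"
    have km: "?k \<in> borel_measurable borel" by (rule half_line_continuous_measurable[OF cf[OF 0]])
    have kb: "\<bar>?k x\<bar> \<le> C" for x using b[OF tT(2,3), of x] C by (auto simp: indicator_def)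
    have "(\<lambda>x. \<phi> (0,x)) \<in> Cc_half_line"
      unfolding Cc_half_line_def using cf[OF 0] zz by (auto intro!: exI[of _ "{0..R}"])
    then have w: "(\<lambda>n. \<integral>x. \<phi> (0,x) \<partial>density half_line (\<lambda>x. ennreal (F n 0 x))) \<longlonglongrightarrow> (\<integral>x. \<phi> (0, x) \<partial>\<mu>in)"
      using init unfolding weak_star_tendsto_def by blast
    have "(\<integral>x. \<phi> (0,x) \<partial>density half_line (\<lambda>x. ennreal (F n 0 x))) = (\<integral>x. F n 0 x * ?k x \<partial>lborel)" for n
      by (rule integral_density_half_line(1)[OF F_meas _ km]) (simp add: F_nn)
    with w have "(\<lambda>n. \<integral>x. F n 0 x * ?k x \<partial>lborel) \<longlonglongrightarrow> (\<integral>x. \<phi> (0, x) \<partial>\<mu>in)" by simp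
    from LIMSEQ_unique[OF this tendsto_uniform_limitI[OF conv[OF km kb] tT(1)]]
    have "(\<integral>x. \<phi> (0, x) \<partial>\<mu>in) = (\<integral>x. f 0 x * ?k x \<partial>lborel)" .
    then show ?thesis
      unfolding S_def using riemann_sum_tendsto[OF cf[OF 0] zz R tT(1) N(2)] by simp
  qed
  have lim3: "(\<lambda>n. integral {0..T1} (\<lambda>t. \<phi> (t, \<epsilon> n * 2) * JJ n 1 t)) \<longlonglongrightarrow> (LINT r|lebesgue_on {0..T1}. \<phi> (r, 0) * Nrate (ul r))"
  proof -
    have l: "(\<lambda>n. integral {0..T1} (\<lambda>r. \<phi> (r, 0) * JJ n 1 r)) \<longlonglongrightarrow> (LINT r|lebesgue_on {0..T1}. \<phi> (r, 0) * Nrate (ul r))"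
    proof (rule boundary_flux_weak_limit)
      fix r assume "0 \<le> r" "r \<le> T1"
      then have r: "r \<in> {0..T1}" by simp
      show "((\<lambda>r. \<phi> (r, 0)) has_real_derivative \<phi>t (r, 0)) (at r within {0..})" using d_t[OF r] by simp
      show "\<bar>\<phi> (r, 0)\<bar> \<le> C" "\<bar>\<phi>t (r, 0)\<bar> \<le> C" using b[of r 0] in_T[OF r] by auto
    qed (use T1 in auto)
    have "(\<lambda>n. integral {0..T1} (\<lambda>t. \<phi> (t, \<epsilon> n * 2) * JJ n 1 t) - integral {0..T1} (\<lambda>r. \<phi> (r, 0) * JJ n 1 r)) \<longlonglongrightarrow> 0"
    proof (rule Lim_null_comparison)
      show "(\<lambda>n. \<epsilon> n * (2 * C * j1max * T1)) \<longlonglongrightarrow> 0" using tendsto_mult_right[OF eps_lim] by fastforce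
      show "\<forall>\<^sub>F n in sequentially. norm (integral {0..T1} (\<lambda>t. \<phi> (t, \<epsilon> n * 2) * JJ n 1 t) - integral {0..T1} (\<lambda>r. \<phi> (r, 0) * JJ n 1 r)) \<le> \<epsilon> n * (2 * C * j1max * T1)"
      proof (intro always_eventually allI)
        fix n
        have c0: "continuous_on {0..T1} (\<lambda>r. \<phi> (r, 0) * JJ n 1 r)"
          by (intro continuous_intros cft JJ_cont[OF _ sub]) auto
        have "integral {0..T1} (\<lambda>t. \<phi> (t, \<epsilon> n * 2) * JJ n 1 t) - integral {0..T1} (\<lambda>r. \<phi> (r, 0) * JJ n 1 r)
           = integral {0..T1} (\<lambda>t. \<phi> (t, \<epsilon> n * 2) * JJ n 1 t - \<phi> (t, 0) * JJ n 1 t)"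
          by (intro Henstock_Kurzweil_Integration.integral_diff[symmetric] integrable_continuous_real Bc c0)
        also have "norm \<dots> \<le> (\<epsilon> n * (2 * C * j1max)) * (T1 - 0)"
        proof (rule integral_bound)
          show "continuous_on {0..T1} (\<lambda>t. \<phi> (t, \<epsilon> n * 2) * JJ n 1 t - \<phi> (t, 0) * JJ n 1 t)"
            by (intro continuous_intros Bc c0)
          fix t assume t: "t \<in> {0..T1}"
          note tT = in_T[OF t]
          obtain y where y: "0 \<le> y" "\<phi> (t, \<epsilon> n * 2) - \<phi> (t, 0) = (\<epsilon> n * 2 - 0) * \<phi>x (t, y)"
            using increment_le_derivative_bound[OF d_x[OF t], of 0 "\<epsilon> n * 2"] eps_pos[of n] by auto
          have "\<bar>\<phi>x (t,y)\<bar> * \<bar>JJ n 1 t\<bar> \<le> C * j1max"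
            using b[OF tT(2,3) y(1)] abs_JJ1_le[OF tT(1)] C by (intro mult_mono) auto
          then have "(\<epsilon> n * 2) * (\<bar>\<phi>x (t,y)\<bar> * \<bar>JJ n 1 t\<bar>) \<le> (\<epsilon> n * 2) * (C * j1max)"
            using eps_pos[of n] by (intro mult_left_mono) auto
          moreover have "\<phi> (t, \<epsilon> n * 2) * JJ n 1 t - \<phi> (t, 0) * JJ n 1 t = (\<epsilon> n * 2) * (\<phi>x (t,y) * JJ n 1 t)"
            using y(2) by (simp add: left_diff_distrib[symmetric])
          ultimately show "norm (\<phi> (t, \<epsilon> n * 2) * JJ n 1 t - \<phi> (t, 0) * JJ n 1 t) \<le> \<epsilon> n * (2 * C * j1max)"
            using eps_pos[of n] by (simp add: abs_mult mult_ac)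
        qed (use T1 in auto)
        finally show "norm (integral {0..T1} (\<lambda>t. \<phi> (t, \<epsilon> n * 2) * JJ n 1 t) - integral {0..T1} (\<lambda>r. \<phi> (r, 0) * JJ n 1 r)) \<le> \<epsilon> n * (2 * C * j1max * T1)"
          by (simp add: mult_ac)
      qed
    qed
    from tendsto_add[OF this l] show ?thesis by simp
  qed
  have "(LINT t|lebesgue_on {0..T1}. An n t) = - S n 0 - integral {0..T1} (\<lambda>t. \<phi> (t, \<epsilon> n * 2) * JJ n 1 t)" for n
    using lebesgue_integral_eq_integral[OF continuous_imp_integrable_real[OF Anc]] FTC by simp
  then have "(\<lambda>n. LINT t|lebesgue_on {0..T1}. An n t) \<longlonglongrightarrow> - (\<integral>x. \<phi> (0, x) \<partial>\<mu>in) - (LINT r|lebesgue_on {0..T1}. \<phi> (r, 0) * Nrate (ul r))"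
    using tendsto_diff[OF tendsto_minus[OF lim2] lim3] by simp
  from LIMSEQ_unique[OF lim1 this]
  have main: "(LINT t|lebesgue_on {0..T1}. G t) + (\<integral>x. \<phi> (0, x) \<partial>\<mu>in) + (LINT r|lebesgue_on {0..T1}. \<phi> (r, 0) * Nrate (ul r)) = 0" by simp
  have e1: "(LINT t|lebesgue_on {0..<T}. G t) = (LINT t|lebesgue_on {0..T1}. G t)"
  proof (rule lebesgue_on_extend_zero[OF T1(2)])
    fix t assume t: "T1 < t" "t < T"
    have "indicator {0..} x * (\<phi>t (t,x) + (abar * x powr s * ul t - bbar * x powr s) * \<phi>x (t,x)) = 0" for x
      using z[of t x] t T1 by (auto simp: indicator_def)
    then show "G t = 0" unfolding G_def by (intro integral_eq_zero_AE AE_I2) (simp only: mult_zero_right)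
  qed
  have e2: "(LINT r|lebesgue_on {0..<T}. \<phi> (r, 0) * Nrate (ul r)) = (LINT r|lebesgue_on {0..T1}. \<phi> (r, 0) * Nrate (ul r))"
    by (rule lebesgue_on_extend_zero[OF T1(2)]) (use z T1 in auto)
  have "(LINT t|lebesgue_on {0..<T}. G t) + (\<integral>x. \<phi> (0, x) \<partial>\<mu>in) + (LINT r|lebesgue_on {0..<T}. \<phi> (r, 0) * Nrate (ul r)) = 0"
    using main unfolding e1 e2 .
  then show ?thesis unfolding G_def[abs_def] .
qed

end

abbreviation power_line :: "real \<Rightarrow> real measure" where
  "power_line p \<equiv> density half_line (\<lambda>x. ennreal (x powr p))"

lemma power_line_test:
  assumes g: "g \<in> Linf (power_line p)" and p: "0 \<le> p" "p \<le> 1"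
  obtains h C where "h \<in> borel_measurable borel" "\<And>x. 0 < x \<Longrightarrow> \<bar>h x\<bar> \<le> C * (1 + x)" "h 0 = 0"
    "\<And>q. q \<in> borel_measurable borel \<Longrightarrow> (\<integral>x. q x * g x \<partial>power_line p) = (\<integral>x. q x * h x \<partial>lborel)"
proof -
  from g obtain C0 where gm: "g \<in> borel_measurable (power_line p)" and gb: "AE x in power_line p. \<bar>g x\<bar> \<le> C0"
    by (auto simp: Linf_def)
  have gm': "(\<lambda>x. indicator {0..} x * g x) \<in> borel_measurable borel"
    using gm by (simp add: half_line_measurable_iff)
  define C where "C = \<bar>C0\<bar>"
  define h where "h x = (if 0 < x \<and> \<bar>indicator {0..} x * g x\<bar> \<le> C then x powr p * (indicator {0..} x * g x) else 0)" for x
  have pm: "(\<lambda>x::real. ennreal (x powr p)) \<in> borel_measurable half_line"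
  proof -
    have "(\<lambda>x::real. x powr p) \<in> borel_measurable borel" by measurable
    then have "(\<lambda>x::real. x powr p) \<in> borel_measurable half_line" by (simp add: half_line_measurable_iff)
    then show ?thesis by measurable
  qed
  have "AE x in half_line. 0 < ennreal (x powr p) \<longrightarrow> \<bar>g x\<bar> \<le> C0"
    using gb by (subst (asm) AE_density[OF pm])
  then have "AE x in lborel. x \<in> {0..} \<longrightarrow> 0 < ennreal (x powr p) \<longrightarrow> \<bar>g x\<bar> \<le> C0"
    by (subst (asm) AE_restrict_space_iff) auto
  then have AEg: "AE x in lborel. 0 < x \<longrightarrow> \<bar>g x\<bar> \<le> C0"
    by eventually_elim auto
  have hm: "h \<in> borel_measurable borel" unfolding h_def[abs_def] using gm' by measurable
  show ?thesis
  proof (rule that[OF hm])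
    fix x :: real assume x: "0 < x"
    have "x powr p \<le> 1 + x"
    proof (cases "x \<le> 1")
      case True
      then have "x powr p \<le> 1" using x p by (intro powr_le1) auto
      then show ?thesis using x by linarith
    next
      case False
      then have "x powr p \<le> x powr 1" using p by (intro powr_mono) auto
      then show ?thesis using x by simp
    qed
    then show "\<bar>h x\<bar> \<le> C * (1 + x)"
    proof (cases "\<bar>indicator {0..} x * g x\<bar> \<le> C")
      case True
      then have "x powr p * \<bar>indicator {0..} x * g x\<bar> \<le> (1 + x) * C" using \<open>x powr p \<le> 1 + x\<close> x by (intro mult_mono) auto
      then show ?thesis using True x by (simp add: h_def abs_mult mult.commute)
    qed (use x in \<open>simp add: h_def C_def\<close>)
  next
    show "h 0 = 0" by (simp add: h_def)
  next
    fix q :: "real \<Rightarrow> real" assume q: "q \<in> borel_measurable borel"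
    note [measurable] = q gm' hm
    have "(\<integral>x. q x * g x \<partial>power_line p) = (\<integral>x. x powr p * (indicator {0..} x * (q x * g x)) \<partial>lborel)"
    proof (rule integral_density_half_line(1))
      have "(\<lambda>x. q x * (indicator {0..} x * g x)) \<in> borel_measurable borel" by measurable
      then show "(\<lambda>x. indicator {0..} x * (q x * g x)) \<in> borel_measurable borel" by (simp add: mult.left_commute)
    qed auto
    also have "\<dots> = (\<integral>x. q x * h x \<partial>lborel)"
    proof (rule integral_cong_AE)
      have "(\<lambda>x. x powr p * (q x * (indicator {0..} x * g x))) \<in> borel_measurable borel" by measurable
      then show "(\<lambda>x. x powr p * (indicator {0..} x * (q x * g x))) \<in> borel_measurable lborel" by (simp add: mult.left_commute)
      have "AE x in lborel. x \<noteq> (0::real)" by (rule AE_lborel_singleton)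
      with AEg show "AE x in lborel. x powr p * (indicator {0..} x * (q x * g x)) = q x * h x"
      proof eventually_elim
        case (elim x)
        consider "x < 0" | "0 < x" using elim(2) by linarith
        then show ?case
        proof cases
          case 2
          then have "\<bar>g x\<bar> \<le> C" using elim(1) by (simp add: C_def)
          then show ?thesis using 2 by (simp add: h_def)
        qed (simp add: h_def)
      qed
    qed auto
    finally show "(\<integral>x. q x * g x \<partial>power_line p) = (\<integral>x. q x * h x \<partial>lborel)" .
  qed
qed

lemma integrable_power_line:
  assumes q: "q \<in> borel_measurable borel"
  shows "integrable (power_line p) q \<longleftrightarrow> integrable lborel (\<lambda>x. q x * (indicator {0..} x * x powr p))"
proof -
  have "integrable (power_line p) q \<longleftrightarrow> integrable lborel (\<lambda>x. x powr p * (indicator {0..} x * q x))"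
    using q by (intro integral_density_half_line(2)) auto
  then show ?thesis by (simp add: mult_ac)
qed

context BD_limit_setting
begin

lemma power_weight:
  assumes "0 \<le> p" "p \<le> 1" "0 < (x::real)"
  shows "\<bar>indicator {0..} x * x powr p\<bar> \<le> 1 * (1 + x)"
proof (cases "x \<le> 1")
  case True
  then have "x powr p \<le> 1" using assms by (intro powr_le1) auto
  then show ?thesis using assms by simp
next
  case False
  then have "x powr p \<le> x powr 1" using assms by (intro powr_mono) auto
  then show ?thesis using assms by simp
qed

lemma F_C_weak: assumes p: "0 \<le> p" "p \<le> 1" shows "F n \<in> C_weak_L1 {0..T} (power_line p)"
  unfolding C_weak_L1_def
proof (intro CollectI conjI ballI)
  fix t assume t: "t \<in> {0..T}"
  show "integrable (power_line p) (F n t)"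
    unfolding integrable_power_line[OF F_meas] by (rule F_growth_int[OF t _ power_weight[OF p]]) measurable
next
  fix g assume "g \<in> Linf (power_line p)"
  then obtain h C where h: "h \<in> borel_measurable borel" "\<And>x. 0 < x \<Longrightarrow> \<bar>h x\<bar> \<le> C * (1 + x)"
    "\<And>q. q \<in> borel_measurable borel \<Longrightarrow> (\<integral>x. q x * g x \<partial>power_line p) = (\<integral>x. q x * h x \<partial>lborel)"
    by (rule power_line_test[OF _ p]) blast
  show "continuous_on {0..T} (\<lambda>t. \<integral>x. F n t x * g x \<partial>power_line p)"
    unfolding h(3)[OF F_meas] by (rule F_weak_continuous[OF h(1,2)])
qed

lemma f_C_weak: assumes p: "0 < p" "p \<le> 1" shows "f \<in> C_weak_L1 {0..T} (power_line p)"
  unfolding C_weak_L1_def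
proof (intro CollectI conjI ballI)
  have p': "0 \<le> p" using p by simp
  fix t assume t: "t \<in> {0..T}"
  show "integrable (power_line p) (f t)"
    unfolding integrable_power_line[OF f_meas[OF t]]
  proof (rule f_growth_int[OF t _ power_weight[OF p' p(2)]])
    show "(\<lambda>x::real. indicator {0..} x * x powr p) \<in> borel_measurable borel" by measurable
  qed simp_all
next
  have p': "0 \<le> p" using p by simp
  fix g assume "g \<in> Linf (power_line p)"
  then obtain h C where h: "h \<in> borel_measurable borel" "\<And>x. 0 < x \<Longrightarrow> \<bar>h x\<bar> \<le> C * (1 + x)" "h 0 = 0"
    "\<And>q. q \<in> borel_measurable borel \<Longrightarrow> (\<integral>x. q x * g x \<partial>power_line p) = (\<integral>x. q x * h x \<partial>lborel)"
    by (rule power_line_test[OF _ p' p(2)]) blast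
  have "continuous_on {0..T} (\<lambda>t. \<integral>x. f t x * h x \<partial>lborel)" by (rule f_weak_continuous[OF h(1,2,3)])
  then show "continuous_on {0..T} (\<lambda>t. \<integral>x. f t x * g x \<partial>power_line p)"
    by (rule continuous_on_eq) (simp add: h(4)[OF f_meas])
qed

lemma tendsto_C_weak: assumes p: "0 < p" "p \<le> 1" shows "tendsto_C_weak_L1 {0..T} (power_line p) F f"
  unfolding tendsto_C_weak_L1_def
proof (intro conjI allI ballI)
  have p': "0 \<le> p" using p by simp
  show "F n \<in> C_weak_L1 {0..T} (power_line p)" for n by (rule F_C_weak[OF p' p(2)])
  show "f \<in> C_weak_L1 {0..T} (power_line p)" by (rule f_C_weak[OF p])
  fix g assume "g \<in> Linf (power_line p)"
  then obtain h C where h: "h \<in> borel_measurable borel" "\<And>x. 0 < x \<Longrightarrow> \<bar>h x\<bar> \<le> C * (1 + x)" "h 0 = 0"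
    "\<And>q. q \<in> borel_measurable borel \<Longrightarrow> (\<integral>x. q x * g x \<partial>power_line p) = (\<integral>x. q x * h x \<partial>lborel)"
    by (rule power_line_test[OF _ p' p(2)]) blast
  have "uniform_limit {0..T} (\<lambda>n t. \<integral>x. F n t x * h x \<partial>lborel) (\<lambda>t. \<integral>x. f t x * h x \<partial>lborel) sequentially"
    by (rule conv_growth[OF h(1,2,3)])
  then show "uniform_limit {0..T} (\<lambda>n t. \<integral>x. F n t x * g x \<partial>power_line p) (\<lambda>t. \<integral>x. f t x * g x \<partial>power_line p) sequentially"
    unfolding uniform_limit_iff by (simp add: h(4)[OF F_meas] h(4)[OF f_meas])
qed

lemma f_mass_le: assumes t: "t \<in> {0..T}" shows "(\<integral>x. f t x \<partial>lborel) \<le> Q"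
proof -
  have "(\<lambda>n. \<integral>x. F n t x * 1 \<partial>lborel) \<longlonglongrightarrow> (\<integral>x. f t x * 1 \<partial>lborel)"
    by (rule tendsto_uniform_limitI[OF conv[where C=1] t]) auto
  then have "(\<integral>x. f t x * 1 \<partial>lborel) \<le> Q"
    by (rule LIMSEQ_le_const2) (use F_int(2)[OF t] in auto)
  then show ?thesis by simp
qed

lemma f_weight: assumes t: "t \<in> {0..T}" shows "weight_integrable (f t)" "weight_norm (f t) \<le> Q + M"
proof -
  have eq: "indicator {0..} x * (1 + x) * \<bar>f t x\<bar> = f t x + f t x * x" for x
    using f_nn[OF t, of x] f_neg[of x t] by (cases "x < 0") (auto simp: algebra_simps)
  show "weight_integrable (f t)" unfolding weight_integrable_def eq
    using f_meas[OF t] f_int[OF t] f_moment(1)[OF t] by auto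
  show "weight_norm (f t) \<le> Q + M" unfolding weight_norm_def eq
    using f_int[OF t] f_moment[OF t] f_mass_le[OF t] by simp
qed

lemma weight_measure:
  assumes q: "weight_integrable q"
  shows "integrable (density half_line (\<lambda>x. ennreal (1 + x))) q"
    "(\<integral>x. \<bar>q x\<bar> \<partial>density half_line (\<lambda>x. ennreal (1 + x))) = weight_norm q"
    "(\<integral>\<^sup>+x. ennreal \<bar>q x\<bar> \<partial>density half_line (\<lambda>x. ennreal (1 + x))) = ennreal (weight_norm q)"
proof -
  have qm [measurable]: "q \<in> borel_measurable borel" and qi: "integrable lborel (\<lambda>x. indicator {0..} x * (1 + x) * \<bar>q x\<bar>)"
    using q by (auto simp: weight_integrable_def)
  let ?D = "density half_line (\<lambda>x. ennreal (1 + x))"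
  have e: "(\<lambda>x. (1 + x) * (indicator {0..} x * \<bar>q x\<bar>)) = (\<lambda>x. indicator {0..} x * (1 + x) * \<bar>q x\<bar>)" by auto
  have iabs: "integrable ?D (\<lambda>x. \<bar>q x\<bar>)"
    by (subst integral_density_half_line(2)) (use qi in \<open>auto simp: e\<close>)
  have qD: "q \<in> borel_measurable ?D" using qm by (simp add: half_line_measurable_iff)
  show "integrable ?D q" using iabs integrable_abs_iff[OF qD] by simp
  show eq: "(\<integral>x. \<bar>q x\<bar> \<partial>?D) = weight_norm q"
    by (subst integral_density_half_line(1)) (auto simp: e weight_norm_def)
  show "(\<integral>\<^sup>+x. ennreal \<bar>q x\<bar> \<partial>?D) = ennreal (weight_norm q)"
    using nn_integral_eq_integral[OF iabs] eq by simp
qed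

lemma f_Linf_L1: "f \<in> Linf_L1 {0<..<T} (density half_line (\<lambda>x. ennreal (1 + x)))"
proof -
  let ?M = "lebesgue_on {0<..<T}" and ?D = "density half_line (\<lambda>x. ennreal (1 + x))"
  have sp: "t \<in> {0..T}" if "t \<in> space ?M" for t using that by auto
  obtain s where s: "\<And>n::nat. simple_function ?M (s n)" "\<And>n t. t \<in> space ?M \<Longrightarrow> weight_integrable (s n t)"
    "\<And>t. t \<in> space ?M \<Longrightarrow> (\<lambda>n. weight_norm (\<lambda>x. s n t x - f t x)) \<longlonglongrightarrow> 0"
  proof (rule weakly_measurable_simple_approx[of ?M f Q])
    show "weight_integrable (f t)" if "t \<in> space ?M" for t by (rule f_weight[OF sp[OF that]])
    fix n j :: nat assume "0 < n"
    have c: "continuous_on {0..T} (\<lambda>t. \<integral>x. f t x * indicator (grid_cell n j) x \<partial>lborel)"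
      by (rule f_bounded_weak_continuous[where C=1]) (auto simp: indicator_def)
    have e: "(\<lambda>t. \<integral>x. f t x * indicator (grid_cell n j) x \<partial>lborel) = (\<lambda>t. LINT x:grid_cell n j|lborel. f t x)"
      by (simp add: set_lebesgue_integral_def mult.commute)
    show "(\<lambda>t. LINT x:grid_cell n j|lborel. f t x) \<in> borel_measurable ?M"
      by (rule continuous_imp_measurable_on_sets_lebesgue[OF continuous_on_subset[OF c[unfolded e]]]) auto
    fix t assume "t \<in> space ?M"
    note t = sp[OF this]
    have nn: "0 \<le> (LINT x:grid_cell n j|lborel. f t x)"
      unfolding set_lebesgue_integral_def using f_nn[OF t] by (intro integral_nonneg_AE AE_I2) auto
    have "(LINT x:grid_cell n j|lborel. f t x) \<le> (\<integral>x. f t x \<partial>lborel)"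
      unfolding set_lebesgue_integral_def
      using f_nn[OF t] f_int[OF t] set_integrable_subset_borel[OF f_int[OF t] grid_cell_borel, of n j]
      by (intro integral_mono) (auto simp: indicator_def set_integrable_def)
    then show "\<bar>LINT x:grid_cell n j|lborel. f t x\<bar> \<le> Q" using nn f_mass_le[OF t] by simp
  qed blast
  show ?thesis unfolding Linf_L1_def
  proof (intro CollectI conjI exI[of _ s] exI[of _ "Q + M"] allI ballI)
    show "simple_function ?M (s n)" for n by (rule s(1))
    show "integrable ?D (s n t)" if "t \<in> {0<..<T}" for n t
      using s(2)[of t n] that by (intro weight_measure(1)) simp
    show "AE t in ?M. (\<lambda>n. \<integral>\<^sup>+x. ennreal \<bar>s n t x - f t x\<bar> \<partial>?D) \<longlonglongrightarrow> 0"
    proof (intro AE_I2)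
      fix t assume t: "t \<in> space ?M"
      have "(\<integral>\<^sup>+x. ennreal \<bar>s n t x - f t x\<bar> \<partial>?D) = ennreal (weight_norm (\<lambda>x. s n t x - f t x))" for n
        by (rule weight_measure(3)[OF weight_integrable_cong_diff(1)[OF s(2)[OF t] f_weight(1)[OF sp[OF t]]]])
      then show "(\<lambda>n. \<integral>\<^sup>+x. ennreal \<bar>s n t x - f t x\<bar> \<partial>?D) \<longlonglongrightarrow> 0"
        using tendsto_ennrealI[OF s(3)[OF t]] by simp
    qed
    show "AE t in ?M. integrable ?D (f t) \<and> (\<integral>x. \<bar>f t x\<bar> \<partial>?D) \<le> Q + M"
    proof (intro AE_I2)
      fix t assume "t \<in> space ?M"
      note t = sp[OF this]
      show "integrable ?D (f t) \<and> (\<integral>x. \<bar>f t x\<bar> \<partial>?D) \<le> Q + M"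
        using weight_measure(1,2)[OF f_weight(1)[OF t]] f_weight(2)[OF t] by simp
    qed
  qed
qed

lemma density_f_measure:
  assumes t: "t \<in> {0..T}"
  shows "finite_half_line_measure (density half_line (\<lambda>x. ennreal (f t x)))"
    "measure (density half_line (\<lambda>x. ennreal (f t x))) {0..} \<le> Q"
proof -
  let ?D = "density half_line (\<lambda>x. ennreal (f t x))"
  have fm: "f t \<in> borel_measurable half_line" using f_meas[OF t] by (simp add: half_line_measurable_iff)
  have "emeasure ?D (space ?D) = (\<integral>\<^sup>+x. ennreal (f t x) \<partial>half_line)"
  proof -
    have "space ?D \<in> sets half_line" using sets.top[of half_line] by simp
    with fm show ?thesis by (subst emeasure_density) (auto simp: nn_integral_set_ennreal intro!: nn_integral_cong)
  qed
  also have "\<dots> = (\<integral>\<^sup>+x. ennreal (f t x) \<partial>lborel)"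
    using f_neg[of _ t] by (subst nn_integral_restrict_space) (auto intro!: nn_integral_cong simp: indicator_def)
  also have "\<dots> = ennreal (\<integral>x. f t x \<partial>lborel)"
    using nn_integral_eq_integral[OF f_int[OF t]] f_nn[OF t] by simp
  finally have em: "emeasure ?D (space ?D) = ennreal (\<integral>x. f t x \<partial>lborel)" .
  have sp: "space ?D = {0..}" by simp
  show "finite_half_line_measure ?D" unfolding finite_half_line_measure_def
  proof
    show "finite_measure ?D" by (rule finite_measureI) (simp only: em, simp)
    show "sets ?D = sets (restrict_space borel {0..})" by (simp add: sets_restrict_space)
  qed
  have "0 \<le> (\<integral>x. f t x \<partial>lborel)" using f_nn[OF t] by simp
  then show "measure ?D {0..} \<le> Q" using em f_mass_le[OF t] unfolding sp measure_def by simp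
qed

lemma nucleation_rate_eq:
  assumes "\<rho> = bbar / abar" "t \<in> {0..T}"
  shows "nucleation_rate \<eta> s \<alpha> \<beta> abar bbar \<rho> (ul t) = Nrate (ul t)"
proof -
  have v: "0 < abar * ul t - bbar" using ul_v_low[OF assms(2)] vmin_pos by linarith
  then have "\<rho> < ul t" using assms(1) ab by (simp add: pos_divide_less_eq mult.commute)
  then show ?thesis using v BD_power_law.eta[OF bd]
    by (auto simp: nucleation_rate_def Nrate_def kap_lim_def)
qed

lemma nucleation_rate_Linf:
  assumes rho: "\<rho> = bbar / abar" shows "nucleation_rate \<eta> s \<alpha> \<beta> abar bbar \<rho> \<in> Linf (lebesgue_on {0..R})"
  unfolding Linf_def
proof (intro CollectI conjI exI[of _ "\<bar>\<alpha>\<bar> * R\<^sup>2"] AE_I2)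
  have "nucleation_rate \<eta> s \<alpha> \<beta> abar bbar \<rho> \<in> borel_measurable borel"
    unfolding nucleation_rate_def[abs_def] by measurable
  then show "nucleation_rate \<eta> s \<alpha> \<beta> abar bbar \<rho> \<in> borel_measurable (lebesgue_on {0..R})"
    by (intro measurable_restrict_space1 measurable_completion) simp
  fix w assume "w \<in> space (lebesgue_on {0..R})"
  then have w: "0 \<le> w" "w \<le> R" by auto
  have w2: "\<bar>\<alpha>\<bar> * w\<^sup>2 \<le> \<bar>\<alpha>\<bar> * R\<^sup>2" using w by (intro mult_left_mono power_mono) auto
  show "\<bar>nucleation_rate \<eta> s \<alpha> \<beta> abar bbar \<rho> w\<bar> \<le> \<bar>\<alpha>\<bar> * R\<^sup>2"
  proof (cases "\<not> \<eta> > s \<and> w > \<rho>")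
    case True
    then have v: "0 < abar * w - bbar" using rho ab by (simp add: pos_divide_less_eq mult.commute)
    have "0 \<le> \<beta> / 2 powr \<eta>" using beta_pos by simp
    then have "0 \<le> (abar * w - bbar) / (abar * w - bbar + \<beta> / 2 powr \<eta>)" "(abar * w - bbar) / (abar * w - bbar + \<beta> / 2 powr \<eta>) \<le> 1"
      using v by auto
    then have "\<bar>\<alpha> * w\<^sup>2\<bar> * \<bar>(abar * w - bbar) / (abar * w - bbar + \<beta> / 2 powr \<eta>)\<bar> \<le> (\<bar>\<alpha>\<bar> * R\<^sup>2) * 1"
      using w2 by (intro mult_mono) (simp_all only: abs_mult abs_of_nonneg abs_power2 power2_abs mult_nonneg_nonneg abs_ge_zero zero_le_power2)
    then show ?thesis using True by (simp add: nucleation_rate_def abs_mult)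
  qed (use w2 in \<open>auto simp: nucleation_rate_def abs_mult\<close>)
qed

lemma N_solution_limit:
  assumes a: "\<And>x. 0 \<le> x \<Longrightarrow> a x = abar * x powr s" and b: "\<And>x. 0 \<le> x \<Longrightarrow> b x = bbar * x powr s"
    and rho: "\<rho> = bbar / abar"
  shows "N_solution a b \<rho> uin \<mu>in (nucleation_rate \<eta> s \<alpha> \<beta> abar bbar \<rho>) T m (\<lambda>t. density half_line (\<lambda>x. ennreal (f t x)))"
  unfolding N_solution_def
proof (intro conjI allI impI)
  let ?D = "\<lambda>t. density half_line (\<lambda>x. ennreal (f t x))" and ?N = "nucleation_rate \<eta> s \<alpha> \<beta> abar bbar \<rho>"
  have DI: "(\<integral>x. h x \<partial>?D t) = (\<integral>x. f t x * (indicator {0..} x * h x) \<partial>lborel)"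
    "integrable (?D t) h \<longleftrightarrow> integrable lborel (\<lambda>x. f t x * (indicator {0..} x * h x))"
    if "t \<in> {0..T}" "(\<lambda>x. indicator {0..} x * h x) \<in> borel_measurable borel" for t and h :: "real \<Rightarrow> real"
    using integral_density_half_line[OF f_meas[OF that(1)] _ that(2)] f_nn[OF that(1)] by auto
  show "?N \<in> Linf (lebesgue_on {0..R})" for R by (rule nucleation_rate_Linf[OF rho])
  show "?D \<in> Linf_measures T"
    unfolding Linf_measures_def
  proof (intro CollectI conjI ballI exI[of _ Q])
    fix \<phi> assume \<phi>: "\<phi> \<in> Cc_half_line"
    then have c: "continuous_on {0..} \<phi>" by (simp add: Cc_half_line_def)
    obtain K where K: "compact K" "K \<subseteq> {0..}" "\<And>x. x \<in> {0..} - K \<Longrightarrow> \<phi> x = 0"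
      using \<phi> by (auto simp: Cc_half_line_def)
    have "compact (\<phi> ` K)" using K by (intro compact_continuous_image continuous_on_subset[OF c])
    then obtain C0 where C0: "\<forall>y\<in>\<phi> ` K. norm y \<le> C0" using compact_imp_bounded bounded_iff by blast
    have bd: "\<bar>indicator {0..} x * \<phi> x\<bar> \<le> \<bar>C0\<bar>" for x
    proof (cases "x \<in> K")
      case True
      then have "\<bar>\<phi> x\<bar> \<le> C0" using C0 by auto
      then show ?thesis by (auto simp: indicator_def)
    qed (use K(3)[of x] in \<open>auto simp: indicator_def\<close>)
    have m: "(\<lambda>x. indicator {0..} x * \<phi> x) \<in> borel_measurable borel" by (rule half_line_continuous_measurable[OF c])
    have "continuous_on {0..T} (\<lambda>t. \<integral>x. f t x * (indicator {0..} x * \<phi> x) \<partial>lborel)"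
      by (rule f_bounded_weak_continuous[OF m bd])
    then have "continuous_on {0..T} (\<lambda>t. \<integral>x. \<phi> x \<partial>?D t)"
      by (rule continuous_on_eq) (simp add: DI(1)[OF _ m])
    then show "(\<lambda>t. \<integral>x. \<phi> x \<partial>?D t) \<in> borel_measurable (lebesgue_on {0..T})"
      by (rule continuous_imp_measurable_on_sets_lebesgue) auto
  next
    show "AE t in lebesgue_on {0..T}. finite_half_line_measure (?D t) \<and> measure (?D t) {0..} \<le> Q"
      using density_f_measure by (intro AE_I2) simp
  qed
  show "\<exists>u. continuous_on {0..T} u \<and> (\<forall>t\<in>{0..T}. 0 \<le> u t) \<and> u 0 = uin \<and> \<rho> < (INF t\<in>{0..T}. u t) \<and>
      (\<exists>\<nu>. (AE t in lebesgue_on {0..T}. \<nu> t = ?D t) \<and> (\<forall>t\<in>{0..T}. finite_half_line_measure (\<nu> t) \<and>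
          integrable (\<nu> t) (\<lambda>x. x) \<and> u t + (\<integral>x. x \<partial>\<nu> t) = m)) \<and>
      (\<forall>\<phi> \<phi>t \<phi>x. C1c_test T \<phi> \<phi>t \<phi>x \<longrightarrow>
         (LINT t|lebesgue_on {0..<T}. (\<integral>x. \<phi>t (t, x) + (a x * u t - b x) * \<phi>x (t, x) \<partial>?D t))
         + (\<integral>x. \<phi> (0, x) \<partial>\<mu>in) + (LINT r|lebesgue_on {0..<T}. \<phi> (r, 0) * ?N (u r)) = 0)"
  proof (intro exI[of _ ul] exI[of _ ?D] conjI ballI allI impI)
    show "continuous_on {0..T} ul" by (rule ul_cont)
    show "0 \<le> ul t" if "t \<in> {0..T}" for t using ul_low[OF that] ustar(1) by linarith
    show "ul 0 = uin" by (rule ul_init)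
    have "ustar \<le> (INF t\<in>{0..T}. ul t)" using T ul_low by (intro cINF_greatest) auto
    moreover have "\<rho> < ustar" using rho ab ustar by (simp add: pos_divide_less_eq mult.commute)
    ultimately show "\<rho> < (INF t\<in>{0..T}. ul t)" by linarith
    show "AE t in lebesgue_on {0..T}. ?D t = ?D t" by simp
    fix t assume t: "t \<in> {0..T}"
    have e: "f t x * (indicator {0..} x * x) = f t x * x" for x using f_neg[of x t] by (cases "x < 0") auto
    have m: "(\<lambda>x::real. indicator {0..} x * x) \<in> borel_measurable borel" by measurable
    show "finite_half_line_measure (?D t)" by (rule density_f_measure[OF t])
    show "integrable (?D t) (\<lambda>x. x)" unfolding DI(2)[OF t m] e by (rule f_moment[OF t])
    show "ul t + (\<integral>x. x \<partial>?D t) = m" unfolding DI(1)[OF t m] e ul_def by simp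
  next
    fix \<phi> \<phi>t \<phi>x assume \<phi>: "C1c_test T \<phi> \<phi>t \<phi>x"
    note \<phi>' = \<phi>[unfolded C1c_test_def Let_def]
    note ct = \<phi>'[THEN conjunct2, THEN conjunct1]
    note cx = \<phi>'[THEN conjunct2, THEN conjunct2, THEN conjunct1]
    have inner: "(\<integral>x. \<phi>t (t, x) + (a x * ul t - b x) * \<phi>x (t, x) \<partial>?D t)
       = (\<integral>x. f t x * (indicator {0..} x * (\<phi>t (t,x) + (abar * x powr s * ul t - bbar * x powr s) * \<phi>x (t,x))) \<partial>lborel)"
      if t: "t \<in> {0..<T}" for t
    proof -
      have e: "indicator {0..} x * (\<phi>t (t, x) + (a x * ul t - b x) * \<phi>x (t, x))
        = indicator {0..} x * (\<phi>t (t,x) + (abar * x powr s * ul t - bbar * x powr s) * \<phi>x (t,x))" for x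
        by (auto simp: indicator_def a b)
      have "continuous_on {0..} (\<lambda>x. \<phi>t (t,x) + (abar * x powr s * ul t - bbar * x powr s) * \<phi>x (t,x))"
        using t s01 by (intro continuous_intros continuous_on_powr' continuous_on_compose2[OF ct] continuous_on_compose2[OF cx]) auto
      from half_line_continuous_measurable[OF this]
      have m: "(\<lambda>x. indicator {0..} x * (\<phi>t (t, x) + (a x * ul t - b x) * \<phi>x (t, x))) \<in> borel_measurable borel"
        unfolding e .
      have "t \<in> {0..T}" using t by auto
      from DI(1)[OF this m] show ?thesis unfolding e .
    qed
    have i1: "(LINT t|lebesgue_on {0..<T}. (\<integral>x. \<phi>t (t, x) + (a x * ul t - b x) * \<phi>x (t, x) \<partial>?D t))
       = (LINT t|lebesgue_on {0..<T}. (\<integral>x. f t x * (indicator {0..} x * (\<phi>t (t,x) + (abar * x powr s * ul t - bbar * x powr s) * \<phi>x (t,x))) \<partial>lborel))"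
      by (rule Bochner_Integration.integral_cong) (use inner in auto)
    have i2: "(LINT r|lebesgue_on {0..<T}. \<phi> (r, 0) * ?N (ul r)) = (LINT r|lebesgue_on {0..<T}. \<phi> (r, 0) * Nrate (ul r))"
      by (rule Bochner_Integration.integral_cong) (use nucleation_rate_eq[OF rho] in auto)
    show "(LINT t|lebesgue_on {0..<T}. (\<integral>x. \<phi>t (t, x) + (a x * ul t - b x) * \<phi>x (t, x) \<partial>?D t))
         + (\<integral>x. \<phi> (0, x) \<partial>\<mu>in) + (LINT r|lebesgue_on {0..<T}. \<phi> (r, 0) * ?N (ul r)) = 0"
      unfolding i1 i2 by (rule weak_equation[OF \<phi>])
  qed
qed

end

context BD_power_law
begin

lemma weighted_sum_time_lipschitz:
  assumes rt: "0 \<le> r" "r \<le> t" and Q: "\<And>N x. 0 \<le> x \<Longrightarrow> x \<le> t \<Longrightarrow> (\<Sum>i=2..N. \<epsilon> * c i x) \<le> Q"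
    and J1: "\<And>x. 0 \<le> x \<Longrightarrow> x \<le> t \<Longrightarrow> \<bar>J 1 x\<bar> \<le> j1"
    and w: "\<bar>w 2\<bar> \<le> W" "\<And>i. 2 \<le> i \<Longrightarrow> \<bar>w (i+1) - w i\<bar> \<le> D * \<epsilon>" "w N = 0" and N: "2 \<le> N" and D: "0 \<le> D"
  shows "\<bar>(\<Sum>i=2..N. w i * (\<epsilon> * c i t)) - (\<Sum>i=2..N. w i * (\<epsilon> * c i r))\<bar>
    \<le> (W * j1 + D * ((abar * M + bbar) * (Q + M))) * (t - r)"
proof (rule derivative_bounded_imp_lipschitz[OF rt weighted_deriv])
  fix x assume x: "0 \<le> x" "x \<le> t"
  show "\<bar>\<Sum>i=2..N. w i * (J (i-1) x - J i x)\<bar> \<le> W * j1 + D * ((abar * M + bbar) * (Q + M))"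
    by (rule flux_against_weights_le[OF x(1) Q[OF x] J1[OF x] w N D])
qed

lemma test_integral_time_lipschitz:
  assumes rt: "0 \<le> r" "r \<le> t" and Q: "\<And>N x. 0 \<le> x \<Longrightarrow> x \<le> t \<Longrightarrow> (\<Sum>i=2..N. \<epsilon> * c i x) \<le> Q"
    and J1: "\<And>x. 0 \<le> x \<Longrightarrow> x \<le> t \<Longrightarrow> \<bar>J 1 x\<bar> \<le> j1"
    and \<phi>: "\<phi> \<in> borel_measurable borel" "\<And>x. \<bar>\<phi> x\<bar> \<le> W" "\<And>x y. \<bar>\<phi> x - \<phi> y\<bar> \<le> D * \<bar>x - y\<bar>" "\<And>x. L \<le> x \<Longrightarrow> \<phi> x = 0"
  shows "\<bar>(\<integral>x. step_fun \<epsilon> 2 (\<lambda>i. c i t) x * \<phi> x \<partial>lborel) - (\<integral>x. step_fun \<epsilon> 2 (\<lambda>i. c i r) x * \<phi> x \<partial>lborel)\<bar>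
    \<le> (W * j1 + D * ((abar * M + bbar) * (Q + M))) * (t - r)"
proof -
  define w where "w i = (1/\<epsilon>) * (LINT x:size_cell \<epsilon> i|lborel. \<phi> x)" for i
  note [measurable] = \<phi>(1)
  have ind: "integrable lborel (indicator (size_cell \<epsilon> i) :: real \<Rightarrow> real)" for i
    using measure_size_cell(2)[OF eps(1), of i] by (intro integrable_real_indicator) (simp_all add: ennreal_less_top)
  have \<phi>i: "set_integrable lborel (size_cell \<epsilon> i) \<phi>" for i
    unfolding set_integrable_def real_scaleR_def by (rule integrable_mult_bounded[OF ind \<phi>(1,2)])
  have D: "0 \<le> D" using \<phi>(3)[of 0 1] by simp
  have cellint: "(\<integral>x. indicator (size_cell \<epsilon> i) x * k \<partial>lborel) = \<epsilon> * k" for i and k :: real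
    using measure_size_cell(1)[OF eps(1), of i] by simp
  have wb: "\<bar>w i\<bar> \<le> W" for i
  proof -
    have "\<bar>LINT x:size_cell \<epsilon> i|lborel. \<phi> x\<bar> \<le> (\<integral>x. indicator (size_cell \<epsilon> i) x * W \<partial>lborel)"
      unfolding set_lebesgue_integral_def real_scaleR_def
      by (rule abs_integral_mult_le(2)[OF _ \<phi>(1)]) (use ind \<phi>(2) in auto)
    then show ?thesis unfolding cellint using eps by (simp add: w_def abs_mult field_simps)
  qed
  have wd: "\<bar>w (i+1) - w i\<bar> \<le> D * \<epsilon>" for i
  proof -
    have "(LINT x:size_cell \<epsilon> (i+1)|lborel. \<phi> x) = (\<integral>x. indicator (size_cell \<epsilon> (i+1)) (\<epsilon> + 1 * x) * \<phi> (\<epsilon> + 1 * x) \<partial>lborel)"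
      unfolding set_lebesgue_integral_def real_scaleR_def
      by (subst lborel_integral_real_affine[where c=1 and t=\<epsilon>]) auto
    also have "(\<lambda>x. indicator (size_cell \<epsilon> (i+1)) (\<epsilon> + 1 * x) * \<phi> (\<epsilon> + 1 * x)) = (\<lambda>x. indicator (size_cell \<epsilon> i) x * \<phi> (\<epsilon> + x))"
    proof
      fix x
      have "(real (i+1) - 1/2) * \<epsilon> = \<epsilon> + (real i - 1/2) * \<epsilon>" "(real (i+1) + 1/2) * \<epsilon> = \<epsilon> + (real i + 1/2) * \<epsilon>"
        by (simp_all add: algebra_simps)
      then have "\<epsilon> + x \<in> size_cell \<epsilon> (i+1) \<longleftrightarrow> x \<in> size_cell \<epsilon> i"
        unfolding size_cell_def by simp
      then show "indicator (size_cell \<epsilon> (i+1)) (\<epsilon> + 1 * x) * \<phi> (\<epsilon> + 1 * x) = indicator (size_cell \<epsilon> i) x * \<phi> (\<epsilon> + x)"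
        by (cases "x \<in> size_cell \<epsilon> i") auto
    qed
    finally have sh: "(LINT x:size_cell \<epsilon> (i+1)|lborel. \<phi> x) = (\<integral>x. indicator (size_cell \<epsilon> i) x * \<phi> (\<epsilon> + x) \<partial>lborel)" .
    have "(\<lambda>x. \<phi> (\<epsilon> + x)) \<in> borel_measurable borel" by measurable
    then have "integrable lborel (\<lambda>x. indicator (size_cell \<epsilon> i) x * \<phi> (\<epsilon> + x))"
      by (rule integrable_mult_bounded[OF ind]) (rule \<phi>(2))
    then have "(LINT x:size_cell \<epsilon> (i+1)|lborel. \<phi> x) - (LINT x:size_cell \<epsilon> i|lborel. \<phi> x)
        = (\<integral>x. indicator (size_cell \<epsilon> i) x * (\<phi> (\<epsilon> + x) - \<phi> x) \<partial>lborel)"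
      unfolding sh using \<phi>i[of i] by (simp add: set_lebesgue_integral_def set_integrable_def right_diff_distrib)
    also have "\<bar>\<dots>\<bar> \<le> (\<integral>x. indicator (size_cell \<epsilon> i) x * (D * \<epsilon>) \<partial>lborel)"
    proof (rule abs_integral_mult_le(2))
      show "integrable lborel (\<lambda>x. indicat_real (size_cell \<epsilon> i) x * (D * \<epsilon>))" using ind by simp
      show "\<bar>\<phi> (\<epsilon> + x) - \<phi> x\<bar> \<le> D * \<epsilon>" for x using \<phi>(3)[of "\<epsilon> + x" x] eps by simp
    qed auto
    finally show ?thesis unfolding cellint using eps by (simp add: w_def right_diff_distrib[symmetric] abs_mult field_simps)
  qed
  obtain N0 :: nat where N0: "max 1 L / \<epsilon> + 2 < real N0" using reals_Archimedean2 by blast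
  have N2: "2 \<le> N0" and NL: "L \<le> (real N0 - 1/2) * \<epsilon>"
  proof -
    have "0 \<le> max 1 L / \<epsilon>" using eps by simp
    then show "2 \<le> N0" using N0 by linarith
    have "L / \<epsilon> \<le> max 1 L / \<epsilon>" using eps by (intro divide_right_mono) auto
    then have "L / \<epsilon> \<le> real N0 - 1/2" using N0 by linarith
    then show "L \<le> (real N0 - 1/2) * \<epsilon>" using eps by (simp add: pos_divide_le_eq)
  qed
  have "(LINT x:size_cell \<epsilon> N0|lborel. \<phi> x) = 0"
  proof -
    have "(\<lambda>x. indicator (size_cell \<epsilon> N0) x * \<phi> x) = (\<lambda>x. 0)"
      using NL \<phi>(4) by (auto simp: size_cell_def indicator_def)
    then show ?thesis by (simp add: set_lebesgue_integral_def)
  qed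
  then have wN: "w N0 = 0" by (simp add: w_def)
  have rep: "(\<integral>x. step_fun \<epsilon> 2 (\<lambda>i. c i x0) x * \<phi> x \<partial>lborel) = (\<Sum>i=2..N0. w i * (\<epsilon> * c i x0))" for x0
  proof -
    have "\<phi> x = 0" if "(real N0 + 1/2) * \<epsilon> \<le> x" for x
      using that NL eps by (intro \<phi>(4)) (simp add: algebra_simps)
    then have "(\<integral>x. step_fun \<epsilon> 2 (\<lambda>i. c i x0) x * \<phi> x \<partial>lborel) = (\<Sum>i=2..N0. c i x0 * (LINT x:size_cell \<epsilon> i|lborel. \<phi> x))"
      by (intro step_integral_truncated(1)[OF eps(1) _ \<phi>i]) auto
    also have "\<dots> = (\<Sum>i=2..N0. w i * (\<epsilon> * c i x0))" using eps by (intro sum.cong) (auto simp: w_def)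
    finally show ?thesis .
  qed
  show ?thesis unfolding rep by (rule weighted_sum_time_lipschitz[OF rt Q J1 wb wd wN N2 D])
qed

end

lemma powr_near_0_integrable:
  assumes s: "s < 1" and R: "0 \<le> R"
  shows "integrable lborel (\<lambda>x::real. indicator {0<..<R} x * x powr (-s))"
proof -
  have "(\<lambda>x. x powr (-s)) integrable_on {0..R}"
    using has_integral_powr_from_0[of "-s" R] s R by (auto simp: integrable_on_def)
  then have "(\<lambda>x. x powr (-s)) absolutely_integrable_on {0..R}"
    by (intro nonnegative_absolutely_integrable_1) auto
  then have "integrable lebesgue (\<lambda>x. indicator {0..R} x * x powr (-s))"
    by (simp add: set_integrable_def)
  then have i: "integrable lborel (\<lambda>x. indicator {0..R} x * x powr (-s))"
    by (subst (asm) integrable_completion) auto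
  show ?thesis
  proof (rule Bochner_Integration.integrable_bound[OF i])
    show "AE x in lborel. norm (indicator {0<..<R} x * x powr (-s)) \<le> norm (indicator {0..R} x * x powr (-s))"
      by (intro AE_I2) (auto simp: indicator_def)
  qed measurable
qed

lemma le_power_split:
  fixes x y K :: real
  assumes "0 < x" "0 \<le> y" "0 < K" "0 < \<delta>"
  shows "y \<le> K * x powr (-s) + x powr (s*\<delta>) * y powr (1+\<delta>) / K powr \<delta>"
proof (cases "x powr s * y \<le> K")
  case True
  then have "y \<le> K * x powr (-s)" using assms by (simp add: powr_minus field_simps)
  then show ?thesis by (simp add: add_increasing2)
next
  case False
  then have "1 \<le> x powr s * y / K" using assms by simp
  then have "1 \<le> (x powr s * y / K) powr \<delta>" using assms by (intro ge_one_powr_ge_zero) auto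
  then have "y * 1 \<le> y * (x powr s * y / K) powr \<delta>" using assms by (intro mult_left_mono) auto
  also have "y * (x powr s * y / K) powr \<delta> = x powr (s*\<delta>) * y powr (1+\<delta>) / K powr \<delta>"
  proof (cases "y = 0")
    case y: False
    have "(x powr s * y / K) powr \<delta> = x powr (s*\<delta>) * y powr \<delta> / K powr \<delta>"
      using assms by (simp add: powr_divide powr_mult powr_powr)
    then show ?thesis using assms y by (simp add: powr_add)
  qed simp
  finally show ?thesis using assms by (simp add: add_increasing)
qed

locale BD_sequence =
  fixes \<eta> s abar bbar \<delta> M u0 ustar \<theta> P H P2 Ax Bx :: real
    and \<epsilon> A B :: "nat \<Rightarrow> real" and ae be :: "nat \<Rightarrow> nat \<Rightarrow> real"
    and u :: "nat \<Rightarrow> real \<Rightarrow> real" and c :: "nat \<Rightarrow> nat \<Rightarrow> real \<Rightarrow> real"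
  assumes bd: "\<And>n. BD_power_law \<eta> (\<epsilon> n) (A n) (B n) abar bbar s M (ae n) (be n) (u n) (c n)"
    and Ax: "\<And>n. A n \<le> Ax" and Bx: "\<And>n. B n \<le> Bx"
    and u0: "\<And>n. u0 \<le> u n 0" "ustar < u0" and ustar: "0 < ustar" "bbar < abar * ustar"
    and exp_eps: "\<And>n. bbar \<le> exp (- \<epsilon> n) * (abar * ustar)"
    and delta: "0 < \<delta>" "s * \<delta> \<le> 1"
    and theta: "0 < \<theta>" "\<theta> < 1" "bbar / (abar * ustar) < \<theta>"
    and number0: "\<And>n N. (\<Sum>i=2..N. \<epsilon> n * c n i 0) \<le> P"
    and moment0: "\<And>n N. (\<Sum>i=2..N. \<theta>^i * (\<epsilon> n powr s * c n i 0)) \<le> H"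
    and power0: "\<And>n N. (\<Sum>i=2..N. \<epsilon> n * c n i 0 powr (1+\<delta>)) \<le> P2"
    and tail0: "\<And>e. 0 < e \<Longrightarrow> \<exists>R\<ge>2. \<forall>n N. (\<Sum>i=2..N. max (\<epsilon> n * real i - R) 0 * (\<epsilon> n * c n i 0)) \<le> e"
begin

definition "Q = P + Ax * M\<^sup>2"
definition "L = 2 * (Ax * M\<^sup>2 + Bx * Q) + (abar * M + bbar) * (Q + M)"
definition "T = min 1 ((u0 - ustar) / (L + 1))"
definition "H' = max H ((Ax * M\<^sup>2 + bbar) / ((1-\<theta>) * (\<theta> * (abar * ustar) - bbar)))"
definition "P2' = P2 + ((abar * ustar - bbar) powr (-\<delta>) * (Ax * M\<^sup>2) powr (1+\<delta>) + bbar)"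

abbreviation F :: "nat \<Rightarrow> real \<Rightarrow> real \<Rightarrow> real" where
  "F n t x \<equiv> step_fun (\<epsilon> n) 2 (\<lambda>i. c n i t) x"

lemma eps: "0 < \<epsilon> n" "\<epsilon> n \<le> 1" using BD_power_law.eps[OF bd] by auto
lemma AB_pos: "0 < A n" "0 < B n" using BD_power_law.AB[OF bd] by auto
lemma Ax_pos: "0 < Ax" and Bx_pos: "0 < Bx" using AB_pos[of 0] Ax[of 0] Bx[of 0] by linarith+
lemma ab: "0 < abar" "0 < bbar" using BD_power_law.ab[OF bd] by auto
lemma s01: "0 < s" "s < 1" using BD_power_law.s[OF bd] by auto
lemma M_nn: "0 \<le> M" using BD_power_law.M_nonneg[OF bd[of 0]] .
lemma c_nn: "2 \<le> i \<Longrightarrow> 0 \<le> t \<Longrightarrow> 0 \<le> c n i t" using BD_power_law.c_nonneg[OF bd] .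
lemma P_nn: "0 \<le> P" using number0[of 0 0] by simp
lemma Q_nn: "0 \<le> Q" using P_nn Ax_pos by (simp add: Q_def)
lemma L_nn: "0 \<le> L" using Q_nn Ax_pos Bx_pos M_nn ab by (simp add: L_def)
lemma P2'_nn: "0 \<le> P2'" using power0[of 0 0] ab by (simp add: P2'_def)

lemma T: "0 < T" "T \<le> 1" "L * T \<le> u0 - ustar"
proof -
  show "0 < T" "T \<le> 1" using u0(2) L_nn by (auto simp: T_def)
  have "L * T \<le> (L + 1) * ((u0 - ustar) / (L + 1))" using L_nn u0(2) by (intro mult_mono) (auto simp: T_def)
  then show "L * T \<le> u0 - ustar" using L_nn by simp
qed

lemma number: assumes "t \<in> {0..T}" shows "(\<Sum>i=2..N. \<epsilon> n * c n i t) \<le> Q"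
proof -
  have t: "0 \<le> t" "t \<le> 1" using assms T by auto
  have "(\<Sum>i=2..N. \<epsilon> n * c n i t) \<le> P + A n * M\<^sup>2 * t"
    by (rule BD_power_law.number_bound[OF bd number0 t(1)])
  also have "A n * M\<^sup>2 * t \<le> Ax * M\<^sup>2 * 1"
    using t Ax[of n] Ax_pos AB_pos[of n] by (intro mult_mono) auto
  finally show ?thesis by (simp add: Q_def)
qed

lemma u_lipschitz:
  assumes t: "t \<in> {0..T}"
  shows "\<exists>u'. (u n has_real_derivative u') (at t within {0..}) \<and> \<bar>u'\<bar> \<le> L"
proof (intro exI conjI)
  have t0: "0 \<le> t" using t by auto
  show "(u n has_real_derivative - \<epsilon> n * BD_power_law.J \<eta> (\<epsilon> n) (A n) (B n) (ae n) (be n) (u n) (c n) 1 t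
      - \<epsilon> n * (\<Sum>i. BD_power_law.J \<eta> (\<epsilon> n) (A n) (B n) (ae n) (be n) (u n) (c n) (Suc i) t)) (at t within {0..})"
    by (rule BD_power_law.u_deriv[OF bd t0])
  have "A n * M\<^sup>2 \<le> Ax * M\<^sup>2" "B n * Q \<le> Bx * Q" using Ax[of n] Bx[of n] Q_nn by (auto intro: mult_right_mono)
  then have "BD_power_law.u_rate (A n) (B n) abar bbar M Q \<le> L"
    by (simp add: BD_power_law.u_rate_def[OF bd] L_def)
  then show "\<bar>- \<epsilon> n * BD_power_law.J \<eta> (\<epsilon> n) (A n) (B n) (ae n) (be n) (u n) (c n) 1 t
      - \<epsilon> n * (\<Sum>i. BD_power_law.J \<eta> (\<epsilon> n) (A n) (B n) (ae n) (be n) (u n) (c n) (Suc i) t)\<bar> \<le> L"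
    using BD_power_law.u_deriv_bound[OF bd t0 number[OF t]] by (rule order_trans[rotated])
qed

lemma u_low: assumes t: "t \<in> {0..T}" shows "ustar \<le> u n t"
proof -
  have "\<exists>u'. \<forall>x\<in>{0..T}. (u n has_real_derivative u' x) (at x within {0..}) \<and> \<bar>u' x\<bar> \<le> L"
    using u_lipschitz[where n=n] by (intro bchoice ballI)
  then obtain u' where u': "\<And>x. x \<in> {0..T} \<Longrightarrow> (u n has_real_derivative u' x) (at x within {0..})" "\<And>x. x \<in> {0..T} \<Longrightarrow> \<bar>u' x\<bar> \<le> L"
    by blast
  have "\<bar>u n t - u n 0\<bar> \<le> L * (t - 0)"
    by (rule derivative_bounded_imp_lipschitz[where Z'=u']) (use t u' in auto)
  moreover have "L * t \<le> L * T" using t L_nn by (intro mult_left_mono) auto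
  ultimately show ?thesis using T(3) u0(1)[of n] by simp
qed

lemma theta_gap: "0 < \<theta> * (abar * ustar) - bbar"
  using theta(3) ab ustar by (simp add: pos_divide_less_eq)

lemma moment: assumes t: "t \<in> {0..T}" shows "(\<Sum>i=2..N. \<theta>^i * (\<epsilon> n powr s * c n i t)) \<le> H'"
proof -
  have "(\<Sum>i=2..N. \<theta>^i * (\<epsilon> n powr s * c n i t)) \<le> max H ((A n * M\<^sup>2 + bbar) / ((1-\<theta>) * (\<theta> * (abar * ustar) - bbar)))"
    by (rule BD_power_law.exponential_moment[OF bd _ _ theta(1,2) theta_gap moment0]) (use t u_low in auto)
  also have "\<dots> \<le> H'"
    unfolding H'_def using theta theta_gap Ax[of n]
    by (intro max.mono order_refl divide_right_mono add_right_mono mult_right_mono mult_nonneg_nonneg) auto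
  finally show ?thesis .
qed

lemma power_sum:
  assumes t: "t \<in> {0..T}"
  shows "(\<Sum>i=2..N. exp (- (\<epsilon> n * real i)) * (\<epsilon> n * ((\<epsilon> n * real i) powr (s*\<delta>) * c n i t powr (1+\<delta>)))) \<le> P2'"
proof -
  let ?X = "\<lambda>a. (abar * ustar - bbar) powr (-\<delta>) * (a * M\<^sup>2) powr (1+\<delta>) + bbar"
  have t1: "0 \<le> t" "t \<le> 1" using t T by auto
  have "(\<Sum>i=2..N. exp (- (\<epsilon> n * real i)) * (\<epsilon> n * ((\<epsilon> n * real i) powr (s*\<delta>) * c n i t powr (1+\<delta>)))) \<le> P2 + ?X (A n) * t"
    by (rule BD_power_law.power_moment[OF bd _ _ exp_eps delta(1) power0 delta(2)]) (use t u_low in auto)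
  also have "?X (A n) * t \<le> ?X Ax * 1"
  proof (rule mult_mono)
    show "?X (A n) \<le> ?X Ax"
      using Ax[of n] AB_pos[of n] delta by (intro add_right_mono mult_left_mono powr_mono2 mult_right_mono) auto
    show "0 \<le> ?X Ax" using ab by simp
  qed (use t1 in auto)
  finally show ?thesis by (simp add: P2'_def)
qed

lemma F_meas [measurable]: "F n t \<in> borel_measurable borel" using eps by measurable

lemma F_nn: "0 \<le> t \<Longrightarrow> 0 \<le> F n t x"
  using step_fun_nonneg[OF eps(1)[of n], of "\<lambda>i. c n i t" x] c_nn by blast

lemma F_neg: "x \<le> 0 \<Longrightarrow> F n t x = 0" using step_fun_neg[OF eps(1)] .

lemma F_int: assumes "t \<in> {0..T}" shows "integrable lborel (F n t)"
proof -
  have w: "0 \<le> c n i t" if "2 \<le> i" for i using c_nn that assms by auto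
  have "(\<Sum>i=2..N. c n i t * (\<epsilon> n * 1)) \<le> Q" for N using number[OF assms, where n=n and N=N] by (simp add: mult.commute)
  note * = step_integral_le(1)[where h="\<lambda>_. 1" and b="\<lambda>_. 1" and C=Q and w="\<lambda>i. c n i t" and \<epsilon>="\<epsilon> n", OF eps(1) w _ _ _ this]
  show ?thesis using * by auto
qed

lemma tail:
  assumes e: "0 < e"
  shows "\<exists>R>0. \<forall>n. \<forall>t\<in>{0..T}. integrable lborel (\<lambda>x. F n t x * (indicator {R..} x * x)) \<and>
    (\<integral>x. F n t x * (indicator {R..} x * x) \<partial>lborel) \<le> e"
proof -
  obtain R0 where R0: "2 \<le> R0" "\<And>n N. (\<Sum>i=2..N. max (\<epsilon> n * real i - R0) 0 * (\<epsilon> n * c n i 0)) \<le> e/8"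
    using tail0[of "e/8"] e by auto
  have "((\<lambda>R. abar * M\<^sup>2 * (R/2) powr (s-1)) \<longlongrightarrow> abar * M\<^sup>2 * 0) at_top"
  proof (intro tendsto_mult_left tendsto_neg_powr)
    show "filterlim (\<lambda>R::real. R/2) at_top at_top" by real_asymp
  qed (use s01 in auto)
  then have "((\<lambda>R. abar * M\<^sup>2 * (R/2) powr (s-1)) \<longlongrightarrow> 0) at_top" by simp
  then have "\<forall>\<^sub>F R in at_top. abar * M\<^sup>2 * (R/2) powr (s-1) < e/8" using e by (intro order_tendstoD) auto
  moreover have "\<forall>\<^sub>F R in at_top. R0 \<le> R" by (rule eventually_ge_at_top)
  ultimately have "\<forall>\<^sub>F R in at_top. abar * M\<^sup>2 * (R/2) powr (s-1) < e/8 \<and> R0 \<le> R" by (rule eventually_conj)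
  then obtain R where R: "R0 \<le> R" and Rp: "abar * M\<^sup>2 * (R/2) powr (s-1) < e/8" by (auto simp: eventually_at_top_linorder)
  have i0: "(\<Sum>i=2..N. max (\<epsilon> n * real i - R) 0 * (\<epsilon> n * c n i 0)) \<le> e/8" for n N
  proof (rule order_trans[OF _ R0(2)])
    show "(\<Sum>i=2..N. max (\<epsilon> n * real i - R) 0 * (\<epsilon> n * c n i 0)) \<le> (\<Sum>i=2..N. max (\<epsilon> n * real i - R0) 0 * (\<epsilon> n * c n i 0))"
      using R eps(1)[of n] c_nn by (intro sum_mono mult_right_mono mult_nonneg_nonneg) auto
  qed
  have main: "integrable lborel (\<lambda>x. F n t x * (indicator {4*R..} x * x)) \<and> (\<integral>x. F n t x * (indicator {4*R..} x * x) \<partial>lborel) \<le> e"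
    if t: "t \<in> {0..T}" for n t
  proof -
    have t1: "0 \<le> t" "t \<le> 1" using t T by auto
    have X1: "(\<Sum>i=2..N. max (\<epsilon> n * real i - R) 0 * (\<epsilon> n * c n i t)) \<le> e/8 + abar * M\<^sup>2 * (R/2) powr (s-1) * t" for N
      by (rule BD_power_law.tail_mass_le[OF bd t1(1) _ i0]) (use R R0 in auto)
    have X2: "abar * M\<^sup>2 * (R/2) powr (s-1) * t \<le> e/8 * 1"
      using Rp t1 e ab by (intro mult_mono) auto
    have S: "(\<Sum>i=2..N. max (\<epsilon> n * real i - R) 0 * (\<epsilon> n * c n i t)) \<le> e/4" for N
      using X1[of N] X2 by linarith
    have "(\<Sum>i=2..N. c n i t * (\<epsilon> n * (4 * max (\<epsilon> n * real i - R) 0))) \<le> e" for N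
    proof -
      have "(\<Sum>i=2..N. c n i t * (\<epsilon> n * (4 * max (\<epsilon> n * real i - R) 0))) = 4 * (\<Sum>i=2..N. max (\<epsilon> n * real i - R) 0 * (\<epsilon> n * c n i t))"
        unfolding sum_distrib_left by (intro sum.cong) auto
      then show ?thesis using S[of N] by linarith
    qed
    note S4 = this
    have b: "indicator {4*R..} x * x \<le> 4 * max (\<epsilon> n * real i - R) 0" if "2 \<le> i" "x \<in> size_cell (\<epsilon> n) i" for i x
    proof (cases "4*R \<le> x")
      case True
      have "x \<le> 4 * (y - R)" if "x \<le> 2 * y" for y using that True by argo
      from this[OF size_cell_bounds(4)[OF eps(1) that]]
      have "x \<le> 4 * max (\<epsilon> n * real i - R) 0" by (rule order_trans) (rule mult_left_mono, auto)
      then show ?thesis using True by simp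
    qed simp
    have w: "0 \<le> c n i t" if "2 \<le> i" for i using c_nn[OF that t1(1)] .
    have hm: "(\<lambda>x. indicator {4*R..} x * x :: real) \<in> borel_measurable borel" by measurable
    have hn: "0 \<le> indicator {4*R..} x * x" if "0 < x" for x :: real using that by simp
    show ?thesis using step_integral_le[OF eps(1) w hm hn b S4] by simp
  qed
  show ?thesis by (rule exI[of _ "4*R"]) (use main R R0 in auto)
qed

lemma power_integral:
  assumes t: "t \<in> {0..T}" and R: "0 < R"
  shows "integrable lborel (\<lambda>x. F n t x powr (1+\<delta>) * (indicator {0<..<R} x * x powr (s*\<delta>)))"
    "(\<integral>x. F n t x powr (1+\<delta>) * (indicator {0<..<R} x * x powr (s*\<delta>)) \<partial>lborel) \<le> 2 * exp (2*R) * P2'"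
proof -
  define b where "b i = 2 * exp (2*R) * (exp (- (\<epsilon> n * real i)) * (\<epsilon> n * real i) powr (s*\<delta>))" for i
  have eq: "F n t x powr (1+\<delta>) = step_fun (\<epsilon> n) 2 (\<lambda>i. c n i t powr (1+\<delta>)) x" for x
    by (rule step_fun_comp[OF eps(1), of "\<lambda>y. y powr (1+\<delta>)"]) simp
  have S: "(\<Sum>i=2..N. c n i t powr (1+\<delta>) * (\<epsilon> n * b i)) \<le> 2 * exp (2*R) * P2'" for N
  proof -
    have "(\<Sum>i=2..N. c n i t powr (1+\<delta>) * (\<epsilon> n * b i)) = 2 * exp (2*R) *
       (\<Sum>i=2..N. exp (- (\<epsilon> n * real i)) * (\<epsilon> n * ((\<epsilon> n * real i) powr (s*\<delta>) * c n i t powr (1+\<delta>))))"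
      unfolding sum_distrib_left by (intro sum.cong) (auto simp: b_def)
    then show ?thesis using power_sum[OF t, where n=n and N=N] by simp
  qed
  have b: "indicator {0<..<R} x * x powr (s*\<delta>) \<le> b i" if i: "2 \<le> i" "x \<in> size_cell (\<epsilon> n) i" for i x
  proof (cases "x < R")
    case True
    note sc = size_cell_bounds[OF eps(1) i]
    have ei: "0 < \<epsilon> n * real i" using eps(1)[of n] i by simp
    have "x powr (s*\<delta>) \<le> (2 * (\<epsilon> n * real i)) powr (s*\<delta>)" using sc s01 delta by (intro powr_mono2) auto
    also have "\<dots> = 2 powr (s*\<delta>) * (\<epsilon> n * real i) powr (s*\<delta>)" using ei by (simp add: powr_mult)
    also have "\<dots> \<le> 2 powr 1 * (\<epsilon> n * real i) powr (s*\<delta>)" using delta by (intro mult_right_mono powr_mono) auto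
    also have "\<dots> \<le> (2 * (exp (2*R) * exp (- (\<epsilon> n * real i)))) * (\<epsilon> n * real i) powr (s*\<delta>)"
    proof (rule mult_right_mono)
      have "1 \<le> exp (2*R - \<epsilon> n * real i)" using sc(3) True by simp
      then show "2 powr 1 \<le> 2 * (exp (2*R) * exp (- (\<epsilon> n * real i)))" by (simp add: exp_add[symmetric])
    qed simp
    finally show ?thesis using sc(1) True by (simp add: b_def mult_ac)
  qed (simp add: b_def)
  have hm: "(\<lambda>x. indicator {0<..<R} x * x powr (s*\<delta>) :: real) \<in> borel_measurable borel" by measurable
  have hn: "0 \<le> indicator {0<..<R} x * x powr (s*\<delta>)" for x :: real by simp
  have w: "0 \<le> c n i t powr (1+\<delta>)" for i by simp
  show "integrable lborel (\<lambda>x. F n t x powr (1+\<delta>) * (indicator {0<..<R} x * x powr (s*\<delta>)))"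
    "(\<integral>x. F n t x powr (1+\<delta>) * (indicator {0<..<R} x * x powr (s*\<delta>)) \<partial>lborel) \<le> 2 * exp (2*R) * P2'"
    unfolding eq using step_integral_le[OF eps(1) w hm hn b S] by auto
qed

lemma equi_integrable_F: "equi_integrable (UNIV \<times> {0..T}) (\<lambda>(n,t). F n t)"
  unfolding equi_integrable_def
proof (intro conjI allI impI ballI)
  fix i :: "nat \<times> real" assume "i \<in> UNIV \<times> {0..T}"
  then show "integrable lborel ((\<lambda>(n,t). F n t) i)" "0 \<le> (\<lambda>(n,t). F n t) i x" for x
    using F_int F_nn by auto
next
  fix e :: real assume e: "0 < e"
  obtain R0 where R0: "0 < R0" "\<And>n t. t \<in> {0..T} \<Longrightarrow> integrable lborel (\<lambda>x. F n t x * (indicator {R0..} x * x))"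
    "\<And>n t. t \<in> {0..T} \<Longrightarrow> (\<integral>x. F n t x * (indicator {R0..} x * x) \<partial>lborel) \<le> e/2"
    using tail[of "e/2"] e by auto
  define R where "R = max R0 1"
  have R: "R0 \<le> R" "1 \<le> R" by (auto simp: R_def)
  define Kd where "Kd = 2 * (2 * exp (2*R) * P2') / e + 1"
  have Kd: "0 < Kd" using e P2'_nn by (simp add: Kd_def add_nonneg_pos)
  define K where "K = Kd powr (1/\<delta>)"
  have K: "0 < K" "K powr \<delta> = Kd" using Kd delta by (auto simp: K_def powr_powr)
  have small: "2 * exp (2*R) * P2' / K powr \<delta> \<le> e/2"
  proof -
    have "2 * exp (2*R) * P2' \<le> e/2 * Kd" using e by (simp add: Kd_def field_simps)
    then show ?thesis unfolding K(2) using Kd by (simp add: pos_divide_le_eq)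
  qed
  define h where "h x = K * (indicator {0<..<R} x * x powr (-s))" for x :: real
  have hi: "integrable lborel h" unfolding h_def[abs_def] using powr_near_0_integrable[of s R] s01 R by simp
  have hn: "0 \<le> h x" for x using K by (simp add: h_def)
  have main: "(LINT x:D|lborel. F n t x) \<le> e + (LINT x:D|lborel. h x)" if t: "t \<in> {0..T}" and D: "D \<in> sets borel" for n t D
  proof -
    let ?p = "\<lambda>x. F n t x powr (1+\<delta>) * (indicator {0<..<R} x * x powr (s*\<delta>))"
    let ?q = "\<lambda>x. F n t x * (indicator {R0..} x * x)"
    have Di: "integrable lborel (\<lambda>x. indicator D x * h x)"
      using set_integrable_subset_borel[OF hi D] by (simp add: set_integrable_def)
    have "(LINT x:D|lborel. F n t x) \<le> (\<integral>x. ?q x + (?p x * (1 / K powr \<delta>) + indicator D x * h x) \<partial>lborel)"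
      unfolding set_lebesgue_integral_def
    proof (rule integral_mono)
      show "integrable lborel (\<lambda>x. indicat_real D x *\<^sub>R F n t x)"
        using set_integrable_subset_borel[OF F_int[OF t] D] by (simp add: set_integrable_def)
      show "integrable lborel (\<lambda>x. ?q x + (?p x * (1 / K powr \<delta>) + indicator D x * h x))"
        using R0(2)[OF t, of n] power_integral(1)[OF t, of R n] R Di by (intro Bochner_Integration.integrable_add integrable_mult_left) auto
      fix x :: real
      have F0: "0 \<le> F n t x" using F_nn t by auto
      have p0: "0 \<le> ?p x * (1 / K powr \<delta>)" by simp
      have q0: "0 \<le> ?q x" using F0 R0(1) by (auto simp: indicator_def)
      show "indicat_real D x *\<^sub>R F n t x \<le> ?q x + (?p x * (1 / K powr \<delta>) + indicator D x * h x)"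
      proof (cases "x \<in> D")
        case True
        consider "x \<le> 0" | "0 < x" "x < R" | "R \<le> x" by linarith
        then have "F n t x \<le> ?q x + (?p x * (1 / K powr \<delta>) + h x)"
        proof cases
          case 1
          then have "F n t x = 0" by (rule F_neg)
          then show ?thesis using p0 q0 hn[of x] by linarith
        next
          case 2
          have "F n t x \<le> K * x powr (-s) + x powr (s*\<delta>) * F n t x powr (1+\<delta>) / K powr \<delta>"
            by (rule le_power_split) (use 2 F0 K delta in auto)
          moreover have "?p x * (1 / K powr \<delta>) = x powr (s*\<delta>) * F n t x powr (1+\<delta>) / K powr \<delta>" "h x = K * x powr (-s)"
            using 2 by (auto simp: h_def)
          ultimately show ?thesis using q0 by linarith
        next
          case 3
          then have "F n t x * 1 \<le> F n t x * x" using F0 R by (intro mult_left_mono) auto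
          then have "F n t x \<le> ?q x" using 3 R by simp
          then show ?thesis using p0 hn[of x] by linarith
        qed
        then show ?thesis using True by simp
      next
        case False
        then show ?thesis using p0 q0 by simp
      qed
    qed
    also have "\<dots> = (\<integral>x. ?q x \<partial>lborel) + ((\<integral>x. ?p x \<partial>lborel) / K powr \<delta> + (\<integral>x. indicator D x * h x \<partial>lborel))"
      using R0(2)[OF t, of n] power_integral(1)[OF t, of R n] R Di by (subst Bochner_Integration.integral_add; simp)+
    also have "(\<integral>x. ?p x \<partial>lborel) / K powr \<delta> \<le> (2 * exp (2*R) * P2') / K powr \<delta>"
      using power_integral(2)[OF t, of R n] R by (intro divide_right_mono) auto
    finally show ?thesis using R0(3)[OF t, of n] small by (simp add: set_lebesgue_integral_def)
  qed
  show "\<exists>h. integrable lborel h \<and> (\<forall>x. 0 \<le> h x) \<and>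
        (\<forall>i\<in>UNIV \<times> {0..T}. \<forall>A\<in>sets borel. (LINT x:A|lborel. (\<lambda>(n,t). F n t) i x) \<le> e + (LINT x:A|lborel. h x))"
    by (intro exI[of _ h]) (use hi hn main in auto)
qed

lemma J1_bound:
  assumes t: "t \<in> {0..T}"
  shows "\<bar>BD_power_law.J \<eta> (\<epsilon> n) (A n) (B n) (ae n) (be n) (u n) (c n) 1 t\<bar> \<le> Ax * M\<^sup>2 + Bx * (2 * H' / \<theta>^2)"
proof -
  have t0: "0 \<le> t" using t by auto
  note g = BD_power_law.two_moment_le[OF bd t0 theta(1) moment[OF t]]
  have "0 \<le> H'" using moment[OF t, where n=0 and N=0] by simp
  then have "A n * M\<^sup>2 + B n * (2 * H' / \<theta>^2) \<le> Ax * M\<^sup>2 + Bx * (2 * H' / \<theta>^2)"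
    using Ax[of n] Bx[of n] by (intro add_mono mult_right_mono) auto
  with BD_power_law.abs_J1_le[OF bd t0 g] show ?thesis by (rule order_trans)
qed

lemma rays_time_equicontinuous:
  assumes e: "0 < (e::real)"
  shows "\<exists>d>0. \<forall>n. \<forall>r\<in>{0..T}. \<forall>t\<in>{0..T}. \<bar>r - t\<bar> < d \<longrightarrow>
      \<bar>(LINT x:{..a}|lborel. F n r x) - (LINT x:{..a}|lborel. F n t x)\<bar> < e"
proof -
  have "\<exists>k0. \<forall>i\<in>UNIV \<times> {0..T}. \<forall>k\<ge>k0. (LINT x:{a<..<a + 1 / (real k + 1)}|lborel. (\<lambda>(n,t). F n t) i x) < e/4"
  proof (rule equi_integrable_shrinking[OF equi_integrable_F])
    show "AE x in lborel. \<forall>\<^sub>F k in sequentially. x \<notin> {a<..<a + 1 / (real k + 1)}"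
    proof (intro AE_I2)
      fix x :: real
      have "(\<lambda>k. a + 1 / (real k + 1)) \<longlonglongrightarrow> a" by real_asymp
      then have "\<forall>\<^sub>F k in sequentially. a + 1 / (real k + 1) < x" if "a < x" using that by (rule order_tendstoD)
      then show "\<forall>\<^sub>F k in sequentially. x \<notin> {a<..<a + 1 / (real k + 1)}"
        by (cases "a < x") (auto elim: eventually_mono)
    qed
  qed (use e in auto)
  then obtain k :: nat where k0: "\<forall>i\<in>UNIV \<times> {0..T}. \<forall>k'\<ge>k. (LINT x:{a<..<a + 1 / (real k' + 1)}|lborel. (\<lambda>(n,t). F n t) i x) < e/4" ..
  have k: "(LINT x:{a<..<a + 1 / (real k + 1)}|lborel. F n t x) < e/4" if "t \<in> {0..T}" for n t
    using bspec[OF k0, of "(n,t)"] that by (simp del: less_divide_eq_numeral1)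
  define D where "D = real k + 1"
  define \<phi> where "\<phi> x = max 0 (min 1 ((a + 1/D - x) * D))" for x
  have D: "0 < D" by (simp add: D_def)
  have \<phi>m: "\<phi> \<in> borel_measurable borel" unfolding \<phi>_def[abs_def] by measurable
  have \<phi>b: "\<bar>\<phi> x\<bar> \<le> 1" "0 \<le> \<phi> x" "\<phi> x \<le> 1" for x by (auto simp: \<phi>_def)
  have \<phi>L: "\<bar>\<phi> x - \<phi> y\<bar> \<le> D * \<bar>x - y\<bar>" for x y
  proof -
    have "\<bar>\<phi> x - \<phi> y\<bar> \<le> \<bar>(a + 1/D - x) * D - (a + 1/D - y) * D\<bar>" unfolding \<phi>_def by linarith
    also have "\<dots> = \<bar>D * (y - x)\<bar>" by (simp add: algebra_simps)
    also have "\<dots> = D * \<bar>x - y\<bar>" using D by (simp add: abs_mult)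
    finally show ?thesis .
  qed
  have \<phi>0: "\<phi> x = 0" if "a + 1/D \<le> x" for x
    using that D mult_nonpos_nonneg[of "a + 1/D - x" D] by (simp add: \<phi>_def)
  have \<phi>1: "\<phi> x = 1" if "x \<le> a" for x
  proof -
    have "1/D * D \<le> (a + 1/D - x) * D" using that D by (intro mult_right_mono) auto
    then show ?thesis using D by (simp add: \<phi>_def)
  qed
  define \<Lambda> where "\<Lambda> = 1 * (Ax * M\<^sup>2 + Bx * (2 * H' / \<theta>^2)) + D * ((abar * M + bbar) * (Q + M))"
  have lip: "\<bar>(\<integral>x. F n t x * \<phi> x \<partial>lborel) - (\<integral>x. F n r x * \<phi> x \<partial>lborel)\<bar> \<le> \<Lambda> * (t - r)"
    if rt: "0 \<le> r" "r \<le> t" "t \<le> T" for n r t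
    unfolding \<Lambda>_def
  proof (rule BD_power_law.test_integral_time_lipschitz[OF bd rt(1,2) _ _ \<phi>m \<phi>b(1) \<phi>L \<phi>0])
    fix N :: nat and x assume "0 \<le> x" "x \<le> t"
    then have x: "x \<in> {0..T}" using rt by auto
    show "(\<Sum>i=2..N. \<epsilon> n * c n i x) \<le> Q" by (rule number[OF x])
    show "\<bar>BD_power_law.J \<eta> (\<epsilon> n) (A n) (B n) (ae n) (be n) (u n) (c n) 1 x\<bar> \<le> Ax * M\<^sup>2 + Bx * (2 * H' / \<theta>^2)"
      by (rule J1_bound[OF x])
  qed
  have near: "\<bar>(LINT x:{..a}|lborel. F n t x) - (\<integral>x. F n t x * \<phi> x \<partial>lborel)\<bar> < e/4" if t: "t \<in> {0..T}" for n t
  proof -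
    have i1: "integrable lborel (\<lambda>x. indicator B x * F n t x)" if "B \<in> sets borel" for B
      using set_integrable_subset_borel[OF F_int[OF t] that] by (simp add: set_integrable_def)
    have i2: "integrable lborel (\<lambda>x. F n t x * \<phi> x)" by (rule integrable_mult_bounded[OF F_int[OF t] \<phi>m \<phi>b(1)])
    have pt: "indicator {..a} x * F n t x \<le> F n t x * \<phi> x" "F n t x * \<phi> x - indicator {..a} x * F n t x \<le> indicator {a<..<a + 1/D} x * F n t x" for x
    proof -
      have F0: "0 \<le> F n t x" using F_nn t by auto
      have "F n t x * \<phi> x \<le> F n t x * 1" using F0 \<phi>b by (intro mult_left_mono) auto
      then show "indicator {..a} x * F n t x \<le> F n t x * \<phi> x" "F n t x * \<phi> x - indicator {..a} x * F n t x \<le> indicator {a<..<a + 1/D} x * F n t x"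
        using F0 \<phi>b(2)[of x] \<phi>1[of x] \<phi>0[of x] by (auto simp: indicator_def not_less)
    qed
    have "(\<integral>x. indicator {..a} x * F n t x \<partial>lborel) \<le> (\<integral>x. F n t x * \<phi> x \<partial>lborel)"
      by (rule integral_mono[OF i1 i2 pt(1)]) simp
    moreover have "(\<integral>x. F n t x * \<phi> x - indicator {..a} x * F n t x \<partial>lborel) \<le> (\<integral>x. indicator {a<..<a + 1/D} x * F n t x \<partial>lborel)"
      by (rule integral_mono[OF Bochner_Integration.integrable_diff[OF i2 i1] i1 pt(2)]) auto
    moreover have "(\<integral>x. F n t x * \<phi> x - indicator {..a} x * F n t x \<partial>lborel) = (\<integral>x. F n t x * \<phi> x \<partial>lborel) - (\<integral>x. indicator {..a} x * F n t x \<partial>lborel)"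
      by (rule Bochner_Integration.integral_diff[OF i2 i1]) simp
    moreover have "(\<integral>x. indicator {a<..<a + 1/D} x * F n t x \<partial>lborel) < e/4"
      using k[OF t, of n] by (simp add: set_lebesgue_integral_def D_def)
    ultimately show ?thesis unfolding set_lebesgue_integral_def real_scaleR_def by linarith
  qed
  have \<Lambda>0: "0 \<le> \<Lambda>"
  proof -
    have "0 \<le> \<Lambda> * (T - 0)" using lip[of 0 T 0] T(1) by linarith
    then show ?thesis using T(1) by (simp add: zero_le_mult_iff)
  qed
  define d where "d = e / (4 * (\<Lambda> + 1))"
  have d: "0 < d" "\<Lambda> * d \<le> e/4"
  proof -
    show "0 < d" using e \<Lambda>0 by (simp add: d_def)
    have "(\<Lambda> + 1) * d = e/4" using \<Lambda>0 by (simp add: d_def field_simps)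
    then show "\<Lambda> * d \<le> e/4" using \<open>0 < d\<close> by (simp add: algebra_simps)
  qed
  have lip2: "\<bar>(\<integral>x. F n r x * \<phi> x \<partial>lborel) - (\<integral>x. F n t x * \<phi> x \<partial>lborel)\<bar> \<le> e/4"
    if rt: "r \<in> {0..T}" "t \<in> {0..T}" "\<bar>r - t\<bar> < d" for n r t
  proof -
    have "\<bar>(\<integral>x. F n r x * \<phi> x \<partial>lborel) - (\<integral>x. F n t x * \<phi> x \<partial>lborel)\<bar> \<le> \<Lambda> * \<bar>r - t\<bar>"
      using lip[of r t n] lip[of t r n] rt by (cases "r \<le> t") auto
    also have "\<dots> \<le> \<Lambda> * d" using rt \<Lambda>0 by (intro mult_left_mono) auto
    finally show ?thesis using d by linarith
  qed
  show ?thesis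
  proof (intro exI[of _ d] conjI allI ballI impI)
    fix n r t assume rt: "r \<in> {0..T}" "t \<in> {0..T}" "\<bar>r - t\<bar> < d"
    show "\<bar>(LINT x:{..a}|lborel. F n r x) - (LINT x:{..a}|lborel. F n t x)\<bar> < e"
      using near[OF rt(1), of n] near[OF rt(2), of n] lip2[OF rt, of n] e by linarith
  qed (rule d)
qed

end

lemma first_moment_weak_star_limit:
  fixes f :: "nat \<Rightarrow> real \<Rightarrow> real"
  assumes f: "\<And>n. f n \<in> borel_measurable borel" "\<And>n x. 0 \<le> f n x" "\<And>n x. x < 0 \<Longrightarrow> f n x = 0"
    and fi: "\<And>n. integrable lborel (f n)" "\<And>n. integrable lborel (\<lambda>x. f n x * x)"
    and tail: "\<And>e. 0 < e \<Longrightarrow> \<exists>R>0. \<forall>n. integrable lborel (\<lambda>x. f n x * (indicator {R..} x * x)) \<and>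
        (\<integral>x. f n x * (indicator {R..} x * x) \<partial>lborel) \<le> e"
    and conv: "weak_star_tendsto (\<lambda>n. density half_line (\<lambda>x. ennreal (f n x))) \<mu> sequentially"
    and \<mu>: "finite_half_line_measure \<mu>"
  shows "(\<lambda>n. \<integral>x. f n x * x \<partial>lborel) \<longlonglongrightarrow> (\<integral>x. x \<partial>\<mu>)"
proof -
  have \<mu>sets: "sets \<mu> = sets (restrict_space borel {0..})" and \<mu>fin: "finite_measure \<mu>"
    using \<mu> by (auto simp: finite_half_line_measure_def)
  have \<mu>space: "space \<mu> = {0..}" using sets_eq_imp_space_eq[OF \<mu>sets] by simp
  define k where "k j = real (Suc j)" for j
  define \<tau> where "\<tau> j x = max 0 (min x (2 * k j - x))" for j and x :: real
  have k0: "0 < k j" for j by (simp add: k_def)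
  have \<tau>c: "continuous_on S (\<tau> j)" for S j unfolding \<tau>_def[abs_def] by (intro continuous_intros)
  have \<tau>b: "0 \<le> \<tau> j x" "\<tau> j x \<le> k j" "0 \<le> x \<Longrightarrow> \<tau> j x \<le> x" for j x using k0[of j] by (auto simp: \<tau>_def)
  have \<tau>m: "(\<lambda>x. indicator {0..} x * \<tau> j x) \<in> borel_measurable borel" for j by (rule half_line_continuous_measurable[OF \<tau>c])
  have \<tau>Cc: "\<tau> j \<in> Cc_half_line" for j
  proof -
    have "\<tau> j x = 0" if "x \<in> {0..} - {0..2 * k j}" for x using that by (auto simp: \<tau>_def)
    then show ?thesis unfolding Cc_half_line_def using \<tau>c by (intro CollectI conjI exI[of _ "{0..2 * k j}"]) auto
  qed
  define a where "a n = (\<integral>x. f n x * x \<partial>lborel)" for n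
  define b where "b n j = (\<integral>x. f n x * (indicator {0..} x * \<tau> j x) \<partial>lborel)" for n j
  define c where "c j = (\<integral>x. \<tau> j x \<partial>\<mu>)" for j
  have bi: "integrable lborel (\<lambda>x. f n x * (indicator {0..} x * \<tau> j x))" for n j
    by (rule integrable_mult_bounded[OF fi(1) \<tau>m, of _ "k j"]) (use \<tau>b[of j] k0[of j] in \<open>auto simp: indicator_def less_imp_le\<close>)
  have bc: "(\<lambda>n. b n j) \<longlonglongrightarrow> c j" for j
  proof -
    have "b n j = (\<integral>x. \<tau> j x \<partial>density half_line (\<lambda>x. ennreal (f n x)))" for n
      unfolding b_def by (rule integral_density_half_line(1)[symmetric, OF f(1,2) \<tau>m])
    then show ?thesis using conv \<tau>Cc[of j] unfolding weak_star_tendsto_def c_def by simp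
  qed
  have ab: "\<bar>a n - b n j\<bar> \<le> e"
    if R: "R \<le> k j" "integrable lborel (\<lambda>x. f n x * (indicator {R..} x * x))" "(\<integral>x. f n x * (indicator {R..} x * x) \<partial>lborel) \<le> e" "0 < R" for n j R e
  proof -
    have d: "a n - b n j = (\<integral>x. f n x * (x - indicator {0..} x * \<tau> j x) \<partial>lborel)"
      unfolding a_def b_def using fi(2) bi by (subst Bochner_Integration.integral_diff[symmetric]) (auto simp: right_diff_distrib)
    have "\<bar>\<integral>x. f n x * (x - indicator {0..} x * \<tau> j x) \<partial>lborel\<bar> \<le> (\<integral>x. f n x * (indicator {R..} x * x) \<partial>lborel)"
    proof (rule abs_integral_mult_le(2)[OF R(2) _ f(1,2)])
      show "(\<lambda>x. x - indicator {0..} x * \<tau> j x) \<in> borel_measurable borel" using \<tau>m[of j] by measurable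
      fix x assume "f n x \<noteq> 0"
      then have x: "0 \<le> x" using f(3)[of x n] by force
      show "\<bar>x - indicator {0..} x * \<tau> j x\<bar> \<le> indicator {R..} x * x"
      proof (cases "R \<le> x")
        case True
        then show ?thesis using \<tau>b(1)[where j=j and x=x] \<tau>b(3)[where j=j and x=x] x by simp
      next
        case False
        then have "\<tau> j x = x" using x R(1) by (simp add: \<tau>_def)
        then show ?thesis using x by simp
      qed
    qed
    then show ?thesis unfolding d using R(3) by linarith
  qed
  have unif: "\<exists>j0. \<forall>j\<ge>j0. \<forall>n. \<bar>a n - b n j\<bar> \<le> e" if e: "0 < e" for e
  proof -
    obtain R where R: "0 < R" "\<And>n. integrable lborel (\<lambda>x. f n x * (indicator {R..} x * x))"
       "\<And>n. (\<integral>x. f n x * (indicator {R..} x * x) \<partial>lborel) \<le> e" using tail[OF e] by blast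
    obtain j0 :: nat where j0: "R < real j0" using reals_Archimedean2 by blast
    have "\<bar>a n - b n j\<bar> \<le> e" if "j0 \<le> j" for j n
      by (rule ab[OF _ R(2,3,1)]) (use j0 that in \<open>simp add: k_def\<close>)
    then show ?thesis by blast
  qed
  have "Cauchy a"
  proof (rule metric_CauchyI)
    fix e :: real assume e: "0 < e"
    obtain j where j: "\<And>n. \<bar>a n - b n j\<bar> \<le> e/4" using unif[of "e/4"] e by auto
    have "Cauchy (\<lambda>n. b n j)" using bc by (rule LIMSEQ_imp_Cauchy)
    then obtain n0 where n0: "\<And>n n'. n0 \<le> n \<Longrightarrow> n0 \<le> n' \<Longrightarrow> \<bar>b n j - b n' j\<bar> < e/4"
      using metric_CauchyD[of "\<lambda>n. b n j" "e/4"] e unfolding dist_real_def by (metis divide_pos_pos zero_less_numeral)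
    have "\<bar>a n - a n'\<bar> < e" if "n0 \<le> n" "n0 \<le> n'" for n n' using n0[OF that] j[of n] j[of n'] e by linarith
    then show "\<exists>M. \<forall>m\<ge>M. \<forall>n\<ge>M. dist (a m) (a n) < e" unfolding dist_real_def by blast
  qed
  then obtain l where l: "a \<longlonglongrightarrow> l" using Cauchy_convergent_iff convergent_def by blast
  have "c \<longlonglongrightarrow> l"
  proof (rule metric_LIMSEQ_I)
    fix e :: real assume e: "0 < e"
    obtain j0 where j0: "\<And>j n. j0 \<le> j \<Longrightarrow> \<bar>a n - b n j\<bar> \<le> e/2" using unif[of "e/2"] e by auto
    have "\<bar>l - c j\<bar> \<le> e/2" if "j0 \<le> j" for j
    proof (rule LIMSEQ_le_const2)
      show "(\<lambda>n. \<bar>a n - b n j\<bar>) \<longlonglongrightarrow> \<bar>l - c j\<bar>" by (intro tendsto_intros l bc)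
    qed (use j0[OF that] in auto)
    then have "\<bar>c j - l\<bar> < e" if "j0 \<le> j" for j using e that by (fastforce simp: abs_minus_commute)
    then show "\<exists>no. \<forall>n\<ge>no. dist (c n) l < e" unfolding dist_real_def by blast
  qed
  have "(\<integral>x. x \<partial>\<mu>) = l"
  proof (rule integral_monotone_convergence_nonneg(2))
    fix j
    have m: "\<tau> j \<in> borel_measurable \<mu>"
      using \<tau>c[of "{0..}" j] by (subst measurable_cong_sets[OF \<mu>sets refl]) (rule borel_measurable_continuous_on_restrict)
    show "integrable \<mu> (\<tau> j)"
      by (rule finite_measure.integrable_const_bound[OF \<mu>fin _ m, of "k j"]) (use \<tau>b in auto)
    show "AE x in \<mu>. 0 \<le> \<tau> j x" using \<tau>b by simp
  next
    have "mono (\<lambda>j. \<tau> j x)" for x by (intro monoI) (auto simp: \<tau>_def k_def)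
    then show "AE x in \<mu>. mono (\<lambda>j. \<tau> j x)" by simp
    show "AE x in \<mu>. (\<lambda>j. \<tau> j x) \<longlonglongrightarrow> x"
    proof (intro AE_I2 tendsto_eventually)
      fix x assume "x \<in> space \<mu>"
      then have x: "0 \<le> x" using \<mu>space by simp
      obtain j0 :: nat where j0: "x < real j0" using reals_Archimedean2 by blast
      have "\<tau> j x = x" if "j0 \<le> j" for j using j0 that x by (simp add: \<tau>_def k_def)
      then show "\<forall>\<^sub>F j in sequentially. \<tau> j x = x" unfolding eventually_sequentially by blast
    qed
    show "(\<lambda>j. \<integral>x. \<tau> j x \<partial>\<mu>) \<longlonglongrightarrow> l" using \<open>c \<longlonglongrightarrow> l\<close> by (simp add: c_def[abs_def])
    show "(\<lambda>x. x) \<in> borel_measurable \<mu>"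
      by (subst measurable_cong_sets[OF \<mu>sets refl]) (rule borel_measurable_continuous_on_restrict[OF continuous_on_id])
  qed
  then show ?thesis using l by (simp add: a_def[abs_def])
qed

lemma (in BD_sequence) initial_first_moment_tendsto:
  assumes mass: "\<And>n. ((\<lambda>i. (\<epsilon> n)\<^sup>2 * real i * c n i 0) has_sum S n) {2..}"
    and init: "weak_star_tendsto (\<lambda>n. density half_line (\<lambda>x. ennreal (F n 0 x))) \<mu> sequentially"
    and \<mu>: "finite_half_line_measure \<mu>"
  shows "S \<longlonglongrightarrow> (\<integral>x. x \<partial>\<mu>)"
proof -
  have T0: "0 \<in> {0..T}" using T by simp
  have w: "0 \<le> c n i 0" if "2 \<le> i" for i n using c_nn[OF that] by simp
  have "(\<lambda>n. \<integral>x. F n 0 x * x \<partial>lborel) \<longlonglongrightarrow> (\<integral>x. x \<partial>\<mu>)"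
  proof (rule first_moment_weak_star_limit[OF F_meas F_nn _ F_int[OF T0] _ _ init \<mu>])
    show "integrable lborel (\<lambda>x. F n 0 x * x)" for n by (rule step_first_moment(1)[OF eps(1) w mass])
    show "\<exists>R>0. \<forall>n. integrable lborel (\<lambda>x. F n 0 x * (indicator {R..} x * x)) \<and>
        (\<integral>x. F n 0 x * (indicator {R..} x * x) \<partial>lborel) \<le> e" if "0 < e" for e
      using tail[OF that] T0 by blast
  qed (auto intro: F_neg)
  moreover have "(\<integral>x. F n 0 x * x \<partial>lborel) = S n" for n by (rule step_first_moment(2)[OF eps(1) w mass])
  ultimately show ?thesis by simp
qed

lemma (in BD_sequence) limit_along_subsequence:
  assumes eps_lim: "\<epsilon> \<longlonglongrightarrow> 0" and A_lim: "A \<longlonglongrightarrow> \<alpha>" and B_lim: "B \<longlonglongrightarrow> \<beta>" and beta_pos: "0 < \<beta>"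
    and mass_balance: "\<And>n t. 0 \<le> t \<Longrightarrow> ((\<lambda>i. (\<epsilon> n)\<^sup>2 * real i * c n i t) has_sum (me n - u n t)) {2..}"
    and uin_lim: "(\<lambda>n. u n 0) \<longlonglongrightarrow> uin" and m: "m = uin + (\<integral>x. x \<partial>\<mu>in)"
    and init: "weak_star_tendsto (\<lambda>n. density half_line (\<lambda>x. ennreal (F n 0 x))) \<mu>in sequentially"
    and \<mu>in: "finite_half_line_measure \<mu>in"
  obtains r f where "strict_mono (r :: nat \<Rightarrow> nat)"
    "BD_limit_setting \<eta> s abar bbar \<alpha> \<beta> m uin T M ustar \<theta> Q H' L Ax Bx (\<lambda>n. \<epsilon> (r n)) (\<lambda>n. A (r n)) (\<lambda>n. B (r n))
       (\<lambda>n. me (r n)) (\<lambda>n. ae (r n)) (\<lambda>n. be (r n)) (\<lambda>n. u (r n)) (\<lambda>n. c (r n)) f \<mu>in"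
proof (rule weak_L1_compactness[OF equi_integrable_F])
  fix a e :: real assume "0 < e"
  then show "\<exists>d>0. \<forall>n. \<forall>r\<in>{0..T}. \<forall>t\<in>{0..T}. \<bar>r - t\<bar> < d \<longrightarrow>
      \<bar>(LINT x:{..a}|lborel. F n r x) - (LINT x:{..a}|lborel. F n t x)\<bar> < e"
    by (rule rays_time_equicontinuous)
next
  fix r f'
  assume r: "strict_mono (r :: nat \<Rightarrow> nat)" and f'i: "\<And>t. t \<in> {0..T} \<Longrightarrow> integrable lborel (f' t)"
    and f'n: "\<And>t x. t \<in> {0..T} \<Longrightarrow> 0 \<le> f' t x"
    and conv: "\<And>g B. g \<in> borel_measurable borel \<Longrightarrow> (\<And>x. \<bar>g x\<bar> \<le> (B::real)) \<Longrightarrow>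
      uniform_limit {0..T} (\<lambda>n t. \<integral>x. F (r n) t x * g x \<partial>lborel) (\<lambda>t. \<integral>x. f' t x * g x \<partial>lborel) sequentially"
  define f where "f t x = f' t x * indicator {0..} x" for t x
  have sub: "(\<lambda>n. X (r n)) \<longlonglongrightarrow> x" if "X \<longlonglongrightarrow> x" for X and x :: real
    using LIMSEQ_subseq_LIMSEQ[OF that r] by (simp add: o_def)
  have me_lim: "me \<longlonglongrightarrow> m"
  proof -
    have "(\<lambda>n. (me n - u n 0) + u n 0) \<longlonglongrightarrow> (\<integral>x. x \<partial>\<mu>in) + uin"
      by (rule tendsto_add[OF initial_first_moment_tendsto[OF mass_balance init \<mu>in] uin_lim]) simp
    then show ?thesis by (simp add: m add.commute)
  qed
  have "BD_limit_setting \<eta> s abar bbar \<alpha> \<beta> m uin T M ustar \<theta> Q H' L Ax Bx (\<lambda>n. \<epsilon> (r n)) (\<lambda>n. A (r n)) (\<lambda>n. B (r n))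
       (\<lambda>n. me (r n)) (\<lambda>n. ae (r n)) (\<lambda>n. be (r n)) (\<lambda>n. u (r n)) (\<lambda>n. c (r n)) f \<mu>in"
  proof (rule BD_limit_setting.intro)
    fix n :: nat and t :: real assume "0 \<le> t"
    then show "((\<lambda>i. (\<epsilon> (r n))\<^sup>2 * real i * c (r n) i t) has_sum (me (r n) - u (r n) t)) {2..}" by (rule mass_balance)
  next
    fix e :: real assume "0 < e"
    from tail[OF this] show "\<exists>R>0. \<forall>n. \<forall>t\<in>{0..T}. (\<integral>x. F (r n) t x * (indicator {R..} x * x) \<partial>lborel) \<le> e" by blast
  next
    fix g :: "real \<Rightarrow> real" and C assume g: "g \<in> borel_measurable borel" "\<And>x. \<bar>g x\<bar> \<le> C"
    note [measurable] = g(1)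
    have "(\<lambda>x. indicator {0..} x * g x) \<in> borel_measurable borel" by measurable
    moreover have "\<bar>indicator {0..} x * g x\<bar> \<le> C" for x using g(2)[of x] by (cases "x \<in> {0..}") auto
    ultimately have "uniform_limit {0..T} (\<lambda>n t. \<integral>x. F (r n) t x * (indicator {0..} x * g x) \<partial>lborel)
      (\<lambda>t. \<integral>x. f' t x * (indicator {0..} x * g x) \<partial>lborel) sequentially" by (rule conv)
    moreover have "F (r n) t x * (indicator {0..} x * g x) = F (r n) t x * g x" for n t x
      using F_neg[of x "r n" t] by (cases "x \<le> 0") auto
    ultimately show "uniform_limit {0..T} (\<lambda>n t. \<integral>x. F (r n) t x * g x \<partial>lborel) (\<lambda>t. \<integral>x. f t x * g x \<partial>lborel) sequentially"
      by (simp add: f_def mult.assoc)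
  next
    fix t assume t: "t \<in> {0..T}"
    show "integrable lborel (f t)" unfolding f_def[abs_def]
      by (rule integrable_mult_bounded[OF f'i[OF t], of _ 1]) (auto simp: indicator_def)
    show "0 \<le> f t x" for x using f'n[OF t] by (simp add: f_def)
  next
    show "weak_star_tendsto (\<lambda>n. density half_line (\<lambda>x. ennreal (F (r n) 0 x))) \<mu>in sequentially"
      unfolding weak_star_tendsto_def
    proof
      fix \<phi> assume "\<phi> \<in> Cc_half_line"
      then have "(\<lambda>n. \<integral>x. \<phi> x \<partial>density half_line (\<lambda>x. ennreal (F n 0 x))) \<longlonglongrightarrow> (\<integral>x. \<phi> x \<partial>\<mu>in)"
        using init by (simp add: weak_star_tendsto_def)
      then show "(\<lambda>n. \<integral>x. \<phi> x \<partial>density half_line (\<lambda>x. ennreal (F (r n) 0 x))) \<longlonglongrightarrow> (\<integral>x. \<phi> x \<partial>\<mu>in)"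
        by (rule sub)
    qed
  qed (use bd Ax Bx ustar theta T beta_pos number moment u_low u_lipschitz sub[OF eps_lim] sub[OF A_lim] sub[OF B_lim] sub[OF me_lim] sub[OF uin_lim] in \<open>auto simp: f_def\<close>)
  then show thesis by (rule that[OF r])
qed

lemma step_power_tendsto:
  fixes x :: real
  assumes x: "0 < x"
    and w: "\<And>\<epsilon> i. 0 < \<epsilon> \<Longrightarrow> k \<le> i \<Longrightarrow> w \<epsilon> i = C * (\<epsilon> * real i) powr s"
  shows "((\<lambda>\<epsilon>. step_fun \<epsilon> k (w \<epsilon>) x) \<longlongrightarrow> C * x powr s) (at_right 0)"
proof -
  define j where "j \<epsilon> = \<lfloor>x / \<epsilon> + 1/2\<rfloor>" for \<epsilon>
  have near: "\<bar>\<epsilon> * real_of_int (j \<epsilon>) - x\<bar> \<le> \<epsilon>" if "0 < \<epsilon>" for \<epsilon>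
  proof -
    have "\<bar>real_of_int (j \<epsilon>) - x / \<epsilon>\<bar> \<le> 1" unfolding j_def by linarith
    then have "\<epsilon> * \<bar>real_of_int (j \<epsilon>) - x / \<epsilon>\<bar> \<le> \<epsilon> * 1" using that by (intro mult_left_mono) auto
    also have "\<epsilon> * \<bar>real_of_int (j \<epsilon>) - x / \<epsilon>\<bar> = \<bar>\<epsilon> * (real_of_int (j \<epsilon>) - x / \<epsilon>)\<bar>" using that by (simp add: abs_mult)
    also have "\<epsilon> * (real_of_int (j \<epsilon>) - x / \<epsilon>) = \<epsilon> * real_of_int (j \<epsilon>) - x" using that by (simp add: algebra_simps)
    finally show ?thesis by simp
  qed
  have "((\<lambda>\<epsilon>. \<epsilon> * real_of_int (j \<epsilon>) - x) \<longlongrightarrow> 0) (at_right 0)"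
  proof (rule Lim_null_comparison)
    show "\<forall>\<^sub>F \<epsilon> in at_right 0. norm (\<epsilon> * real_of_int (j \<epsilon>) - x) \<le> \<epsilon>"
      using eventually_at_right_less[of "0::real"] by eventually_elim (use near in auto)
  qed (rule tendsto_ident_at)
  then have lim: "((\<lambda>\<epsilon>. \<epsilon> * real_of_int (j \<epsilon>)) \<longlongrightarrow> x) (at_right 0)" by (simp add: LIM_zero_iff)
  have "((\<lambda>\<epsilon>. C * (\<epsilon> * real_of_int (j \<epsilon>)) powr s) \<longlongrightarrow> C * x powr s) (at_right 0)"
    using x by (intro tendsto_intros lim) auto
  moreover have "\<forall>\<^sub>F \<epsilon> in at_right 0. C * (\<epsilon> * real_of_int (j \<epsilon>)) powr s = step_fun \<epsilon> k (w \<epsilon>) x"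
  proof -
    have "\<forall>\<^sub>F \<epsilon> in at_right 0. \<epsilon> < x / real (k + 1)" using x by (intro order_tendstoD(2)[OF tendsto_ident_at]) auto
    moreover have "\<forall>\<^sub>F \<epsilon> in at_right 0. (0::real) < \<epsilon>" by (rule eventually_at_right_less)
    ultimately show ?thesis
    proof eventually_elim
      case (elim \<epsilon>)
      then have "real (k + 1) < x / \<epsilon>" by (simp add: field_simps)
      then have kj: "int k \<le> j \<epsilon>" unfolding j_def by linarith
      then have "w \<epsilon> (nat (j \<epsilon>)) = C * (\<epsilon> * real (nat (j \<epsilon>))) powr s" using elim by (intro w) auto
      then show ?case using kj unfolding step_fun_eq[OF elim(2)] j_def[symmetric] by simp
    qed
  qed
  ultimately show ?thesis by (rule Lim_transform_eventually)
qed

text \<open>rates\<close>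
lemma limit_rate_power:
  assumes lim: "\<And>S. compact S \<Longrightarrow> S \<subseteq> {0..} \<Longrightarrow> uniform_limit S (\<lambda>\<epsilon>. step_fun \<epsilon> k (w \<epsilon>)) a (at_right 0)"
    and w: "\<And>\<epsilon> i. 0 < \<epsilon> \<Longrightarrow> k \<le> i \<Longrightarrow> w \<epsilon> i = C * (\<epsilon> * real i) powr s" and k: "1 \<le> k" and x: "0 \<le> x"
  shows "a x = C * x powr s"
proof -
  have "((\<lambda>\<epsilon>. step_fun \<epsilon> k (w \<epsilon>) x) \<longlongrightarrow> a x) (at_right 0)"
    by (rule tendsto_uniform_limitI[OF lim[of "{x}"]]) (use x in auto)
  moreover have "((\<lambda>\<epsilon>. step_fun \<epsilon> k (w \<epsilon>) x) \<longlongrightarrow> C * x powr s) (at_right 0)"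
  proof (cases "x = 0")
    case True
    have "\<forall>\<^sub>F \<epsilon> in at_right 0. step_fun \<epsilon> k (w \<epsilon>) 0 = 0"
      using eventually_at_right_less[of "0::real"]
    proof eventually_elim
      case (elim \<epsilon>)
      then show ?case using k by (simp add: step_fun_eq)
    qed
    then show ?thesis using True by (simp add: tendsto_eventually)
  next
    case False
    then show ?thesis using x by (intro step_power_tendsto w) auto
  qed
  ultimately show ?thesis by (intro tendsto_unique[OF _ \<open>(_ \<longlongrightarrow> a x) _\<close>]) auto
qed

lemma nn_integral_step_half_line:
  assumes "0 < \<epsilon>"
  shows "(\<integral>\<^sup>+x. ennreal (step_fun \<epsilon> 2 w x * h x) \<partial>lborel) = (\<integral>\<^sup>+x. ennreal (step_fun \<epsilon> 2 w x * h x) \<partial>half_line)"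
  using step_fun_neg[OF assms, of _ w] by (subst nn_integral_restrict_space) (auto intro!: nn_integral_cong simp: indicator_def)

lemma initial_power_sum_bounded:
  assumes bound: "(SUP \<epsilon>\<in>{0<..}. \<integral>\<^sup>+x. ennreal (step_fun \<epsilon> 2 (w \<epsilon>) x powr p) \<partial>half_line) < \<infinity>"
  shows "\<exists>C\<ge>0. \<forall>\<epsilon>>0. \<forall>N. (\<Sum>i=2..N. \<epsilon> * w \<epsilon> i powr p) \<le> C"
proof -
  define C where "C = enn2real (SUP \<epsilon>\<in>{0<..}. \<integral>\<^sup>+x. ennreal (step_fun \<epsilon> 2 (w \<epsilon>) x powr p) \<partial>half_line)"
  have "(\<Sum>i=2..N. \<epsilon> * w \<epsilon> i powr p) \<le> C" if e: "0 < \<epsilon>" for \<epsilon> N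
  proof -
    have "(\<Sum>i=2..N. w \<epsilon> i powr p * (\<epsilon> * 1)) \<le> C"
    proof (rule step_sum_le[where h="\<lambda>_. 1"])
      have "(\<integral>\<^sup>+x. ennreal (step_fun \<epsilon> 2 (\<lambda>i. w \<epsilon> i powr p) x * 1) \<partial>lborel) = (\<integral>\<^sup>+x. ennreal (step_fun \<epsilon> 2 (w \<epsilon>) x powr p) \<partial>half_line)"
        unfolding nn_integral_step_half_line[OF e] using step_fun_comp[OF e, of "\<lambda>y. y powr p"] by simp
      also have "\<dots> \<le> (SUP \<epsilon>\<in>{0<..}. \<integral>\<^sup>+x. ennreal (step_fun \<epsilon> 2 (w \<epsilon>) x powr p) \<partial>half_line)"
        by (rule SUP_upper) (use e in auto)
      also have "\<dots> = ennreal C" unfolding C_def by (subst ennreal_enn2real) (use bound in \<open>simp_all only: infinity_ennreal_def\<close>)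
      finally show "(\<integral>\<^sup>+x. ennreal (step_fun \<epsilon> 2 (\<lambda>i. w \<epsilon> i powr p) x * 1) \<partial>lborel) \<le> ennreal C" .
    qed (use e in \<open>auto simp: C_def\<close>)
    then show ?thesis by (simp add: mult.commute)
  qed
  moreover have "0 \<le> C" by (simp add: C_def)
  ultimately show ?thesis by blast
qed

lemma initial_tail_small:
  assumes \<Phi>: "\<Phi> \<in> superlinear_weights" and w: "\<And>\<epsilon> i. 0 < \<epsilon> \<Longrightarrow> 2 \<le> i \<Longrightarrow> 0 \<le> w \<epsilon> i"
    and bound: "(SUP \<epsilon>\<in>{0<..}. \<integral>\<^sup>+x. ennreal (\<Phi> x * step_fun \<epsilon> 2 (w \<epsilon>) x) \<partial>half_line) < \<infinity>" and e: "0 < e"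
  shows "\<exists>R\<ge>2. \<forall>\<epsilon>>0. \<forall>N. (\<Sum>i=2..N. max (\<epsilon> * real i - R) 0 * (\<epsilon> * w \<epsilon> i)) \<le> e"
proof -
  define C where "C = enn2real (SUP \<epsilon>\<in>{0<..}. \<integral>\<^sup>+x. ennreal (\<Phi> x * step_fun \<epsilon> 2 (w \<epsilon>) x) \<partial>half_line)"
  have C0: "0 \<le> C" by (simp add: C_def)
  obtain \<Phi>' where \<Phi>d: "\<And>x. 0 \<le> x \<Longrightarrow> (\<Phi> has_real_derivative \<Phi>' x) (at x within {0..})"
    using \<Phi> by (auto simp: superlinear_weights_def)
  have \<Phi>c: "continuous_on {0..} \<Phi>" using DERIV_continuous_on[OF \<Phi>d] by auto
  have \<Phi>n: "\<And>x. 0 \<le> x \<Longrightarrow> 0 \<le> \<Phi> x" and \<Phi>lim: "filterlim (\<lambda>x. \<Phi> x / x) at_top at_top"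
    using \<Phi> by (auto simp: superlinear_weights_def)
  define k where "k = 2 * (C + 1) / e"
  have k: "0 < k" using C0 e by (simp add: k_def)
  have "\<forall>\<^sub>F x in at_top. k \<le> \<Phi> x / x" using \<Phi>lim by (simp add: filterlim_at_top)
  then obtain X where X: "\<And>x. X \<le> x \<Longrightarrow> k \<le> \<Phi> x / x" by (auto simp: eventually_at_top_linorder)
  define R where "R = 2 * max X 1"
  have R: "2 \<le> R" "X \<le> R/2" "1 \<le> R/2" by (auto simp: R_def)
  define h where "h x = 2 / k * (indicator {0..} x * \<Phi> x)" for x
  have hm: "h \<in> borel_measurable borel"
    unfolding h_def[abs_def] using half_line_continuous_measurable[OF \<Phi>c] by measurable
  have hn: "0 \<le> h x" if "0 < x" for x using \<Phi>n[of x] k that by (simp add: h_def)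
  have hb: "max (\<epsilon> * real i - R) 0 \<le> h x" if \<epsilon>: "0 < \<epsilon>" and i: "2 \<le> i" "x \<in> size_cell \<epsilon> i" for \<epsilon> i x
  proof (cases "\<epsilon> * real i \<le> R")
    case True
    then show ?thesis using hn[OF size_cell_bounds(1)[OF \<epsilon> i]] by simp
  next
    case False
    note sc = size_cell_bounds(1,3)[OF \<epsilon> i]
    have x: "R/2 \<le> x" using sc(2) False by linarith
    then have "k \<le> \<Phi> x / x" using R by (intro X) auto
    then have "k * x \<le> \<Phi> x" using sc(1) by (simp add: pos_le_divide_eq)
    then have "2 * x \<le> h x" using sc(1) k by (simp add: h_def field_simps)
    moreover have "\<epsilon> * real i - R \<le> 2 * x" using sc R by linarith
    ultimately show ?thesis using sc by simp
  qed
  have "(\<Sum>i=2..N. max (\<epsilon> * real i - R) 0 * (\<epsilon> * w \<epsilon> i)) \<le> e" if \<epsilon>: "0 < \<epsilon>" for \<epsilon> N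
  proof -
    have "(\<Sum>i=2..N. w \<epsilon> i * (\<epsilon> * max (\<epsilon> * real i - R) 0)) \<le> 2 / k * C"
    proof (rule step_sum_le[OF \<epsilon> w[OF \<epsilon>] hm hn hb[OF \<epsilon>]])
      have "(\<integral>\<^sup>+x. ennreal (step_fun \<epsilon> 2 (w \<epsilon>) x * h x) \<partial>lborel) = (\<integral>\<^sup>+x. ennreal (2 / k) * ennreal (\<Phi> x * step_fun \<epsilon> 2 (w \<epsilon>) x) \<partial>half_line)"
        unfolding nn_integral_step_half_line[OF \<epsilon>]
      proof (rule nn_integral_cong)
        fix x assume "x \<in> space half_line"
        then have "0 \<le> x" by simp
        then have "step_fun \<epsilon> 2 (w \<epsilon>) x * h x = 2 / k * (\<Phi> x * step_fun \<epsilon> 2 (w \<epsilon>) x)" by (simp add: h_def)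
        then show "ennreal (step_fun \<epsilon> 2 (w \<epsilon>) x * h x) = ennreal (2 / k) * ennreal (\<Phi> x * step_fun \<epsilon> 2 (w \<epsilon>) x)"
          using k \<Phi>n[OF \<open>0 \<le> x\<close>] step_fun_nonneg[OF \<epsilon>, of "w \<epsilon>" x] w[OF \<epsilon>] by (simp only:) (intro ennreal_mult, auto)
      qed
      also have "\<dots> = ennreal (2 / k) * (\<integral>\<^sup>+x. ennreal (\<Phi> x * step_fun \<epsilon> 2 (w \<epsilon>) x) \<partial>half_line)"
      proof (rule nn_integral_cmult)
        have "(\<lambda>x. (indicator {0..} x * \<Phi> x) * step_fun \<epsilon> 2 (w \<epsilon>) x) \<in> borel_measurable borel"
          using half_line_continuous_measurable[OF \<Phi>c] step_fun_measurable[OF \<epsilon>] by measurable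
        then have "(\<lambda>x. \<Phi> x * step_fun \<epsilon> 2 (w \<epsilon>) x) \<in> borel_measurable half_line"
          by (simp add: half_line_measurable_iff mult.assoc)
        then show "(\<lambda>x. ennreal (\<Phi> x * step_fun \<epsilon> 2 (w \<epsilon>) x)) \<in> borel_measurable half_line" by measurable
      qed
      also have "\<dots> \<le> ennreal (2 / k) * (SUP \<epsilon>\<in>{0<..}. \<integral>\<^sup>+x. ennreal (\<Phi> x * step_fun \<epsilon> 2 (w \<epsilon>) x) \<partial>half_line)"
        by (intro mult_left_mono SUP_upper) (use \<epsilon> in auto)
      also have "\<dots> = ennreal (2 / k) * ennreal C" unfolding C_def by (subst ennreal_enn2real) (use bound in \<open>simp_all only: infinity_ennreal_def\<close>)
      also have "\<dots> = ennreal (2 / k * C)" using k C0 by (intro ennreal_mult[symmetric]) auto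
      finally show "(\<integral>\<^sup>+x. ennreal (step_fun \<epsilon> 2 (w \<epsilon>) x * h x) \<partial>lborel) \<le> ennreal (2 / k * C)" .
    qed (use k C0 in auto)
    also have "2 / k * C \<le> e" using e C0 by (simp add: k_def field_simps)
    finally show ?thesis by (simp add: mult_ac)
  qed
  then show ?thesis using R by blast
qed

lemma initial_exponential_sum_bounded:
  assumes bound: "(SUP \<epsilon>\<in>{0<..}. \<Sum>\<^sub>\<infinity>i\<in>{2..}. ennreal (v \<epsilon> i * exp (- (real i * z)))) < \<infinity>"
    and v: "\<And>\<epsilon> i. 0 < \<epsilon> \<Longrightarrow> 2 \<le> i \<Longrightarrow> 0 \<le> v \<epsilon> i"
  shows "\<exists>H. \<forall>\<epsilon>>0. \<forall>N. (\<Sum>i=2..N. exp (-z) ^ i * v \<epsilon> i) \<le> H"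
proof -
  define H where "H = enn2real (SUP \<epsilon>\<in>{0<..}. \<Sum>\<^sub>\<infinity>i\<in>{2..}. ennreal (v \<epsilon> i * exp (- (real i * z))))"
  have "(\<Sum>i=2..N. exp (-z) ^ i * v \<epsilon> i) \<le> H" if \<epsilon>: "0 < \<epsilon>" for \<epsilon> N
  proof -
    have "ennreal (\<Sum>i=2..N. exp (-z) ^ i * v \<epsilon> i) = (\<Sum>i=2..N. ennreal (v \<epsilon> i * exp (- (real i * z))))"
      using v[OF \<epsilon>] by (subst sum_ennreal) (auto intro!: sum.cong simp: exp_of_nat_mult[symmetric] mult.commute)
    also have "\<dots> \<le> (\<Sum>\<^sub>\<infinity>i\<in>{2..}. ennreal (v \<epsilon> i * exp (- (real i * z))))"
      by (subst nonneg_infsum_complete) (auto intro!: SUP_upper)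
    also have "\<dots> \<le> (SUP \<epsilon>\<in>{0<..}. \<Sum>\<^sub>\<infinity>i\<in>{2..}. ennreal (v \<epsilon> i * exp (- (real i * z))))"
      by (rule SUP_upper) (use \<epsilon> in auto)
    also have "\<dots> = ennreal H" unfolding H_def by (subst ennreal_enn2real) (use bound in \<open>simp_all only: infinity_ennreal_def\<close>)
    finally show ?thesis by (simp add: ennreal_le_iff H_def)
  qed
  then show ?thesis by blast
qed

lemma number_le_power_sum_tail:
  assumes \<epsilon>: "0 < \<epsilon>" "\<epsilon> \<le> (1::real)" and R: "0 \<le> R" and d: "0 \<le> \<delta>" and w: "\<And>i. 2 \<le> i \<Longrightarrow> 0 \<le> w i"
    and C: "(\<Sum>i=2..N. \<epsilon> * w i powr (1+\<delta>)) \<le> C"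
    and tail: "(\<Sum>i=2..N. max (\<epsilon> * real i - R) 0 * (\<epsilon> * w i)) \<le> 1"
  shows "(\<Sum>i=2..N. \<epsilon> * w i) \<le> R + 2 + C"
    "(\<Sum>i=2..N. \<epsilon>\<^sup>2 * real i * w i) \<le> R * (R + 2 + C) + 1"
proof -
  have few: "(\<Sum>i=2..N. if \<epsilon> * real i \<le> R + 1 then \<epsilon> else 0) \<le> R + 1"
  proof -
    define K where "K = nat \<lfloor>(R + 1) / \<epsilon>\<rfloor>"
    have nn: "0 \<le> (R + 1) / \<epsilon>" using R \<epsilon> by simp
    have iK: "\<epsilon> * real i \<le> R + 1 \<longleftrightarrow> i \<le> K" for i
    proof -
      have "\<epsilon> * real i \<le> R + 1 \<longleftrightarrow> real i \<le> (R + 1) / \<epsilon>" using \<epsilon> by (simp add: field_simps)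
      also have "\<dots> \<longleftrightarrow> i \<le> K" unfolding K_def using nn by (simp add: le_nat_iff le_floor_iff)
      finally show ?thesis .
    qed
    have "(\<Sum>i=2..N. if \<epsilon> * real i \<le> R + 1 then \<epsilon> else 0) = (\<Sum>i\<in>{i\<in>{2..N}. i \<le> K}. \<epsilon>)"
      unfolding iK by (rule sum.inter_filter[symmetric]) simp
    also have "\<dots> \<le> (\<Sum>i\<in>{1..K}. \<epsilon>)" by (rule sum_mono2) (use \<epsilon> in auto)
    also have "\<dots> = \<epsilon> * real K" by simp
    also have "\<dots> \<le> R + 1" using iK[of K] by simp
    finally show ?thesis .
  qed
  have "(\<Sum>i=2..N. \<epsilon> * w i) \<le> (\<Sum>i=2..N. ((if \<epsilon> * real i \<le> R + 1 then \<epsilon> else 0) + \<epsilon> * w i powr (1+\<delta>)) + max (\<epsilon> * real i - R) 0 * (\<epsilon> * w i))"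
  proof (rule sum_mono)
    fix i assume "i \<in> {2..N}"
    then have w0: "0 \<le> w i" using w by auto
    then have ew: "0 \<le> \<epsilon> * w i" "0 \<le> \<epsilon> * w i powr (1+\<delta>)" using \<epsilon> by auto
    show "\<epsilon> * w i \<le> ((if \<epsilon> * real i \<le> R + 1 then \<epsilon> else 0) + \<epsilon> * w i powr (1+\<delta>)) + max (\<epsilon> * real i - R) 0 * (\<epsilon> * w i)"
    proof (cases "\<epsilon> * real i \<le> R + 1")
      case True
      have "w i \<le> 1 + w i powr (1+\<delta>)"
      proof (cases "w i \<le> 1")
        case False
        then have "w i powr 1 \<le> w i powr (1+\<delta>)" using d by (intro powr_mono) auto
        then show ?thesis using False by simp
      qed (simp add: add_increasing2)
      then have "\<epsilon> * w i \<le> \<epsilon> + \<epsilon> * w i powr (1+\<delta>)" using mult_left_mono[of "w i" "1 + w i powr (1+\<delta>)" \<epsilon>] \<epsilon> by (simp add: algebra_simps)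
      moreover have "0 \<le> max (\<epsilon> * real i - R) 0 * (\<epsilon> * w i)" using ew by simp
      ultimately show ?thesis using True by simp
    next
      case False
      then have "1 * (\<epsilon> * w i) \<le> max (\<epsilon> * real i - R) 0 * (\<epsilon> * w i)" using ew by (intro mult_right_mono) auto
      then show ?thesis using False ew by simp
    qed
  qed
  also have "\<dots> \<le> (R + 1) + C + 1" unfolding sum.distrib by (intro add_mono few C tail)
  finally show n: "(\<Sum>i=2..N. \<epsilon> * w i) \<le> R + 2 + C" by simp
  have "(\<Sum>i=2..N. \<epsilon>\<^sup>2 * real i * w i) \<le> (\<Sum>i=2..N. R * (\<epsilon> * w i) + max (\<epsilon> * real i - R) 0 * (\<epsilon> * w i))"
  proof (rule sum_mono)
    fix i assume "i \<in> {2..N}"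
    then have "0 \<le> \<epsilon> * w i" using w[of i] \<epsilon> by auto
    then have "(\<epsilon> * real i) * (\<epsilon> * w i) \<le> (R + max (\<epsilon> * real i - R) 0) * (\<epsilon> * w i)" by (intro mult_right_mono) auto
    then show "\<epsilon>\<^sup>2 * real i * w i \<le> R * (\<epsilon> * w i) + max (\<epsilon> * real i - R) 0 * (\<epsilon> * w i)"
      by (simp add: power2_eq_square algebra_simps)
  qed
  also have "\<dots> = R * (\<Sum>i=2..N. \<epsilon> * w i) + (\<Sum>i=2..N. max (\<epsilon> * real i - R) 0 * (\<epsilon> * w i))"
    by (simp add: sum.distrib sum_distrib_left)
  also have "\<dots> \<le> R * (R + 2 + C) + 1" using n tail R by (intro add_mono mult_left_mono) auto
  finally show "(\<Sum>i=2..N. \<epsilon>\<^sup>2 * real i * w i) \<le> R * (R + 2 + C) + 1" .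
qed

lemma exponent_positive:
  assumes a: "continuous_on {0..} a" "a (0::real) = (0::real)" and C: "0 < C" and s: "0 \<le> s"
    and equiv: "asymp_equiv a (at_right 0) (\<lambda>x. C * x powr s)"
  shows "0 < s"
proof (rule ccontr)
  assume "\<not> 0 < s"
  then have s0: "s = 0" using s by simp
  have "(a \<longlongrightarrow> a 0) (at 0 within {0..})" using a(1) by (simp add: continuous_on_def)
  then have a0: "(a \<longlongrightarrow> 0) (at_right 0)" unfolding a(2) by (rule tendsto_within_subset) auto
  have "((\<lambda>x. C * x powr s) \<longlongrightarrow> C) (at_right 0)"
  proof (rule tendsto_eventually)
    show "\<forall>\<^sub>F x in at_right 0. C * x powr s = C"
      using eventually_at_right_less[of "0::real"] by eventually_elim (simp add: s0)
  qed
  then have "(a \<longlongrightarrow> C) (at_right 0)" by (rule asymp_equiv_tendsto_transfer[OF asymp_equiv_symI[OF equiv]])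
  then have "C = 0" using a0 by (intro tendsto_unique[OF _ _ a0]) auto
  then show False using C by simp
qed

theorem theorem4:
  fixes \<eta> :: real
    and \<alpha>e \<beta>e :: "real \<Rightarrow> real"
    and ae be :: "real \<Rightarrow> nat \<Rightarrow> real"
    and ue :: "real \<Rightarrow> real \<Rightarrow> real"
    and ce :: "real \<Rightarrow> nat \<Rightarrow> real \<Rightarrow> real"
    and me :: "real \<Rightarrow> real"
    and fe :: "real \<Rightarrow> real \<Rightarrow> real \<Rightarrow> real"
    and afun bfun :: "real \<Rightarrow> real \<Rightarrow> real"
    and K :: "real \<Rightarrow> real"
    and \<alpha> \<beta> :: real
    and a b :: "real \<Rightarrow> real"
    and Ka Kb ra rb abar bbar \<rho> :: real
    and uin :: real and \<mu>in :: "real measure" and m :: real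
    and \<Phi> :: "real \<Rightarrow> real" and \<delta> :: real
    and e :: "nat \<Rightarrow> real"
  \<comment> \<open>the rescaled system\<close>
  assumes eta_nonneg: "\<eta> \<ge> 0"
    and alpha_beta_e_pos: "\<And>\<epsilon>. \<epsilon> > 0 \<Longrightarrow> \<alpha>e \<epsilon> > 0 \<and> \<beta>e \<epsilon> > 0"
    and ae_pos: "\<And>\<epsilon> i. \<epsilon> > 0 \<Longrightarrow> i \<ge> 2 \<Longrightarrow> ae \<epsilon> i > 0"
    and be_pos: "\<And>\<epsilon> i. \<epsilon> > 0 \<Longrightarrow> i \<ge> 3 \<Longrightarrow> be \<epsilon> i > 0"
    and K_pos: "\<And>\<epsilon>. \<epsilon> > 0 \<Longrightarrow> K \<epsilon> > 0"
    and ae_incr: "\<And>\<epsilon> i. \<epsilon> > 0 \<Longrightarrow> i \<ge> 2 \<Longrightarrow> ae \<epsilon> (i + 1) - ae \<epsilon> i \<le> K \<epsilon>"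
    and be_decr: "\<And>\<epsilon> i. \<epsilon> > 0 \<Longrightarrow> i \<ge> 3 \<Longrightarrow> be \<epsilon> i - be \<epsilon> (i + 1) \<le> K \<epsilon>"
    and solution: "\<And>\<epsilon>. \<epsilon> > 0 \<Longrightarrow>
          BD_solution \<eta> \<epsilon> (\<alpha>e \<epsilon>) (\<beta>e \<epsilon>) (ae \<epsilon>) (be \<epsilon>) (ue \<epsilon>) (ce \<epsilon>)"
    and mass_balance: "\<And>\<epsilon> t. \<epsilon> > 0 \<Longrightarrow> t \<ge> 0 \<Longrightarrow>
          ((\<lambda>i. \<epsilon>\<^sup>2 * real i * ce \<epsilon> i t) has_sum (me \<epsilon> - ue \<epsilon> t)) {2..}"
    and fe_def: "\<And>\<epsilon> t x. fe \<epsilon> t x = step_fun \<epsilon> 2 (\<lambda>i. ce \<epsilon> i t) x"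
    and afun_def: "\<And>\<epsilon> x. afun \<epsilon> x = step_fun \<epsilon> 2 (ae \<epsilon>) x"
    and bfun_def: "\<And>\<epsilon> x. bfun \<epsilon> x = step_fun \<epsilon> 3 (be \<epsilon>) x"
  \<comment> \<open>the rates\<close>
    and alpha_pos: "\<alpha> > 0" and beta_pos: "\<beta> > 0"
    and a_cont: "continuous_on {0..} a" and b_cont: "continuous_on {0..} b"
    and ab_nonneg: "\<And>x. x \<ge> 0 \<Longrightarrow> a x \<ge> 0 \<and> b x \<ge> 0"
    and ab_pos: "\<And>x. x > 0 \<Longrightarrow> a x > 0 \<and> b x > 0"
    and alpha_lim: "(\<alpha>e \<longlongrightarrow> \<alpha>) (at_right 0)"
    and beta_lim: "(\<beta>e \<longlongrightarrow> \<beta>) (at_right 0)"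
    and a_lim: "\<And>S. compact S \<Longrightarrow> S \<subseteq> {0..} \<Longrightarrow> uniform_limit S afun a (at_right 0)"
    and b_lim: "\<And>S. compact S \<Longrightarrow> S \<subseteq> {0..} \<Longrightarrow> uniform_limit S bfun b (at_right 0)"
    and Ka_pos: "Ka > 0" and Kb_pos: "Kb > 0"
    and a_bound: "\<And>\<epsilon> x. \<epsilon> > 0 \<Longrightarrow> x \<ge> 0 \<Longrightarrow> afun \<epsilon> x \<le> Ka * (1 + x)"
    and b_bound: "\<And>\<epsilon> x. \<epsilon> > 0 \<Longrightarrow> x \<ge> 0 \<Longrightarrow> bfun \<epsilon> x \<le> Kb * (1 + x)"
    and ra: "0 \<le> ra" "ra < 1" and rb: "ra \<le> rb"
    and abar_pos: "abar > 0" and bbar_pos: "bbar > 0"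
    and a_equiv: "asymp_equiv a (at_right 0) (\<lambda>x. abar * x powr ra)"
    and b_equiv: "asymp_equiv b (at_right 0) (\<lambda>x. bbar * x powr rb)"
    and a_small: "(\<lambda>(\<epsilon>, i). afun \<epsilon> (\<epsilon> * real i) - a (\<epsilon> * real i))
          \<in> o[small_sizes 2](\<lambda>(\<epsilon>, i). (\<epsilon> * real i) powr ra)"
    and b_small: "(\<lambda>(\<epsilon>, i). bfun \<epsilon> (\<epsilon> * real i) - b (\<epsilon> * real i))
          \<in> o[small_sizes 3](\<lambda>(\<epsilon>, i). (\<epsilon> * real i) powr rb)"
    and rho_lim: "((\<lambda>x. b x / a x) \<longlongrightarrow> \<rho>) (at_right 0)"
  \<comment> \<open>the initial data\<close>
    and uin_gt: "uin > \<rho>"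
    and muin: "finite_half_line_measure \<mu>in"
    and uin_lim: "((\<lambda>\<epsilon>. ue \<epsilon> 0) \<longlongrightarrow> uin) (at_right 0)"
    and fin_lim: "weak_star_tendsto (\<lambda>\<epsilon>. density half_line (\<lambda>x. ennreal (fe \<epsilon> 0 x))) \<mu>in (at_right 0)"
    and Phi: "\<Phi> \<in> superlinear_weights"
    and Phi_bound: "(SUP \<epsilon>\<in>{0<..}. \<integral>\<^sup>+x. ennreal (\<Phi> x * fe \<epsilon> 0 x) \<partial>half_line) < \<infinity>"
    and exp_bound: "\<And>z. 0 < z \<Longrightarrow> z < 1 \<Longrightarrow>
          (SUP \<epsilon>\<in>{0<..}. \<Sum>\<^sub>\<infinity>i\<in>{2..}.
             ennreal (\<epsilon> powr ra * ce \<epsilon> i 0 * exp (- (real i * z)))) < \<infinity>"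
    and m_def: "m = uin + (\<integral>x. x \<partial>\<mu>in)"
  \<comment> \<open>the extra assumption\<close>
    and delta: "\<delta> > 0" "ra > 0 \<Longrightarrow> \<delta> < 1 / ra - 1"
    and Psi_bound: "(SUP \<epsilon>\<in>{0<..}. \<integral>\<^sup>+x. ennreal (fe \<epsilon> 0 x powr (1 + \<delta>)) \<partial>half_line) < \<infinity>"
    and ae_power: "\<And>\<epsilon> i. \<epsilon> > 0 \<Longrightarrow> i \<ge> 2 \<Longrightarrow> ae \<epsilon> i = abar * (\<epsilon> * real i) powr ra"
    and be_power: "\<And>\<epsilon> i. \<epsilon> > 0 \<Longrightarrow> i \<ge> 3 \<Longrightarrow> be \<epsilon> i = bbar * (\<epsilon> * real i) powr rb"
  \<comment> \<open>the hypotheses of the theorem\<close>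
    and eta_ra: "\<eta> \<ge> ra" and ra_rb: "ra = rb"
    and e_pos: "\<And>n. e n > 0" and e_lim: "e \<longlonglongrightarrow> 0"
  shows "\<exists>T r f. T > 0 \<and> strict_mono (r :: nat \<Rightarrow> nat) \<and>
    f \<in> C_weak_L1 {0..T} (density half_line (\<lambda>x. ennreal (x powr (ra * \<delta>)))) \<and>
    f \<in> Linf_L1 {0<..<T} (density half_line (\<lambda>x. ennreal (1 + x))) \<and>
    (\<forall>t\<in>{0..T}. AE x in half_line. 0 \<le> f t x) \<and>
    N_solution a b \<rho> uin \<mu>in (nucleation_rate \<eta> ra \<alpha> \<beta> abar bbar \<rho>) T m
      (\<lambda>t. density half_line (\<lambda>x. ennreal (f t x))) \<and>
    tendsto_C_weak_L1 {0..T} (density half_line (\<lambda>x. ennreal (x powr (ra * \<delta>))))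
      (\<lambda>n. fe (e (r n))) f"
proof -
  define s where "s = ra"
  have sr: "ra = s" "rb = s" using ra_rb by (auto simp: s_def)
  have fe: "fe = (\<lambda>\<epsilon> t x. step_fun \<epsilon> 2 (\<lambda>i. ce \<epsilon> i t) x)" by (intro ext) (rule fe_def)
  have c_nn: "0 \<le> ce \<epsilon> i t" if "0 < \<epsilon>" "2 \<le> i" "0 \<le> t" for \<epsilon> i t
    using solution[OF that(1)] that by (auto simp: BD_solution_def)
  have afun: "afun = (\<lambda>\<epsilon> x. step_fun \<epsilon> 2 (ae \<epsilon>) x)" "bfun = (\<lambda>\<epsilon> x. step_fun \<epsilon> 3 (be \<epsilon>) x)"
    by (intro ext, rule afun_def bfun_def)+
  have a: "a x = abar * x powr s" if "0 \<le> x" for x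
    by (rule limit_rate_power[OF a_lim[unfolded afun] ae_power[unfolded sr] _ that]) auto
  have b: "b x = bbar * x powr s" if "0 \<le> x" for x
    by (rule limit_rate_power[OF b_lim[unfolded afun] be_power[unfolded sr] _ that]) auto
  have s0: "0 < s"
    by (rule exponent_positive[OF a_cont _ abar_pos _ a_equiv[unfolded sr]]) (use a[of 0] ra sr in auto)
  have s1: "s < 1" using ra sr by simp
  have sd: "s * \<delta> < 1 - s"
  proof -
    have "\<delta> < 1/s - 1" using delta(2) s0 sr by simp
    then have "s * \<delta> < s * (1/s - 1)" using s0 by (intro mult_strict_left_mono) auto
    also have "\<dots> = 1 - s" using s0 by (simp add: algebra_simps)
    finally show ?thesis .
  qed
  have p: "0 < s * \<delta>" "s * \<delta> \<le> 1" using sd s0 delta(1) by auto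
  have rho: "\<rho> = bbar / abar"
  proof (rule tendsto_unique[OF _ rho_lim])
    show "((\<lambda>x. b x / a x) \<longlongrightarrow> bbar / abar) (at_right 0)"
    proof (rule tendsto_eventually)
      show "\<forall>\<^sub>F x in at_right 0. b x / a x = bbar / abar"
        using eventually_at_right_less[of "0::real"] by eventually_elim (simp add: a b)
    qed
  qed simp
  have rho0: "0 < \<rho>" using rho abar_pos bbar_pos by simp
  define u0 where "u0 = (\<rho> + 2 * uin) / 3"
  define ustar where "ustar = (2 * \<rho> + uin) / 3"
  have us: "\<rho> < ustar" "ustar < u0" "u0 < uin" "0 < ustar" using uin_gt rho0 by (auto simp: u0_def ustar_def field_simps)
  have gap: "bbar < abar * ustar" using us(1) rho abar_pos by (simp add: pos_divide_less_eq mult.commute)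
  define q where "q = bbar / (abar * ustar)"
  have q: "q < 1" using gap bbar_pos by (simp add: q_def)
  have "max q (exp (-1)) < (1::real)" using q by simp
  then obtain \<theta> where "max q (exp (-1)) < \<theta>" "\<theta> < (1::real)" using dense by blast
  then have \<theta>: "q < \<theta>" "exp (-1) < \<theta>" "\<theta> < 1" by auto
  have \<theta>0: "0 < \<theta>" using \<theta>(2) exp_gt_zero[of "-1::real"] by linarith
  have z: "0 < - ln \<theta>" "- ln \<theta> < 1" "exp (- (- ln \<theta>)) = \<theta>"
    using \<theta> \<theta>0 exp_less_cancel_iff[of "-1" "ln \<theta>"] by (auto simp del: exp_less_cancel_iff)

  \<comment> \<open>uniform bounds on the initial data\<close>
  obtain H where H: "\<And>\<epsilon> N. 0 < \<epsilon> \<Longrightarrow> (\<Sum>i=2..N. \<theta>^i * (\<epsilon> powr s * ce \<epsilon> i 0)) \<le> H"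
  proof -
    have "0 \<le> \<epsilon> powr s * ce \<epsilon> i 0" if "0 < \<epsilon>" "2 \<le> i" for \<epsilon> i using c_nn[OF that] by simp
    from initial_exponential_sum_bounded[OF exp_bound[OF z(1,2), unfolded sr] this]
    show thesis unfolding z(3) using that by blast
  qed
  obtain C where C: "0 \<le> C" "\<And>\<epsilon> N. 0 < \<epsilon> \<Longrightarrow> (\<Sum>i=2..N. \<epsilon> * ce \<epsilon> i 0 powr (1+\<delta>)) \<le> C"
    using initial_power_sum_bounded[of "\<lambda>\<epsilon> i. ce \<epsilon> i 0", OF Psi_bound[unfolded fe]] by blast
  have tail0: "\<exists>R\<ge>2. \<forall>\<epsilon>>0. \<forall>N. (\<Sum>i=2..N. max (\<epsilon> * real i - R) 0 * (\<epsilon> * ce \<epsilon> i 0)) \<le> d" if "0 < d" for d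
    by (rule initial_tail_small[OF Phi _ Phi_bound[unfolded fe] that]) (use c_nn in auto)
  obtain R where R: "2 \<le> R" "\<And>\<epsilon> N. 0 < \<epsilon> \<Longrightarrow> (\<Sum>i=2..N. max (\<epsilon> * real i - R) 0 * (\<epsilon> * ce \<epsilon> i 0)) \<le> 1"
    using tail0[of 1] by auto
  define P where "P = R + 2 + C"
  define M where "M = uin + 1 + (R * P + 1)"
  have number: "(\<Sum>i=2..N. \<epsilon> * ce \<epsilon> i 0) \<le> P" "(\<Sum>i=2..N. \<epsilon>\<^sup>2 * real i * ce \<epsilon> i 0) \<le> R * P + 1"
    if "0 < \<epsilon>" "\<epsilon> \<le> 1" for \<epsilon> N
    unfolding P_def using number_le_power_sum_tail[OF that _ _ _ C(2)[OF that(1)] R(2)[OF that(1)]] R(1) delta(1) c_nn[OF that(1)]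
    by auto

  \<comment> \<open>the part of the sequence along which all bounds hold\<close>
  have elim0: "filterlim e (at_right 0) sequentially"
    using e_lim e_pos by (simp add: filterlim_at less_imp_neq[OF e_pos, THEN not_sym])
  have "\<forall>\<^sub>F \<epsilon> in at_right 0. \<epsilon> \<le> 1 \<and> \<alpha>e \<epsilon> < \<alpha> + 1 \<and> \<beta>e \<epsilon> < \<beta> + 1 \<and> u0 < ue \<epsilon> 0 \<and> ue \<epsilon> 0 < uin + 1
      \<and> bbar < exp (- \<epsilon>) * (abar * ustar)"
  proof (intro eventually_conj)
    show "\<forall>\<^sub>F \<epsilon> in at_right 0. \<epsilon> \<le> (1::real)"
      by (rule eventually_mono[OF order_tendstoD(2)[OF tendsto_ident_at, of 0 1]]) auto
    show "\<forall>\<^sub>F \<epsilon> in at_right 0. \<alpha>e \<epsilon> < \<alpha> + 1" by (rule order_tendstoD(2)[OF alpha_lim]) simp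
    show "\<forall>\<^sub>F \<epsilon> in at_right 0. \<beta>e \<epsilon> < \<beta> + 1" by (rule order_tendstoD(2)[OF beta_lim]) simp
    show "\<forall>\<^sub>F \<epsilon> in at_right 0. u0 < ue \<epsilon> 0" by (rule order_tendstoD(1)[OF uin_lim us(3)])
    show "\<forall>\<^sub>F \<epsilon> in at_right 0. ue \<epsilon> 0 < uin + 1" by (rule order_tendstoD(2)[OF uin_lim]) simp
    have "((\<lambda>\<epsilon>::real. exp (- \<epsilon>) * (abar * ustar)) \<longlongrightarrow> exp (- 0) * (abar * ustar)) (at_right 0)"
      by (intro tendsto_intros)
    then show "\<forall>\<^sub>F \<epsilon> in at_right 0. bbar < exp (- \<epsilon>) * (abar * ustar)"
      by (rule order_tendstoD(1)) (use gap in simp)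
  qed
  from eventually_compose_filterlim[OF this elim0] obtain n0 where n0: "\<And>n. n0 \<le> n \<Longrightarrow> e n \<le> 1 \<and> \<alpha>e (e n) < \<alpha> + 1 \<and>
      \<beta>e (e n) < \<beta> + 1 \<and> u0 < ue (e n) 0 \<and> ue (e n) 0 < uin + 1 \<and> bbar < exp (- e n) * (abar * ustar)"
    unfolding eventually_sequentially by blast
  define \<epsilon> where "\<epsilon> n = e (n + n0)" for n
  have e0: "0 < \<epsilon> n" "\<epsilon> n \<le> 1" "\<alpha>e (\<epsilon> n) \<le> \<alpha> + 1" "\<beta>e (\<epsilon> n) \<le> \<beta> + 1" "u0 \<le> ue (\<epsilon> n) 0" "ue (\<epsilon> n) 0 \<le> uin + 1"
    "bbar \<le> exp (- \<epsilon> n) * (abar * ustar)" for n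
    using e_pos[of "n + n0"] n0[of "n + n0"] by (auto simp: \<epsilon>_def)
  have \<epsilon>0: "filterlim \<epsilon> (at_right 0) sequentially"
    unfolding \<epsilon>_def using filterlim_compose[OF elim0 filterlim_add_const_nat_at_top] by simp
  have mass: "ue (\<epsilon> n) t + (\<Sum>i=2..N. (\<epsilon> n)\<^sup>2 * real i * ce (\<epsilon> n) i t) \<le> M" if t: "0 \<le> t" for n t N
  proof -
    have "(\<Sum>i=2..N. (\<epsilon> n)\<^sup>2 * real i * ce (\<epsilon> n) i t) \<le> me (\<epsilon> n) - ue (\<epsilon> n) t"
      by (rule finite_sum_le_has_sum[OF mass_balance[OF e0(1) t]]) (auto intro!: mult_nonneg_nonneg c_nn[OF e0(1)] t)
    moreover have "me (\<epsilon> n) - ue (\<epsilon> n) 0 \<le> R * P + 1"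
    proof (rule has_sum_le_finite_sums[OF mass_balance[OF e0(1)]])
      fix Z :: "nat set" assume Z: "finite Z" "Z \<subseteq> {2..}"
      then obtain N where "Z \<subseteq> {..N}" by (meson finite_nat_iff_bounded_le)
      then have "(\<Sum>i\<in>Z. (\<epsilon> n)\<^sup>2 * real i * ce (\<epsilon> n) i 0) \<le> (\<Sum>i=2..N. (\<epsilon> n)\<^sup>2 * real i * ce (\<epsilon> n) i 0)"
        using Z(2) by (intro sum_mono2) (auto intro!: mult_nonneg_nonneg c_nn[OF e0(1)])
      also have "\<dots> \<le> R * P + 1" by (rule number(2)[OF e0(1,2)])
      finally show "(\<Sum>i\<in>Z. (\<epsilon> n)\<^sup>2 * real i * ce (\<epsilon> n) i 0) \<le> R * P + 1" .
    qed simp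
    ultimately show ?thesis using e0(6)[of n] by (simp add: M_def)
  qed
  interpret S: BD_sequence \<eta> s abar bbar \<delta> M u0 ustar \<theta> P H C "\<alpha> + 1" "\<beta> + 1" \<epsilon> "\<lambda>n. \<alpha>e (\<epsilon> n)" "\<lambda>n. \<beta>e (\<epsilon> n)"
    "\<lambda>n. ae (\<epsilon> n)" "\<lambda>n. be (\<epsilon> n)" "\<lambda>n. ue (\<epsilon> n)" "\<lambda>n. ce (\<epsilon> n)"
  proof (rule BD_sequence.intro)
    fix n
    show "BD_power_law \<eta> (\<epsilon> n) (\<alpha>e (\<epsilon> n)) (\<beta>e (\<epsilon> n)) abar bbar s M (ae (\<epsilon> n)) (be (\<epsilon> n)) (ue (\<epsilon> n)) (ce (\<epsilon> n))"
      by (rule BD_power_law.intro)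
        (use e0[of n] s0 s1 eta_ra sr alpha_beta_e_pos[OF e0(1)] abar_pos bbar_pos ae_power[OF e0(1)] be_power[OF e0(1)]
          solution[OF e0(1)] mass in auto)
  next
    fix d :: real assume "0 < d"
    from tail0[OF this] show "\<exists>R\<ge>2. \<forall>n N. (\<Sum>i=2..N. max (\<epsilon> n * real i - R) 0 * (\<epsilon> n * ce (\<epsilon> n) i 0)) \<le> d"
      using e0(1) by blast
  qed (use e0 us gap delta p \<theta> \<theta>0 number H C in \<open>auto simp: q_def\<close>)
  have init: "weak_star_tendsto (\<lambda>n. density half_line (\<lambda>x. ennreal (step_fun (\<epsilon> n) 2 (\<lambda>i. ce (\<epsilon> n) i 0) x))) \<mu>in sequentially"
    unfolding weak_star_tendsto_def
  proof
    fix \<phi> assume "\<phi> \<in> Cc_half_line"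
    then have "((\<lambda>\<epsilon>. \<integral>x. \<phi> x \<partial>density half_line (\<lambda>x. ennreal (fe \<epsilon> 0 x))) \<longlongrightarrow> (\<integral>x. \<phi> x \<partial>\<mu>in)) (at_right 0)"
      using fin_lim by (simp add: weak_star_tendsto_def)
    from filterlim_compose[OF this \<epsilon>0]
    show "(\<lambda>n. \<integral>x. \<phi> x \<partial>density half_line (\<lambda>x. ennreal (step_fun (\<epsilon> n) 2 (\<lambda>i. ce (\<epsilon> n) i 0) x))) \<longlonglongrightarrow> (\<integral>x. \<phi> x \<partial>\<mu>in)"
      unfolding fe .
  qed
  have eps_lim: "\<epsilon> \<longlonglongrightarrow> 0" using \<epsilon>0 by (simp add: filterlim_at)
  show ?thesis
  proof (rule S.limit_along_subsequence[OF eps_lim filterlim_compose[OF alpha_lim \<epsilon>0] filterlim_compose[OF beta_lim \<epsilon>0] beta_pos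
        _ filterlim_compose[OF uin_lim \<epsilon>0] m_def init muin])
    show "((\<lambda>i. (\<epsilon> n)\<^sup>2 * real i * ce (\<epsilon> n) i t) has_sum (me (\<epsilon> n) - ue (\<epsilon> n) t)) {2..}" if "0 \<le> t" for n t
      by (rule mass_balance[OF e0(1) that])
    fix r f
    assume r: "strict_mono (r :: nat \<Rightarrow> nat)" and lim: "BD_limit_setting \<eta> s abar bbar \<alpha> \<beta> m uin S.T M ustar \<theta> S.Q S.H' S.L (\<alpha> + 1) (\<beta> + 1)
      (\<lambda>n. \<epsilon> (r n)) (\<lambda>n. \<alpha>e (\<epsilon> (r n))) (\<lambda>n. \<beta>e (\<epsilon> (r n))) (\<lambda>n. me (\<epsilon> (r n))) (\<lambda>n. ae (\<epsilon> (r n))) (\<lambda>n. be (\<epsilon> (r n)))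
      (\<lambda>n. ue (\<epsilon> (r n))) (\<lambda>n. ce (\<epsilon> (r n))) f \<mu>in"
    interpret V: BD_limit_setting \<eta> s abar bbar \<alpha> \<beta> m uin S.T M ustar \<theta> S.Q S.H' S.L "\<alpha> + 1" "\<beta> + 1"
      "\<lambda>n. \<epsilon> (r n)" "\<lambda>n. \<alpha>e (\<epsilon> (r n))" "\<lambda>n. \<beta>e (\<epsilon> (r n))" "\<lambda>n. me (\<epsilon> (r n))" "\<lambda>n. ae (\<epsilon> (r n))" "\<lambda>n. be (\<epsilon> (r n))"
      "\<lambda>n. ue (\<epsilon> (r n))" "\<lambda>n. ce (\<epsilon> (r n))" f \<mu>in
      by (rule lim)
    have conv: "tendsto_C_weak_L1 {0..S.T} (power_line (s * \<delta>)) (\<lambda>n. fe (e (r n + n0))) f"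
      using V.tendsto_C_weak[OF p] unfolding fe \<epsilon>_def .
    show ?thesis
      unfolding sr
    proof (intro exI[of _ S.T] exI[of _ "\<lambda>n. r n + n0"] exI[of _ f] conjI ballI)
      show "strict_mono (\<lambda>n. r n + n0)" using r by (simp add: strict_mono_def)
      show "AE x in half_line. 0 \<le> f t x" if "t \<in> {0..S.T}" for t using V.f_nn[OF that] by simp
      show "N_solution a b \<rho> uin \<mu>in (nucleation_rate \<eta> s \<alpha> \<beta> abar bbar \<rho>) S.T m (\<lambda>t. density half_line (\<lambda>x. ennreal (f t x)))"
        by (rule V.N_solution_limit[OF a b rho])
    qed (rule S.T V.f_C_weak[OF p] V.f_Linf_L1 conv)+
  qed
qed

end
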